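(* Consider the linear exponential family model described in the context, under its orthogonal parametrization $\theta=(\psi,\lambda)$, $\psi\in\mathbb{R}$, $\lambda\in\mathbb{R}^{p-1}$. Let $\zeta>4$ be an integer, let $c_3,c_4\le 1$ and $0\le c_\infty\le1/2$ be constants, let $p=O(n^\alpha)$ with $\alpha\le \frac12-\frac{1}{2(\zeta-1)}$, and put $$e_{n,p}=\max\left\{\frac{p^2\log(n)^2}{n},\ \frac{p^{\zeta-1}\log(n)^{\zeta/2}}{n^{(\zeta-2)/2}},\ \frac{p\log(n)^{1/2}}{n^{3/2-c_3}}\right\}.$$ Suppose that: (a) the sequence of functions $\theta\mapsto g_n(\theta)$ on $\mathbb{R}^p$ satisfies the Laplace conditions (defined in the context) with constants $c_3,c_4,c_\infty,\zeta$ and rate $e_{n,p}$; (b) for every sequence $\psi=\psi_n$ with $|\psi-\hat\psi|=O(\log(n)^{1/2}/n^{1/2})$, the sequence of functions $\lambda\mapsto g_n(\psi,\lambda)$ on $\mathbb{R}^{p-1}$ satisfies the Laplace conditions with constants $c_3,c_4,c_\infty,\zeta$ and rate $e_{n,p}$. Then, for all $\psi$ with $|\psi-\hat\psi|= O(\log(n)^{1/2}/n^{1/2})$, $$\frac{f(\psi|X_n)}{\hat f(\psi|X_n)}=1+O(e_{n,p}).$$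
   Context: The asymptotics are as $n\to\infty$ with the dimension $p=p_n$ growing with $n$; $\gamma_n^2=p\log(n)/n$. The data are subsequences of a fixed infinite sequence of realizations. Model. Let $X$ be an $n\times p$ matrix of covariates with entries $x_{jk}$ and $j$th row $x_j^\top$. The observations $y_1,\dots,y_n$ are independent, each from a full exponential family, with canonical parameter $(\psi,\tau)$, $\psi\in\mathbb{R}$, $\tau=(\tau_2,\dots,\tau_p)$, and log-likelihood $$l(\psi,\tau;y)=\psi\sum_{j=1}^n y_jx_{j1}+\sum_{k=2}^p\tau_k\sum_{j=1}^n y_jx_{jk}-\sum_{j=1}^nK\{x_j^\top(\psi,\tau)\}.$$ The orthogonal parametrization $(\psi,\lambda)$ replaces $\tau$ by the nuisance mean parameter $\lambda=(\lambda_1,\dots,\lambda_{p-1})$, $\lambda_k=\mathbb{E}[\sum_{j=1}^n y_jx_{j,k+1}/n]$. The prior for $\psi$ is independent of the prior for $\lambda$. In this parametrization $g_n(\theta)=\log\pi(\theta)+l_n(\theta)$ denotes log-prior plus log-likelihood, viewed as a function of $\theta=(\psi,\lambda)\in\mathbb{R}^p$. $\hat\theta_n=(\hat\psi,\hat\lambda)$ is the maximizer of $g_n$; $\hat\lambda_\psi$ is the maximizer of $\lambda\mapsto g_n(\psi,\lambda)$ and $\hat\theta_\psi=(\psi,\hat\lambda_\psi)$. In this parametrization $g^{(2)}_{\psi\lambda}(\hat\theta_\psi)=0$ and $\hat\lambda_\psi=\hat\lambda$. The marginal posterior density of $\psi$ and its Laplace approximation are $$f(\psi|X_n)=\frac{\int_{\mathbb{R}^{p-1}}\exp\{g_n(\psi,\lambda)\}d\lambda}{\int_{\mathbb{R}^p}\exp\{g_n(\theta)\}d\theta},\qquad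 \hat f(\psi|X_n)=\frac{\det\{-g^{(2)}_n(\hat\theta_n)\}^{1/2}}{(2\pi)^{1/2}\det\{-g^{(2)}_{\lambda\lambda}(\hat\theta_\psi)\}^{1/2}}\exp\{g_n(\psi,\hat\lambda_\psi)-g_n(\hat\psi,\hat\lambda)\},$$ where $g^{(2)}_{\lambda\lambda}$ is the block of the Hessian of $g_n$ for the nuisance parameters. Laplace conditions. A sequence of functions $h_n:\mathbb{R}^{q}\to\mathbb{R}$ ($q=q_n\in\{p,p-1\}$) with maximizer $\hat z_n$ satisfies the Laplace conditions with constants $c_3,c_4,c_\infty,\zeta$ and rate $e_{n,p}$ if there are constants $\delta,\eta_1,\eta_2>0$, $\eta_3,\dots,\eta_6\in\mathbb{R}$ and $B_k,C_k\in\mathbb{R}$, not depending on $n,p$, such that: (1) $e_{n,p}\to0$ and $(2\pi)^{-q/2}\det\{-h_n^{(2)}(\hat z_n)\}^{1/2}\int_{B^C_{\hat z_n}(\delta)}\exp\{h_n(z)-h_n(\hat z_n)\}dz=O(e_{n,p})$; (2) $0<\eta_1n\le\lambda_q[-h_n^{(2)}(z)]\le\lambda_1[-h_n^{(2)}(z)]\le\eta_2n$ for all $z\in B_{\hat z_n}(\delta)$, and $\|\{-h_n^{(2)}(\hat z_n)\}^{-1/2}\|_\infty=O(p^{c_\infty}n^{-1/2})$; (3) $\eta_3n^{c_3}\le\lambda_q[h^{(3)}_{\cdot\cdot l}(\hat z_n)]\le\lambda_1[h^{(3)}_{\cdot\cdot l}(\hat z_n)]\le\eta_4n^{c_3}$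 for all $l=1,\dots,q$; (4) $\eta_5n^{c_4}\le\lambda_q[h^{(4)}_{\cdot\cdot lm}(z)]\le\lambda_1[h^{(4)}_{\cdot\cdot lm}(z)]\le\eta_6n^{c_4}$ for all $z\in B_{\hat z_n}(2^{1/2}\gamma_n)$ and all $l,m=1,\dots,q$; (5) for every integer $k$ with $4<k\le\zeta$, $B_kn\le\lambda_q[h^{(k)}_{\cdot\cdot j_1\cdots j_{k-2}}(z)]\le\lambda_1[h^{(k)}_{\cdot\cdot j_1\cdots j_{k-2}}(z)]\le C_kn$ for all $z\in B_{\hat z_n}(2^{1/2}\gamma_n)$ and $j_1,\dots,j_{k-2}\in\{1,\dots,q\}$. Here $h^{(k)}_{\cdot\cdot j_1\cdots j_{k-2}}$ is the $q\times q$ matrix whose $(a,b)$ entry is the $k$-th order partial derivative of $h_n$ in coordinates $a,b,j_1,\dots,j_{k-2}$ (existence of these derivatives is part of the conditions). Notation: $B_x(r)$ is the Euclidean ball with center $x$ and radius $r$, $S^C$ the complement of $S$; $\lambda_1(A)\ge\dots\ge\lambda_q(A)$ are the ordered eigenvalues of a real symmetric $q\times q$ matrix; $\|A\|_\infty=\max_j\sum_k|a_{jk}|$. *)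

theory Defs
  imports
    "HOL-Analysis.Analysis"
    "HOL-Library.Landau_Symbols"
    "Jordan_Normal_Form.Char_Poly"
begin

text \<open>
  The dimension varies with the sample size, so a vector of \<open>q\<close> reals is a function on
  \<open>{..<q}\<close>, extended by \<^const>\<open>undefined\<close> (that is, an element of \<open>{..<q} \<rightarrow>\<^sub>E UNIV\<close>).
  Coordinates, observations and covariates are numbered from 0: coordinate 0 of a
  full parameter is \<open>\<psi>\<close>, and \<open>case_nat \<psi> l\<close> is the vector with first coordinate \<open>\<psi>\<close> followed by \<open>l\<close>.
\<close>

abbreviation Rvec :: "nat \<Rightarrow> (nat \<Rightarrow> real) set" where
  "Rvec q \<equiv> {..<q} \<rightarrow>\<^sub>E UNIV"

abbreviation lebesgue_Rvec :: "nat \<Rightarrow> (nat \<Rightarrow> real) measure" where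
  "lebesgue_Rvec q \<equiv> PiM {..<q} (\<lambda>_. lborel)"

definition eball :: "nat \<Rightarrow> (nat \<Rightarrow> real) \<Rightarrow> real \<Rightarrow> (nat \<Rightarrow> real) set" where
  "eball q c r = {z \<in> Rvec q. L2_set (\<lambda>i. z i - c i) {..<q} < r}"


subsection \<open>Partial derivatives\<close>

fun partials :: "nat list \<Rightarrow> ((nat \<Rightarrow> real) \<Rightarrow> real) \<Rightarrow> (nat \<Rightarrow> real) \<Rightarrow> real" where
  "partials [] h z = h z"
| "partials (j # js) h z = deriv (\<lambda>t. partials js h (z(j := t))) (z j)"

text \<open>On an open set \<open>S\<close>: the function is defined on \<open>S\<close> (its domain is \<open>D\<close>) and all its iterated
  partial derivatives of order at most \<open>k\<close> exist at the points of \<open>S\<close>.\<close>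

definition partials_exist ::
  "nat \<Rightarrow> nat \<Rightarrow> (nat \<Rightarrow> real) set \<Rightarrow> ((nat \<Rightarrow> real) \<Rightarrow> real) \<Rightarrow> (nat \<Rightarrow> real) set \<Rightarrow> bool" where
  "partials_exist q k D h S \<longleftrightarrow> S \<subseteq> D \<and>
     (\<forall>js. set js \<subseteq> {..<q} \<and> length js < k \<longrightarrow>
        (\<forall>z\<in>S. \<forall>i<q. (\<lambda>t. partials js h (z(i := t))) field_differentiable (at (z i))))"

text \<open>The matrix of derivatives of order \<open>2 + length js\<close> in coordinates \<open>a\<close>, \<open>b\<close> and \<open>js\<close>;
  \<open>js = []\<close> gives the Hessian.\<close>

definition deriv_slice ::
  "nat \<Rightarrow> ((nat \<Rightarrow> real) \<Rightarrow> real) \<Rightarrow> (nat \<Rightarrow> real) \<Rightarrow> nat list \<Rightarrow> real Matrix.mat" where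
  "deriv_slice q h z js = Matrix.mat q q (\<lambda>(a, b). partials (a # b # js) h z)"


subsection \<open>Matrices\<close>

definition max_eigenvalue :: "real Matrix.mat \<Rightarrow> real" where
  "max_eigenvalue A = Max {k. eigenvalue A k}"

definition min_eigenvalue :: "real Matrix.mat \<Rightarrow> real" where
  "min_eigenvalue A = Min {k. eigenvalue A k}"

text \<open>Symmetry is required because ordered eigenvalues are only defined for symmetric matrices,
  and the mere existence of partial derivatives does not make the slices symmetric.\<close>

definition eigenvalues_between :: "real \<Rightarrow> real Matrix.mat \<Rightarrow> real \<Rightarrow> bool" where
  "eigenvalues_between a A b \<longleftrightarrow>
     transpose_mat A = A \<and> a \<le> min_eigenvalue A \<and> max_eigenvalue A \<le> b"

text \<open>The inverse of the positive definite square root of a positive definite matrix.\<close>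

definition inv_sqrt_mat :: "real Matrix.mat \<Rightarrow> real Matrix.mat" where
  "inv_sqrt_mat A = (THE R. R \<in> carrier_mat (dim_row A) (dim_row A) \<and> transpose_mat R = R \<and>
     (\<forall>k. eigenvalue R k \<longrightarrow> 0 < k) \<and> R * R * A = 1\<^sub>m (dim_row A))"

definition inf_norm_mat :: "real Matrix.mat \<Rightarrow> real" where
  "inf_norm_mat A = Max ((\<lambda>j. \<Sum>k<dim_col A. \<bar>A $$ (j, k)\<bar>) ` {..<dim_row A})"


subsection \<open>Laplace conditions\<close>

definition gam :: "(nat \<Rightarrow> nat) \<Rightarrow> nat \<Rightarrow> real" where
  "gam p n = sqrt (real (p n) * ln (real n) / real n)"

definition err_rate :: "(nat \<Rightarrow> nat) \<Rightarrow> real \<Rightarrow> nat \<Rightarrow> nat \<Rightarrow> real" where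
  "err_rate p c3 \<zeta> n =
     max (real (p n) ^ 2 * ln (real n) ^ 2 / real n)
    (max (real (p n) ^ (\<zeta> - 1) * ln (real n) powr (real \<zeta> / 2)
            / real n powr ((real \<zeta> - 2) / 2))
         (real (p n) * ln (real n) powr (1 / 2) / real n powr (3 / 2 - c3)))"

text \<open>
  \<open>h n\<close> is a function with domain \<open>D n \<subseteq> Rvec (q n)\<close>, and \<open>exp (h n)\<close> is understood to vanish off
  \<open>D n\<close>, so that integrals over \<open>Rvec (q n)\<close> are integrals over \<open>D n\<close>; for a function on the whole
  space take \<open>D n = Rvec (q n)\<close>. Integrability is stated separately in the first condition because
  the Bochner integral of a non-integrable function is 0. Conditions indexed by \<open>n\<close> are
  required for all sufficiently large \<open>n\<close>.
\<close>

definition laplace_conditions ::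
  "(nat \<Rightarrow> nat) \<Rightarrow> (nat \<Rightarrow> nat) \<Rightarrow> (nat \<Rightarrow> (nat \<Rightarrow> real) set) \<Rightarrow>
   (nat \<Rightarrow> (nat \<Rightarrow> real) \<Rightarrow> real) \<Rightarrow> real \<Rightarrow> real \<Rightarrow> real \<Rightarrow> nat \<Rightarrow> (nat \<Rightarrow> real) \<Rightarrow> bool" where
  "laplace_conditions p q D h c3 c4 cinf \<zeta> e \<longleftrightarrow>
   (let zh = (\<lambda>n. arg_max_on (h n) (D n));
        outer = (\<lambda>\<delta> n. D n - eball (q n) (zh n) \<delta>);
        local_ball = (\<lambda>n. eball (q n) (zh n) (sqrt 2 * gam p n))
    in
    (\<forall>\<^sub>F n in sequentially. is_arg_max (h n) (\<lambda>z. z \<in> D n) (zh n)) \<and>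
    (\<exists>\<delta> \<eta>1 \<eta>2 \<eta>3 \<eta>4 \<eta>5 \<eta>6 :: real. \<exists>B C :: nat \<Rightarrow> real.
      \<delta> > 0 \<and> \<eta>1 > 0 \<and> \<eta>2 > 0 \<and>
      e \<longlonglongrightarrow> 0 \<and>
      (\<forall>\<^sub>F n in sequentially.
         set_integrable (lebesgue_Rvec (q n)) (outer \<delta> n) (\<lambda>z. exp (h n z - h n (zh n)))) \<and>
      (\<lambda>n. (2 * pi) powr (- real (q n) / 2)
           * sqrt (Determinant.det (- deriv_slice (q n) (h n) (zh n) []))
           * (LINT z : outer \<delta> n | lebesgue_Rvec (q n). exp (h n z - h n (zh n)))) \<in> O(e) \<and>
      (\<forall>\<^sub>F n in sequentially.
         0 < \<eta>1 * real n \<and>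
         partials_exist (q n) 2 (D n) (h n) (eball (q n) (zh n) \<delta>) \<and>
         (\<forall>z\<in>eball (q n) (zh n) \<delta>.
            eigenvalues_between (\<eta>1 * real n) (- deriv_slice (q n) (h n) z []) (\<eta>2 * real n))) \<and>
      (\<lambda>n. inf_norm_mat (inv_sqrt_mat (- deriv_slice (q n) (h n) (zh n) [])))
         \<in> O(\<lambda>n. real (p n) powr cinf * real n powr (- 1 / 2)) \<and>
      (\<forall>\<^sub>F n in sequentially. \<forall>l<q n.
         eigenvalues_between (\<eta>3 * real n powr c3)
           (deriv_slice (q n) (h n) (zh n) [l]) (\<eta>4 * real n powr c3)) \<and>
      \<comment> \<open>the existence required here includes that of the third derivatives above\<close>
      (\<forall>\<^sub>F n in sequentially.
         partials_exist (q n) 4 (D n) (h n) (local_ball n) \<and>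
         (\<forall>z\<in>local_ball n. \<forall>l<q n. \<forall>m<q n.
            eigenvalues_between (\<eta>5 * real n powr c4)
              (deriv_slice (q n) (h n) z [l, m]) (\<eta>6 * real n powr c4))) \<and>
      (\<forall>k. 4 < k \<and> k \<le> \<zeta> \<longrightarrow>
        (\<forall>\<^sub>F n in sequentially.
           partials_exist (q n) k (D n) (h n) (local_ball n) \<and>
           (\<forall>z\<in>local_ball n. \<forall>js. length js = k - 2 \<and> set js \<subseteq> {..<q n} \<longrightarrow>
              eigenvalues_between (B k * real n)
                (deriv_slice (q n) (h n) z js) (C k * real n))))))"


subsection \<open>Linear exponential family\<close>

text \<open>A full one-parameter exponential family is given by its base measure \<open>\<mu>\<close>; its canonical
  parameter ranges over all \<open>\<eta>\<close> for which the normalizing constant is finite.\<close>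

definition natural_space :: "real measure \<Rightarrow> real set" where
  "natural_space \<mu> = {\<eta>. integrable \<mu> (\<lambda>t. exp (\<eta> * t))}"

definition expfam_base :: "real measure \<Rightarrow> bool" where
  "expfam_base \<mu> \<longleftrightarrow> sets \<mu> = sets borel \<and> emeasure \<mu> UNIV \<noteq> 0 \<and> natural_space \<mu> \<noteq> {}"

definition log_partition :: "real measure \<Rightarrow> real \<Rightarrow> real" where
  "log_partition \<mu> \<eta> = ln (LINT t | \<mu>. exp (\<eta> * t))"

definition expfam_law :: "real measure \<Rightarrow> real \<Rightarrow> real measure" where
  "expfam_law \<mu> \<eta> = density \<mu> (\<lambda>t. ennreal (exp (\<eta> * t - log_partition \<mu> \<eta>)))"

text \<open>In the following, \<open>x\<close> is the \<open>n \<times> p\<close> covariate matrix and \<open>\<phi>\<close> the canonical parameter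
  \<open>(\<psi>, \<tau>)\<close>.\<close>

definition lin_pred :: "nat \<Rightarrow> (nat \<Rightarrow> nat \<Rightarrow> real) \<Rightarrow> (nat \<Rightarrow> real) \<Rightarrow> nat \<Rightarrow> real" where
  "lin_pred p x \<phi> j = (\<Sum>k<p. x j k * \<phi> k)"

text \<open>Existence of the mean is automatic except possibly on the boundary of the natural
  parameter space.\<close>

definition canonical_space ::
  "real measure \<Rightarrow> nat \<Rightarrow> nat \<Rightarrow> (nat \<Rightarrow> nat \<Rightarrow> real) \<Rightarrow> (nat \<Rightarrow> real) set" where
  "canonical_space \<mu> n p x = {\<phi> \<in> Rvec p. \<forall>j<n. lin_pred p x \<phi> j \<in> natural_space \<mu> \<and>
     integrable (expfam_law \<mu> (lin_pred p x \<phi> j)) (\<lambda>t. t)}"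

definition obs_law ::
  "real measure \<Rightarrow> nat \<Rightarrow> nat \<Rightarrow> (nat \<Rightarrow> nat \<Rightarrow> real) \<Rightarrow> (nat \<Rightarrow> real) \<Rightarrow> (nat \<Rightarrow> real) measure" where
  "obs_law \<mu> n p x \<phi> = PiM {..<n} (\<lambda>j. expfam_law \<mu> (lin_pred p x \<phi> j))"

definition loglik ::
  "real measure \<Rightarrow> nat \<Rightarrow> nat \<Rightarrow> (nat \<Rightarrow> nat \<Rightarrow> real) \<Rightarrow> (nat \<Rightarrow> real) \<Rightarrow> (nat \<Rightarrow> real) \<Rightarrow> real" where
  "loglik \<mu> n p x y \<phi> =
     \<phi> 0 * (\<Sum>j<n. y j * x j 0) + (\<Sum>k=1..<p. \<phi> k * (\<Sum>j<n. y j * x j k))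
     - (\<Sum>j<n. log_partition \<mu> (lin_pred p x \<phi> j))"

definition nuisance_mean ::
  "real measure \<Rightarrow> nat \<Rightarrow> nat \<Rightarrow> (nat \<Rightarrow> nat \<Rightarrow> real) \<Rightarrow> (nat \<Rightarrow> real) \<Rightarrow> nat \<Rightarrow> real" where
  "nuisance_mean \<mu> n p x \<phi> =
     (\<lambda>k\<in>{..<p - 1}. LINT Y | obs_law \<mu> n p x \<phi>. (\<Sum>j<n. Y j * x j (Suc k) / real n))"

text \<open>The map \<open>(\<psi>, \<tau>) \<mapsto> (\<psi>, \<lambda>)\<close>.\<close>

definition orth_param ::
  "real measure \<Rightarrow> nat \<Rightarrow> nat \<Rightarrow> (nat \<Rightarrow> nat \<Rightarrow> real) \<Rightarrow> (nat \<Rightarrow> real) \<Rightarrow> nat \<Rightarrow> real" where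
  "orth_param \<mu> n p x \<phi> = case_nat (\<phi> 0) (nuisance_mean \<mu> n p x \<phi>)"


subsection \<open>Posterior\<close>

definition joint_prior ::
  "(real \<Rightarrow> real) \<Rightarrow> ((nat \<Rightarrow> real) \<Rightarrow> real) \<Rightarrow> (nat \<Rightarrow> real) \<Rightarrow> real" where
  "joint_prior \<pi>\<psi> \<pi>l \<theta> = \<pi>\<psi> (\<theta> 0) * \<pi>l (\<lambda>k. \<theta> (Suc k))"

text \<open>The points at which the log-posterior is finite: \<open>\<theta>\<close> is the orthogonal
  parameter of a member of the model, and the prior is positive. The posterior density vanishes
  elsewhere.\<close>

definition param_space ::
  "real measure \<Rightarrow> nat \<Rightarrow> nat \<Rightarrow> (nat \<Rightarrow> nat \<Rightarrow> real) \<Rightarrow>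
   (real \<Rightarrow> real) \<Rightarrow> ((nat \<Rightarrow> real) \<Rightarrow> real) \<Rightarrow> (nat \<Rightarrow> real) set" where
  "param_space \<mu> n p x \<pi>\<psi> \<pi>l =
     {\<theta> \<in> orth_param \<mu> n p x ` canonical_space \<mu> n p x. 0 < joint_prior \<pi>\<psi> \<pi>l \<theta>}"

definition log_posterior ::
  "real measure \<Rightarrow> nat \<Rightarrow> nat \<Rightarrow> (nat \<Rightarrow> nat \<Rightarrow> real) \<Rightarrow> (nat \<Rightarrow> real) \<Rightarrow>
   (real \<Rightarrow> real) \<Rightarrow> ((nat \<Rightarrow> real) \<Rightarrow> real) \<Rightarrow> (nat \<Rightarrow> real) \<Rightarrow> real" where
  "log_posterior \<mu> n p x y \<pi>\<psi> \<pi>l \<theta> = ln (joint_prior \<pi>\<psi> \<pi>l \<theta>)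
     + loglik \<mu> n p x y (the_inv_into (canonical_space \<mu> n p x) (orth_param \<mu> n p x) \<theta>)"

definition slice_dom :: "nat \<Rightarrow> (nat \<Rightarrow> real) set \<Rightarrow> real \<Rightarrow> (nat \<Rightarrow> real) set" where
  "slice_dom p D \<psi> = {l \<in> Rvec (p - 1). case_nat \<psi> l \<in> D}"

definition slice_fun :: "((nat \<Rightarrow> real) \<Rightarrow> real) \<Rightarrow> real \<Rightarrow> (nat \<Rightarrow> real) \<Rightarrow> real" where
  "slice_fun g \<psi> l = g (case_nat \<psi> l)"

definition marginal_posterior ::
  "nat \<Rightarrow> (nat \<Rightarrow> real) set \<Rightarrow> ((nat \<Rightarrow> real) \<Rightarrow> real) \<Rightarrow> real \<Rightarrow> real" where
  "marginal_posterior p D g \<psi> =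
     (LINT l : slice_dom p D \<psi> | lebesgue_Rvec (p - 1). exp (g (case_nat \<psi> l)))
     / (LINT \<theta> : D | lebesgue_Rvec p. exp (g \<theta>))"

definition laplace_marginal ::
  "nat \<Rightarrow> (nat \<Rightarrow> real) set \<Rightarrow> ((nat \<Rightarrow> real) \<Rightarrow> real) \<Rightarrow> real \<Rightarrow> real" where
  "laplace_marginal p D g \<psi> =
     (let \<theta>h = arg_max_on g D;
          \<theta>h\<psi> = case_nat \<psi> (arg_max_on (slice_fun g \<psi>) (slice_dom p D \<psi>));
          H = deriv_slice p g \<theta>h [];
          Hll = Matrix.mat (p - 1) (p - 1) (\<lambda>(a, b). partials [Suc a, Suc b] g \<theta>h\<psi>)
      in sqrt (Determinant.det (- H)) / (sqrt (2 * pi) * sqrt (Determinant.det (- Hll)))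
         * exp (g \<theta>h\<psi> - g \<theta>h))"

end

theory Submission
  imports Defs "HOL-Probability.Distributions"
begin

text \<open>
  Near the maximizer \<open>zh\<close>, \<open>exp (h z - h zh)\<close> is the Gaussian weight of the Hessian times \<open>exp R\<close>, where
  \<open>R\<close> vanishes to second order, and one has to show that the localized Gaussian mean of \<open>exp R\<close> is
  \<open>1 + O(p^2 / n)\<close> although \<open>R\<close> is not uniformly small when the dimension grows. From below,
  \<open>exp R \<ge> 1 + R\<close>, and the mean of \<open>R\<close> is computed by Gaussian integration by parts. From above, let
  \<open>u\<close>, \<open>v\<close> be independent Gaussian vectors. The rotations \<open>cos \<theta> u + sin \<theta> v\<close> and
  \<open>- sin \<theta> u + cos \<theta> v\<close> are again independent Gaussian, so Jensen's inequality along the path from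
  \<open>u\<close> to \<open>v\<close> bounds the mean of \<open>exp R\<close> by its mean part and the mean of the exponential of a multiple
  of the derivative of \<open>R\<close> at \<open>u\<close> in the direction \<open>v\<close>. Applying this to that directional derivative
  and once more climbs to the third derivative, whose slices are bounded by assumption, so that the
  resulting Gaussian trilinear form has an exponential moment of the required size; the means that
  appear on the way are controlled by integration by parts and the slices of the fourth derivative.

  Away from the small ball, strong concavity of \<open>h\<close> gives Gaussian tails. There the second
  derivatives are only known to exist and to be bounded, so the mean value theorem for the gradient
  is applied after averaging. The theorem is the quotient of the resulting expansions in dimensions
  \<open>p - 1\<close> and \<open>p\<close>, because the Hessian of \<open>\<lambda> \<mapsto> g(\<psi>, \<lambda>)\<close> is the nuisance block of that of \<open>g\<close>.
\<close>

subsection \<open>Lebesgue measure on finitely many coordinates\<close>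

text \<open>A uniform bound for \<open>R\<close> on the ball of radius \<gamma> = sqrt(p log n / n)
  is too weak: a cubic form whose slices have norm n can reach n sqrt(p) \<gamma>^3 = p^2
  log(n)^(3/2) / sqrt(n) there, which need not stay bounded. At a Gaussian argument only the
  Frobenius norm of the tensor counts. Each of its p^2 rows has norm of order n at most, and the
  covariances contribute n^(-3), so the exponent is of order p^2 n^2 / n^3 = p^2 / n: this is the
  origin of the rate. The estimate is elementary for a trilinear form in three independent Gaussian
  vectors, which is why \<open>R\<close> is decoupled until only its third derivative at a further
  vector is left.

  Each decoupling doubles the radius, because rotating a pair of vectors of length sqrt(2) r can
  produce length 2 r. Three of them lead from r to 8 r, which has to stay below sqrt(2) \<gamma>,
  the radius up to which higher derivatives are controlled; hence r = \<gamma> / 8. The logarithm in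
  \<gamma> then makes the Gaussian mass beyond radius r at most of order 1/n, although the tail
  bound carries a factor exponential in p.\<close>

definition lebR :: "nat set \<Rightarrow> (nat \<Rightarrow> real) measure" where
  "lebR I = distr (PiM I (\<lambda>_. lborel)) borel (\<lambda>u i. if i \<in> I then u i else 0)"

lemma borel_measurable_coord [measurable (raw)]: "(\<lambda>u::nat \<Rightarrow> real. u i) \<in> borel_measurable borel"
  by (intro borel_measurable_continuous_onI continuous_on_product_coordinates)

lemma borel_measurable_into_fun:
  assumes "\<And>i. (\<lambda>x. f x i) \<in> borel_measurable M"
  shows "(f :: 'a \<Rightarrow> nat \<Rightarrow> real) \<in> borel_measurable M"
  using assms by (rule measurable_coordinatewise_then_product)

text \<open>Extension by zero makes \<open>lebR\<close> a measure on functions on all naturals: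
  vectors of every dimension share one type, and sums and multiples of vectors that vanish off
  \<open>I\<close> vanish there as well. Extensional functions, which are \<open>undefined\<close>
  off \<open>I\<close>, have no such stability.\<close>

lemma zero_ext_measurable [measurable]:
  "(\<lambda>u (i::nat). if i \<in> I then u i else 0 :: real) \<in> PiM I (\<lambda>_. lborel) \<rightarrow>\<^sub>M borel"
proof (rule borel_measurable_into_fun)
  fix i show "(\<lambda>u. if i \<in> I then u i else 0 :: real) \<in> borel_measurable (PiM I (\<lambda>_. lborel))"
    using measurable_component_singleton[of i I "\<lambda>_. lborel :: real measure"] by (cases "i \<in> I") auto
qed

lemma sets_lebR [simp, measurable_cong]: "sets (lebR I) = sets borel"
  and space_lebR [simp]: "space (lebR I) = UNIV"
  by (auto simp: lebR_def)

lemma borel_measurable_fun_upd [measurable]: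
  assumes [measurable]: "f \<in> borel_measurable M" "g \<in> borel_measurable M"
  shows "(\<lambda>x. (f x)(i := g x) :: nat \<Rightarrow> real) \<in> borel_measurable M"
proof (rule borel_measurable_into_fun)
  fix j
  have "(\<lambda>x. f x j) \<in> borel_measurable M"
    using measurable_compose[OF assms(1) borel_measurable_coord[of j]] .
  then show "(\<lambda>x. ((f x)(i := g x)) j) \<in> borel_measurable M"
    by (cases "j = i") auto
qed

lemma borel_measurable_coord' [measurable_dest]:
  "f \<in> borel_measurable M \<Longrightarrow> (\<lambda>x. (f x :: nat \<Rightarrow> real) i) \<in> borel_measurable M"
  by (rule measurable_compose[OF _ borel_measurable_coord])

lemma borel_measurable_coord_fst [measurable (raw)]:
  "f \<in> M \<rightarrow>\<^sub>M borel \<Otimes>\<^sub>M N \<Longrightarrow> (\<lambda>x. fst (f x) (i::nat) :: real) \<in> borel_measurable M"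
  by (rule borel_measurable_coord'[OF measurable_compose[OF _ measurable_fst]])

lemma borel_measurable_coord_snd [measurable (raw)]:
  "f \<in> M \<rightarrow>\<^sub>M N \<Otimes>\<^sub>M borel \<Longrightarrow> (\<lambda>x. snd (f x) (i::nat) :: real) \<in> borel_measurable M"
  by (rule borel_measurable_coord'[OF measurable_compose[OF _ measurable_snd]])

lemma nn_integral_lebR:
  assumes "f \<in> borel_measurable borel"
  shows "(\<integral>\<^sup>+u. f u \<partial>lebR I) = (\<integral>\<^sup>+u. f (\<lambda>i. if i \<in> I then u i else 0) \<partial>PiM I (\<lambda>_. lborel))"
  unfolding lebR_def by (subst nn_integral_distr) (use assms in auto)

lemma nn_integral_lebR_insert:
  assumes I: "finite I" "i \<notin> I" and f [measurable]: "f \<in> borel_measurable borel"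
  shows "(\<integral>\<^sup>+u. f u \<partial>lebR (insert i I)) = (\<integral>\<^sup>+u. \<integral>\<^sup>+t. f (u(i := t)) \<partial>lborel \<partial>lebR I)"
proof -
  interpret product_sigma_finite "\<lambda>_. lborel :: real measure" by standard
  have *: "(\<lambda>j. if j = i \<or> j \<in> I then (u(i := t)) j else 0) = (\<lambda>j. if j \<in> I then u j else 0)(i := t)"
    for u and t :: real using I by auto
  show ?thesis
    by (subst nn_integral_lebR, simp, subst product_nn_integral_insert[OF I])
       (auto simp: * nn_integral_lebR intro!: measurable_compose[OF zero_ext_measurable[of "insert i I", simplified]])
qed

text \<open>A shift by a second integration variable is legitimate only if that variable vanishes
  off \<open>I\<close>; almost every one does.\<close>

lemma AE_lebR_zero: "AE u in lebR I. \<forall>j. j \<notin> I \<longrightarrow> u j = 0"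
  unfolding lebR_def by (subst AE_distr_iff) auto

lemma sigma_finite_lebR:
  assumes "finite I"
  shows "sigma_finite_measure (lebR I)"
proof
  interpret product_sigma_finite "\<lambda>_. lborel :: real measure" by standard
  define A where "A n = {u::nat \<Rightarrow> real. \<forall>i\<in>I. \<bar>u i\<bar> \<le> real n}" for n :: nat
  have A [measurable]: "A n \<in> sets borel" for n
    unfolding A_def using assms by measurable
  have "emeasure (lebR I) (A n) < \<infinity>" for n
  proof -
    have "emeasure (lebR I) (A n) = emeasure (PiM I (\<lambda>_. lborel)) (PiE I (\<lambda>_. {- real n..real n}))"
      unfolding lebR_def
      by (subst emeasure_distr) (auto intro!: arg_cong[where f = "emeasure _"]
          simp: A_def space_PiM PiE_iff abs_le_iff minus_le_iff)
    also have "\<dots> = (\<Prod>i\<in>I. ennreal (2 * real n))"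
      using assms by (subst emeasure_PiM) auto
    finally show ?thesis
      by (simp add: power_less_top_ennreal)
  qed
  moreover have "(\<Union>n. A n) = UNIV"
  proof safe
    fix u :: "nat \<Rightarrow> real"
    obtain n where "(\<Sum>i\<in>I. \<bar>u i\<bar>) \<le> real n" using real_arch_simple by blast
    then have "u \<in> A n"
      unfolding A_def using member_le_sum[of _ I "\<lambda>i. \<bar>u i\<bar>"] assms by force
    then show "u \<in> (\<Union>n. A n)" by blast
  qed simp
  ultimately show "\<exists>A. countable A \<and> A \<subseteq> sets (lebR I) \<and> \<Union> A = space (lebR I) \<and>
      (\<forall>a\<in>A. emeasure (lebR I) a \<noteq> \<infinity>)"
    by (intro exI[of _ "range A"]) (auto simp: less_top[symmetric])
qed

lemma nn_integral_lborel_shift: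
  assumes "f \<in> borel_measurable borel"
  shows "(\<integral>\<^sup>+t. f (t + c) \<partial>lborel) = (\<integral>\<^sup>+t. f t \<partial>(lborel :: real measure))"
  using nn_integral_real_affine[of f 1 c] assms by (simp add: add.commute)

text \<open>By induction, one coordinate at a time. The measure sits on functions that vanish off
  \<open>I\<close>, hence the condition on \<open>c\<close>.\<close>

lemma nn_integral_lebR_translate:
  assumes "finite I" "f \<in> borel_measurable borel" "\<And>j. j \<notin> I \<Longrightarrow> c j = 0"
  shows "(\<integral>\<^sup>+u. f (\<lambda>j. u j + c j) \<partial>lebR I) = (\<integral>\<^sup>+u. f u \<partial>lebR I)"
  using assms
proof (induction I arbitrary: f c rule: finite_induct)
  case empty
  then show ?case by simp
next
  case (insert i I)
  note [measurable] = insert.prems(1)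
  interpret sigma_finite_measure lborel by standard
  have [measurable]: "(\<lambda>u j. u j + b j :: real) \<in> borel_measurable borel" for b :: "nat \<Rightarrow> real"
    by (rule borel_measurable_into_fun) simp
  have "(\<integral>\<^sup>+u. f (\<lambda>j. u j + c j) \<partial>lebR (insert i I))
      = (\<integral>\<^sup>+u. \<integral>\<^sup>+t. f (\<lambda>j. (u(i := t)) j + c j) \<partial>lborel \<partial>lebR I)"
    using insert.hyps by (intro nn_integral_lebR_insert) auto
  also have "\<dots> = (\<integral>\<^sup>+u. \<integral>\<^sup>+t. f ((\<lambda>j. u j + (c(i := 0)) j)(i := t + c i)) \<partial>lborel \<partial>lebR I)"
    by (intro nn_integral_cong arg_cong[where f = f]) auto
  also have "\<dots> = (\<integral>\<^sup>+u. \<integral>\<^sup>+t. f ((\<lambda>j. u j + (c(i := 0)) j)(i := t)) \<partial>lborel \<partial>lebR I)"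
  proof (rule nn_integral_cong)
    fix u :: "nat \<Rightarrow> real"
    show "(\<integral>\<^sup>+t. f ((\<lambda>j. u j + (c(i := 0)) j)(i := t + c i)) \<partial>lborel)
      = (\<integral>\<^sup>+t. f ((\<lambda>j. u j + (c(i := 0)) j)(i := t)) \<partial>lborel)"
      by (rule nn_integral_lborel_shift[where f = "\<lambda>t. f ((\<lambda>j. u j + (c(i := 0)) j)(i := t))"]) measurable
  qed
  also have "\<dots> = (\<integral>\<^sup>+u. \<integral>\<^sup>+t. f (u(i := t)) \<partial>lborel \<partial>lebR I)"
    by (rule insert.IH, measurable) (use insert.prems in auto)
  also have "\<dots> = (\<integral>\<^sup>+u. f u \<partial>lebR (insert i I))"
    using insert.hyps by (intro nn_integral_lebR_insert[symmetric]) auto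
  finally show ?case .
qed

lemma integral_lebR:
  assumes "f \<in> borel_measurable borel"
  shows "(\<integral>u. f u \<partial>lebR I) = (\<integral>u. f (\<lambda>i. if i \<in> I then u i else 0) \<partial>PiM I (\<lambda>_. lborel) :: real)"
  unfolding lebR_def by (subst integral_distr) (use assms in auto)

lemma integrable_lebR_iff:
  assumes "f \<in> borel_measurable borel"
  shows "integrable (lebR I) f \<longleftrightarrow>
    integrable (PiM I (\<lambda>_. lborel)) (\<lambda>u. f (\<lambda>i. if i \<in> I then u i else 0) :: real)"
  unfolding lebR_def by (subst integrable_distr_eq) (use assms in auto)

lemma integral_lebR_insert:
  assumes I: "finite I" "i \<notin> I" and f: "integrable (lebR (insert i I)) (f :: _ \<Rightarrow> real)"
  shows "(\<integral>u. f u \<partial>lebR (insert i I)) = (\<integral>u. \<integral>t. f (u(i := t)) \<partial>lborel \<partial>lebR I)"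
proof -
  interpret product_sigma_finite "\<lambda>_. lborel :: real measure" by standard
  have [measurable]: "f \<in> borel_measurable borel"
    using f borel_measurable_integrable by auto
  have *: "(\<lambda>j. if j = i \<or> j \<in> I then (u(i := t)) j else 0) = (\<lambda>j. if j \<in> I then u j else 0)(i := t)"
    for u and t :: real using I by auto
  have "integrable (PiM (insert i I) (\<lambda>_. lborel)) (\<lambda>u. f (\<lambda>j. if j \<in> insert i I then u j else 0))"
    using f by (subst (asm) integrable_lebR_iff) auto
  from product_integral_insert[OF I this]
  have "(\<integral>u. f u \<partial>lebR (insert i I))
      = (\<integral>u. \<integral>t. f ((\<lambda>j. if j \<in> I then u j else 0)(i := t)) \<partial>lborel \<partial>PiM I (\<lambda>_. lborel))"
    by (simp add: integral_lebR *)
  also have "\<dots> = (\<integral>u. \<integral>t. f (u(i := t)) \<partial>lborel \<partial>lebR I)"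
    by (subst integral_lebR) auto
  finally show ?thesis .
qed

subsection \<open>Gaussian integrals\<close>

definition ip :: "nat \<Rightarrow> (nat \<Rightarrow> real) \<Rightarrow> (nat \<Rightarrow> real) \<Rightarrow> real" where
  "ip q u v = (\<Sum>i<q. u i * v i)"

definition bil :: "nat \<Rightarrow> (nat \<Rightarrow> nat \<Rightarrow> real) \<Rightarrow> (nat \<Rightarrow> real) \<Rightarrow> (nat \<Rightarrow> real) \<Rightarrow> real" where
  "bil q A u v = (\<Sum>i<q. \<Sum>j<q. A i j * u i * v j)"

abbreviation nm :: "nat \<Rightarrow> (nat \<Rightarrow> real) \<Rightarrow> real" where
  "nm q u \<equiv> L2_set u {..<q}"

lemma nm_sq: "(nm q u)\<^sup>2 = ip q u u"
  by (simp add: L2_set_def ip_def power2_eq_square sum_nonneg)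

lemma ip_nonneg: "0 \<le> ip q u u"
  by (simp add: ip_def sum_nonneg)

lemma abs_ip_le: "\<bar>ip q u v\<bar> \<le> nm q u * nm q v"
proof -
  have "\<bar>ip q u v\<bar> \<le> (\<Sum>i<q. \<bar>u i\<bar> * \<bar>v i\<bar>)"
    unfolding ip_def by (rule order_trans[OF sum_abs]) (simp add: abs_mult)
  then show ?thesis using L2_set_mult_ineq[of u v "{..<q}"] by simp
qed

lemma ip_le: "ip q u v \<le> nm q u * nm q v"
  using abs_ip_le[of q u v] by linarith

text \<open>Take \<open>y = b\<close>. The assumptions on derivatives bound bilinear forms, so norms
  of gradients and of matrix rows are obtained by this duality.\<close>

lemma nm_le_if_dual:
  assumes "\<And>y. \<bar>ip q b y\<bar> \<le> c * nm q y" "0 \<le> c"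
  shows "nm q b \<le> c"
proof (cases "nm q b = 0")
  case False
  have "nm q b * nm q b \<le> c * nm q b"
    using assms(1)[of b] by (simp add: nm_sq[symmetric] power2_eq_square)
  then show ?thesis using False L2_set_nonneg[of b "{..<q}"] by (simp add: mult_le_cancel_right)
qed (use assms in simp)

lemma bil_eq_ip: "bil q A u v = ip q u (\<lambda>i. \<Sum>j<q. A i j * v j)"
  by (simp add: bil_def ip_def sum_distrib_left mult_ac)

lemma bil_sym:
  assumes "\<And>i j. i < q \<Longrightarrow> j < q \<Longrightarrow> A i j = A j i"
  shows "bil q A u v = bil q A v u"
  unfolding bil_def by (subst sum.swap, intro sum.cong) (auto simp: assms)

lemma bil_add_left: "bil q A (\<lambda>i. u i + v i) z = bil q A u z + bil q A v z"
  and bil_add_right: "bil q A z (\<lambda>i. u i + v i) = bil q A z u + bil q A z v"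
  and bil_diff_left: "bil q A (\<lambda>i. u i - v i) z = bil q A u z - bil q A v z"
  and bil_diff_right: "bil q A z (\<lambda>i. u i - v i) = bil q A z u - bil q A z v"
  and bil_scale_left: "bil q A (\<lambda>i. c * u i) z = c * bil q A u z"
  and bil_scale_right: "bil q A z (\<lambda>i. c * u i) = c * bil q A z u"
  by (simp_all add: bil_def algebra_simps sum.distrib sum_subtractf sum_distrib_left)

lemmas bil_simps = bil_add_left bil_add_right bil_diff_left bil_diff_right bil_scale_left bil_scale_right

lemma borel_measurable_ip [measurable (raw)]:
  assumes [measurable]: "f \<in> borel_measurable M" "g \<in> borel_measurable M"
  shows "(\<lambda>x. ip q (f x) (g x)) \<in> borel_measurable M"
  unfolding ip_def by measurable

lemma borel_measurable_bil [measurable (raw)]: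
  assumes [measurable]: "f \<in> borel_measurable M" "g \<in> borel_measurable M"
  shows "(\<lambda>x. bil q A (f x) (g x)) \<in> borel_measurable M"
  unfolding bil_def by measurable

lemma borel_measurable_nm [measurable (raw)]:
  assumes [measurable]: "f \<in> borel_measurable M"
  shows "(\<lambda>x. nm q (f x)) \<in> borel_measurable M"
  unfolding L2_set_def by measurable

lemma borel_measurable_lin [measurable (raw)]:
  assumes [measurable]: "f \<in> borel_measurable M" "g \<in> borel_measurable M"
    "h \<in> borel_measurable M" "k \<in> borel_measurable M"
  shows "(\<lambda>x (j::nat). f x * g x j + h x * k x j :: real) \<in> borel_measurable M"
  by (rule borel_measurable_into_fun) measurable

lemma nn_integral_gauss1:
  assumes "0 < a"
  shows "(\<integral>\<^sup>+t. ennreal (exp (- (a * (t + c)\<^sup>2) / 2)) \<partial>lborel) = ennreal (sqrt (2 * pi / a))"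
proof -
  have eq: "exp (- (a * (t + c)\<^sup>2) / 2) = sqrt (2 * pi / a) * normal_density (- c) (1 / sqrt a) t" for t
    using assms by (simp add: normal_density_def real_sqrt_divide power_divide field_simps)
  have "(\<integral>\<^sup>+t. ennreal (exp (- (a * (t + c)\<^sup>2) / 2)) \<partial>lborel)
      = ennreal (sqrt (2 * pi / a)) * (\<integral>\<^sup>+t. ennreal (normal_density (- c) (1 / sqrt a) t) \<partial>lborel)"
    unfolding eq using assms by (subst nn_integral_cmult[symmetric]) (auto simp: ennreal_mult'')
  also have "(\<integral>\<^sup>+t. ennreal (normal_density (- c) (1 / sqrt a) t) \<partial>lborel) = 1"
    using assms by (subst nn_integral_eq_integral) auto
  finally show ?thesis by simp
qed

text \<open>Block elimination of the last row and column; it serves to remove one coordinate at a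
  time from a Gaussian integral.\<close>

lemma det_schur_complement:
  fixes Q :: "nat \<Rightarrow> nat \<Rightarrow> real"
  assumes a: "Q q q \<noteq> 0"
  shows "Determinant.det (Matrix.mat (Suc q) (Suc q) (\<lambda>(i, j). Q i j))
    = Q q q * Determinant.det (Matrix.mat q q (\<lambda>(i, j). Q i j - Q i q * Q q j / Q q q))"
proof -
  define Q' where "Q' = Matrix.mat q q (\<lambda>(i, j). Q i j - Q i q * Q q j / Q q q)"
  define b where "b = Matrix.mat q 1 (\<lambda>(i, j). Q i q)"
  define c where "c = Matrix.mat 1 q (\<lambda>(i, j). Q q j / Q q q)"
  define a' where "a' = Matrix.mat 1 1 (\<lambda>_. Q q q)"
  have car: "Q' \<in> carrier_mat q q" "b \<in> carrier_mat q 1" "c \<in> carrier_mat 1 q" "a' \<in> carrier_mat 1 1"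
    by (auto simp: Q'_def b_def c_def a'_def)
  \<comment> \<open>Despite the names, \<open>?L\<close> is block upper triangular and
    \<open>?U\<close> unit block lower triangular, so both determinants can be read off.\<close>
  let ?L = "four_block_mat Q' b (0\<^sub>m 1 q) a'"
  let ?U = "four_block_mat (1\<^sub>m q) (0\<^sub>m q 1) c (1\<^sub>m 1)"
  have "?L * ?U = four_block_mat (Q' * 1\<^sub>m q + b * c) (Q' * 0\<^sub>m q 1 + b * 1\<^sub>m 1)
      (0\<^sub>m 1 q * 1\<^sub>m q + a' * c) (0\<^sub>m 1 q * 0\<^sub>m q 1 + a' * 1\<^sub>m 1)"
    by (rule mult_four_block_mat) (use car in auto)
  also have "\<dots> = Matrix.mat (Suc q) (Suc q) (\<lambda>(i, j). Q i j)"
    using a by (intro eq_matI) (auto simp: Q'_def b_def c_def a'_def scalar_prod_def less_Suc_eq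
        four_block_mat_def Let_def)
  finally have "Determinant.det (Matrix.mat (Suc q) (Suc q) (\<lambda>(i, j). Q i j))
      = Determinant.det (?L * ?U)" by simp
  also have "\<dots> = Determinant.det ?L * Determinant.det ?U"
    by (rule Determinant.det_mult[of _ "q + 1"]) (use car in auto)
  also have "Determinant.det ?L = Determinant.det Q' * Q q q"
    using car by (subst det_four_block_mat_lower_left_zero) (auto simp: det_single a'_def)
  also have "Determinant.det ?U = 1"
    using car by (subst det_four_block_mat_upper_right_zero) auto
  finally show ?thesis by (simp add: Q'_def)
qed

text \<open>Completing the square in the last coordinate leaves the Schur complement as the form of
  the remaining ones.\<close>

lemma bil_Suc_complete_square:
  assumes sym: "\<And>i j. i < Suc q \<Longrightarrow> j < Suc q \<Longrightarrow> Q i j = Q j i" and a: "Q q q \<noteq> 0"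
  shows "bil (Suc q) Q (u(q := t)) (u(q := t))
    = bil q (\<lambda>i j. Q i j - Q i q * Q q j / Q q q) u u + Q q q * (t + (\<Sum>i<q. Q q i * u i) / Q q q)\<^sup>2"
proof -
  define S where "S = (\<Sum>i<q. Q q i * u i)"
  have S': "(\<Sum>i<q. Q i q * u i) = S"
    unfolding S_def by (intro sum.cong) (auto simp: sym)
  have "bil (Suc q) Q (u(q := t)) (u(q := t)) = (\<Sum>i<q. \<Sum>j<q. Q i j * u i * u j)
      + (\<Sum>i<q. Q i q * u i * t) + (\<Sum>j<q. Q q j * t * u j) + Q q q * t * t"
    by (simp add: bil_def sum.distrib)
  also have "(\<Sum>i<q. Q i q * u i * t) = S * t"
    by (simp add: S'[symmetric] sum_distrib_right)
  also have "(\<Sum>j<q. Q q j * t * u j) = S * t"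
    by (simp add: S_def sum_distrib_left mult_ac)
  also have "(\<Sum>i<q. \<Sum>j<q. Q i j * u i * u j)
      = bil q (\<lambda>i j. Q i j - Q i q * Q q j / Q q q) u u + (\<Sum>i<q. \<Sum>j<q. Q i q * Q q j / Q q q * u i * u j)"
    by (simp add: bil_def sum.distrib[symmetric] algebra_simps)
  also have "(\<Sum>i<q. \<Sum>j<q. Q i q * Q q j / Q q q * u i * u j) = S * S / Q q q"
    unfolding S'[symmetric] by (subst S', unfold S_def) (simp add: sum_product sum_divide_distrib mult_ac)
  finally have "bil (Suc q) Q (u(q := t)) (u(q := t))
    = bil q (\<lambda>i j. Q i j - Q i q * Q q j / Q q q) u u + S * S / Q q q + S * t + S * t + Q q q * t * t" .
  moreover have "S * S / Q q q + S * t + S * t + Q q q * t * t = Q q q * (t + S / Q q q)\<^sup>2"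
    using a by (simp add: power2_eq_square field_simps)
  ultimately show ?thesis
    unfolding S_def by linarith
qed

lemma gauss_normalization:
  assumes "\<And>i j. i < q \<Longrightarrow> j < q \<Longrightarrow> Q i j = Q j i" "0 < \<kappa>" "\<And>u. \<kappa> * ip q u u \<le> bil q Q u u"
  shows "0 < Determinant.det (Matrix.mat q q (\<lambda>(i, j). Q i j)) \<and>
    (\<integral>\<^sup>+u. ennreal (exp (- bil q Q u u / 2)) \<partial>lebR {..<q})
      = ennreal (sqrt ((2 * pi) ^ q / Determinant.det (Matrix.mat q q (\<lambda>(i, j). Q i j))))"
  using assms
proof (induction q arbitrary: Q)
  case 0
  have "emeasure (lebR {}) UNIV = 1"
    unfolding lebR_def by (subst emeasure_distr) (auto simp: PiM_empty)
  then show ?case by (simp add: bil_def)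
next
  case (Suc q)
  define a where "a = Q q q"
  define Q' where "Q' = (\<lambda>i j. Q i j - Q i q * Q q j / Q q q)"
  define S where "S u = (\<Sum>i<q. Q q i * u i) / a" for u
  have a: "0 < a"
  proof -
    have "(\<Sum>i<Suc q. (if i = q then 1 else 0) * (if i = q then 1 else (0::real))) = 1"
      by (simp add: if_distrib cong: if_cong)
    then have "\<kappa> * 1 \<le> bil (Suc q) Q (\<lambda>i. if i = q then 1 else 0) (\<lambda>i. if i = q then 1 else 0)"
      using Suc.prems(3)[of "\<lambda>i. if i = q then 1 else 0"] by (simp only: ip_def)
    also have "\<dots> = a"
      by (simp add: bil_def a_def if_distrib cong: if_cong)
    finally show ?thesis using Suc.prems by simp
  qed
  have sq: "bil (Suc q) Q (u(q := t)) (u(q := t)) = bil q Q' u u + a * (t + S u)\<^sup>2" for u t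
    using bil_Suc_complete_square[of q Q u t] Suc.prems(1) a unfolding Q'_def S_def a_def by simp
  \<comment> \<open>The choice \<open>t = - S u\<close> kills the square, and the additional
    coordinate only enlarges the norm: the Schur complement is coercive with the same
    \<kappa>.\<close>
  have low: "\<kappa> * ip q u u \<le> bil q Q' u u" for u
  proof -
    have "\<kappa> * ip q u u \<le> \<kappa> * ip (Suc q) (u(q := - S u)) (u(q := - S u))"
      using Suc.prems(2) by (simp add: ip_def)
    also have "\<dots> \<le> bil q Q' u u"
      using Suc.prems(3)[of "u(q := - S u)"] unfolding sq
      by (simp only: add.left_inverse) (simp del: fun_upd_apply)
    finally show ?thesis .
  qed
  have IH: "0 < Determinant.det (Matrix.mat q q (\<lambda>(i, j). Q' i j))"
    "(\<integral>\<^sup>+u. ennreal (exp (- bil q Q' u u / 2)) \<partial>lebR {..<q})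
      = ennreal (sqrt ((2 * pi) ^ q / Determinant.det (Matrix.mat q q (\<lambda>(i, j). Q' i j))))"
    using Suc.IH[of Q'] Suc.prems(1) low Suc.prems(2) by (auto simp: Q'_def)
  have det: "Determinant.det (Matrix.mat (Suc q) (Suc q) (\<lambda>(i, j). Q i j))
      = a * Determinant.det (Matrix.mat q q (\<lambda>(i, j). Q' i j))"
    using det_schur_complement[of Q q] a by (simp add: a_def Q'_def)
  have "(\<integral>\<^sup>+u. ennreal (exp (- bil (Suc q) Q u u / 2)) \<partial>lebR {..<Suc q})
      = (\<integral>\<^sup>+u. \<integral>\<^sup>+t. ennreal (exp (- bil (Suc q) Q (u(q := t)) (u(q := t)) / 2)) \<partial>lborel \<partial>lebR {..<q})"
    unfolding lessThan_Suc by (rule nn_integral_lebR_insert) auto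
  also have "\<dots> = (\<integral>\<^sup>+u. ennreal (exp (- bil q Q' u u / 2)) * ennreal (sqrt (2 * pi / a)) \<partial>lebR {..<q})"
  proof (rule nn_integral_cong)
    fix u :: "nat \<Rightarrow> real"
    have "exp (- bil (Suc q) Q (u(q := t)) (u(q := t)) / 2)
        = exp (- bil q Q' u u / 2) * exp (- (a * (t + S u)\<^sup>2) / 2)" for t
      by (simp add: sq diff_divide_distrib exp_add[symmetric] add_divide_distrib)
    then show "(\<integral>\<^sup>+t. ennreal (exp (- bil (Suc q) Q (u(q := t)) (u(q := t)) / 2)) \<partial>lborel)
        = ennreal (exp (- bil q Q' u u / 2)) * ennreal (sqrt (2 * pi / a))"
      using nn_integral_gauss1[OF a, of "S u"]
      by (simp add: ennreal_mult nn_integral_cmult)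
  qed
  also have "\<dots> = ennreal (sqrt ((2 * pi) ^ q / Determinant.det (Matrix.mat q q (\<lambda>(i, j). Q' i j))))
      * ennreal (sqrt (2 * pi / a))"
    unfolding IH(2)[symmetric] by (rule nn_integral_multc) measurable
  also have "\<dots> = ennreal (sqrt ((2 * pi) ^ Suc q
      / Determinant.det (Matrix.mat (Suc q) (Suc q) (\<lambda>(i, j). Q i j))))"
    using IH(1) a by (simp add: det ennreal_mult[symmetric] real_sqrt_mult[symmetric] mult_ac)
  finally show ?case using IH(1) a det by simp
qed

subsection \<open>Gaussian measures and rotations\<close>

text \<open>Uses the tangent of the exponential at the mean. The weight \<open>w\<close> may have
  any positive mass, because it will be a cutoff under a Gaussian measure.\<close>

lemma exp_Jensen:
  fixes w F :: "'a \<Rightarrow> real"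
  assumes int: "integrable M w" "integrable M (\<lambda>u. w u * F u)" "integrable M (\<lambda>u. w u * exp (- F u))"
    and nonneg: "\<And>u. 0 \<le> w u" and pos: "0 < (\<integral>u. w u \<partial>M)"
  shows "(\<integral>u. w u \<partial>M) * exp (- (\<integral>u. w u * F u \<partial>M) / (\<integral>u. w u \<partial>M))
    \<le> (\<integral>u. w u * exp (- F u) \<partial>M)"
proof -
  define a m where "a = (\<integral>u. w u \<partial>M)" and "m = (\<integral>u. w u * F u \<partial>M)"
  have a: "a > 0" using pos by (simp add: a_def)
  have "(\<integral>u. exp (- m / a) * ((1 + m / a) * w u - w u * F u) \<partial>M)
      = exp (- m / a) * ((1 + m / a) * a - m)"
    using int by (simp add: a_def m_def)
  also have "\<dots> = a * exp (- m / a)"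
    using a by (simp add: field_simps)
  finally have "a * exp (- m / a) = (\<integral>u. exp (- m / a) * ((1 + m / a) * w u - w u * F u) \<partial>M)" ..
  also have "\<dots> \<le> (\<integral>u. w u * exp (- F u) \<partial>M)"
  proof (rule integral_mono)
    fix u
    have "exp (- m / a) * (1 + (m / a - F u)) \<le> exp (- m / a) * exp (m / a - F u)"
      by (intro mult_left_mono exp_ge_add_one_self) auto
    also have "\<dots> = exp (- F u)"
      by (simp add: exp_add[symmetric])
    finally have "w u * (exp (- m / a) * (1 + (m / a - F u))) \<le> w u * exp (- F u)"
      using nonneg by (intro mult_left_mono)
    then show "exp (- m / a) * ((1 + m / a) * w u - w u * F u) \<le> w u * exp (- F u)"
      by (simp add: algebra_simps)
  qed (use int in auto)
  finally show ?thesis by (simp add: a_def m_def)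
qed

lemma lebR_shear_left:
  assumes I: "finite I" and f [measurable]: "case_prod f \<in> borel_measurable (borel \<Otimes>\<^sub>M borel)"
  shows "(\<integral>\<^sup>+u. \<integral>\<^sup>+v. f (\<lambda>j. u j + a * v j) v \<partial>lebR I \<partial>lebR I) = (\<integral>\<^sup>+u. \<integral>\<^sup>+v. f u v \<partial>lebR I \<partial>lebR I)"
proof -
  interpret sigma_finite_measure "lebR I" by (rule sigma_finite_lebR[OF I])
  interpret pair_sigma_finite "lebR I" "lebR I" ..
  have [measurable]: "(\<lambda>(u, v). f (\<lambda>j. u j + a * v j) v) \<in> borel_measurable (borel \<Otimes>\<^sub>M borel)"
  proof -
    have [measurable]: "(\<lambda>x (j::nat). fst x j + a * snd x j) \<in> borel_measurable (borel \<Otimes>\<^sub>M borel)"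
      by (rule borel_measurable_into_fun) measurable
    have "(\<lambda>x. (\<lambda>j::nat. fst x j + a * snd x j, snd x)) \<in> borel \<Otimes>\<^sub>M borel \<rightarrow>\<^sub>M borel \<Otimes>\<^sub>M borel"
      by (intro measurable_Pair) measurable
    from measurable_compose[OF this f] show ?thesis
      by (simp add: split_beta')
  qed
  have "(\<integral>\<^sup>+u. \<integral>\<^sup>+v. f (\<lambda>j. u j + a * v j) v \<partial>lebR I \<partial>lebR I)
      = (\<integral>\<^sup>+v. \<integral>\<^sup>+u. f (\<lambda>j. u j + a * v j) v \<partial>lebR I \<partial>lebR I)"
    by (rule Fubini'[symmetric]) measurable
  also have "\<dots> = (\<integral>\<^sup>+v. \<integral>\<^sup>+u. f u v \<partial>lebR I \<partial>lebR I)"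
  proof (rule nn_integral_cong_AE)
    show "AE v in lebR I. (\<integral>\<^sup>+u. f (\<lambda>j. u j + a * v j) v \<partial>lebR I) = (\<integral>\<^sup>+u. f u v \<partial>lebR I)"
      using AE_lebR_zero
    proof eventually_elim
      case (elim v)
      show ?case
        by (rule nn_integral_lebR_translate[OF I, of "\<lambda>u. f u v" "\<lambda>j. a * v j"]) (use elim in auto)
    qed
  qed
  also have "\<dots> = (\<integral>\<^sup>+u. \<integral>\<^sup>+v. f u v \<partial>lebR I \<partial>lebR I)"
    by (rule Fubini') measurable
  finally show ?thesis .
qed

lemma lebR_shear_right:
  assumes I: "finite I" and f [measurable]: "case_prod f \<in> borel_measurable (borel \<Otimes>\<^sub>M borel)"
  shows "(\<integral>\<^sup>+u. \<integral>\<^sup>+v. f u (\<lambda>j. v j + a * u j) \<partial>lebR I \<partial>lebR I) = (\<integral>\<^sup>+u. \<integral>\<^sup>+v. f u v \<partial>lebR I \<partial>lebR I)"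
proof (rule nn_integral_cong_AE)
  show "AE u in lebR I. (\<integral>\<^sup>+v. f u (\<lambda>j. v j + a * u j) \<partial>lebR I) = (\<integral>\<^sup>+v. f u v \<partial>lebR I)"
    using AE_lebR_zero
  proof eventually_elim
    case (elim u)
    show ?case
      by (rule nn_integral_lebR_translate[OF I, of "\<lambda>v. f u v" "\<lambda>j. a * u j"]) (use elim in auto)
  qed
qed

lemma borel_measurable_lin_pair:
  assumes f: "case_prod f \<in> borel_measurable (borel \<Otimes>\<^sub>M borel)"
  shows "(\<lambda>(u, v). f (\<lambda>j::nat. a * u j + b * v j :: real) (\<lambda>j::nat. c * u j + d * v j))
    \<in> borel_measurable (borel \<Otimes>\<^sub>M borel)"
proof -
  have "(\<lambda>x. (\<lambda>j::nat. a * fst x j + b * snd x j, \<lambda>j::nat. c * fst x j + d * snd x j))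
      \<in> borel \<Otimes>\<^sub>M borel \<rightarrow>\<^sub>M borel \<Otimes>\<^sub>M borel"
    by (intro measurable_Pair borel_measurable_lin) measurable
  from measurable_compose[OF this f] show ?thesis
    by (simp add: split_beta')
qed

text \<open>A rotation by an angle that is not a multiple of \<open>\<pi>\<close> is a product of three shears.\<close>

lemma lebR_rotation:
  assumes I: "finite I" and f [measurable]: "case_prod f \<in> borel_measurable (borel \<Otimes>\<^sub>M borel)"
    and cs: "c\<^sup>2 + s\<^sup>2 = 1" "s = 0 \<Longrightarrow> c = 1"
  shows "(\<integral>\<^sup>+u. \<integral>\<^sup>+v. f (\<lambda>j. c * u j + s * v j) (\<lambda>j. - s * u j + c * v j) \<partial>lebR I \<partial>lebR I)
    = (\<integral>\<^sup>+u. \<integral>\<^sup>+v. f u v \<partial>lebR I \<partial>lebR I)"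
proof (cases "s = 0")
  case True
  then show ?thesis using cs by simp
next
  case False
  \<comment> \<open>For the angle with cosine \<open>c\<close> and sine \<open>s\<close> this is the
    tangent of half the angle, the parameter of the first and the last shear; the middle one has
    parameter \<open>- s\<close>.\<close>
  define t where "t = (1 - c) / s"
  have ts: "t * s = 1 - c" using False by (simp add: t_def)
  have tc: "t * (1 + c) = s"
    using cs(1) False by (simp add: t_def field_simps power2_eq_square)
  define g where "g = (\<lambda>u v. f (\<lambda>j. 1 * u j + t * v j) (\<lambda>j. 0 * u j + 1 * v j))"
  define h where "h = (\<lambda>u v. g (\<lambda>j. 1 * u j + 0 * v j) (\<lambda>j. - s * u j + 1 * v j))"
  have [measurable]: "case_prod g \<in> borel_measurable (borel \<Otimes>\<^sub>M borel)"
    unfolding g_def by (rule borel_measurable_lin_pair[OF f])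
  then have [measurable]: "case_prod h \<in> borel_measurable (borel \<Otimes>\<^sub>M borel)"
    unfolding h_def by (rule borel_measurable_lin_pair)
  have "f (\<lambda>j. c * u j + s * v j) (\<lambda>j. - s * u j + c * v j) = h (\<lambda>j. u j + t * v j) v" for u v
  proof -
    have "(u j + t * v j) + t * (- s * (u j + t * v j) + v j)
        = (1 - t * s) * u j + (t * (1 + (1 - t * s))) * v j" for j
      by (simp add: algebra_simps)
    then have 1: "(u j + t * v j) + t * (- s * (u j + t * v j) + v j) = c * u j + s * v j" for j
      unfolding ts using tc by simp
    have 2: "- s * (u j + t * v j) + v j = - s * u j + c * v j" for j
    proof -
      have "- s * (u j + t * v j) + v j = - s * u j + (1 - t * s) * v j"
        by (simp add: algebra_simps)
      then show ?thesis using ts by simp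
    qed
    show ?thesis
      unfolding h_def g_def using 1 2 by simp
  qed
  then have "(\<integral>\<^sup>+u. \<integral>\<^sup>+v. f (\<lambda>j. c * u j + s * v j) (\<lambda>j. - s * u j + c * v j) \<partial>lebR I \<partial>lebR I)
      = (\<integral>\<^sup>+u. \<integral>\<^sup>+v. h (\<lambda>j. u j + t * v j) v \<partial>lebR I \<partial>lebR I)"
    by simp
  also have "\<dots> = (\<integral>\<^sup>+u. \<integral>\<^sup>+v. h u v \<partial>lebR I \<partial>lebR I)"
    by (rule lebR_shear_left[OF I]) measurable
  also have "\<dots> = (\<integral>\<^sup>+u. \<integral>\<^sup>+v. g u (\<lambda>j. v j + (- s) * u j) \<partial>lebR I \<partial>lebR I)"
    by (simp add: h_def add.commute)
  also have "\<dots> = (\<integral>\<^sup>+u. \<integral>\<^sup>+v. g u v \<partial>lebR I \<partial>lebR I)"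
    by (rule lebR_shear_right[OF I]) measurable
  also have "\<dots> = (\<integral>\<^sup>+u. \<integral>\<^sup>+v. f (\<lambda>j. u j + t * v j) v \<partial>lebR I \<partial>lebR I)"
    by (simp add: g_def)
  also have "\<dots> = (\<integral>\<^sup>+u. \<integral>\<^sup>+v. f u v \<partial>lebR I \<partial>lebR I)"
    by (rule lebR_shear_left[OF I]) measurable
  finally show ?thesis .
qed

text \<open>The form \<open>Q\<close> plays the role of minus the Hessian at the maximizer. Its
  spectrum enters through the lower bound \<kappa>, which is of order n; the tail bounds need an
  upper bound as well.\<close>

locale pd_form =
  fixes q :: nat and Q :: "nat \<Rightarrow> nat \<Rightarrow> real" and \<kappa> :: real
  assumes sym: "\<And>i j. i < q \<Longrightarrow> j < q \<Longrightarrow> Q i j = Q j i"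
    and kappa_pos: "0 < \<kappa>"
    and coercive: "\<And>u. \<kappa> * ip q u u \<le> bil q Q u u"
begin

definition Qdet :: real where
  "Qdet = Determinant.det (Matrix.mat q q (\<lambda>(i, j). Q i j))"

definition Z :: real where
  "Z = sqrt ((2 * pi) ^ q / Qdet)"

definition wt :: "(nat \<Rightarrow> real) \<Rightarrow> real" where
  "wt u = exp (- bil q Q u u / 2)"

definition G :: "(nat \<Rightarrow> real) measure" where
  "G = density (lebR {..<q}) (\<lambda>u. ennreal (wt u / Z))"

lemma Qdet_pos: "0 < Qdet"
  and nn_integral_wt: "(\<integral>\<^sup>+u. ennreal (wt u) \<partial>lebR {..<q}) = ennreal Z"
  using gauss_normalization[of q Q \<kappa>] sym kappa_pos coercive
  by (auto simp: Qdet_def Z_def wt_def)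

lemma Z_pos: "0 < Z"
  using Qdet_pos by (simp add: Z_def)

lemma wt_pos: "0 < wt u" by (simp add: wt_def)

lemma wt_measurable [measurable]: "wt \<in> borel_measurable borel"
  unfolding wt_def[abs_def] by measurable

lemma sets_G [simp, measurable_cong]: "sets G = sets borel"
  and space_G [simp]: "space G = UNIV"
  by (auto simp: G_def)

lemma nn_integral_G:
  assumes [measurable]: "f \<in> borel_measurable borel"
  shows "(\<integral>\<^sup>+u. f u \<partial>G) = (\<integral>\<^sup>+u. ennreal (wt u / Z) * f u \<partial>lebR {..<q})"
  unfolding G_def by (rule nn_integral_density) measurable

lemma prob_G: "prob_space G"
proof
  have "emeasure G (space G) = (\<integral>\<^sup>+u. 1 \<partial>G)" by simp
  also have "\<dots> = (\<integral>\<^sup>+u. ennreal (wt u) * ennreal (1 / Z) \<partial>lebR {..<q})"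
    using Z_pos wt_pos
    by (subst nn_integral_G) (auto simp: ennreal_mult[symmetric] less_imp_le intro!: nn_integral_cong)
  also have "\<dots> = 1"
    using Z_pos by (subst nn_integral_multc) (auto simp: nn_integral_wt ennreal_mult[symmetric])
  finally show "emeasure G (space G) = 1" .
qed

sublocale G: prob_space G by (rule prob_G)

lemma ex_inverse: "\<exists>P. \<forall>i<q. \<forall>k<q. (\<Sum>j<q. Q i j * P j k) = (if i = k then 1 else 0)"
proof -
  define A where "A = Matrix.mat q q (\<lambda>(i, j). Q i j)"
  have A: "A \<in> carrier_mat q q" by (simp add: A_def)
  have "Determinant.det A \<noteq> 0" using Qdet_pos by (simp add: Qdet_def A_def)
  from det_non_zero_imp_unit[OF A this, of "()"]
  obtain B where B: "B \<in> carrier_mat q q" "A * B = 1\<^sub>m q"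
    by (auto simp: Units_def ring_mat_def)
  have "(\<Sum>j<q. Q i j * B $$ (j, k)) = (if i = k then 1 else 0)" if "i < q" "k < q" for i k
  proof -
    have "(A * B) $$ (i, k) = (if i = k then 1 else 0)"
      using that by (simp add: B(2))
    then show ?thesis
      using that A B(1) by (simp add: scalar_prod_def A_def atLeast0LessThan)
  qed
  then show ?thesis
    by (intro exI[of _ "\<lambda>j k. B $$ (j, k)"]) auto
qed

text \<open>The covariance matrix of \<open>G\<close>. Only its entries with indices below
  \<open>q\<close> are determined.\<close>

definition Qi :: "nat \<Rightarrow> nat \<Rightarrow> real" where
  "Qi = (SOME P. \<forall>i<q. \<forall>k<q. (\<Sum>j<q. Q i j * P j k) = (if i = k then 1 else 0))"

lemma Q_Qi: "i < q \<Longrightarrow> k < q \<Longrightarrow> (\<Sum>j<q. Q i j * Qi j k) = (if i = k then 1 else 0)"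
  using someI_ex[OF ex_inverse] unfolding Qi_def[symmetric] by blast

lemma Qi_sym:
  assumes ab: "a < q" "b < q"
  shows "Qi a b = Qi b a"
proof -
  have "Qi b a = (\<Sum>j<q. Qi j a * (if j = b then 1 else 0))"
    using ab by (simp add: mult_delta_left mult_delta_right)
  also have "\<dots> = (\<Sum>j<q. Qi j a * (\<Sum>k<q. Q j k * Qi k b))"
    using ab by (intro sum.cong) (auto simp: Q_Qi)
  also have "\<dots> = (\<Sum>j<q. \<Sum>k<q. Q k j * Qi j a * Qi k b)"
    by (simp add: sum_distrib_left, intro sum.cong refl) (simp add: sym mult_ac)
  also have "\<dots> = (\<Sum>k<q. (\<Sum>j<q. Q k j * Qi j a) * Qi k b)"
    by (subst sum.swap) (simp add: sum_distrib_right)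
  also have "\<dots> = (\<Sum>k<q. (if k = a then 1 else 0) * Qi k b)"
    using ab by (intro sum.cong) (auto simp: Q_Qi)
  also have "\<dots> = Qi a b"
    using ab by (simp add: mult_delta_left mult_delta_right)
  finally show ?thesis ..
qed

text \<open>The solution of \<open>Q v = b\<close>, set to zero beyond \<open>q\<close> so that it
  is an admissible translation of \<open>lebR\<close>.\<close>

definition Qinv :: "(nat \<Rightarrow> real) \<Rightarrow> nat \<Rightarrow> real" where
  "Qinv b = (\<lambda>i. if i < q then \<Sum>j<q. Qi i j * b j else 0)"

lemma Q_Qinv: "i < q \<Longrightarrow> (\<Sum>j<q. Q i j * Qinv b j) = b i"
proof -
  assume i: "i < q"
  have "(\<Sum>j<q. Q i j * Qinv b j) = (\<Sum>j<q. \<Sum>k<q. Q i j * Qi j k * b k)"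
    by (simp add: Qinv_def sum_distrib_left mult_ac)
  also have "\<dots> = (\<Sum>k<q. (\<Sum>j<q. Q i j * Qi j k) * b k)"
    by (subst sum.swap) (simp add: sum_distrib_right)
  also have "\<dots> = (\<Sum>k<q. (if i = k then 1 else 0) * b k)"
    using i by (intro sum.cong) (auto simp: Q_Qi)
  also have "\<dots> = b i"
    using i by (simp add: mult_delta_left mult_delta_right)
  finally show ?thesis .
qed

lemma bil_Qinv: "bil q Q u (Qinv b) = ip q u b"
  unfolding bil_eq_ip ip_def by (intro sum.cong) (auto simp: Q_Qinv)

lemma nm_Qinv_le: "nm q (Qinv b) \<le> nm q b / \<kappa>"
proof (cases "nm q (Qinv b) = 0")
  case True
  then show ?thesis using kappa_pos by (simp add: L2_set_nonneg)
next
  case False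
  then have pos: "nm q (Qinv b) > 0" using L2_set_nonneg[of "Qinv b" "{..<q}"] by linarith
  have "\<kappa> * (nm q (Qinv b))\<^sup>2 \<le> ip q (Qinv b) b"
    using coercive[of "Qinv b"] by (simp add: nm_sq bil_Qinv)
  also have "\<dots> \<le> nm q (Qinv b) * nm q b" by (rule ip_le)
  finally have "\<kappa> * nm q (Qinv b) \<le> nm q b"
    using pos by (simp add: power2_eq_square)
  then show ?thesis using kappa_pos by (simp add: field_simps)
qed

lemma ip_Qinv_le: "ip q (Qinv b) b \<le> (nm q b)\<^sup>2 / \<kappa>"
proof -
  have "ip q (Qinv b) b \<le> nm q (Qinv b) * nm q b" by (rule ip_le)
  also have "\<dots> \<le> nm q b / \<kappa> * nm q b"
    using nm_Qinv_le by (rule mult_right_mono) (rule L2_set_nonneg)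
  finally show ?thesis by (simp add: power2_eq_square)
qed

text \<open>Exponential tilting: the factor \<open>exp (ip q b u)\<close> moves the centre of the
  Gaussian to \<open>Qinv b\<close> and leaves half of \<open>ip q (Qinv b) b\<close> in the
  exponent.\<close>

lemma mgf_le: "(\<integral>\<^sup>+u. ennreal (exp (ip q b u)) \<partial>G) \<le> ennreal (exp ((nm q b)\<^sup>2 / (2 * \<kappa>)))"
proof -
  define v where "v = Qinv b"
  have eq: "wt u * exp (ip q b u) = exp (ip q v b / 2) * wt (\<lambda>j. u j + - v j)" for u
  proof -
    have "bil q Q (\<lambda>j. u j - v j) (\<lambda>j. u j - v j)
        = bil q Q u u - 2 * bil q Q u v + bil q Q v v"
      using bil_sym[of q Q u v] sym by (simp add: bil_simps)
    then have "bil q Q (\<lambda>j. u j + - v j) (\<lambda>j. u j + - v j) = bil q Q u u - 2 * ip q b u + ip q v b"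
      by (simp add: v_def bil_Qinv ip_def mult.commute)
    then show ?thesis
      by (simp add: wt_def exp_add[symmetric] field_simps)
  qed
  have "(\<integral>\<^sup>+u. ennreal (exp (ip q b u)) \<partial>G)
      = (\<integral>\<^sup>+u. ennreal (exp (ip q v b / 2) / Z) * ennreal (wt (\<lambda>j. u j + - v j)) \<partial>lebR {..<q})"
    using Z_pos wt_pos eq
    by (subst nn_integral_G)
       (auto simp: ennreal_mult[symmetric] less_imp_le intro!: nn_integral_cong)
  also have "\<dots> = ennreal (exp (ip q v b / 2) / Z) * (\<integral>\<^sup>+u. ennreal (wt (\<lambda>j. u j + - v j)) \<partial>lebR {..<q})"
  proof (rule nn_integral_cmult)
    have [measurable]: "(\<lambda>u j. u j + - v j :: real) \<in> borel_measurable borel"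
      by (rule borel_measurable_into_fun) measurable
    show "(\<lambda>u. ennreal (wt (\<lambda>j. u j + - v j))) \<in> borel_measurable (lebR {..<q})"
      by measurable
  qed
  also have "(\<integral>\<^sup>+u. ennreal (wt (\<lambda>j. u j + - v j)) \<partial>lebR {..<q}) = (\<integral>\<^sup>+u. ennreal (wt u) \<partial>lebR {..<q})"
    by (rule nn_integral_lebR_translate[where f = "\<lambda>u. ennreal (wt u)"]) (auto simp: v_def Qinv_def)
  also have "ennreal (exp (ip q v b / 2) / Z) * \<dots> = ennreal (exp (ip q v b / 2))"
    using Z_pos by (simp add: nn_integral_wt ennreal_mult[symmetric])
  also have "\<dots> \<le> ennreal (exp ((nm q b)\<^sup>2 / (2 * \<kappa>)))"
    using ip_Qinv_le[of b] kappa_pos by (intro ennreal_leI) (simp add: v_def field_simps)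
  finally show ?thesis .
qed

end

context pd_form
begin

text \<open>The exponential moments at t and - t average to at least one plus t^2 / 2 times the
  second moment; comparing with their common bound as t tends to 0 gives the sharp constant.\<close>

lemma second_moment_le:
  "(\<integral>\<^sup>+u. ennreal ((ip q b u)\<^sup>2) \<partial>G) \<le> ennreal ((nm q b)\<^sup>2 / \<kappa>)"
proof -
  define \<sigma> where "\<sigma> = (nm q b)\<^sup>2 / \<kappa>"
  have \<sigma>: "0 \<le> \<sigma>" using kappa_pos by (simp add: \<sigma>_def)
  define X where "X = (\<integral>\<^sup>+u. ennreal ((ip q b u)\<^sup>2) \<partial>G)"
  have key: "ennreal s * X + 1 \<le> ennreal (exp (s * \<sigma>))" if s: "0 < s" for s
  proof -
    define t where "t = sqrt (2 * s)"
    have t: "t\<^sup>2 = 2 * s" using s by (simp add: t_def)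
    have mgf: "(\<integral>\<^sup>+u. ennreal (exp (c * ip q b u)) \<partial>G) \<le> ennreal (exp (s * \<sigma>))" if "c\<^sup>2 = 2 * s" for c
    proof -
      have "nm q (\<lambda>i. c * b i) ^ 2 = c\<^sup>2 * (nm q b)\<^sup>2"
        unfolding nm_sq by (simp add: ip_def sum_distrib_left power2_eq_square mult_ac)
      then have "(nm q (\<lambda>i. c * b i))\<^sup>2 / (2 * \<kappa>) = s * \<sigma>"
        using that by (simp add: \<sigma>_def)
      moreover have "ip q (\<lambda>i. c * b i) u = c * ip q b u" for u
        by (simp add: ip_def sum_distrib_left mult_ac)
      ultimately show ?thesis using mgf_le[of "\<lambda>i. c * b i"] by simp
    qed
    have "ennreal s * X + 1 = (\<integral>\<^sup>+u. ennreal (s * (ip q b u)\<^sup>2 + 1) \<partial>G)"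
      using s unfolding X_def
      by (simp add: nn_integral_add nn_integral_cmult ennreal_mult G.emeasure_space_1[simplified])
    also have "\<dots> \<le> (\<integral>\<^sup>+u. ennreal (1 / 2) * (ennreal (exp (t * ip q b u)) + ennreal (exp (- t * ip q b u))) \<partial>G)"
    proof (rule nn_integral_mono)
      fix u
      have "1 + x\<^sup>2 / 2 \<le> (exp x + exp (- x)) / 2" for x :: real
      proof -
        have "1 + x + x\<^sup>2 / 2 + x ^ 3 / 6 \<le> exp x" for x :: real
        proof -
          have "\<exists>t. exp x = (\<Sum>m<4. x ^ m / fact m) + exp t / fact 4 * x ^ 4"
            using Maclaurin_exp_le[of x 4] by blast
          then obtain t where "exp x = (\<Sum>m<4. x ^ m / fact m) + exp t / fact 4 * x ^ 4" by blast
          moreover have "0 \<le> exp t / fact 4 * x ^ 4" by simp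
          ultimately show ?thesis by (simp add: eval_nat_numeral)
        qed
        from this[of x] this[of "- x"] show ?thesis by simp
      qed
      from this[of "t * ip q b u"]
      have "s * (ip q b u)\<^sup>2 + 1 \<le> 1 / 2 * (exp (t * ip q b u) + exp (- t * ip q b u))"
        using t by (simp add: power_mult_distrib)
      then have "ennreal (s * (ip q b u)\<^sup>2 + 1)
          \<le> ennreal (1 / 2 * (exp (t * ip q b u) + exp (- t * ip q b u)))"
        by (rule ennreal_leI)
      then show "ennreal (s * (ip q b u)\<^sup>2 + 1)
          \<le> ennreal (1 / 2) * (ennreal (exp (t * ip q b u)) + ennreal (exp (- t * ip q b u)))"
        by (subst (asm) ennreal_mult) (auto simp: ennreal_plus simp del: ennreal_half)
    qed
    also have "\<dots> = ennreal (1 / 2) * ((\<integral>\<^sup>+u. ennreal (exp (t * ip q b u)) \<partial>G)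
        + (\<integral>\<^sup>+u. ennreal (exp (- t * ip q b u)) \<partial>G))"
      by (subst nn_integral_cmult, measurable, subst nn_integral_add, measurable)
    also have "\<dots> \<le> ennreal (1 / 2) * (ennreal (exp (s * \<sigma>)) + ennreal (exp (s * \<sigma>)))"
      using t by (intro mult_left_mono add_mono mgf) auto
    also have "\<dots> = ennreal (exp (s * \<sigma>))"
      by (simp add: ennreal_plus[symmetric] ennreal_mult[symmetric] del: ennreal_plus ennreal_half)
    finally show ?thesis .
  qed
  have "X \<noteq> \<infinity>" using key[of 1] by (auto simp: top_unique)
  then obtain x where x: "X = ennreal x" "0 \<le> x"
    by (cases X) auto
  have real_key: "s * x + 1 \<le> exp (s * \<sigma>)" if "0 < s" for s
    using key[OF that] x that
    by (simp add: ennreal_mult[symmetric] ennreal_1[symmetric] ennreal_plus[symmetric]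
        del: ennreal_1 ennreal_plus)
  have "x \<le> \<sigma>"
  proof (rule ccontr)
    assume "\<not> x \<le> \<sigma>"
    have "((\<lambda>s. exp (s * \<sigma>) - s * x) has_real_derivative (\<sigma> - x)) (at 0)"
      by (auto intro!: derivative_eq_intros)
    then obtain d where d: "d > 0" "\<And>h. 0 < h \<Longrightarrow> h < d \<Longrightarrow> exp (h * \<sigma>) - h * x < 1"
      using DERIV_neg_dec_right[of "\<lambda>s. exp (s * \<sigma>) - s * x" "\<sigma> - x" 0] \<open>\<not> x \<le> \<sigma>\<close> by auto
    with real_key[of "d / 2"] d(2)[of "d / 2"] show False by auto
  qed
  then show ?thesis using x by (simp add: X_def[symmetric] \<sigma>_def[symmetric] ennreal_leI)
qed

text \<open>The quadratic exponent turns \<open>G\<close> into another Gaussian, whose form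
  \<open>P\<close> is \<open>Q\<close> minus the sum of the squares, and the integral is the
  quotient of the two normalizations. Instead of comparing determinants, the inverse quotient is
  written as the mean of \<open>exp (- F / 2)\<close> under the new Gaussian and bounded below by
  Jensen's inequality.\<close>

lemma exp_quadratic_le:
  assumes K: "finite K"
    and small: "\<And>x. (\<Sum>k\<in>K. (ip q (s k) x)\<^sup>2) \<le> \<kappa> / 2 * ip q x x"
  shows "(\<integral>\<^sup>+u. ennreal (exp ((\<Sum>k\<in>K. (ip q (s k) u)\<^sup>2) / 2)) \<partial>G)
    \<le> ennreal (exp ((\<Sum>k\<in>K. (nm q (s k))\<^sup>2) / \<kappa>))"
proof -
  define F where "F u = (\<Sum>k\<in>K. (ip q (s k) u)\<^sup>2)" for u
  define P where "P i j = Q i j - (\<Sum>k\<in>K. s k i * s k j)" for i j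
  have F_meas [measurable]: "F \<in> borel_measurable borel"
    unfolding F_def by measurable
  have bilP: "bil q P u u = bil q Q u u - F u" for u
  proof -
    have "(ip q (s k) u)\<^sup>2 = (\<Sum>i<q. \<Sum>j<q. s k i * s k j * u i * u j)" for k
      by (simp add: ip_def power2_eq_square sum_product mult_ac)
    then have "F u = (\<Sum>i<q. \<Sum>k\<in>K. \<Sum>j<q. s k i * s k j * u i * u j)"
      unfolding F_def by (subst sum.swap) simp
    also have "\<dots> = (\<Sum>i<q. \<Sum>j<q. \<Sum>k\<in>K. s k i * s k j * u i * u j)"
      by (intro sum.cong refl sum.swap)
    finally show ?thesis
      by (simp add: bil_def P_def algebra_simps sum_subtractf sum_distrib_left sum_distrib_right)
  qed
  interpret P: pd_form q P "\<kappa> / 2"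
  proof
    show "P i j = P j i" if "i < q" "j < q" for i j
      using sym[OF that] by (simp add: P_def mult.commute)
    show "\<kappa> / 2 * ip q u u \<le> bil q P u u" for u
      using small[of u] coercive[of u] by (simp add: bilP F_def[symmetric])
  qed (use kappa_pos in simp)
  have wt: "P.wt u = wt u * exp (F u / 2)" "wt u = P.wt u * exp (- F u / 2)" for u
    by (simp_all add: P.wt_def wt_def bilP exp_add[symmetric] field_simps)
  have 1: "(\<integral>\<^sup>+u. ennreal (exp (F u / 2)) \<partial>G) = ennreal (P.Z / Z)"
  proof -
    have "(\<integral>\<^sup>+u. ennreal (exp (F u / 2)) \<partial>G) = (\<integral>\<^sup>+u. ennreal (P.wt u) * ennreal (1 / Z) \<partial>lebR {..<q})"
      using Z_pos wt_pos P.wt_pos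
      by (subst nn_integral_G) (auto simp: ennreal_mult[symmetric] wt(1) less_imp_le intro!: nn_integral_cong)
    also have "\<dots> = ennreal (P.Z / Z)"
      using Z_pos P.Z_pos by (subst nn_integral_multc) (auto simp: P.nn_integral_wt ennreal_mult[symmetric])
    finally show ?thesis .
  qed
  have 2: "(\<integral>\<^sup>+u. ennreal (exp (- F u / 2)) \<partial>P.G) = ennreal (Z / P.Z)"
  proof -
    have "(\<integral>\<^sup>+u. ennreal (exp (- F u / 2)) \<partial>P.G) = (\<integral>\<^sup>+u. ennreal (wt u) * ennreal (1 / P.Z) \<partial>lebR {..<q})"
      using P.Z_pos wt_pos P.wt_pos
      by (subst P.nn_integral_G)
         (auto simp: ennreal_mult[symmetric] wt(2) less_imp_le simp del: P.wt_def intro!: nn_integral_cong)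
    also have "\<dots> = ennreal (Z / P.Z)"
      using Z_pos P.Z_pos by (subst nn_integral_multc) (auto simp: nn_integral_wt ennreal_mult[symmetric])
    finally show ?thesis .
  qed
  define B where "B = (\<Sum>k\<in>K. (nm q (s k))\<^sup>2) / \<kappa>"
  have F_nonneg: "0 \<le> F u" for u by (simp add: F_def sum_nonneg)
  have B: "0 \<le> B" unfolding B_def using kappa_pos by (auto intro!: divide_nonneg_pos sum_nonneg)
  \<comment> \<open>The form \<open>P\<close> is coercive only with \<open>\<kappa> / 2\<close>,
    hence the factor 2.\<close>
  have 3: "(\<integral>\<^sup>+u. ennreal (F u) \<partial>P.G) \<le> ennreal (2 * B)"
  proof -
    have "(\<integral>\<^sup>+u. ennreal (F u) \<partial>P.G) = (\<Sum>k\<in>K. \<integral>\<^sup>+u. ennreal ((ip q (s k) u)\<^sup>2) \<partial>P.G)"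
      unfolding F_def by (subst nn_integral_sum[symmetric]) (auto simp: sum_ennreal)
    also have "\<dots> \<le> (\<Sum>k\<in>K. ennreal ((nm q (s k))\<^sup>2 / (\<kappa> / 2)))"
      by (intro sum_mono P.second_moment_le)
    also have "\<dots> = ennreal (2 * B)"
      using kappa_pos by (subst sum_ennreal) (auto simp: B_def sum_divide_distrib sum_distrib_left mult_ac)
    finally show ?thesis .
  qed
  have intF: "integrable P.G F"
    using 3 by (intro integrableI_nonneg) (auto simp: F_nonneg intro: le_less_trans)
  have intE: "integrable P.G (\<lambda>u. exp (- F u / 2))"
    by (rule P.G.integrable_const_bound[where B = 1]) (auto simp: F_nonneg)
  have "(\<integral>u. F u \<partial>P.G) \<le> 2 * B"
    using 3 B nn_integral_eq_integral[OF intF] F_nonneg by (simp add: ennreal_le_iff)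
  then have "exp (- B) \<le> exp (- (\<integral>u. F u / 2 \<partial>P.G))" by simp
  also have "\<dots> \<le> (\<integral>u. exp (- F u / 2) \<partial>P.G)"
    using exp_Jensen[of P.G "\<lambda>_. 1" "\<lambda>u. F u / 2"] intF intE
    by (simp add: P.G.prob_space[simplified])
  also have "\<dots> = Z / P.Z"
    using nn_integral_eq_integral[OF intE] Z_pos P.Z_pos unfolding 2
    by (simp add: integral_nonneg_AE less_imp_le)
  finally have "P.Z / Z \<le> exp B"
    using Z_pos P.Z_pos by (simp add: exp_minus field_simps)
  then show ?thesis using 1 by (simp add: F_def[symmetric] B_def[symmetric] ennreal_leI)
qed

text \<open>The sum of the quadratic forms of the two vectors does not change when the pair is
  rotated, so the invariance of Lebesgue measure carries over.\<close>

lemma G_rotation: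
  assumes f [measurable]: "case_prod f \<in> borel_measurable (borel \<Otimes>\<^sub>M borel)"
    and cs: "c\<^sup>2 + s\<^sup>2 = 1" "s = 0 \<Longrightarrow> c = 1"
  shows "(\<integral>\<^sup>+u. \<integral>\<^sup>+v. f (\<lambda>j. c * u j + s * v j) (\<lambda>j. - s * u j + c * v j) \<partial>G \<partial>G)
    = (\<integral>\<^sup>+u. \<integral>\<^sup>+v. f u v \<partial>G \<partial>G)"
proof -
  interpret lebR: sigma_finite_measure "lebR {..<q}" by (rule sigma_finite_lebR) simp
  define g where "g u v = ennreal (wt u / Z) * (ennreal (wt v / Z) * f u v)" for u v
  have [measurable]: "case_prod g \<in> borel_measurable (borel \<Otimes>\<^sub>M borel)"
    unfolding g_def[abs_def] by measurable
  have GG: "(\<integral>\<^sup>+u. \<integral>\<^sup>+v. h u v \<partial>G \<partial>G)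
      = (\<integral>\<^sup>+u. \<integral>\<^sup>+v. ennreal (wt u / Z) * (ennreal (wt v / Z) * h u v) \<partial>lebR {..<q} \<partial>lebR {..<q})"
    if [measurable]: "case_prod h \<in> borel_measurable (borel \<Otimes>\<^sub>M borel)" for h
    by (simp add: nn_integral_G nn_integral_cmult)
  have wt: "wt u * wt v = wt (\<lambda>j. c * u j + s * v j) * wt (\<lambda>j. - s * u j + c * v j)" for u v
  proof -
    have "bil q Q (\<lambda>j. c * u j + s * v j) (\<lambda>j. c * u j + s * v j)
        + bil q Q (\<lambda>j. - s * u j + c * v j) (\<lambda>j. - s * u j + c * v j)
        = (c\<^sup>2 + s\<^sup>2) * (bil q Q u u + bil q Q v v)"
      unfolding bil_simps by (simp add: power2_eq_square algebra_simps)
    then show ?thesis using cs by (simp add: wt_def exp_add[symmetric] diff_divide_distrib)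
  qed
  have "(\<integral>\<^sup>+u. \<integral>\<^sup>+v. f (\<lambda>j. c * u j + s * v j) (\<lambda>j. - s * u j + c * v j) \<partial>G \<partial>G)
      = (\<integral>\<^sup>+u. \<integral>\<^sup>+v. g (\<lambda>j. c * u j + s * v j) (\<lambda>j. - s * u j + c * v j) \<partial>lebR {..<q} \<partial>lebR {..<q})"
  proof (subst GG)
    show "(\<lambda>(u, v). f (\<lambda>j. c * u j + s * v j) (\<lambda>j. - s * u j + c * v j))
        \<in> borel_measurable (borel \<Otimes>\<^sub>M borel)"
      by (rule borel_measurable_lin_pair[OF f])
    have "ennreal (wt u / Z) * (ennreal (wt v / Z) * x)
        = ennreal (wt (\<lambda>j. c * u j + s * v j) / Z) * (ennreal (wt (\<lambda>j. - s * u j + c * v j) / Z) * x)"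
      for u v x
      using wt[of u v] Z_pos wt_pos
      by (simp add: mult.assoc[symmetric] ennreal_mult[symmetric] less_imp_le)
    then show "(\<integral>\<^sup>+u. \<integral>\<^sup>+v. ennreal (wt u / Z) * (ennreal (wt v / Z)
          * f (\<lambda>j. c * u j + s * v j) (\<lambda>j. - s * u j + c * v j)) \<partial>lebR {..<q} \<partial>lebR {..<q})
        = (\<integral>\<^sup>+u. \<integral>\<^sup>+v. g (\<lambda>j. c * u j + s * v j) (\<lambda>j. - s * u j + c * v j) \<partial>lebR {..<q} \<partial>lebR {..<q})"
      by (simp add: g_def)
  qed
  also have "\<dots> = (\<integral>\<^sup>+u. \<integral>\<^sup>+v. g u v \<partial>lebR {..<q} \<partial>lebR {..<q})"
    by (rule lebR_rotation) (use cs in auto)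
  also have "\<dots> = (\<integral>\<^sup>+u. \<integral>\<^sup>+v. f u v \<partial>G \<partial>G)"
    unfolding g_def by (rule GG[OF f, symmetric])
  finally show ?thesis .
qed

end

section \<open>Gaussian tail bounds\<close>

lemma ip_diag: "bil q (\<lambda>i j. if i = j then a else 0) u u = a * ip q u u"
proof -
  have "bil q (\<lambda>i j. if i = j then a else 0) u u = (\<Sum>i<q. \<Sum>j<q. if i = j then a * u i * u j else 0)"
    unfolding bil_def by (intro sum.cong) auto
  then show ?thesis by (simp add: ip_def sum_distrib_left mult_ac)
qed

lemma nn_integral_gauss_iso:
  assumes "0 < a"
  shows "(\<integral>\<^sup>+u. ennreal (exp (- (a * ip q u u) / 2)) \<partial>lebR {..<q}) = ennreal (sqrt ((2 * pi / a) ^ q))"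
proof -
  have "Matrix.mat q q (\<lambda>(i, j). if i = j then a else 0) = a \<cdot>\<^sub>m 1\<^sub>m q"
    by (rule eq_matI) auto
  then have "Determinant.det (Matrix.mat q q (\<lambda>(i, j). if i = j then a else 0)) = a ^ q"
    by simp
  with gauss_normalization[of q "\<lambda>i j. if i = j then a else 0" a] assms show ?thesis
    by (auto simp: ip_diag power_divide)
qed

context pd_form
begin

definition tail :: "real \<Rightarrow> real \<Rightarrow> real" where
  "tail \<kappa>' r = exp (- (\<kappa> * r\<^sup>2 / 4)) * sqrt ((2 * \<kappa>' / \<kappa>) ^ q)"

text \<open>Half of the exponent is spent on the factor exp(- \<kappa> r^2 / 4), the other half is
  kept for integrability. Comparing the isotropic normalization of that half with \<open>Z\<close>
  costs a factor exponential in the dimension. The isotropic integrand dominates the weight and also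
  \<open>exp f\<close>, for which only strong concavity is available far from the maximizer.\<close>

lemma gauss_tail_le:
  assumes upper: "\<And>u. bil q Q u u \<le> \<kappa>' * ip q u u" and \<kappa>': "0 < \<kappa>'" and r: "0 \<le> r"
  shows "(\<integral>\<^sup>+u. indicator {u. r \<le> nm q u} u * ennreal (exp (- (\<kappa> * ip q u u) / 2) / Z) \<partial>lebR {..<q})
    \<le> ennreal (tail \<kappa>' r)"
proof -
  have Z_lower: "sqrt ((2 * pi / \<kappa>') ^ q) \<le> Z"
  proof -
    have "ennreal (sqrt ((2 * pi / \<kappa>') ^ q)) \<le> ennreal Z"
      unfolding nn_integral_wt[symmetric] nn_integral_gauss_iso[OF \<kappa>', symmetric]
      by (intro nn_integral_mono ennreal_leI) (use upper in \<open>auto simp: wt_def\<close>)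
    then show ?thesis using Z_pos by (simp add: ennreal_le_iff)
  qed
  have pos: "0 < sqrt ((2 * pi / \<kappa>') ^ q)" using \<kappa>' by simp
  have "(\<integral>\<^sup>+u. indicator {u. r \<le> nm q u} u * ennreal (exp (- (\<kappa> * ip q u u) / 2) / Z) \<partial>lebR {..<q})
      \<le> (\<integral>\<^sup>+u. ennreal (exp (- (\<kappa> * r\<^sup>2 / 4)) / Z) * ennreal (exp (- (\<kappa> / 2 * ip q u u) / 2)) \<partial>lebR {..<q})"
  proof (rule nn_integral_mono)
    fix u
    show "indicator {u. r \<le> nm q u} u * ennreal (exp (- (\<kappa> * ip q u u) / 2) / Z)
        \<le> ennreal (exp (- (\<kappa> * r\<^sup>2 / 4)) / Z) * ennreal (exp (- (\<kappa> / 2 * ip q u u) / 2))"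
    proof (cases "r \<le> nm q u")
      case True
      then have "r\<^sup>2 \<le> ip q u u" using r by (simp add: nm_sq[symmetric])
      then have "\<kappa> * r\<^sup>2 \<le> \<kappa> * ip q u u" using kappa_pos by simp
      then show ?thesis using Z_pos True
        by (simp add: ennreal_mult[symmetric] exp_add[symmetric] ennreal_le_iff divide_right_mono)
    qed simp
  qed
  also have "\<dots> = ennreal (exp (- (\<kappa> * r\<^sup>2 / 4)) / Z) * ennreal (sqrt ((2 * pi / (\<kappa> / 2)) ^ q))"
    using nn_integral_gauss_iso[of "\<kappa> / 2" q] kappa_pos
    by (subst nn_integral_cmult) auto
  also have "\<dots> = ennreal (exp (- (\<kappa> * r\<^sup>2 / 4)) * (sqrt ((2 * pi / (\<kappa> / 2)) ^ q) / Z))"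
    using Z_pos kappa_pos by (simp add: ennreal_mult[symmetric])
  also have "\<dots> \<le> ennreal (tail \<kappa>' r)"
  proof (rule ennreal_leI)
    have "sqrt ((2 * pi / (\<kappa> / 2)) ^ q) / Z \<le> sqrt ((2 * pi / (\<kappa> / 2)) ^ q) / sqrt ((2 * pi / \<kappa>') ^ q)"
      using Z_lower pos kappa_pos by (intro divide_left_mono mult_pos_pos Z_pos) auto
    also have "\<dots> = sqrt ((2 * \<kappa>' / \<kappa>) ^ q)"
      using kappa_pos \<kappa>'
      by (simp add: real_sqrt_divide[symmetric] power_divide[symmetric] mult.commute)
    finally show "exp (- (\<kappa> * r\<^sup>2 / 4)) * (sqrt ((2 * pi / (\<kappa> / 2)) ^ q) / Z) \<le> tail \<kappa>' r"
      unfolding tail_def by (rule mult_left_mono) simp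
  qed
  finally show ?thesis .
qed

lemma G_tail_le:
  assumes upper: "\<And>u. bil q Q u u \<le> \<kappa>' * ip q u u" and \<kappa>': "0 < \<kappa>'" and r: "0 \<le> r"
  shows "measure G {u. r \<le> nm q u} \<le> tail \<kappa>' r"
proof -
  have "emeasure G {u. r \<le> nm q u} = (\<integral>\<^sup>+u. indicator {u. r \<le> nm q u} u \<partial>G)"
    by (subst nn_integral_indicator) auto
  also have "\<dots> = (\<integral>\<^sup>+u. ennreal (wt u / Z) * indicator {u. r \<le> nm q u} u \<partial>lebR {..<q})"
    by (rule nn_integral_G) measurable
  also have "\<dots> \<le> (\<integral>\<^sup>+u. indicator {u. r \<le> nm q u} u * ennreal (exp (- (\<kappa> * ip q u u) / 2) / Z) \<partial>lebR {..<q})"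
    using Z_pos coercive
    by (intro nn_integral_mono) (auto simp: indicator_def wt_def intro!: ennreal_leI divide_right_mono)
  also have "\<dots> \<le> ennreal (tail \<kappa>' r)"
    by (rule gauss_tail_le[OF assms])
  finally show ?thesis
    using kappa_pos \<kappa>' by (simp add: G.emeasure_eq_measure tail_def)
qed

end

subsection \<open>Functions with partial derivatives\<close>

text \<open>A point is a function on all naturals, but only the coordinates below \<open>q\<close>
  are meant. The predicate \<open>cyl\<close> states this for a function, while
  \<open>cts_at\<close> and \<open>ob\<close> look at these coordinates alone.\<close>

definition cyl :: "nat \<Rightarrow> ((nat \<Rightarrow> real) \<Rightarrow> real) \<Rightarrow> bool" where
  "cyl q F \<longleftrightarrow> (\<forall>u v. (\<forall>i<q. u i = v i) \<longrightarrow> F u = F v)"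

definition cts_at :: "nat \<Rightarrow> ((nat \<Rightarrow> real) \<Rightarrow> real) \<Rightarrow> (nat \<Rightarrow> real) \<Rightarrow> bool" where
  "cts_at q F u \<longleftrightarrow> (\<forall>\<epsilon>>0. \<exists>d>0. \<forall>v. (\<forall>i<q. \<bar>v i - u i\<bar> < d) \<longrightarrow> \<bar>F v - F u\<bar> < \<epsilon>)"

definition partial_on ::
  "nat \<Rightarrow> (nat \<Rightarrow> real) set \<Rightarrow> ((nat \<Rightarrow> real) \<Rightarrow> real) \<Rightarrow> (nat \<Rightarrow> (nat \<Rightarrow> real) \<Rightarrow> real) \<Rightarrow> bool" where
  "partial_on q S F F' \<longleftrightarrow>
    (\<forall>u\<in>S. \<forall>i<q. ((\<lambda>t. F (u(i := t))) has_real_derivative F' i u) (at (u i)))"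

definition ob :: "nat \<Rightarrow> real \<Rightarrow> (nat \<Rightarrow> real) set" where
  "ob q \<rho> = {u. nm q u < \<rho>}"

lemma nm_triangle: "nm q (\<lambda>i. u i + v i) \<le> nm q u + nm q v"
  by (rule L2_set_triangle_ineq)

lemma nm_scale: "nm q (\<lambda>i. c * u i) = \<bar>c\<bar> * nm q u"
  unfolding L2_set_def by (simp add: power_mult_distrib sum_distrib_left[symmetric] real_sqrt_mult)

lemma abs_coord_le_nm: "i < q \<Longrightarrow> \<bar>u i\<bar> \<le> nm q u"
  using member_le_L2_set[of "{..<q}" i "\<lambda>i. \<bar>u i\<bar>"] by (simp add: L2_set_def)

lemma sum_abs_le_nm: "(\<Sum>i<q. \<bar>u i\<bar>) \<le> sqrt (real q) * nm q u"
proof -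
  have "(\<Sum>i<q. \<bar>1\<bar> * \<bar>u i\<bar>) \<le> nm q (\<lambda>_. 1) * nm q u"
    by (rule L2_set_mult_ineq)
  then show ?thesis by (simp add: L2_set_def)
qed

lemma nm_cong: "(\<And>i. i < q \<Longrightarrow> u i = v i) \<Longrightarrow> nm q u = nm q v"
  by (simp add: L2_set_def)

lemma cylD: "cyl q F \<Longrightarrow> (\<And>i. i < q \<Longrightarrow> u i = v i) \<Longrightarrow> F u = F v"
  by (auto simp: cyl_def)

lemma partial_onD:
  "partial_on q S F F' \<Longrightarrow> u \<in> S \<Longrightarrow> i < q \<Longrightarrow>
    ((\<lambda>t. F (u(i := t))) has_real_derivative F' i u) (at (u i))"
  by (auto simp: partial_on_def)

lemma partial_onD':
  assumes "partial_on q S F F'" "u(i := t) \<in> S" "i < q"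
  shows "((\<lambda>t. F (u(i := t))) has_real_derivative F' i (u(i := t))) (at t)"
  using partial_onD[OF assms] by simp

lemma deriv_bound_linear:
  fixes f :: "real \<Rightarrow> real"
  assumes "\<And>t. t \<in> closed_segment a b \<Longrightarrow> (f has_real_derivative f' t) (at t)"
    "\<And>t. t \<in> closed_segment a b \<Longrightarrow> \<bar>f' t - c\<bar> \<le> \<epsilon>"
  shows "\<bar>f b - f a - c * (b - a)\<bar> \<le> \<epsilon> * \<bar>b - a\<bar>"
proof -
  have "norm ((f b - c * b) - (f a - c * a)) \<le> \<epsilon> * norm (b - a)"
  proof (rule field_differentiable_bound[where S = "closed_segment a b" and f' = "\<lambda>t. f' t - c"])
    show "((\<lambda>t. f t - c * t) has_real_derivative f' t - c) (at t within closed_segment a b)"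
      if "t \<in> closed_segment a b" for t
      by (rule has_field_derivative_at_within) (use assms(1)[OF that] in \<open>auto intro!: derivative_eq_intros\<close>)
  qed (use assms(2) in auto)
  then show ?thesis by (simp add: algebra_simps)
qed

definition hyb :: "nat \<Rightarrow> (nat \<Rightarrow> real) \<Rightarrow> (nat \<Rightarrow> real) \<Rightarrow> nat \<Rightarrow> real" where
  "hyb k v u = (\<lambda>i. if i < k then v i else u i)"

text \<open>The coordinates of \<open>u\<close> are replaced by those of \<open>v\<close> one at a
  time, and the mean value inequality is applied to each replacement. All intermediate points lie in
  the box spanned by \<open>u\<close> and \<open>v\<close>, so partial differentiability
  suffices.\<close>

lemma telescoping_bound:
  assumes cyl: "cyl q F" and part: "partial_on q S F F'"
    and S: "\<And>x. (\<And>i. i < q \<Longrightarrow> \<bar>x i - u i\<bar> \<le> \<bar>v i - u i\<bar>) \<Longrightarrow> x \<in> S"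
    and near: "\<And>x i. (\<And>i. i < q \<Longrightarrow> \<bar>x i - u i\<bar> \<le> \<bar>v i - u i\<bar>) \<Longrightarrow> i < q \<Longrightarrow> \<bar>F' i x - c i\<bar> \<le> \<epsilon>"
  shows "\<bar>F v - F u - (\<Sum>i<q. c i * (v i - u i))\<bar> \<le> \<epsilon> * (\<Sum>i<q. \<bar>v i - u i\<bar>)"
proof -
  have step: "\<bar>F (hyb (Suc k) v u) - F (hyb k v u) - c k * (v k - u k)\<bar> \<le> \<epsilon> * \<bar>v k - u k\<bar>" if k: "k < q" for k
  proof -
    have hyb: "hyb (Suc k) v u = (hyb k v u)(k := v k)" "hyb k v u = (hyb k v u)(k := u k)"
      by (auto simp: hyb_def less_Suc_eq)
    have pt: "\<bar>((hyb k v u)(k := t)) i - u i\<bar> \<le> \<bar>v i - u i\<bar>" if "t \<in> closed_segment (u k) (v k)" for t i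
      using that by (auto simp: hyb_def closed_segment_eq_real_ivl split: if_splits)
    have "\<bar>F ((hyb k v u)(k := v k)) - F ((hyb k v u)(k := u k)) - c k * (v k - u k)\<bar> \<le> \<epsilon> * \<bar>v k - u k\<bar>"
      by (rule deriv_bound_linear[where f = "\<lambda>t. F ((hyb k v u)(k := t))"
            and f' = "\<lambda>t. F' k ((hyb k v u)(k := t))"])
         (use pt k in \<open>auto intro!: partial_onD'[OF part] S near simp del: fun_upd_apply\<close>)
    then show ?thesis using hyb by simp
  qed
  have "F v = F (hyb q v u)" by (rule cylD[OF cyl]) (simp add: hyb_def)
  moreover have "F u = F (hyb 0 v u)" by (simp add: hyb_def)
  moreover have "F (hyb q v u) - F (hyb 0 v u) = (\<Sum>k<q. F (hyb (Suc k) v u) - F (hyb k v u))"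
    by (rule sum_lessThan_telescope[symmetric])
  ultimately have "F v - F u - (\<Sum>i<q. c i * (v i - u i))
      = (\<Sum>k<q. F (hyb (Suc k) v u) - F (hyb k v u) - c k * (v k - u k))"
    by (simp add: sum_subtractf)
  also have "\<bar>\<dots>\<bar> \<le> (\<Sum>k<q. \<epsilon> * \<bar>v k - u k\<bar>)"
    by (rule order_trans[OF sum_abs sum_mono]) (use step in auto)
  finally show ?thesis by (simp add: sum_distrib_left)
qed

lemma ob_nbhd:
  assumes "u \<in> ob q \<rho>"
  shows "\<exists>d>0. \<forall>v. (\<forall>i<q. \<bar>v i - u i\<bar> < d) \<longrightarrow> v \<in> ob q \<rho>"
proof -
  define d where "d = (\<rho> - nm q u) / (real q + 1)"
  have d: "d > 0" using assms by (simp add: d_def ob_def)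
  have "v \<in> ob q \<rho>" if v: "\<forall>i<q. \<bar>v i - u i\<bar> < d" for v
  proof -
    have "nm q v \<le> nm q u + nm q (\<lambda>i. v i - u i)"
      using nm_triangle[where q = q and u = u and v = "\<lambda>i. v i - u i"] by simp
    also have "nm q (\<lambda>i. v i - u i) \<le> (\<Sum>i<q. \<bar>v i - u i\<bar>)"
      by (rule L2_set_le_sum_abs)
    also have "\<dots> \<le> (\<Sum>i<q. d)" using v by (intro sum_mono) auto
    also have "\<dots> < (real q + 1) * d" using d by simp
    also have "\<dots> = \<rho> - nm q u" by (simp add: d_def)
    finally show ?thesis by (simp add: ob_def)
  qed
  with d show ?thesis by blast
qed

text \<open>The telescoping bound with all \<open>c i = 0\<close>. This supplies continuity just
  below the highest order, where derivatives are known to be bounded but not to be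
  continuous.\<close>

lemma cts_at_of_bounded_partials:
  assumes cyl: "cyl q F" and part: "partial_on q (ob q \<rho>) F F'"
    and bd: "\<And>u i. u \<in> ob q \<rho> \<Longrightarrow> i < q \<Longrightarrow> \<bar>F' i u\<bar> \<le> M" and u: "u \<in> ob q \<rho>"
  shows "cts_at q F u"
  unfolding cts_at_def
proof (intro allI impI)
  fix \<epsilon> :: real assume \<epsilon>: "\<epsilon> > 0"
  obtain d where d: "d > 0" "\<And>v. (\<forall>i<q. \<bar>v i - u i\<bar> < d) \<Longrightarrow> v \<in> ob q \<rho>"
    using ob_nbhd[OF u] by blast
  define M' where "M' = max M 1"
  define e where "e = min d (\<epsilon> / (M' * (real q + 1)))"
  have M': "M' > 0" by (simp add: M'_def)
  have e: "e > 0" using d \<epsilon> M' by (simp add: e_def)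
  have "\<bar>F v - F u\<bar> < \<epsilon>" if v: "\<forall>i<q. \<bar>v i - u i\<bar> < e" for v
  proof -
    have *: "x \<in> ob q \<rho>" if "\<And>i. i < q \<Longrightarrow> \<bar>x i - u i\<bar> \<le> \<bar>v i - u i\<bar>" for x
      using that v by (intro d(2)) (force simp: e_def)
    have near: "\<bar>F' i x - 0\<bar> \<le> M'" if "\<And>i. i < q \<Longrightarrow> \<bar>x i - u i\<bar> \<le> \<bar>v i - u i\<bar>" "i < q" for x i
      using bd[OF *[OF that(1)] that(2)] by (simp add: M'_def)
    have "\<bar>F v - F u - (\<Sum>i<q. 0 * (v i - u i))\<bar> \<le> M' * (\<Sum>i<q. \<bar>v i - u i\<bar>)"
      by (rule telescoping_bound[OF cyl part * near])
    also have "\<dots> \<le> M' * (\<Sum>i<q. e)"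
      using v M' by (intro mult_left_mono sum_mono) auto
    also have "\<dots> < M' * ((real q + 1) * e)" using M' e by simp
    also have "\<dots> \<le> M' * ((real q + 1) * (\<epsilon> / (M' * (real q + 1))))"
      using M' by (intro mult_left_mono) (auto simp: e_def)
    also have "\<dots> = \<epsilon>" using M' by simp
    finally show ?thesis by simp
  qed
  with e show "\<exists>d>0. \<forall>v. (\<forall>i<q. \<bar>v i - u i\<bar> < d) \<longrightarrow> \<bar>F v - F u\<bar> < \<epsilon>" by blast
qed

lemma eventually_coords_near:
  fixes x :: "'a \<Rightarrow> nat \<Rightarrow> real"
  assumes "\<And>i. i < q \<Longrightarrow> ((\<lambda>t. x t i) \<longlongrightarrow> u i) net" "d > 0"
  shows "\<forall>\<^sub>F t in net. \<forall>i<q. \<bar>x t i - (u i :: real)\<bar> < d"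
proof -
  have "\<forall>\<^sub>F t in net. \<forall>i\<in>{..<q}. \<bar>x t i - u i\<bar> < d"
    using tendstoD[OF assms(1) assms(2)]
    by (intro eventually_ball_finite) (auto simp: dist_real_def)
  then show ?thesis unfolding Ball_def lessThan_iff .
qed

lemma cts_at_tendsto:
  assumes "cts_at q F u" "\<And>i. i < q \<Longrightarrow> ((\<lambda>t. x t i) \<longlongrightarrow> u i) net"
  shows "((\<lambda>t. F (x t)) \<longlongrightarrow> F u) net"
proof (rule tendstoI)
  fix \<epsilon> :: real assume "\<epsilon> > 0"
  then obtain d where d: "d > 0" "\<And>v. (\<forall>i<q. \<bar>v i - u i\<bar> < d) \<Longrightarrow> \<bar>F v - F u\<bar> < \<epsilon>"
    using assms(1) by (auto simp: cts_at_def)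
  have "\<forall>\<^sub>F t in net. \<forall>i<q. \<bar>x t i - u i\<bar> < d"
    by (rule eventually_coords_near) (use assms(2) d(1) in auto)
  then show "\<forall>\<^sub>F t in net. dist (F (x t)) (F u) < \<epsilon>"
    by eventually_elim (use d(2) in \<open>auto simp: dist_real_def\<close>)
qed

lemma cts_at_cyl_const: "cts_at q (\<lambda>_. c) u"
  by (auto simp: cts_at_def intro: exI[of _ 1])

lemma cts_at_add:
  assumes "cts_at q F u" "cts_at q H u"
  shows "cts_at q (\<lambda>u. F u + H u) u"
  unfolding cts_at_def
proof (intro allI impI)
  fix \<epsilon> :: real assume "\<epsilon> > 0"
  then obtain d e where "d > 0" "\<forall>v. (\<forall>i<q. \<bar>v i - u i\<bar> < d) \<longrightarrow> \<bar>F v - F u\<bar> < \<epsilon> / 2"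
    "e > 0" "\<forall>v. (\<forall>i<q. \<bar>v i - u i\<bar> < e) \<longrightarrow> \<bar>H v - H u\<bar> < \<epsilon> / 2"
    using assms half_gt_zero[OF \<open>\<epsilon> > 0\<close>] unfolding cts_at_def by blast
  then show "\<exists>d>0. \<forall>v. (\<forall>i<q. \<bar>v i - u i\<bar> < d) \<longrightarrow> \<bar>F v + H v - (F u + H u)\<bar> < \<epsilon>"
    by (intro exI[of _ "min d e"]) (simp, smt (verit, ccfv_threshold))
qed

lemma cts_at_cmult:
  assumes "cts_at q F u"
  shows "cts_at q (\<lambda>u. c * F u) u"
  unfolding cts_at_def
proof (intro allI impI)
  fix \<epsilon> :: real assume \<epsilon>: "\<epsilon> > 0"
  have "0 < \<epsilon> / (\<bar>c\<bar> + 1)"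
    using \<epsilon> by (intro divide_pos_pos add_nonneg_pos) auto
  then obtain d where d: "d > 0" "\<And>v. (\<forall>i<q. \<bar>v i - u i\<bar> < d) \<Longrightarrow> \<bar>F v - F u\<bar> < \<epsilon> / (\<bar>c\<bar> + 1)"
    using assms unfolding cts_at_def by blast
  have "\<bar>c * F v - c * F u\<bar> < \<epsilon>" if "\<forall>i<q. \<bar>v i - u i\<bar> < d" for v
  proof -
    have "\<bar>c * F v - c * F u\<bar> = \<bar>c\<bar> * \<bar>F v - F u\<bar>" by (simp add: abs_mult[symmetric] algebra_simps)
    also have "\<dots> \<le> (\<bar>c\<bar> + 1) * \<bar>F v - F u\<bar>" by (intro mult_right_mono) auto
    also have "\<dots> < (\<bar>c\<bar> + 1) * (\<epsilon> / (\<bar>c\<bar> + 1))" using d(2)[OF that] by (intro mult_strict_left_mono) auto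
    also have "\<dots> = \<epsilon>" by (simp add: add_nonneg_eq_0_iff)
    finally show ?thesis .
  qed
  with d(1) show "\<exists>d>0. \<forall>v. (\<forall>i<q. \<bar>v i - u i\<bar> < d) \<longrightarrow> \<bar>c * F v - c * F u\<bar> < \<epsilon>" by blast
qed

lemma cts_at_sum:
  assumes "\<And>k. k \<in> K \<Longrightarrow> cts_at q (F k) u"
  shows "cts_at q (\<lambda>u. \<Sum>k\<in>K. F k u) u"
  using assms by (induction K rule: infinite_finite_induct) (auto intro: cts_at_cyl_const cts_at_add)

lemma continuous_on_of_cts_at:
  assumes "\<And>u. u \<in> S \<Longrightarrow> cts_at q F u"
  shows "continuous_on S F"
  unfolding continuous_on_def
proof
  fix u assume u: "u \<in> S"
  have "((\<lambda>v :: nat \<Rightarrow> real. v i) \<longlongrightarrow> u i) (at u within S)" for i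
    using continuous_on_subset[OF continuous_on_product_coordinates[of i] subset_UNIV, of S] u
    by (simp add: continuous_on_def)
  then show "(F \<longlongrightarrow> F u) (at u within S)"
    by (intro cts_at_tendsto[OF assms[OF u], where x = "\<lambda>v. v"])
qed

lemma continuous_nm: "continuous_on S (nm q)"
  unfolding L2_set_def[abs_def]
  by (intro continuous_intros continuous_on_subset[OF continuous_on_product_coordinates subset_UNIV])

lemma open_ob: "open (ob q \<rho>)"
  unfolding ob_def by (intro open_Collect_less continuous_nm continuous_intros)

lemma ob_sets [measurable]: "ob q \<rho> \<in> sets borel"
  using open_ob by (rule borel_open)

lemma borel_measurable_of_cts_at:
  assumes "\<And>u. u \<in> ob q \<rho> \<Longrightarrow> cts_at q F u"
  shows "(\<lambda>u. if u \<in> ob q \<rho> then F u else 0) \<in> borel_measurable borel"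
proof -
  have "(\<lambda>u. indicator (ob q \<rho>) u *\<^sub>R F u) \<in> borel_measurable borel"
    by (rule borel_measurable_continuous_on_indicator[OF ob_sets continuous_on_of_cts_at]) (rule assms)
  also have "(\<lambda>u. indicator (ob q \<rho>) u *\<^sub>R F u) = (\<lambda>u. if u \<in> ob q \<rho> then F u else 0)"
    by (auto simp: indicator_def)
  finally show ?thesis .
qed

lemma chain_rule:
  fixes x :: "real \<Rightarrow> nat \<Rightarrow> real"
  assumes cyl: "cyl q F" and part: "partial_on q (ob q \<rho>) F F'"
    and cts: "\<And>i. i < q \<Longrightarrow> cts_at q (F' i) (x t)" and t: "x t \<in> ob q \<rho>"
    and x: "\<And>i. i < q \<Longrightarrow> ((\<lambda>t. x t i) has_real_derivative x' i) (at t)"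
  shows "((\<lambda>t. F (x t)) has_real_derivative (\<Sum>i<q. F' i (x t) * x' i)) (at t)"
proof -
  define e where "e s = F (x s) - F (x t) - (\<Sum>i<q. F' i (x t) * (x s i - x t i))" for s
  have xt: "((\<lambda>s. x s i) \<longlongrightarrow> x t i) (at t)" if "i < q" for i
    using DERIV_isCont[OF x[OF that]] by (simp add: isCont_def)
  have "(e has_real_derivative 0) (at t)"
    unfolding has_field_derivative_iff
  proof (rule tendstoI)
    fix \<epsilon> :: real assume \<epsilon>: "\<epsilon> > 0"
    define K where "K = (\<Sum>i<q. \<bar>x' i\<bar>) + 1"
    have K: "K > 0" unfolding K_def by (rule add_nonneg_pos) (auto intro: sum_nonneg)
    obtain d where d: "d > 0" "\<And>v. (\<forall>i<q. \<bar>v i - x t i\<bar> < d) \<Longrightarrow> v \<in> ob q \<rho>"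
      using ob_nbhd[OF t] by blast
    have "\<forall>i\<in>{..<q}. \<exists>d>0. \<forall>v. (\<forall>j<q. \<bar>v j - x t j\<bar> < d) \<longrightarrow> \<bar>F' i v - F' i (x t)\<bar> < \<epsilon> / K"
      using cts \<epsilon> K by (auto simp: cts_at_def)
    then obtain g where g: "\<And>i. i < q \<Longrightarrow> g i > 0"
      "\<And>i v. i < q \<Longrightarrow> (\<forall>j<q. \<bar>v j - x t j\<bar> < g i) \<Longrightarrow> \<bar>F' i v - F' i (x t)\<bar> < \<epsilon> / K"
      by (auto dest!: bchoice)
    define m where "m = Min (insert d (g ` {..<q}))"
    have m: "m > 0" "m \<le> d" "\<And>i. i < q \<Longrightarrow> m \<le> g i"
      using d(1) g(1) by (auto simp: m_def)
    have "((\<lambda>s. \<Sum>i<q. \<bar>(x s i - x t i) / (s - t)\<bar>) \<longlongrightarrow> (\<Sum>i<q. \<bar>x' i\<bar>)) (at t)"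
      using x unfolding has_field_derivative_iff by (intro tendsto_sum tendsto_rabs) auto
    then have ev1: "\<forall>\<^sub>F s in at t. (\<Sum>i<q. \<bar>(x s i - x t i) / (s - t)\<bar>) < K"
      by (rule order_tendstoD) (simp add: K_def)
    have ev2: "\<forall>\<^sub>F s in at t. \<forall>i<q. \<bar>x s i - x t i\<bar> < m"
      by (rule eventually_coords_near[OF xt m(1)])
    have ev3: "\<forall>\<^sub>F s in at t. s \<noteq> t" by (simp add: eventually_neq_at_within)
    show "\<forall>\<^sub>F s in at t. dist ((e s - e t) / (s - t)) 0 < \<epsilon>"
      using ev1 ev2 ev3
    proof eventually_elim
      case (elim s)
      have near: "\<forall>j<q. \<bar>y j - x t j\<bar> < m" if "\<And>i. i < q \<Longrightarrow> \<bar>y i - x t i\<bar> \<le> \<bar>x s i - x t i\<bar>" for y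
        using that elim(2) by force
      have "\<bar>e s\<bar> \<le> \<epsilon> / K * (\<Sum>i<q. \<bar>x s i - x t i\<bar>)"
        unfolding e_def
      proof (rule telescoping_bound[OF cyl part])
        fix y assume y: "\<And>i. i < q \<Longrightarrow> \<bar>y i - x t i\<bar> \<le> \<bar>x s i - x t i\<bar>"
        show "y \<in> ob q \<rho>" using near[OF y] m(2) by (intro d(2)) force
        show "\<bar>F' i y - F' i (x t)\<bar> \<le> \<epsilon> / K" if "i < q" for i
          using near[OF y] m(3)[OF that] by (intro less_imp_le g(2)[OF that]) force
      qed
      then have "\<bar>e s\<bar> / \<bar>s - t\<bar> \<le> \<epsilon> / K * (\<Sum>i<q. \<bar>x s i - x t i\<bar>) / \<bar>s - t\<bar>"
        by (rule divide_right_mono) simp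
      also have "\<dots> = \<epsilon> / K * (\<Sum>i<q. \<bar>(x s i - x t i) / (s - t)\<bar>)"
        by (simp add: sum_divide_distrib[symmetric])
      also have "\<dots> < \<epsilon> / K * K"
        using elim(1) \<epsilon> K by (intro mult_strict_left_mono) auto
      also have "\<dots> = \<epsilon>" using K by simp
      finally show ?case by (simp add: e_def dist_real_def)
    qed
  qed
  then have "((\<lambda>s. e s + F (x t) + (\<Sum>i<q. F' i (x t) * (x s i - x t i))) has_real_derivative
      0 + 0 + (\<Sum>i<q. F' i (x t) * (x' i - 0))) (at t)"
    by (intro DERIV_add DERIV_const DERIV_sum DERIV_cmult DERIV_diff x) auto
  then show ?thesis by (simp add: e_def)
qed

subsection \<open>Smooth cutoff and integration by parts\<close>

definition ppart2 :: "real \<Rightarrow> real" where "ppart2 t = (max 0 t)\<^sup>2"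

lemma ppart2_deriv: "(ppart2 has_real_derivative 2 * max 0 t) (at t)"
proof -
  consider "t < 0" | "t > 0" | "t = 0" by linarith
  then show ?thesis
  proof cases
    case 1
    have "((\<lambda>_. 0) has_real_derivative 0) (at t)" by simp
    then have "(ppart2 has_real_derivative 0) (at t)"
      by (rule has_field_derivative_transform_within_open[of _ _ _ "{..<0}"]) (use 1 in \<open>auto simp: ppart2_def\<close>)
    with 1 show ?thesis by simp
  next
    case 2
    have "((\<lambda>t. t\<^sup>2) has_real_derivative 2 * t) (at t)" by (auto intro!: derivative_eq_intros)
    then have "(ppart2 has_real_derivative 2 * t) (at t)"
      by (rule has_field_derivative_transform_within_open[of _ _ _ "{0<..}"]) (use 2 in \<open>auto simp: ppart2_def\<close>)
    with 2 show ?thesis by simp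
  next
    case 3
    have "(\<lambda>h. (ppart2 h - ppart2 0) / (h - 0)) \<midarrow>0\<rightarrow> 0"
    proof (rule Lim_null_comparison)
      show "\<forall>\<^sub>F h in at 0. norm ((ppart2 h - ppart2 0) / (h - 0)) \<le> \<bar>h\<bar>"
        by (intro always_eventually) (auto simp: ppart2_def max_def power2_eq_square abs_mult)
      show "((\<lambda>h. \<bar>h\<bar>) \<longlongrightarrow> 0) (at (0::real))" by (intro tendsto_eq_intros) auto
    qed
    with 3 show ?thesis by (simp add: has_field_derivative_iff)
  qed
qed

text \<open>A piecewise polynomial that descends from one at \<open>t = 1\<close> to zero at
  \<open>t = 2\<close>. It is merely continuously differentiable, which is enough because it is
  never differentiated twice.\<close>

definition cutoff :: "real \<Rightarrow> real" where "cutoff t = ppart2 (1 - ppart2 (t - 1))"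
definition cutoff' :: "real \<Rightarrow> real" where
  "cutoff' t = - (2 * max 0 (1 - ppart2 (t - 1))) * (2 * max 0 (t - 1))"

lemma cutoff_deriv: "(cutoff has_real_derivative cutoff' t) (at t)"
proof -
  have "((\<lambda>t. ppart2 (t - 1)) has_real_derivative 2 * max 0 (t - 1) * 1) (at t)"
    by (rule DERIV_chain2[OF ppart2_deriv]) (auto intro!: derivative_eq_intros)
  then have "((\<lambda>t. 1 - ppart2 (t - 1)) has_real_derivative - (2 * max 0 (t - 1))) (at t)"
    by (auto intro!: derivative_eq_intros)
  from DERIV_chain2[OF ppart2_deriv this] show ?thesis
    by (simp add: cutoff_def[abs_def] cutoff'_def)
qed

lemma cutoff_bounds: "0 \<le> cutoff t" "cutoff t \<le> 1"
  by (auto simp: cutoff_def ppart2_def power_le_one)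

lemma ppart2_ge_1: "2 \<le> t \<Longrightarrow> 1 \<le> ppart2 (t - 1)"
  by (simp add: ppart2_def)

lemma cutoff_eq_1: "t \<le> 1 \<Longrightarrow> cutoff t = 1"
  by (simp add: cutoff_def ppart2_def)

lemma cutoff_eq_0: "2 \<le> t \<Longrightarrow> cutoff t = 0"
  using ppart2_ge_1[of t] by (simp add: cutoff_def ppart2_def[of "1 - _"])

lemma cutoff'_eq_0: "t \<le> 1 \<or> 2 \<le> t \<Longrightarrow> cutoff' t = 0"
  using ppart2_ge_1[of t] by (auto simp: cutoff'_def max_def)

lemma cutoff'_bound: "\<bar>cutoff' t\<bar> \<le> 4"
proof (cases "t \<le> 1 \<or> 2 \<le> t")
  case False
  then have "\<bar>cutoff' t\<bar> = (2 * max 0 (1 - ppart2 (t - 1))) * (2 * (t - 1))"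
    by (simp add: cutoff'_def abs_mult)
  also have "\<dots> \<le> (2 * 1) * (2 * 1)"
    using False by (intro mult_mono) (auto simp: ppart2_def)
  finally show ?thesis by simp
qed (simp add: cutoff'_eq_0)

text \<open>The argument is the squared norm, a polynomial and hence smooth at the origin. The
  transition between one and two becomes the shell from radius \<open>r\<close> to
  \<open>sqrt 2 * r\<close>.\<close>

definition bump :: "nat \<Rightarrow> real \<Rightarrow> (nat \<Rightarrow> real) \<Rightarrow> real" where
  "bump q r u = cutoff (ip q u u / r\<^sup>2)"

definition bump' :: "nat \<Rightarrow> real \<Rightarrow> nat \<Rightarrow> (nat \<Rightarrow> real) \<Rightarrow> real" where
  "bump' q r i u = cutoff' (ip q u u / r\<^sup>2) * (2 * u i / r\<^sup>2)"

lemma cutoff_measurable [measurable]: "cutoff \<in> borel_measurable borel" "cutoff' \<in> borel_measurable borel"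
  unfolding cutoff_def[abs_def] cutoff'_def[abs_def] ppart2_def by measurable

lemma bump_measurable [measurable]: "bump q r \<in> borel_measurable borel" "bump' q r i \<in> borel_measurable borel"
  unfolding bump_def[abs_def] bump'_def[abs_def] by measurable

lemma bump_bounds: "0 \<le> bump q r u" "bump q r u \<le> 1"
  by (auto simp: bump_def cutoff_bounds)

lemma bump_eq_1: "0 < r \<Longrightarrow> nm q u \<le> r \<Longrightarrow> bump q r u = 1"
  unfolding bump_def nm_sq[symmetric]
  by (rule cutoff_eq_1) (auto simp: power_mono L2_set_nonneg)

lemma sqrt2_sq_le: "0 < r \<Longrightarrow> sqrt 2 * r \<le> nm q u \<Longrightarrow> 2 * r\<^sup>2 \<le> ip q u u"
  using power_mono[of "sqrt 2 * r" "nm q u" 2] by (simp add: nm_sq power_mult_distrib)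

lemma bump_eq_0: "0 < r \<Longrightarrow> sqrt 2 * r \<le> nm q u \<Longrightarrow> bump q r u = 0"
  unfolding bump_def by (rule cutoff_eq_0) (auto simp: field_simps dest!: sqrt2_sq_le)

lemma bump'_eq_0: "0 < r \<Longrightarrow> nm q u \<le> r \<or> sqrt 2 * r \<le> nm q u \<Longrightarrow> bump' q r i u = 0"
proof -
  assume r: "0 < r" and u: "nm q u \<le> r \<or> sqrt 2 * r \<le> nm q u"
  have "ip q u u / r\<^sup>2 \<le> 1" if "nm q u \<le> r"
    unfolding nm_sq[symmetric] using r that by (auto simp: power_mono L2_set_nonneg)
  moreover have "2 \<le> ip q u u / r\<^sup>2" if "sqrt 2 * r \<le> nm q u"
    using sqrt2_sq_le[OF r that] r by (simp add: field_simps)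
  ultimately show "bump' q r i u = 0"
    using u by (auto simp: bump'_def cutoff'_eq_0)
qed
lemma bump_partial: "partial_on q S (bump q r) (bump' q r)"
  unfolding partial_on_def
proof (intro ballI allI impI)
  fix u :: "nat \<Rightarrow> real" and i assume i: "i < q"
  have eq: "ip q (u(i := t)) (u(i := t)) = t * t + (\<Sum>j\<in>{..<q} - {i}. u j * u j)" for t
    using i by (subst ip_def, subst sum.remove[of _ i]) auto
  have "((\<lambda>t. ip q (u(i := t)) (u(i := t)) / r\<^sup>2) has_real_derivative 2 * u i / r\<^sup>2) (at (u i))"
    unfolding eq by (rule DERIV_cdivide) (auto intro!: derivative_eq_intros)
  from DERIV_chain2[OF cutoff_deriv this]
  show "((\<lambda>t. bump q r (u(i := t))) has_real_derivative bump' q r i u) (at (u i))"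
    by (simp add: bump_def bump'_def)
qed

lemma bump'_bound:
  assumes r: "0 < r"
  shows "\<bar>\<Sum>i<q. y i * bump' q r i u\<bar> \<le> 16 / r * nm q y"
proof (cases "sqrt 2 * r \<le> nm q u")
  case True
  then show ?thesis using r by (simp add: bump'_eq_0 L2_set_nonneg)
next
  case False
  have "(\<Sum>i<q. y i * bump' q r i u) = cutoff' (ip q u u / r\<^sup>2) * (2 / r\<^sup>2) * ip q y u"
    unfolding ip_def[of q y] sum_distrib_left by (intro sum.cong) (auto simp: bump'_def)
  then have "\<bar>\<Sum>i<q. y i * bump' q r i u\<bar> = \<bar>cutoff' (ip q u u / r\<^sup>2)\<bar> * (2 / r\<^sup>2) * \<bar>ip q y u\<bar>"
    by (simp add: abs_mult)
  also have "\<dots> \<le> 4 * (2 / r\<^sup>2) * (nm q y * (2 * r))"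
  proof (intro mult_mono)
    have "sqrt 2 * r \<le> 2 * r"
      using r sqrt2_less_2 by (intro mult_right_mono) auto
    then have "nm q u \<le> 2 * r" using False by linarith
    then show "\<bar>ip q y u\<bar> \<le> nm q y * (2 * r)"
      using abs_ip_le[of q y u] mult_left_mono[of "nm q u" "2 * r" "nm q y"] L2_set_nonneg[of y "{..<q}"]
      by linarith
  qed (use cutoff'_bound r in auto)
  also have "\<dots> = 16 / r * nm q y" using r by (simp add: power2_eq_square)
  finally show ?thesis .
qed

text \<open>Comparison with a Gaussian replaces the computation of the volume of a ball.\<close>

lemma emeasure_ob_finite: "emeasure (lebR {..<q}) (ob q \<rho>) < \<infinity>"
proof -
  have "emeasure (lebR {..<q}) (ob q \<rho>) = (\<integral>\<^sup>+u. indicator (ob q \<rho>) u \<partial>lebR {..<q})"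
    by (subst nn_integral_indicator) auto
  also have "\<dots> \<le> (\<integral>\<^sup>+u. ennreal (exp (\<rho>\<^sup>2 / 2)) * ennreal (exp (- (1 * ip q u u) / 2)) \<partial>lebR {..<q})"
  proof (rule nn_integral_mono)
    fix u
    have "1 \<le> exp (\<rho>\<^sup>2 / 2) * exp (- (1 * ip q u u) / 2)" if "u \<in> ob q \<rho>"
    proof -
      have "ip q u u \<le> \<rho>\<^sup>2"
        unfolding nm_sq[symmetric] using that L2_set_nonneg[of u "{..<q}"]
        by (intro power_mono) (auto simp: ob_def)
      then show ?thesis by (simp add: exp_add[symmetric])
    qed
    then show "indicator (ob q \<rho>) u \<le> ennreal (exp (\<rho>\<^sup>2 / 2)) * ennreal (exp (- (1 * ip q u u) / 2))"
      by (auto simp: indicator_def ennreal_mult[symmetric] ennreal_1[symmetric] simp del: ennreal_1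
          intro!: ennreal_leI)
  qed
  also have "\<dots> = ennreal (exp (\<rho>\<^sup>2 / 2)) * ennreal (sqrt ((2 * pi / 1) ^ q))"
    by (subst nn_integral_cmult, measurable, subst nn_integral_gauss_iso) auto
  also have "\<dots> < \<infinity>" by (simp add: ennreal_mult_less_top)
  finally show ?thesis .
qed

lemma integrable_lebR_bounded_support:
  assumes [measurable]: "f \<in> borel_measurable borel"
    and bd: "\<And>u. \<bar>f u\<bar> \<le> (M::real)" and supp: "\<And>u. u \<notin> ob q \<rho> \<Longrightarrow> f u = 0"
  shows "integrable (lebR {..<q}) f"
proof (rule integrableI_bounded_set[where A = "ob q \<rho>" and B = M])
  show "AE x\<in>ob q \<rho> in lebR {..<q}. norm (f x) \<le> M" using bd by simp
qed (use supp emeasure_ob_finite in auto)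

lemma integral_partial_eq_0:
  assumes \<Phi> [measurable]: "\<Phi>' \<in> borel_measurable borel" and i: "i < q"
    and deriv: "\<And>u. ((\<lambda>t. \<Phi> (u(i := t))) has_real_derivative \<Phi>' u) (at (u i))"
    and bd: "\<And>u. \<bar>\<Phi>' u\<bar> \<le> M"
    and supp: "\<And>u. u \<notin> ob q \<rho> \<Longrightarrow> \<Phi> u = 0" "\<And>u. u \<notin> ob q \<rho> \<Longrightarrow> \<Phi>' u = 0" and \<rho>: "0 < \<rho>"
  shows "(\<integral>u. \<Phi>' u \<partial>lebR {..<q}) = 0"
proof -
  have ins: "{..<q} = insert i ({..<q} - {i})" using i by auto
  have int: "integrable (lebR {..<q}) \<Phi>'"
    by (rule integrable_lebR_bounded_support[OF _ bd supp(2)]) auto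
  have "(\<integral>u. \<Phi>' u \<partial>lebR {..<q}) = (\<integral>u. \<integral>t. \<Phi>' (u(i := t)) \<partial>lborel \<partial>lebR ({..<q} - {i}))"
    using integral_lebR_insert[of "{..<q} - {i}" i \<Phi>'] int i by (simp add: insert_absorb)
  moreover have "(\<integral>t. \<Phi>' (u(i := t)) \<partial>lborel) = 0" for u
  proof -
    have out: "u(i := t) \<notin> ob q \<rho>" if "\<rho> \<le> \<bar>t\<bar>" for t
      using abs_coord_le_nm[OF i, of "u(i := t)"] that by (auto simp: ob_def)
    \<comment> \<open>The derivative is bounded but perhaps not continuous. Adding
      \<open>M * t\<close> makes it nonnegative, and the fundamental theorem then holds with
      integrability as part of its conclusion; the added part is subtracted afterwards.\<close>
    have d: "((\<lambda>t. \<Phi> (u(i := t)) + M * t) has_real_derivative \<Phi>' (u(i := t)) + M) (at t)" for t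
      using deriv[of "u(i := t)"] by (auto intro!: derivative_eq_intros)
    have nonneg: "0 \<le> \<Phi>' (u(i := t)) + M" for t
      using bd[of "u(i := t)"] by linarith
    have [measurable]: "(\<lambda>t. \<Phi>' (u(i := t)) + M) \<in> borel_measurable borel" by measurable
    have hb: "has_bochner_integral lborel (\<lambda>t. (\<Phi>' (u(i := t)) + M) * indicator {- \<rho>..\<rho>} t)
        ((\<Phi> (u(i := \<rho>)) + M * \<rho>) - (\<Phi> (u(i := - \<rho>)) + M * (- \<rho>)))"
      by (rule has_bochner_integral_FTC_Icc_nonneg[OF _ d nonneg]) (use \<rho> in auto)
    have "has_bochner_integral lborel (\<lambda>t. M * indicator {- \<rho>..\<rho>} t :: real) (M * (2 * \<rho>))"
      using \<rho> by (auto simp: has_bochner_integral_iff)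
    from has_bochner_integral_diff[OF hb this]
    have "(\<integral>t. \<Phi>' (u(i := t)) * indicator {- \<rho>..\<rho>} t \<partial>lborel) = 0"
      using out \<rho> by (simp add: has_bochner_integral_iff algebra_simps supp(1))
    moreover have "\<Phi>' (u(i := t)) * indicator {- \<rho>..\<rho>} t = \<Phi>' (u(i := t))" for t
      using out[of t] by (cases "\<bar>t\<bar> \<le> \<rho>") (auto simp: indicator_def supp(2) abs_le_iff)
    ultimately show ?thesis by simp
  qed
  ultimately show ?thesis by simp
qed

subsection \<open>Gaussian integration by parts\<close>

text \<open>Averages over a path become integrals with respect to a probability measure, so that
  Jensen's inequality and Fubini's theorem apply to them directly.\<close>

definition U01 :: "real measure" where "U01 = density lborel (indicator {0..1})"

lemma sets_U01 [simp, measurable_cong]: "sets U01 = sets borel" and space_U01 [simp]: "space U01 = UNIV"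
  by (auto simp: U01_def)

lemma prob_U01: "prob_space U01"
proof
  have "emeasure U01 (space U01) = (\<integral>\<^sup>+s. indicator {0..1} s * indicator UNIV s \<partial>(lborel :: real measure))"
    unfolding U01_def by (subst emeasure_density) auto
  then show "emeasure U01 (space U01) = 1" by simp
qed

interpretation U01: prob_space U01 by (rule prob_U01)

lemma AE_U01: "AE s in U01. s \<in> {0..1}"
  unfolding U01_def by (subst AE_density) (auto simp: indicator_def)

lemma integral_U01:
  fixes f :: "real \<Rightarrow> real"
  assumes "f \<in> borel_measurable borel"
  shows "(\<integral>s. f s \<partial>U01) = (\<integral>s. f s * indicator {0..1} s \<partial>lborel :: real)"
proof -
  have "U01 = density lborel (\<lambda>s. ennreal (indicator {0..1} s))"
    unfolding U01_def by (intro arg_cong[where f = "density lborel"]) (auto simp: indicator_def)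
  then have "(\<integral>s. f s \<partial>U01) = (\<integral>s. indicator {0..1} s * f s \<partial>lborel)"
    using assms by (subst (asm) eq_commute, elim subst, subst integral_density) auto
  then show ?thesis by (simp add: mult.commute)
qed

lemma integral_U01_deriv:
  assumes [measurable]: "f' \<in> borel_measurable borel"
    and d: "\<And>s. s \<in> {0..1} \<Longrightarrow> (f has_real_derivative f' s) (at s)"
    and bd: "\<And>s. s \<in> {0..1} \<Longrightarrow> \<bar>f' s\<bar> \<le> M"
  shows "(\<integral>s. f' s \<partial>U01) = f 1 - f 0" "integrable U01 f'"
proof -
  have "f' \<in> borel_measurable U01" by measurable
  then show int: "integrable U01 f'"
    by (intro U01.integrable_const_bound[where B = M]) (use AE_U01 bd in auto)
  have "(\<integral>s. (f' s + M) * indicator {0..1} s \<partial>lborel) = (f 1 + M * 1) - (f 0 + M * 0)"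
  proof (rule integral_FTC_Icc_nonneg)
    fix s :: real assume s: "s \<in> {0..1}"
    show "((\<lambda>s. f s + M * s) has_real_derivative f' s + M) (at s)"
      using d[OF s] by (auto intro!: derivative_eq_intros)
    show "0 \<le> f' s + M" using bd[OF s] by linarith
  qed auto
  then have "(\<integral>s. f' s + M \<partial>U01) = f 1 + M - f 0"
    by (subst integral_U01) auto
  then show "(\<integral>s. f' s \<partial>U01) = f 1 - f 0"
    using int by (simp add: U01.prob_space[simplified])
qed

lemma abs_integral_U01_le:
  fixes f :: "real \<Rightarrow> real"
  assumes [measurable]: "f \<in> borel_measurable borel" and bd: "\<And>s. s \<in> {0..1} \<Longrightarrow> \<bar>f s\<bar> \<le> C"
  shows "\<bar>\<integral>s. f s \<partial>U01\<bar> \<le> C"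
proof -
  have AE: "AE s in U01. norm (f s) \<le> C" using AE_U01 bd by auto
  have int: "integrable U01 f"
    by (rule U01.integrable_const_bound[OF AE]) measurable
  have "\<bar>\<integral>s. f s \<partial>U01\<bar> \<le> (\<integral>s. norm (f s) \<partial>U01)"
    using integral_norm_bound[of U01 f] by simp
  also have "\<dots> \<le> (\<integral>s. C \<partial>U01)"
    using int AE by (intro integral_mono_AE) auto
  finally show ?thesis by (simp add: U01.prob_space[simplified])
qed

definition bddf :: "((nat \<Rightarrow> real) \<Rightarrow> real) \<Rightarrow> bool" where
  "bddf f \<longleftrightarrow> (\<exists>M. \<forall>u. \<bar>f u\<bar> \<le> M)"

lemma bddfI: "(\<And>u. \<bar>f u\<bar> \<le> M) \<Longrightarrow> bddf f"
  by (auto simp: bddf_def)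

lemma bddf_const: "bddf (\<lambda>_. c)" by (rule bddfI) auto

lemma bddf_add:
  assumes "bddf f" "bddf g" shows "bddf (\<lambda>u. f u + g u)"
proof -
  obtain M N where "\<And>u. \<bar>f u\<bar> \<le> M" "\<And>u. \<bar>g u\<bar> \<le> N" using assms by (auto simp: bddf_def)
  then show ?thesis by (intro bddfI[of _ "M + N"] order_trans[OF abs_triangle_ineq] add_mono)
qed

lemma bddf_mult:
  assumes "bddf f" "bddf g" shows "bddf (\<lambda>u. f u * g u)"
proof -
  obtain M N where MN: "\<And>u. \<bar>f u\<bar> \<le> M" "\<And>u. \<bar>g u\<bar> \<le> N" using assms by (auto simp: bddf_def)
  then show ?thesis by (intro bddfI[of _ "M * N"]) (auto simp: abs_mult intro!: mult_mono' )
qed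

lemma bddf_diff: "bddf f \<Longrightarrow> bddf g \<Longrightarrow> bddf (\<lambda>u. f u - g u)"
  using bddf_add[of f "\<lambda>u. -1 * g u"] bddf_mult[of "\<lambda>_. -1" g] bddf_const[of "-1"] by simp

lemma bddf_sum: "(\<And>k. k \<in> K \<Longrightarrow> bddf (f k)) \<Longrightarrow> bddf (\<lambda>u. \<Sum>k\<in>K. f k u)"
  by (induction K rule: infinite_finite_induct) (auto intro: bddf_const bddf_add)

lemmas bddf_intros = bddf_const bddf_add bddf_mult bddf_diff bddf_sum

text \<open>Measurability is demanded globally so that no indicator functions are needed.\<close>

definition C1b :: "nat \<Rightarrow> real \<Rightarrow> ((nat \<Rightarrow> real) \<Rightarrow> real) \<Rightarrow> (nat \<Rightarrow> (nat \<Rightarrow> real) \<Rightarrow> real) \<Rightarrow> bool" where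
  "C1b q \<rho> F F1 \<longleftrightarrow> cyl q F \<and> partial_on q (ob q \<rho>) F F1 \<and>
     (\<forall>i<q. \<forall>u\<in>ob q \<rho>. cts_at q (F1 i) u) \<and> F \<in> borel_measurable borel \<and>
     (\<forall>i<q. F1 i \<in> borel_measurable borel) \<and>
     (\<exists>M. \<forall>u\<in>ob q \<rho>. \<bar>F u\<bar> \<le> M \<and> (\<forall>i<q. \<bar>F1 i u\<bar> \<le> M))"

lemma C1b_sum:
  assumes H: "\<And>k. k \<in> K \<Longrightarrow> C1b q \<rho> (H k) (H1 k)" and fin: "finite K"
  shows "C1b q \<rho> (\<lambda>u. \<Sum>k\<in>K. c k * H k u) (\<lambda>i u. \<Sum>k\<in>K. c k * H1 k i u)"
  unfolding C1b_def
proof (intro conjI allI ballI impI)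
  show "cyl q (\<lambda>u. \<Sum>k\<in>K. c k * H k u)"
    unfolding cyl_def
  proof (intro allI impI)
    fix u v :: "nat \<Rightarrow> real" assume eq: "\<forall>i<q. u i = v i"
    have "H k u = H k v" if "k \<in> K" for k
      using H[OF that] eq by (auto simp: C1b_def cyl_def)
    then show "(\<Sum>k\<in>K. c k * H k u) = (\<Sum>k\<in>K. c k * H k v)" by simp
  qed
  show "partial_on q (ob q \<rho>) (\<lambda>u. \<Sum>k\<in>K. c k * H k u) (\<lambda>i u. \<Sum>k\<in>K. c k * H1 k i u)"
    unfolding partial_on_def
    by (intro ballI allI impI DERIV_sum DERIV_cmult) (use H in \<open>auto simp: C1b_def partial_on_def\<close>)
  show "(\<lambda>u. \<Sum>k\<in>K. c k * H k u) \<in> borel_measurable borel"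
    by (intro borel_measurable_sum borel_measurable_times) (use H in \<open>auto simp: C1b_def\<close>)
  fix i assume i: "i < q"
  show "(\<lambda>u. \<Sum>k\<in>K. c k * H1 k i u) \<in> borel_measurable borel"
    by (intro borel_measurable_sum borel_measurable_times) (use H i in \<open>auto simp: C1b_def\<close>)
  show "cts_at q (\<lambda>u. \<Sum>k\<in>K. c k * H1 k i u) u" if "u \<in> ob q \<rho>" for u
    by (intro cts_at_sum cts_at_cmult) (use H i that in \<open>auto simp: C1b_def\<close>)
next
  have "\<forall>k\<in>K. \<exists>M. \<forall>u\<in>ob q \<rho>. \<bar>H k u\<bar> \<le> M \<and> (\<forall>i<q. \<bar>H1 k i u\<bar> \<le> M)"
    using H by (auto simp: C1b_def)
  then obtain M where M: "\<And>k u. k \<in> K \<Longrightarrow> u \<in> ob q \<rho> \<Longrightarrow> \<bar>H k u\<bar> \<le> M k \<and> (\<forall>i<q. \<bar>H1 k i u\<bar> \<le> M k)"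
    by (auto dest!: bchoice)
  have "\<bar>\<Sum>k\<in>K. c k * f k\<bar> \<le> (\<Sum>k\<in>K. \<bar>c k\<bar> * M k)" if "\<And>k. k \<in> K \<Longrightarrow> \<bar>f k\<bar> \<le> M k" for f
    by (rule order_trans[OF sum_abs sum_mono]) (use that in \<open>auto simp: abs_mult intro!: mult_left_mono\<close>)
  then show "\<exists>M. \<forall>u\<in>ob q \<rho>. \<bar>\<Sum>k\<in>K. c k * H k u\<bar> \<le> M \<and> (\<forall>i<q. \<bar>\<Sum>k\<in>K. c k * H1 k i u\<bar> \<le> M)"
    using M by (intro exI[of _ "\<Sum>k\<in>K. \<bar>c k\<bar> * M k"]) auto
qed

lemma C1b_cmult:
  assumes "C1b q \<rho> H H1" shows "C1b q \<rho> (\<lambda>u. c * H u) (\<lambda>i u. c * H1 i u)"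
  using C1b_sum[of "{0::nat}" q \<rho> "\<lambda>_. H" "\<lambda>_. H1" "\<lambda>_. c"] assms by simp

lemma ob_scale: "u \<in> ob q \<rho> \<Longrightarrow> \<bar>s\<bar> \<le> 1 \<Longrightarrow> (\<lambda>i. s * u i) \<in> ob q \<rho>"
  using mult_left_le_one_le[of "nm q u" "\<bar>s\<bar>"] by (auto simp: ob_def nm_scale L2_set_nonneg)

lemma segment_deriv:
  assumes "cyl q F" "partial_on q (ob q \<rho>) F F1" "\<And>i u. i < q \<Longrightarrow> u \<in> ob q \<rho> \<Longrightarrow> cts_at q (F1 i) u"
    "u \<in> ob q \<rho>" "\<bar>s\<bar> \<le> 1"
  shows "((\<lambda>s. F (\<lambda>i. s * u i)) has_real_derivative ip q (\<lambda>i. F1 i (\<lambda>i. s * u i)) u) (at s)"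
  unfolding ip_def
  by (rule chain_rule[OF assms(1,2)])
     (use assms(3-) in \<open>auto intro!: derivative_eq_intros ob_scale\<close>)

lemma borel_measurable_scale [measurable (raw)]:
  assumes [measurable]: "f \<in> borel_measurable M" "g \<in> borel_measurable M"
  shows "(\<lambda>x (j::nat). f x * g x j :: real) \<in> borel_measurable M"
  by (rule borel_measurable_into_fun) measurable

context pd_form
begin

text \<open>The trace of the covariance matrix times a matrix of second derivatives, the main term
  that Gaussian integration by parts produces.\<close>

definition trQ :: "(nat \<Rightarrow> nat \<Rightarrow> (nat \<Rightarrow> real) \<Rightarrow> real) \<Rightarrow> (nat \<Rightarrow> real) \<Rightarrow> real" where
  "trQ F2 u = (\<Sum>i<q. \<Sum>j<q. Qi i j * F2 j i u)"

lemma integral_G: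
  assumes [measurable]: "f \<in> borel_measurable borel"
  shows "(\<integral>u. f u \<partial>G) = (\<integral>u. wt u / Z * f u \<partial>lebR {..<q} :: real)"
  unfolding G_def
  by (subst integral_density) (use Z_pos wt_pos in \<open>auto simp: less_imp_le\<close>)

lemma integrable_G_bddf:
  assumes "f \<in> borel_measurable borel" "bddf f" shows "integrable G f"
proof -
  obtain M where "\<And>u. \<bar>f u\<bar> \<le> M" using assms by (auto simp: bddf_def)
  then show ?thesis by (intro G.integrable_const_bound[where B = M]) (use assms in auto)
qed

lemma wt_partial: "((\<lambda>t. wt (u(i := t))) has_real_derivative - (\<Sum>k<q. Q i k * u k) * wt u) (at (u i))"
  if i: "i < q"
proof -
  define a b c where "a = Q i i" and "b = (\<Sum>k\<in>{..<q} - {i}. Q i k * u k)"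
    and "c = (\<Sum>j\<in>{..<q} - {i}. \<Sum>k\<in>{..<q} - {i}. Q j k * u j * u k)"
  have eq: "bil q Q (u(i := t)) (u(i := t)) = a * t * t + 2 * b * t + c" for t
  proof -
    have "bil q Q (u(i := t)) (u(i := t)) = (\<Sum>k<q. Q i k * t * (u(i := t)) k)
        + (\<Sum>j\<in>{..<q} - {i}. \<Sum>k<q. Q j k * u j * (u(i := t)) k)"
      unfolding bil_def using i by (subst sum.remove[of _ i]) auto
    also have "(\<Sum>k<q. Q i k * t * (u(i := t)) k) = a * t * t + b * t"
      using i by (subst sum.remove[of _ i]) (auto simp: a_def b_def sum_distrib_left sum_distrib_right mult_ac)
    also have "(\<Sum>j\<in>{..<q} - {i}. \<Sum>k<q. Q j k * u j * (u(i := t)) k)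
        = (\<Sum>j\<in>{..<q} - {i}. Q j i * u j * t + (\<Sum>k\<in>{..<q} - {i}. Q j k * u j * u k))"
      using i by (intro sum.cong refl, subst sum.remove[of _ i]) auto
    also have "\<dots> = b * t + c"
      using i by (simp add: sum.distrib b_def c_def sum_distrib_right sym[of i])
    finally show ?thesis by (simp del: fun_upd_apply)
  qed
  have "((\<lambda>t. wt (u(i := t))) has_real_derivative exp (- (a * u i * u i + 2 * b * u i + c) / 2) * (- (a * u i + b))) (at (u i))"
    unfolding wt_def eq by (auto intro!: derivative_eq_intros simp: field_simps)
  moreover have "a * u i + b = (\<Sum>k<q. Q i k * u k)"
    using i by (subst sum.remove[of _ i]) (auto simp: a_def b_def)
  moreover have "wt u = exp (- (a * u i * u i + 2 * b * u i + c) / 2)"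
    using eq[of "u i"] by (simp add: wt_def)
  ultimately show ?thesis by (simp add: mult.commute)
qed

lemma bddf_wt: "bddf wt"
proof (rule bddfI)
  fix u show "\<bar>wt u\<bar> \<le> 1"
    using coercive[of u] mult_nonneg_nonneg[OF less_imp_le[OF kappa_pos] ip_nonneg[of q u]]
    by (simp add: wt_def)
qed

lemma bddf_bump: "bddf (bump q r)"
  using bump_bounds by (intro bddfI[of _ 1]) (simp add: abs_le_iff order_trans[OF _ bump_bounds(1)])

lemma bddf_bump':
  assumes "0 < r" "i < q" shows "bddf (bump' q r i)"
proof (rule bddfI)
  fix u
  have "(\<Sum>j<q. (if j = i then 1 else 0) * bump' q r j u) = bump' q r i u"
    using assms(2) by (simp add: mult_delta_left)
  then show "\<bar>bump' q r i u\<bar> \<le> 16 / r * nm q (\<lambda>j. if j = i then 1 else 0)"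
    using bump'_bound[OF assms(1), where q = q and y = "\<lambda>j. if j = i then 1 else 0" and u = u] by simp
qed

lemma sqrt2_lt_2: "sqrt 2 * r < 2 * r" if "0 < r" for r :: real
  using that sqrt2_less_2 by (intro mult_strict_right_mono) auto

text \<open>The field with components \<open>bump q r u * Qinv (...) i * wt u\<close> has bounded
  support, so its divergence integrates to zero. Differentiating the weight gives the left-hand
  side, differentiating \<open>F1\<close> the trace, and differentiating the cutoff an error that
  lives on the shell where the cutoff descends. The scaling by \<open>s\<close> is there because the
  identity is applied along rays.\<close>

lemma gauss_ibp:
  assumes F1: "\<And>j. j < q \<Longrightarrow> C1b q \<rho> (F1 j) (F2 j)"
    and r: "0 < r" "2 * r \<le> \<rho>" and s: "0 \<le> s" "s \<le> 1"
  shows "(\<integral>u. bump q r u * ip q (\<lambda>j. F1 j (\<lambda>k. s * u k)) u \<partial>G)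
    = (\<integral>u. (\<Sum>i<q. Qinv (\<lambda>j. F1 j (\<lambda>k. s * u k)) i * bump' q r i u) \<partial>G)
      + s * (\<integral>u. bump q r u * trQ F2 (\<lambda>k. s * u k) \<partial>G)"
proof -
  let ?S = "ob q \<rho>"
  note [measurable] = ob_sets
  define sc where "sc u = (\<lambda>k. s * u k)" for u :: "nat \<Rightarrow> real"
  have sc_upd: "sc (u(i := t)) = (sc u)(i := s * t)" for u i t by (auto simp: sc_def)
  have sc_meas [measurable]: "sc \<in> borel_measurable borel"
    unfolding sc_def[abs_def] by measurable
  have sc_S: "sc u \<in> ?S" if "u \<in> ?S" for u
    unfolding sc_def by (rule ob_scale[OF that]) (use s in auto)
  have [measurable]: "F1 j \<in> borel_measurable borel" "F2 j i \<in> borel_measurable borel" if "j < q" "i < q" for i j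
    using F1[OF that(1)] that by (auto simp: C1b_def)
  \<comment> \<open>Masked by the ball, so that every factor is bounded on the whole space; the
    cutoff vanishes outside the ball.\<close>
  define A1 where "A1 j u = (if u \<in> ?S then F1 j (sc u) else 0)" for j u
  define A2 where "A2 j i u = (if u \<in> ?S then F2 j i (sc u) else 0)" for j i u
  define Y where "Y i u = (\<Sum>j<q. Qi i j * A1 j u)" for i u
  define q' where "q' i u = (if u \<in> ?S then (\<Sum>k<q. Q i k * u k) else 0)" for i u
  have meas [measurable]: "A1 j \<in> borel_measurable borel" "A2 j i \<in> borel_measurable borel"
    "Y i \<in> borel_measurable borel" "q' i \<in> borel_measurable borel" if "i < q" "j < q" for i j
    using that unfolding A1_def[abs_def] A2_def[abs_def] Y_def[abs_def] q'_def[abs_def] by measurable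
  have bdd: "bddf (A1 j)" "bddf (A2 j i)" if ji: "j < q" "i < q" for i j
  proof -
    obtain M where "\<forall>u\<in>?S. \<bar>F1 j u\<bar> \<le> M \<and> (\<forall>i<q. \<bar>F2 j i u\<bar> \<le> M)"
      using F1[OF ji(1)] by (auto simp: C1b_def)
    then have "\<And>u. u \<in> ?S \<Longrightarrow> \<bar>F1 j u\<bar> \<le> \<bar>M\<bar>" "\<And>u. u \<in> ?S \<Longrightarrow> \<bar>F2 j i u\<bar> \<le> \<bar>M\<bar>"
      using ji abs_ge_self[of M] by (blast intro: order_trans)+
    then show "bddf (A1 j)" "bddf (A2 j i)"
      unfolding A1_def[abs_def] A2_def[abs_def] using sc_S
      by (auto intro!: bddfI[of _ "\<bar>M\<bar>"])
  qed
  then have bddY: "bddf (Y i)" if "i < q" for i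
    unfolding Y_def[abs_def] using that by (intro bddf_intros) auto
  have bddq: "bddf (q' i)" if "i < q" for i
  proof (rule bddfI[of _ "(\<Sum>k<q. \<bar>Q i k\<bar>) * \<bar>\<rho>\<bar>"])
    fix u
    have "\<bar>\<Sum>k<q. Q i k * u k\<bar> \<le> (\<Sum>k<q. \<bar>Q i k\<bar>) * \<bar>\<rho>\<bar>" if u: "u \<in> ?S"
    proof -
      have "\<bar>u k\<bar> \<le> \<bar>\<rho>\<bar>" if "k < q" for k
        using abs_coord_le_nm[OF that, of u] u by (auto simp: ob_def)
      then show ?thesis
        unfolding sum_distrib_right by (intro order_trans[OF sum_abs sum_mono]) (auto simp: abs_mult intro!: mult_left_mono)
    qed
    then show "\<bar>q' i u\<bar> \<le> (\<Sum>k<q. \<bar>Q i k\<bar>) * \<bar>\<rho>\<bar>"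
      by (auto simp: q'_def sum_nonneg)
  qed
  \<comment> \<open>The \<open>i\<close>-th partial derivative of
    \<open>bump q r u * Y i u * wt u\<close>, where \<open>q'\<close> comes from the logarithmic
    derivative of the weight.\<close>
  define D where "D i u = bump' q r i u * Y i u * wt u
      + (bump q r u * (s * (\<Sum>j<q. Qi i j * A2 j i u)) * wt u - bump q r u * Y i u * (q' i u * wt u))" for i u
  have D_meas [measurable]: "D i \<in> borel_measurable borel" if "i < q" for i
    using that unfolding D_def[abs_def] by measurable
  have D_bdd: "bddf (D i)" if "i < q" for i
    unfolding D_def[abs_def] using that r bdd bddY bddq bddf_wt bddf_bump bddf_bump'
    by (intro bddf_intros) auto
  have out: "sqrt 2 * r < nm q u" if "u \<notin> ?S" for u
  proof -
    have "2 * r \<le> nm q u" using that r by (simp add: ob_def)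
    with sqrt2_lt_2[OF r(1)] show ?thesis by linarith
  qed
  have D_out: "D i u = 0" if "u \<notin> ?S" for i u
    using out[OF that] r by (simp add: D_def bump_eq_0 bump'_eq_0)
  have D_int: "(\<integral>u. D i u \<partial>lebR {..<q}) = 0" if i: "i < q" for i
  proof -
    obtain M where M: "\<And>u. \<bar>D i u\<bar> \<le> M" using D_bdd[OF i] by (auto simp: bddf_def)
    define \<Phi> where "\<Phi> u = bump q r u * Y i u * wt u" for u
    show ?thesis
    proof (rule integral_partial_eq_0[where \<Phi> = \<Phi> and i = i and M = M and \<rho> = \<rho>])
      fix u
      show "((\<lambda>t. \<Phi> (u(i := t))) has_real_derivative D i u) (at (u i))"
      proof (cases "u \<in> ?S")
        case True
        have dA: "((\<lambda>t. A1 j (u(i := t))) has_real_derivative s * A2 j i u) (at (u i))" if j: "j < q" for j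
        proof -
          have p: "partial_on q ?S (F1 j) (F2 j)" using F1[OF j] by (simp add: C1b_def)
          have "((\<lambda>t. F1 j ((sc u)(i := t))) has_real_derivative F2 j i (sc u)) (at (s * u i))"
            using partial_onD[OF p sc_S[OF True] i] by (simp add: sc_def)
          moreover have "((\<lambda>t. s * t) has_real_derivative s) (at (u i))"
            by (auto intro!: derivative_eq_intros)
          ultimately have dF: "((\<lambda>t. F1 j (sc (u(i := t)))) has_real_derivative F2 j i (sc u) * s) (at (u i))"
            unfolding sc_upd by (rule DERIV_chain2)
          obtain d where d: "d > 0" "\<And>v. (\<forall>i<q. \<bar>v i - u i\<bar> < d) \<Longrightarrow> v \<in> ?S"
            using ob_nbhd[OF True] by blast
          have inS: "u(i := t) \<in> ?S" if "t \<in> {u i - d<..<u i + d}" for t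
            using that d(1) by (intro d(2)) (auto simp: abs_less_iff)
          have "((\<lambda>t. A1 j (u(i := t))) has_real_derivative F2 j i (sc u) * s) (at (u i))"
          proof (rule has_field_derivative_transform_within_open[OF dF])
            show "F1 j (sc (u(i := t))) = A1 j (u(i := t))" if "t \<in> {u i - d<..<u i + d}" for t
              using inS[OF that] by (simp only: A1_def if_True)
          qed (use d(1) in auto)
          then show ?thesis using True by (simp add: A2_def mult.commute)
        qed
        have dY: "((\<lambda>t. Y i (u(i := t))) has_real_derivative s * (\<Sum>j<q. Qi i j * A2 j i u)) (at (u i))"
          unfolding Y_def sum_distrib_left using dA
          by (intro DERIV_sum) (auto intro!: derivative_eq_intros)
        have db: "((\<lambda>t. bump q r (u(i := t))) has_real_derivative bump' q r i u) (at (u i))"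
          using bump_partial[of q "UNIV" r] i by (auto simp: partial_on_def)
        have dw: "((\<lambda>t. wt (u(i := t))) has_real_derivative - q' i u * wt u) (at (u i))"
          using wt_partial[OF i, of u] True by (simp add: q'_def)
        show ?thesis
          unfolding \<Phi>_def using DERIV_mult[OF DERIV_mult[OF db dY] dw]
          by (simp add: D_def algebra_simps)
      next
        case False
        \<comment> \<open>Outside the ball the cutoff vanishes in a whole neighbourhood of
          \<open>u\<close>, since its support ends at \<open>sqrt 2 * r\<close>, strictly inside
          \<rho>.\<close>
        have "((\<lambda>t. 0) has_real_derivative 0) (at (u i))" by simp
        then have "((\<lambda>t. \<Phi> (u(i := t))) has_real_derivative 0) (at (u i))"
        proof (rule has_field_derivative_transform_within_open[where S = "{t. sqrt 2 * r < nm q (u(i := t))}"])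
          have "continuous_on UNIV (\<lambda>t. (u(i := t)) j)" for j
            by (cases "j = i") (auto intro!: continuous_intros)
          then have "continuous_on UNIV (\<lambda>t. nm q (u(i := t)))"
            unfolding L2_set_def by (intro continuous_intros)
          then show "open {t. sqrt 2 * r < nm q (u(i := t))}"
            by (intro open_Collect_less continuous_intros)
        qed (use out[OF False] r in \<open>auto simp: \<Phi>_def bump_eq_0\<close>)
        then show ?thesis using D_out[OF False] by simp
      qed
    next
      fix u assume "u \<notin> ?S"
      then show "\<Phi> u = 0" using out[of u] r by (simp add: \<Phi>_def bump_eq_0)
    qed (use M i r D_out in auto)
  qed
  define E where "E u = (\<Sum>i<q. Qinv (\<lambda>j. F1 j (sc u)) i * bump' q r i u)" for u
  define T where "T u = bump q r u * trQ F2 (sc u)" for u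
  define H where "H u = bump q r u * ip q (\<lambda>j. F1 j (sc u)) u" for u
  have zero: "E u = 0 \<and> T u = 0 \<and> H u = 0" if "u \<notin> ?S" for u
    using out[OF that] r by (simp add: E_def T_def H_def bump_eq_0 bump'_eq_0)
  have sumD: "(\<Sum>i<q. D i u) = wt u * (E u + (s * T u - H u))" for u
  proof (cases "u \<in> ?S")
    case True
    have Y: "Y i u = Qinv (\<lambda>j. F1 j (sc u)) i" if "i < q" for i
      using that True by (simp add: Y_def Qinv_def A1_def)
    have "H u = bump q r u * (\<Sum>i<q. Y i u * q' i u)"
    proof -
      have "ip q (\<lambda>j. F1 j (sc u)) u = bil q Q u (Qinv (\<lambda>j. F1 j (sc u)))"
        by (simp add: bil_Qinv ip_def mult.commute)
      also have "\<dots> = bil q Q (Qinv (\<lambda>j. F1 j (sc u))) u" by (rule bil_sym) (rule sym)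
      also have "\<dots> = (\<Sum>i<q. Y i u * q' i u)"
        unfolding bil_eq_ip ip_def using True Y by (intro sum.cong) (auto simp: q'_def)
      finally show ?thesis by (simp add: H_def)
    qed
    moreover have "E u = (\<Sum>i<q. bump' q r i u * Y i u)"
      unfolding E_def by (intro sum.cong) (auto simp: Y)
    moreover have "T u = bump q r u * (\<Sum>i<q. \<Sum>j<q. Qi i j * A2 j i u)"
      using True by (simp add: T_def trQ_def A2_def)
    ultimately show ?thesis
      by (simp add: D_def sum.distrib sum_subtractf sum_distrib_left sum_distrib_right algebra_simps)
  next
    case False
    then show ?thesis using zero D_out by simp
  qed
  \<comment> \<open>Off the ball both sides vanish. The masked expressions are the ones whose
    measurability and boundedness are evident.\<close>
  have EE: "E u = (\<Sum>i<q. Y i u * bump' q r i u)" for u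
    using zero[of u] by (cases "u \<in> ?S") (auto simp: E_def Y_def A1_def Qinv_def)
  have TT: "T u = bump q r u * (\<Sum>i<q. \<Sum>j<q. Qi i j * A2 j i u)" for u
    using zero[of u] by (cases "u \<in> ?S") (auto simp: T_def A2_def trQ_def)
  define ul where "ul j u = (if u \<in> ?S then u j else 0)" for j and u :: "nat \<Rightarrow> real"
  have [measurable]: "ul j \<in> borel_measurable borel" for j
    unfolding ul_def[abs_def] by measurable
  have "\<bar>ul j u\<bar> \<le> \<bar>\<rho>\<bar>" if "j < q" for j u
    using abs_coord_le_nm[OF that, of u] by (auto simp: ul_def ob_def)
  then have bddul: "bddf (ul j)" if "j < q" for j
    using that by (intro bddfI[of _ "\<bar>\<rho>\<bar>"])
  have HH: "H u = bump q r u * (\<Sum>j<q. A1 j u * ul j u)" for u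
    using zero[of u] by (cases "u \<in> ?S") (auto simp: H_def A1_def ip_def ul_def)
  have "E \<in> borel_measurable borel" "T \<in> borel_measurable borel" "H \<in> borel_measurable borel"
    unfolding EE[abs_def] TT[abs_def] HH[abs_def] by measurable
  note meas' [measurable] = this
  have bddE: "bddf E" "bddf T" "bddf H"
    unfolding EE[abs_def] TT[abs_def] HH[abs_def]
    using bdd bddY bddul bddf_bump bddf_bump' r by (auto intro!: bddf_intros)
  have int: "integrable G E" "integrable G T" "integrable G H"
    by (rule integrable_G_bddf[OF meas'(1) bddE(1)], rule integrable_G_bddf[OF meas'(2) bddE(2)],
        rule integrable_G_bddf[OF meas'(3) bddE(3)])
  have "(\<integral>u. E u + (s * T u - H u) \<partial>G) = (\<integral>u. 1 / Z * (\<Sum>i<q. D i u) \<partial>lebR {..<q})"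
    by (subst integral_G) (auto simp: sumD)
  also have "\<dots> = 1 / Z * (\<Sum>i<q. \<integral>u. D i u \<partial>lebR {..<q})"
  proof -
    have "integrable (lebR {..<q}) (D i)" if i: "i < q" for i
    proof -
      obtain M where "\<And>u. \<bar>D i u\<bar> \<le> M" using D_bdd[OF i] by (auto simp: bddf_def)
      then show ?thesis
        by (rule integrable_lebR_bounded_support[OF D_meas[OF i] _ D_out])
    qed
    then show ?thesis by simp
  qed
  also have "\<dots> = 0" by (simp add: D_int)
  finally show ?thesis
    using int unfolding E_def T_def H_def sc_def by simp
qed

end

subsection \<open>Decoupling by rotation\<close>

context pd_form
begin

lemma bump_support:
  assumes r: "0 < r" "2 * r \<le> \<rho>" and u: "bump q r u \<noteq> 0"
  shows "nm q u < sqrt 2 * r" "u \<in> ob q \<rho>"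
proof -
  show 1: "nm q u < sqrt 2 * r" using u bump_eq_0[OF r(1), where q = q and u = u] by linarith
  with sqrt2_lt_2[OF r(1)] r(2) have "nm q u < \<rho>" by linarith
  then show "u \<in> ob q \<rho>" by (simp add: ob_def)
qed

text \<open>The difference of \<open>F\<close> at \<open>u\<close> and at 0 is the average over
  \<open>s\<close> of the radial derivative at \<open>s u\<close>, whose Gaussian mean integration
  by parts provides. The trace term is at most \<open>A\<close>. The gradient of the cutoff
  contributes at most \<open>16 / r\<close> times the bound \<open>B / \<kappa>\<close> for
  \<open>Qinv\<close>, and only on an event of probability at most \<tau>. Applied to a function and
  then to the resulting trace, the lemma trades every two derivatives for one covariance
  matrix.\<close>

lemma cutoff_mean_bound:
  assumes F: "C1b q \<rho> F F1" and F1: "\<And>j. j < q \<Longrightarrow> C1b q \<rho> (F1 j) (F2 j)"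
    and r: "0 < r" "2 * r \<le> \<rho>"
    and A: "\<And>s. 0 \<le> s \<Longrightarrow> s \<le> 1 \<Longrightarrow> \<bar>\<integral>u. bump q r u * trQ F2 (\<lambda>k. s * u k) \<partial>G\<bar> \<le> A"
    and B: "\<And>u. u \<in> ob q \<rho> \<Longrightarrow> nm q (\<lambda>j. F1 j u) \<le> B"
    and \<tau>: "measure G {u. r \<le> nm q u} \<le> \<tau>"
  shows "\<bar>(\<integral>u. bump q r u * F u \<partial>G) - F (\<lambda>_. 0) * (\<integral>u. bump q r u \<partial>G)\<bar> \<le> A + 16 / (r * \<kappa>) * B * \<tau>"
proof -
  have \<rho>: "0 < \<rho>" using r by linarith
  have zero: "(\<lambda>_. 0) \<in> ob q \<rho>" using \<rho> by (simp add: ob_def L2_set_def)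
  have A0: "0 \<le> A" using A[of 0] by linarith
  have B0: "0 \<le> B" using B[OF zero] L2_set_nonneg[of _ "{..<q}"] order_trans by blast
  have cyl: "cyl q F" and part: "partial_on q (ob q \<rho>) F F1" and Fm: "F \<in> borel_measurable borel"
    and cts: "\<And>i u. i < q \<Longrightarrow> u \<in> ob q \<rho> \<Longrightarrow> cts_at q (F1 i) u"
    using F by (auto simp: C1b_def)
  note [measurable] = Fm
  have F1m [measurable]: "F1 i \<in> borel_measurable borel" if "i < q" for i
    using F that by (auto simp: C1b_def)
  obtain M where M: "\<And>u. u \<in> ob q \<rho> \<Longrightarrow> \<bar>F u\<bar> \<le> M" using F by (auto simp: C1b_def)
  \<comment> \<open>The measure \<open>U01\<close> is a measure on all reals; clamping
    \<open>s\<close> keeps the scaled point in the ball for every real \<open>s\<close>, so that the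
    integrand is bounded everywhere.\<close>
  define c where "c s = max 0 (min 1 s)" for s :: real
  have c: "0 \<le> c s" "c s \<le> 1" "\<bar>c s\<bar> \<le> 1" "s \<in> {0..1} \<Longrightarrow> c s = s" for s
    by (auto simp: c_def)
  have [measurable]: "c \<in> borel_measurable borel" unfolding c_def[abs_def] by measurable
  define h where "h s u = bump q r u * ip q (\<lambda>j. F1 j (\<lambda>k. c s * u k)) u" for s u
  have h_bd: "\<bar>h s u\<bar> \<le> B * \<rho>" for s u
  proof (cases "bump q r u = 0")
    case False
    note u = bump_support(2)[OF r False]
    have "\<bar>ip q (\<lambda>j. F1 j (\<lambda>k. c s * u k)) u\<bar> \<le> nm q (\<lambda>j. F1 j (\<lambda>k. c s * u k)) * nm q u"
      by (rule abs_ip_le)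
    also have "\<dots> \<le> B * \<rho>"
      using u B0 by (intro mult_mono B ob_scale c) (auto simp: ob_def L2_set_nonneg)
    finally show ?thesis
      using bump_bounds[of q r u] mult_mono[of "bump q r u" 1 "\<bar>ip q (\<lambda>j. F1 j (\<lambda>k. c s * u k)) u\<bar>" "B * \<rho>"]
      by (simp add: h_def abs_mult)
  qed (use B0 \<rho> in \<open>simp add: h_def\<close>)
  have h_meas: "(\<lambda>(s, u). h s u) \<in> borel_measurable (borel \<Otimes>\<^sub>M borel)"
    unfolding h_def ip_def by measurable
  interpret P: pair_prob_space U01 G ..
  have h_int: "integrable (U01 \<Otimes>\<^sub>M G) (\<lambda>(s, u). h s u)"
    by (rule P.integrable_const_bound[where B = "B * \<rho>"]) (use h_bd h_meas in auto)
  have path: "bump q r u * F u - F (\<lambda>_. 0) * bump q r u = (\<integral>s. h s u \<partial>U01)" for u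
  proof (cases "bump q r u = 0")
    case False
    note u = bump_support(2)[OF r False]
    have "(\<integral>s. h s u \<partial>U01) = bump q r u * F (\<lambda>i. 1 * u i) - bump q r u * F (\<lambda>i. 0 * u i)"
    proof (rule integral_U01_deriv)
      show "(\<lambda>s. h s u) \<in> borel_measurable borel"
        unfolding h_def ip_def by measurable
      show "\<bar>h s u\<bar> \<le> B * \<rho>" for s by (rule h_bd)
      show "((\<lambda>s. bump q r u * F (\<lambda>i. s * u i)) has_real_derivative h s u) (at s)" if "s \<in> {0..1}" for s
        unfolding h_def c(4)[OF that]
        by (intro DERIV_cmult segment_deriv[OF cyl part cts u]) (use that in auto)
    qed
    then show ?thesis by (simp add: algebra_simps)
  qed (simp add: h_def)
  have bumpint: "integrable G (bump q r)" by (intro integrable_G_bddf bddf_bump) measurable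
  have bumpF: "integrable G (\<lambda>u. bump q r u * F u)"
  proof (rule G.integrable_const_bound[where B = "\<bar>M\<bar>"])
    have "norm (bump q r u * F u) \<le> \<bar>M\<bar>" for u
    proof (cases "bump q r u = 0")
      case False
      have "\<bar>F u\<bar> \<le> \<bar>M\<bar>" using M[OF bump_support(2)[OF r False]] by linarith
      then show ?thesis
        using bump_bounds[of q r u] mult_mono[of "bump q r u" 1 "\<bar>F u\<bar>" "\<bar>M\<bar>"]
        by (simp add: abs_mult)
    qed simp
    then show "AE u in G. norm (bump q r u * F u) \<le> \<bar>M\<bar>" by simp
  qed measurable
  have "(\<integral>u. bump q r u * F u \<partial>G) - F (\<lambda>_. 0) * (\<integral>u. bump q r u \<partial>G)
      = (\<integral>u. bump q r u * F u - F (\<lambda>_. 0) * bump q r u \<partial>G)"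
    using bumpint bumpF by simp
  also have "\<dots> = (\<integral>u. \<integral>s. h s u \<partial>U01 \<partial>G)" by (simp add: path)
  also have "\<dots> = (\<integral>s. \<integral>u. h s u \<partial>G \<partial>U01)"
    by (rule P.Fubini_integral[OF h_int])
  also have "\<bar>\<dots>\<bar> \<le> A + 16 / (r * \<kappa>) * B * \<tau>"
  proof (rule abs_integral_U01_le)
    show "(\<lambda>s. \<integral>u. h s u \<partial>G) \<in> borel_measurable borel"
      using h_meas by measurable
    fix s :: real assume s: "s \<in> {0..1}"
    define E where "E u = (\<Sum>i<q. Qinv (\<lambda>j. F1 j (\<lambda>k. s * u k)) i * bump' q r i u)" for u
    have "(\<integral>u. h s u \<partial>G) = (\<integral>u. E u \<partial>G) + s * (\<integral>u. bump q r u * trQ F2 (\<lambda>k. s * u k) \<partial>G)"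
      unfolding h_def c(4)[OF s] E_def using s by (intro gauss_ibp[OF F1 r]) auto
    moreover have "\<bar>s * (\<integral>u. bump q r u * trQ F2 (\<lambda>k. s * u k) \<partial>G)\<bar> \<le> 1 * A"
      unfolding abs_mult using s A[of s] by (intro mult_mono) auto
    moreover have "\<bar>\<integral>u. E u \<partial>G\<bar> \<le> 16 / (r * \<kappa>) * B * \<tau>"
    proof -
      have E_bd: "\<bar>E u\<bar> \<le> 16 / (r * \<kappa>) * B * indicator {u. r \<le> nm q u} u" for u
      proof (cases "nm q u < r \<or> sqrt 2 * r \<le> nm q u")
        case True
        then have "bump' q r i u = 0" for i
          by (intro bump'_eq_0[OF r(1)]) auto
        then have "E u = 0" by (simp add: E_def)
        then show ?thesis using B0 r kappa_pos by simp
      next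
        case False
        then have "nm q u < \<rho>" using sqrt2_lt_2[OF r(1)] r(2) by linarith
        then have u: "u \<in> ob q \<rho>" by (simp add: ob_def)
        have "\<bar>E u\<bar> \<le> 16 / r * nm q (Qinv (\<lambda>j. F1 j (\<lambda>k. s * u k)))"
          unfolding E_def by (rule bump'_bound[OF r(1)])
        also have "\<dots> \<le> 16 / r * (nm q (\<lambda>j. F1 j (\<lambda>k. s * u k)) / \<kappa>)"
          using r by (intro mult_left_mono nm_Qinv_le) auto
        also have "\<dots> \<le> 16 / r * (B / \<kappa>)"
          using r kappa_pos s by (intro mult_left_mono divide_right_mono B ob_scale u) auto
        finally show ?thesis using False by simp
      qed
      have Em: "E \<in> borel_measurable borel"
      proof -
        have "E = (\<lambda>u. \<Sum>i<q. (\<Sum>j<q. Qi i j * F1 j (\<lambda>k. s * u k)) * bump' q r i u)"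
          by (auto simp: E_def Qinv_def)
        then show ?thesis by simp
      qed
      have ind: "integrable G (\<lambda>u. 16 / (r * \<kappa>) * B * indicator {u. r \<le> nm q u} u)"
        by (intro integrable_mult_right) (auto simp: G.emeasure_eq_measure)
      have Eint: "integrable G E"
        by (rule Bochner_Integration.integrable_bound[OF ind])
           (use Em E_bd B0 r kappa_pos in \<open>auto simp: abs_mult\<close>)
      have "\<bar>\<integral>u. E u \<partial>G\<bar> \<le> (\<integral>u. \<bar>E u\<bar> \<partial>G)"
        using integral_norm_bound[of G E] by simp
      also have "\<dots> \<le> (\<integral>u. 16 / (r * \<kappa>) * B * indicator {u. r \<le> nm q u} u \<partial>G)"
        using E_bd by (intro integral_mono Eint ind) (use Eint in auto)
      also have "\<dots> = 16 / (r * \<kappa>) * B * measure G {u. r \<le> nm q u}"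
        by simp
      also have "\<dots> \<le> 16 / (r * \<kappa>) * B * \<tau>"
        using \<tau> B0 r kappa_pos by (intro mult_left_mono) auto
      finally show ?thesis .
    qed
    ultimately show "\<bar>\<integral>u. h s u \<partial>G\<bar> \<le> A + 16 / (r * \<kappa>) * B * \<tau>" by linarith
  qed
  finally show ?thesis .
qed

text \<open>Decoupling by rotation: the path from \<open>u\<close> to \<open>v\<close> through the rotated points
  \<open>cos \<theta> u + sin \<theta> v\<close> has a velocity which is an independent copy of its position.\<close>

lemma rotation_decoupling:
  assumes F: "C1b q \<rho> F F1" and r: "0 < r" "2 * r < \<rho>"
  shows "(\<integral>\<^sup>+u. \<integral>\<^sup>+v. ennreal (bump q r u * bump q r v * exp (F v - F u)) \<partial>G \<partial>G)
    \<le> (\<integral>\<^sup>+u. \<integral>\<^sup>+v. ennreal (indicator {u. nm q u \<le> 2 * r} u * indicator {u. nm q u \<le> 2 * r} v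
          * exp (pi / 2 * ip q (\<lambda>i. F1 i u) v)) \<partial>G \<partial>G)"
proof -
  have cyl: "cyl q F" and part: "partial_on q (ob q \<rho>) F F1"
    and cts: "\<And>i u. i < q \<Longrightarrow> u \<in> ob q \<rho> \<Longrightarrow> cts_at q (F1 i) u"
    using F by (auto simp: C1b_def)
  have F1m [measurable]: "F1 i \<in> borel_measurable borel" if "i < q" for i
    using F that by (auto simp: C1b_def)
  obtain M where M: "\<And>i u. u \<in> ob q \<rho> \<Longrightarrow> i < q \<Longrightarrow> \<bar>F1 i u\<bar> \<le> M"
    using F unfolding C1b_def by blast
  define B where "B = {u. nm q u \<le> 2 * r}"
  have B_meas [measurable]: "B \<in> sets borel" unfolding B_def by measurable
  define K where "K u v = indicator B u * indicator B v * exp (pi / 2 * ip q (\<lambda>i. F1 i u) v)" for u v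
  have K_meas: "(\<lambda>(u, v). ennreal (K u v)) \<in> borel_measurable (borel \<Otimes>\<^sub>M borel)"
    unfolding K_def ip_def by measurable
  define xs where "xs s u v = (\<lambda>j::nat. cos (pi / 2 * s) * u j + sin (pi / 2 * s) * v j)" for s and u v :: "nat \<Rightarrow> real"
  define ys where "ys s u v = (\<lambda>j::nat. - sin (pi / 2 * s) * u j + cos (pi / 2 * s) * v j)" for s and u v :: "nat \<Rightarrow> real"
  have xys_meas: "(\<lambda>(s, u, v). (xs s u v, ys s u v)) \<in> borel \<Otimes>\<^sub>M (borel \<Otimes>\<^sub>M borel) \<rightarrow>\<^sub>M borel \<Otimes>\<^sub>M borel"
    unfolding xs_def ys_def split_beta' by (intro measurable_Pair borel_measurable_lin) measurable
  have key: "ennreal (bump q r u * bump q r v * exp (F v - F u)) \<le> (\<integral>\<^sup>+s. ennreal (K (xs s u v) (ys s u v)) \<partial>U01)" for u v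
  proof (cases "bump q r u = 0 \<or> bump q r v = 0")
    case False
    then have u: "nm q u \<le> sqrt 2 * r" and v: "nm q v \<le> sqrt 2 * r"
      using bump_support(1)[of r \<rho>] r by (auto intro: less_imp_le)
    \<comment> \<open>The coefficients satisfy |a| + |b| \<le> sqrt 2, and the support of the cutoff
      contributes another sqrt 2: this is the doubling of the radius.\<close>
    have in_B: "nm q (\<lambda>j. a * u j + b * v j) \<le> 2 * r" if ab: "a\<^sup>2 + b\<^sup>2 = 1" for a b
    proof -
      have "nm q (\<lambda>j. a * u j + b * v j) \<le> \<bar>a\<bar> * nm q u + \<bar>b\<bar> * nm q v"
        using nm_triangle[where q = q and u = "\<lambda>j. a * u j" and v = "\<lambda>j. b * v j"] by (simp add: nm_scale)
      also have "\<dots> \<le> \<bar>a\<bar> * (sqrt 2 * r) + \<bar>b\<bar> * (sqrt 2 * r)"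
        using u v by (intro add_mono mult_left_mono) auto
      also have "\<dots> = (\<bar>a\<bar> + \<bar>b\<bar>) * (sqrt 2 * r)" by (simp add: algebra_simps)
      also have "\<dots> \<le> sqrt 2 * (sqrt 2 * r)"
      proof (intro mult_right_mono)
        have "(\<bar>a\<bar> + \<bar>b\<bar>)\<^sup>2 \<le> 2 * (a\<^sup>2 + b\<^sup>2)"
          using zero_le_power2[of "\<bar>a\<bar> - \<bar>b\<bar>"] by (simp add: power2_eq_square algebra_simps)
        then show "\<bar>a\<bar> + \<bar>b\<bar> \<le> sqrt 2" using ab by (intro real_le_rsqrt) simp
      qed (use r in simp)
      also have "\<dots> = 2 * r" by simp
      finally show ?thesis .
    qed
    have xB: "xs s u v \<in> B" and yB: "ys s u v \<in> B" for s
      using in_B[of "cos (pi / 2 * s)" "sin (pi / 2 * s)"] in_B[of "- sin (pi / 2 * s)" "cos (pi / 2 * s)"]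
      unfolding B_def xs_def ys_def by simp_all
    have xS: "xs s u v \<in> ob q \<rho>" for s using xB[of s] r by (simp add: B_def ob_def)
    define g where "g s = pi / 2 * ip q (\<lambda>i. F1 i (xs s u v)) (ys s u v)" for s
    have [measurable]: "g \<in> borel_measurable borel"
    proof -
      have "(\<lambda>s. xs s u v) \<in> borel_measurable borel" "(\<lambda>s. ys s u v) \<in> borel_measurable borel"
        unfolding xs_def ys_def by (intro borel_measurable_lin; measurable)+
      note [measurable] = this
      show ?thesis unfolding g_def[abs_def] ip_def by measurable
    qed
    have g_bd: "\<bar>g s\<bar> \<le> pi / 2 * (\<Sum>i<q. \<bar>M\<bar> * (2 * r))" for s
    proof -
      have "\<bar>ip q (\<lambda>i. F1 i (xs s u v)) (ys s u v)\<bar> \<le> (\<Sum>i<q. \<bar>M\<bar> * (2 * r))"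
        unfolding ip_def
      proof (rule order_trans[OF sum_abs sum_mono])
        fix i assume i: "i \<in> {..<q}"
        have "\<bar>F1 i (xs s u v)\<bar> \<le> \<bar>M\<bar>" using M[OF xS, of i s] i by auto
        moreover have "\<bar>ys s u v i\<bar> \<le> 2 * r"
          using abs_coord_le_nm[of i q "ys s u v"] yB[of s] i by (auto simp: B_def)
        ultimately show "\<bar>F1 i (xs s u v) * ys s u v i\<bar> \<le> \<bar>M\<bar> * (2 * r)"
          unfolding abs_mult by (intro mult_mono) auto
      qed
      then show ?thesis by (simp add: g_def abs_mult)
    qed
    \<comment> \<open>A quarter turn is run through in unit time, hence the factor
      \<open>pi / 2\<close> in front of the velocity \<open>ys\<close>.\<close>
    have d: "((\<lambda>s. F (xs s u v)) has_real_derivative g s) (at s)" for s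
    proof -
      have "((\<lambda>s. F (xs s u v)) has_real_derivative (\<Sum>i<q. F1 i (xs s u v) * (pi / 2 * ys s u v i))) (at s)"
        by (rule chain_rule[OF cyl part cts[OF _ xS] xS])
           (auto intro!: derivative_eq_intros simp: xs_def ys_def algebra_simps)
      then show ?thesis by (simp add: g_def ip_def sum_distrib_left mult_ac)
    qed
    have gi: "(\<integral>s. g s \<partial>U01) = F (xs 1 u v) - F (xs 0 u v)" "integrable U01 g"
      by (rule integral_U01_deriv[OF _ d g_bd]; measurable)+
    have eg: "integrable U01 (\<lambda>s. exp (g s))"
    proof (rule U01.integrable_const_bound)
      show "AE s in U01. norm (exp (g s)) \<le> exp (pi / 2 * (\<Sum>i<q. \<bar>M\<bar> * (2 * r)))"
        using g_bd by (simp add: abs_le_iff)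
    qed measurable
    have "exp (F v - F u) = exp (\<integral>s. g s \<partial>U01)"
      by (simp add: gi xs_def)
    also have "\<dots> \<le> (\<integral>s. exp (g s) \<partial>U01)"
      using exp_Jensen[of U01 "\<lambda>_. 1" "\<lambda>s. - g s"] gi(2) eg by (simp add: U01.prob_space[simplified])
    finally have "bump q r u * bump q r v * exp (F v - F u) \<le> 1 * 1 * (\<integral>s. exp (g s) \<partial>U01)"
      using bump_bounds[of q r u] bump_bounds[of q r v] by (intro mult_mono) auto
    then have "ennreal (bump q r u * bump q r v * exp (F v - F u)) \<le> ennreal (\<integral>s. exp (g s) \<partial>U01)"
      by (intro ennreal_leI) simp
    also have "\<dots> = (\<integral>\<^sup>+s. ennreal (exp (g s)) \<partial>U01)"
      using nn_integral_eq_integral[OF eg] by simp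
    also have "\<dots> = (\<integral>\<^sup>+s. ennreal (K (xs s u v) (ys s u v)) \<partial>U01)"
      using xB yB by (simp add: K_def g_def)
    finally show ?thesis .
  qed auto
  interpret GG: pair_prob_space G G ..
  interpret P: pair_prob_space U01 "G \<Otimes>\<^sub>M G"
    by (intro_locales) (auto intro: GG.P.prob_space_axioms prob_space.axioms prob_space_imp_sigma_finite)
  have KK: "(\<lambda>(s, z). ennreal (K (xs s (fst z) (snd z)) (ys s (fst z) (snd z))))
      \<in> borel_measurable (borel \<Otimes>\<^sub>M (borel \<Otimes>\<^sub>M borel))"
    using measurable_compose[OF xys_meas K_meas] by (simp add: split_beta')
  have "(\<integral>\<^sup>+u. \<integral>\<^sup>+v. ennreal (bump q r u * bump q r v * exp (F v - F u)) \<partial>G \<partial>G)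
      \<le> (\<integral>\<^sup>+u. \<integral>\<^sup>+v. \<integral>\<^sup>+s. ennreal (K (xs s u v) (ys s u v)) \<partial>U01 \<partial>G \<partial>G)"
    by (intro nn_integral_mono key)
  also have "\<dots> = (\<integral>\<^sup>+z. \<integral>\<^sup>+s. ennreal (K (xs s (fst z) (snd z)) (ys s (fst z) (snd z))) \<partial>U01 \<partial>(G \<Otimes>\<^sub>M G))"
  proof -
    have "(\<lambda>z. \<integral>\<^sup>+s. ennreal (K (xs s (fst z) (snd z)) (ys s (fst z) (snd z))) \<partial>U01)
        \<in> borel_measurable (G \<Otimes>\<^sub>M G)"
      using KK by measurable
    from G.nn_integral_fst[OF this] show ?thesis by simp
  qed
  also have "\<dots> = (\<integral>\<^sup>+s. \<integral>\<^sup>+z. ennreal (K (xs s (fst z) (snd z)) (ys s (fst z) (snd z))) \<partial>(G \<Otimes>\<^sub>M G) \<partial>U01)"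
    by (rule P.Fubini') (use KK in measurable)
  also have "\<dots> = (\<integral>\<^sup>+s. \<integral>\<^sup>+u. \<integral>\<^sup>+v. ennreal (K u v) \<partial>G \<partial>G \<partial>U01)"
  proof (rule nn_integral_cong_AE)
    have "(\<integral>\<^sup>+z. ennreal (K (xs s (fst z) (snd z)) (ys s (fst z) (snd z))) \<partial>(G \<Otimes>\<^sub>M G))
        = (\<integral>\<^sup>+u. \<integral>\<^sup>+v. ennreal (K u v) \<partial>G \<partial>G)" if s: "s \<in> {0..1}" for s
    proof -
      \<comment> \<open>The rotation lemma excludes the half turn. For \<open>s\<close> between 0
        and 1 the cosine is nonnegative, so a vanishing sine forces the cosine to be one.\<close>
      have sc: "sin (pi / 2 * s) = 0 \<Longrightarrow> cos (pi / 2 * s) = 1"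
      proof -
        assume 0: "sin (pi / 2 * s) = 0"
        have "pi / 2 * s \<le> pi / 2 * 1" using s by (intro mult_left_mono) auto
        then have "cos (pi / 2 * s) \<ge> 0" using s by (intro cos_ge_zero) (auto intro: order_trans[of _ 0])
        with 0 show "cos (pi / 2 * s) = 1"
          using sin_cos_squared_add[of "pi / 2 * s"] by (simp add: power2_eq_1_iff)
      qed
      have "(\<integral>\<^sup>+z. ennreal (K (xs s (fst z) (snd z)) (ys s (fst z) (snd z))) \<partial>(G \<Otimes>\<^sub>M G))
          = (\<integral>\<^sup>+u. \<integral>\<^sup>+v. ennreal (K (xs s u v) (ys s u v)) \<partial>G \<partial>G)"
      proof -
        have "(\<lambda>z. ennreal (K (xs s (fst z) (snd z)) (ys s (fst z) (snd z)))) \<in> borel_measurable (G \<Otimes>\<^sub>M G)"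
          using KK by measurable
        from G.nn_integral_fst[OF this] show ?thesis by simp
      qed
      also have "\<dots> = (\<integral>\<^sup>+u. \<integral>\<^sup>+v. ennreal (K u v) \<partial>G \<partial>G)"
        unfolding xs_def ys_def
        by (rule G_rotation[where f = "\<lambda>u v. ennreal (K u v)"]) (use K_meas sc in auto)
      finally show ?thesis .
    qed
    with AE_U01 show "AE s in U01. (\<integral>\<^sup>+z. ennreal (K (xs s (fst z) (snd z)) (ys s (fst z) (snd z))) \<partial>(G \<Otimes>\<^sub>M G))
        = (\<integral>\<^sup>+u. \<integral>\<^sup>+v. ennreal (K u v) \<partial>G \<partial>G)"
      by auto
  qed
  also have "\<dots> = (\<integral>\<^sup>+u. \<integral>\<^sup>+v. ennreal (K u v) \<partial>G \<partial>G)"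
    by (simp add: U01.emeasure_space_1[simplified])
  finally show ?thesis by (simp add: K_def B_def)
qed

text \<open>Jensen's inequality for \<open>exp (- F)\<close> turns the decoupled inequality for \<open>F v - F u\<close> into
  a bound for \<open>exp F\<close> at the price of the mean of \<open>F\<close>.\<close>

lemma exp_decoupling:
  assumes F: "C1b q \<rho> F F1" and r: "0 < r" "2 * r < \<rho>"
    and a: "a = (\<integral>u. bump q r u \<partial>G)" "0 < a" and m: "m = (\<integral>u. bump q r u * F u \<partial>G)"
  shows "(\<integral>\<^sup>+u. ennreal (bump q r u * exp (F u)) \<partial>G)
    \<le> ennreal (1 / (2 * a)) * (ennreal (exp (2 * m / a))
      + (\<integral>\<^sup>+u. \<integral>\<^sup>+v. ennreal (indicator {u. nm q u \<le> 2 * r} u * indicator {u. nm q u \<le> 2 * r} v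
          * exp (pi * ip q (\<lambda>i. F1 i u) v)) \<partial>G \<partial>G))" (is "_ \<le> _ * (_ + ?J)")
proof -
  have [measurable]: "F \<in> borel_measurable borel" using F by (simp add: C1b_def)
  obtain M where M: "\<And>u. u \<in> ob q \<rho> \<Longrightarrow> \<bar>F u\<bar> \<le> M" using F unfolding C1b_def by blast
  have bd: "bddf (\<lambda>u. bump q r u * \<phi> (F u))" if "\<And>x. \<bar>x\<bar> \<le> M \<Longrightarrow> \<bar>\<phi> x\<bar> \<le> C" for \<phi> C
  proof (rule bddfI[of _ "\<bar>C\<bar>"])
    fix u show "\<bar>bump q r u * \<phi> (F u)\<bar> \<le> \<bar>C\<bar>"
    proof (cases "bump q r u = 0")
      case False
      have "u \<in> ob q \<rho>" by (rule bump_support(2)[OF _ _ False]) (use r in auto)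
      then have "\<bar>\<phi> (F u)\<bar> \<le> \<bar>C\<bar>" using that[OF M] by fastforce
      then show ?thesis
        using bump_bounds[of q r u] mult_mono[of "bump q r u" 1 "\<bar>\<phi> (F u)\<bar>" "\<bar>C\<bar>"]
        by (simp add: abs_mult)
    qed simp
  qed
  have int: "integrable G (bump q r)" "integrable G (\<lambda>u. bump q r u * F u)"
    "integrable G (\<lambda>u. bump q r u * exp (- F u))" "integrable G (\<lambda>u. bump q r u * exp (F u))"
    by (intro integrable_G_bddf bddf_bump bd[of "\<lambda>x. x" M] bd[of "\<lambda>x. exp (- x)" "exp M"] bd[of exp "exp M"];
        simp; fail)+
  define Ip Im where "Ip = (\<integral>u. bump q r u * exp (F u) \<partial>G)" and "Im = (\<integral>u. bump q r u * exp (- F u) \<partial>G)"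
  have Ip: "0 \<le> Ip" unfolding Ip_def using bump_bounds by (intro integral_nonneg_AE) auto
  have Im: "a * exp (- m / a) \<le> Im"
    unfolding Im_def m a(1) by (rule exp_Jensen) (use int bump_bounds a in auto)
  have eIp: "(\<integral>\<^sup>+u. ennreal (bump q r u * exp (F u)) \<partial>G) = ennreal Ip"
    unfolding Ip_def by (rule nn_integral_eq_integral) (use int bump_bounds in auto)
  have eIm: "(\<integral>\<^sup>+u. ennreal (bump q r u * exp (- F u)) \<partial>G) = ennreal Im"
    unfolding Im_def by (rule nn_integral_eq_integral) (use int bump_bounds in auto)
  have Im0: "0 \<le> Im" unfolding Im_def using bump_bounds by (intro integral_nonneg_AE) auto
  \<comment> \<open>The double integral \<open>D 1\<close> is the product of the integrals of
    \<open>exp F\<close> and \<open>exp (- F)\<close>. The second factor is bounded below by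
    Jensen's inequality, which is how a bound for the first is extracted.\<close>
  define D where "D c = (\<integral>\<^sup>+u. \<integral>\<^sup>+v. ennreal (bump q r u * bump q r v * exp (c * (F v - F u))) \<partial>G \<partial>G)" for c
  have D1: "ennreal Ip * ennreal Im = D 1"
  proof -
    have "D 1 = (\<integral>\<^sup>+u. ennreal (bump q r u * exp (- F u)) * ennreal Ip \<partial>G)"
      unfolding D_def
    proof (rule nn_integral_cong)
      fix u
      have "bump q r u * bump q r v * exp (1 * (F v - F u)) = (bump q r u * exp (- F u)) * (bump q r v * exp (F v))" for v
        by (simp add: exp_diff exp_minus field_simps)
      then have "(\<integral>\<^sup>+v. ennreal (bump q r u * bump q r v * exp (1 * (F v - F u))) \<partial>G)
          = (\<integral>\<^sup>+v. ennreal (bump q r u * exp (- F u)) * ennreal (bump q r v * exp (F v)) \<partial>G)"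
        using bump_bounds by (intro nn_integral_cong) (simp add: ennreal_mult[symmetric])
      also have "\<dots> = ennreal (bump q r u * exp (- F u)) * ennreal Ip"
        unfolding eIp[symmetric] by (rule nn_integral_cmult) measurable
      finally show "(\<integral>\<^sup>+v. ennreal (bump q r u * bump q r v * exp (1 * (F v - F u))) \<partial>G)
          = ennreal (bump q r u * exp (- F u)) * ennreal Ip" .
    qed
    also have "\<dots> = ennreal Im * ennreal Ip"
      unfolding eIm[symmetric] by (rule nn_integral_multc) measurable
    finally show ?thesis by (simp add: mult.commute)
  qed
  have D2: "D 2 \<le> ?J"
  proof -
    \<comment> \<open>The decoupling inequality is applied to \<open>2 * F\<close>, which turns
      \<open>pi / 2\<close> into \<open>pi\<close>.\<close>
    have "(\<integral>\<^sup>+u. \<integral>\<^sup>+v. ennreal (bump q r u * bump q r v * exp (2 * F v - 2 * F u)) \<partial>G \<partial>G)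
      \<le> (\<integral>\<^sup>+u. \<integral>\<^sup>+v. ennreal (indicator {u. nm q u \<le> 2 * r} u * indicator {u. nm q u \<le> 2 * r} v
          * exp (pi / 2 * ip q (\<lambda>i. 2 * F1 i u) v)) \<partial>G \<partial>G)"
      by (rule rotation_decoupling[OF C1b_cmult[OF F, of 2] r])
    moreover have "pi / 2 * ip q (\<lambda>i. 2 * F1 i u) v = pi * ip q (\<lambda>i. F1 i u) v" for u v
      by (simp add: ip_def sum_distrib_left mult_ac)
    ultimately show ?thesis by (simp add: D_def algebra_simps)
  qed
  have "ennreal (exp (m / a)) * D 1
      = (\<integral>\<^sup>+u. \<integral>\<^sup>+v. ennreal (exp (m / a)) * ennreal (bump q r u * bump q r v * exp (1 * (F v - F u))) \<partial>G \<partial>G)"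
    unfolding D_def by (simp add: nn_integral_cmult)
  also have "\<dots> \<le> (\<integral>\<^sup>+u. \<integral>\<^sup>+v. ennreal (exp (2 * m / a) / 2)
      + ennreal (1 / 2) * ennreal (bump q r u * bump q r v * exp (2 * (F v - F u))) \<partial>G \<partial>G)"
  proof (intro nn_integral_mono)
    fix u v
    define b x where "b = bump q r u * bump q r v" and "x = F v - F u"
    have b: "0 \<le> b" "b \<le> 1"
      using bump_bounds[of q r u] bump_bounds[of q r v] by (auto simp: b_def mult_le_one)
    \<comment> \<open>The arithmetic-geometric mean inequality separates the mean from the decoupled
      integral. When \<open>F\<close> itself depends on further Gaussian vectors, the two parts have
      to be integrated over these vectors one by one.\<close>
    have "exp (m / a) * exp x \<le> exp (2 * m / a) / 2 + exp (2 * x) / 2"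
      using zero_le_power2[of "exp (m / a) - exp x"]
      by (simp add: power2_diff exp_double[symmetric])
    then have "b * (exp (m / a) * exp x) \<le> b * (exp (2 * m / a) / 2 + exp (2 * x) / 2)"
      using b by (intro mult_left_mono)
    also have "\<dots> \<le> exp (2 * m / a) / 2 + 1 / 2 * (b * exp (2 * x))"
      using b mult_right_mono[of b 1 "exp (2 * m / a) / 2"] by (simp add: algebra_simps)
    finally have "ennreal (exp (m / a) * (b * exp x)) \<le> ennreal (exp (2 * m / a) / 2 + 1 / 2 * (b * exp (2 * x)))"
      by (intro ennreal_leI) (simp add: mult_ac)
    then show "ennreal (exp (m / a)) * ennreal (bump q r u * bump q r v * exp (1 * (F v - F u)))
      \<le> ennreal (exp (2 * m / a) / 2) + ennreal (1 / 2) * ennreal (bump q r u * bump q r v * exp (2 * (F v - F u)))"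
      using b by (simp add: b_def x_def ennreal_mult[symmetric] ennreal_plus[symmetric] del: ennreal_plus ennreal_half)
  qed
  also have "\<dots> = ennreal (exp (2 * m / a) / 2) + ennreal (1 / 2) * D 2"
    unfolding D_def by (simp add: nn_integral_add nn_integral_cmult G.emeasure_space_1[simplified])
  also have "\<dots> \<le> ennreal (exp (2 * m / a) / 2) + ennreal (1 / 2) * ?J"
    using D2 by (intro add_left_mono mult_left_mono) auto
  also have "\<dots> = ennreal (1 / 2) * (ennreal (exp (2 * m / a)) + ?J)"
    unfolding distrib_left by (subst ennreal_mult[symmetric]) auto
  finally have main: "ennreal (exp (m / a)) * D 1 \<le> ennreal (1 / 2) * (ennreal (exp (2 * m / a)) + ?J)" .
  have "Ip \<le> 1 / a * (exp (m / a) * (Ip * Im))"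
  proof -
    have "1 \<le> exp (m / a) * Im / a"
      using Im a(2) by (simp add: field_simps exp_minus)
    then show ?thesis using Ip mult_left_mono[of 1 "exp (m / a) * Im / a" Ip] by (simp add: mult_ac)
  qed
  then have "ennreal Ip \<le> ennreal (1 / a) * (ennreal (exp (m / a)) * D 1)"
    unfolding D1[symmetric] using a(2) Ip Im0 by (simp add: ennreal_mult[symmetric] ennreal_leI)
  also have "\<dots> \<le> ennreal (1 / a) * (ennreal (1 / 2) * (ennreal (exp (2 * m / a)) + ?J))"
    using main by (intro mult_left_mono) auto
  also have "\<dots> = ennreal (1 / (2 * a)) * (ennreal (exp (2 * m / a)) + ?J)"
    unfolding mult.assoc[symmetric] using a(2) by (subst ennreal_mult[symmetric]) (auto simp: mult_ac)
  finally show ?thesis by (simp add: eIp)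
qed

end

section \<open>Exponential moments of bilinear and trilinear forms\<close>

lemma row_norm_le:
  assumes "\<And>x y. \<bar>bil q A x y\<bar> \<le> L * nm q x * nm q y" "0 \<le> L" "b < q"
  shows "nm q (A b) \<le> L"
proof (rule nm_le_if_dual)
  fix y
  define x where "x i = (if i = b then 1 else 0 :: real)" for i
  have "bil q A x y = (\<Sum>i<q. x i * ip q (A i) y)"
    by (simp add: bil_def ip_def sum_distrib_left mult_ac)
  then have "ip q (A b) y = bil q A x y"
    using assms(3) by (simp add: x_def mult_delta_left)
  moreover have "nm q x = 1"
  proof -
    have "(x i)\<^sup>2 = (if i = b then 1 else 0)" for i by (simp add: x_def)
    then show ?thesis using assms(3) by (simp add: L2_set_def)
  qed
  ultimately show "\<bar>ip q (A b) y\<bar> \<le> L * nm q y"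
    using assms(1)[of x y] by simp
qed (use assms in simp)

context pd_form
begin

text \<open>Integrating over \<open>v\<close> by the moment generating function leaves the
  exponential of a quadratic form in \<open>u\<close>. The condition on the operator norm of
  \<open>M\<close> keeps this form below the Gaussian weight, while the result involves only the
  Frobenius norm.\<close>

lemma exp_bilinear_le:
  assumes small: "\<And>x. (\<Sum>j<q. (ip q (\<lambda>i. M i j) x)\<^sup>2) \<le> \<kappa>\<^sup>2 / 2 * ip q x x"
  shows "(\<integral>\<^sup>+u. \<integral>\<^sup>+v. ennreal (exp (bil q M u v)) \<partial>G \<partial>G) \<le> ennreal (exp ((\<Sum>i<q. \<Sum>j<q. (M i j)\<^sup>2) / \<kappa>\<^sup>2))"
proof -
  define s where "s j = (\<lambda>i. M i j / sqrt \<kappa>)" for j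
  have s: "(ip q (s j) u)\<^sup>2 = (ip q (\<lambda>i. M i j) u)\<^sup>2 / \<kappa>" for j u
  proof -
    have "ip q (s j) u = ip q (\<lambda>i. M i j) u / sqrt \<kappa>"
      by (simp add: ip_def s_def sum_divide_distrib)
    then show ?thesis using kappa_pos by (simp add: power_divide)
  qed
  have "(\<integral>\<^sup>+u. \<integral>\<^sup>+v. ennreal (exp (bil q M u v)) \<partial>G \<partial>G)
      \<le> (\<integral>\<^sup>+u. ennreal (exp ((\<Sum>j<q. (ip q (s j) u)\<^sup>2) / 2)) \<partial>G)"
  proof (rule nn_integral_mono)
    fix u
    define z where "z j = ip q (\<lambda>i. M i j) u" for j
    have h1: "bil q M u v = ip q z v" for v
      unfolding bil_def ip_def z_def by (subst sum.swap) (simp add: sum_distrib_left sum_distrib_right mult_ac)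
    have h2: "(nm q z)\<^sup>2 / (2 * \<kappa>) = (\<Sum>j<q. (ip q (s j) u)\<^sup>2) / 2"
      unfolding s nm_sq by (simp add: ip_def[of q z] z_def power2_eq_square sum_divide_distrib mult_ac)
    show "(\<integral>\<^sup>+v. ennreal (exp (bil q M u v)) \<partial>G) \<le> ennreal (exp ((\<Sum>j<q. (ip q (s j) u)\<^sup>2) / 2))"
      unfolding h1 h2[symmetric] by (rule mgf_le)
  qed
  also have "\<dots> \<le> ennreal (exp ((\<Sum>j<q. (nm q (s j))\<^sup>2) / \<kappa>))"
  proof (rule exp_quadratic_le)
    fix x
    have "(\<Sum>j<q. (ip q (s j) x)\<^sup>2) \<le> (\<kappa>\<^sup>2 / 2 * ip q x x) / \<kappa>"
      unfolding s sum_divide_distrib[symmetric] using kappa_pos by (intro divide_right_mono small) auto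
    then show "(\<Sum>j<q. (ip q (s j) x)\<^sup>2) \<le> \<kappa> / 2 * ip q x x"
      using kappa_pos by (simp add: power2_eq_square)
  qed simp
  also have "(\<Sum>j<q. (nm q (s j))\<^sup>2) / \<kappa> = (\<Sum>i<q. \<Sum>j<q. (M i j)\<^sup>2) / \<kappa>\<^sup>2"
  proof -
    have "(nm q (s j))\<^sup>2 = (\<Sum>i<q. (M i j)\<^sup>2) / \<kappa>" for j
      unfolding nm_sq using kappa_pos
      by (simp add: ip_def s_def power2_eq_square sum_divide_distrib real_sqrt_mult[symmetric])
    then show ?thesis
      by (subst sum.swap) (simp add: sum_divide_distrib[symmetric] power2_eq_square)
  qed
  finally show ?thesis .
qed

lemma exp_bilinear_frobenius_le:
  assumes "(\<Sum>i<q. \<Sum>j<q. (M i j)\<^sup>2) \<le> \<kappa>\<^sup>2 / 2"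
  shows "(\<integral>\<^sup>+u. \<integral>\<^sup>+v. ennreal (exp (bil q M u v)) \<partial>G \<partial>G) \<le> ennreal (exp ((\<Sum>i<q. \<Sum>j<q. (M i j)\<^sup>2) / \<kappa>\<^sup>2))"
proof (rule exp_bilinear_le)
  fix x
  have "(\<Sum>j<q. (ip q (\<lambda>i. M i j) x)\<^sup>2) \<le> (\<Sum>j<q. (\<Sum>i<q. (M i j)\<^sup>2) * ip q x x)"
  proof (rule sum_mono)
    fix j
    have "(ip q (\<lambda>i. M i j) x)\<^sup>2 \<le> (nm q (\<lambda>i. M i j) * nm q x)\<^sup>2"
      using abs_ip_le[of q "\<lambda>i. M i j" x] by (simp add: abs_le_square_iff[symmetric] abs_mult L2_set_nonneg)
    then show "(ip q (\<lambda>i. M i j) x)\<^sup>2 \<le> (\<Sum>i<q. (M i j)\<^sup>2) * ip q x x"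
      unfolding power_mult_distrib nm_sq by (simp add: ip_def[of q "\<lambda>i. M i j"] power2_eq_square)
  qed
  also have "\<dots> = (\<Sum>i<q. \<Sum>j<q. (M i j)\<^sup>2) * ip q x x"
    by (subst sum.swap) (simp add: sum_distrib_right)
  also have "\<dots> \<le> \<kappa>\<^sup>2 / 2 * ip q x x"
    using assms by (intro mult_right_mono ip_nonneg)
  finally show "(\<Sum>j<q. (ip q (\<lambda>i. M i j) x)\<^sup>2) \<le> \<kappa>\<^sup>2 / 2 * ip q x x" .
qed

text \<open>For fixed \<open>u\<close> the form is bilinear in \<open>v\<close> and
  \<open>x\<close>, and restricting \<open>u\<close> to a ball bounds its operator norm by
  \<open>sqrt q * R * L\<close>. The squared Frobenius norm that comes out is a quadratic form in
  \<open>u\<close>, to which \<open>exp_quadratic_le\<close> applies. Only one of the three vectors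
  has to be restricted.\<close>

lemma exp_trilinear_le:
  assumes T: "\<And>a x y. a < q \<Longrightarrow> \<bar>bil q (T a) x y\<bar> \<le> L * nm q x * nm q y" and L: "0 \<le> L"
    and R: "real q * R\<^sup>2 * L\<^sup>2 \<le> \<kappa>\<^sup>2 / 2" "0 \<le> R" and small: "(real q)\<^sup>2 * L\<^sup>2 \<le> \<kappa> ^ 3 / 4"
  shows "(\<integral>\<^sup>+u. ennreal (indicator {u. nm q u \<le> R} u) *
      (\<integral>\<^sup>+v. \<integral>\<^sup>+x. ennreal (exp (\<Sum>a<q. u a * bil q (T a) v x)) \<partial>G \<partial>G) \<partial>G)
    \<le> ennreal (exp (2 * (real q)\<^sup>2 * L\<^sup>2 / \<kappa> ^ 3))"
proof -
  define K where "K = {..<q} \<times> {..<q}"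
  \<comment> \<open>The factor \<open>sqrt 2 / \<kappa>\<close> makes half of the sum of squares
    equal to the exponent that the bilinear estimate yields.\<close>
  define s where "s k = (\<lambda>a. T a (fst k) (snd k) * (sqrt 2 / \<kappa>))" for k
  have frob: "(\<Sum>k\<in>K. (nm q (s k))\<^sup>2) \<le> 2 * (real q)\<^sup>2 * L\<^sup>2 / \<kappa>\<^sup>2"
  proof -
    have "(nm q (s k))\<^sup>2 = (\<Sum>a<q. 2 / \<kappa>\<^sup>2 * (T a (fst k) (snd k))\<^sup>2)" for k
      unfolding s_def nm_sq ip_def
      by (intro sum.cong refl) (simp add: power2_eq_square field_simps)
    then have "(\<Sum>k\<in>K. (nm q (s k))\<^sup>2)
        = (\<Sum>(b, c)\<in>{..<q} \<times> {..<q}. \<Sum>a<q. 2 / \<kappa>\<^sup>2 * (T a b c)\<^sup>2)"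
      by (simp only: K_def split_beta')
    also have "\<dots> = (\<Sum>b<q. \<Sum>c<q. \<Sum>a<q. 2 / \<kappa>\<^sup>2 * (T a b c)\<^sup>2)"
      by (rule sum.cartesian_product[symmetric])
    also have "\<dots> = (\<Sum>b<q. \<Sum>a<q. \<Sum>c<q. 2 / \<kappa>\<^sup>2 * (T a b c)\<^sup>2)"
      by (intro sum.cong refl sum.swap)
    also have "\<dots> = (\<Sum>a<q. \<Sum>b<q. \<Sum>c<q. 2 / \<kappa>\<^sup>2 * (T a b c)\<^sup>2)"
      by (rule sum.swap)
    also have "\<dots> = (\<Sum>a<q. \<Sum>b<q. 2 / \<kappa>\<^sup>2 * (nm q (T a b))\<^sup>2)"
      unfolding nm_sq by (simp add: ip_def power2_eq_square sum_distrib_left)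
    \<comment> \<open>Each of the \<open>q\<close> times \<open>q\<close> rows of the tensor has
      norm at most \<open>L\<close>; this is where the square of the dimension comes from.\<close>
    also have "\<dots> \<le> (\<Sum>a<q. \<Sum>b<q. 2 / \<kappa>\<^sup>2 * L\<^sup>2)"
      using L by (intro sum_mono mult_left_mono power_mono row_norm_le[OF T]) (auto simp: L2_set_nonneg)
    finally show ?thesis by (simp add: power2_eq_square mult_ac)
  qed
  have "(\<integral>\<^sup>+u. ennreal (indicator {u. nm q u \<le> R} u) *
      (\<integral>\<^sup>+v. \<integral>\<^sup>+x. ennreal (exp (\<Sum>a<q. u a * bil q (T a) v x)) \<partial>G \<partial>G) \<partial>G)
    \<le> (\<integral>\<^sup>+u. ennreal (exp ((\<Sum>k\<in>K. (ip q (s k) u)\<^sup>2) / 2)) \<partial>G)"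
  proof (rule nn_integral_mono)
    fix u
    show "ennreal (indicator {u. nm q u \<le> R} u) *
      (\<integral>\<^sup>+v. \<integral>\<^sup>+x. ennreal (exp (\<Sum>a<q. u a * bil q (T a) v x)) \<partial>G \<partial>G)
      \<le> ennreal (exp ((\<Sum>k\<in>K. (ip q (s k) u)\<^sup>2) / 2))"
    proof (cases "nm q u \<le> R")
      case True
      define M where "M b c = (\<Sum>a<q. u a * T a b c)" for b c
      have M: "(\<Sum>a<q. u a * bil q (T a) v x) = bil q M v x" for v x
      proof -
        have "bil q M v x = (\<Sum>b<q. \<Sum>c<q. \<Sum>a<q. u a * T a b c * v b * x c)"
          by (simp add: bil_def M_def sum_distrib_right)
        also have "\<dots> = (\<Sum>b<q. \<Sum>a<q. \<Sum>c<q. u a * T a b c * v b * x c)"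
          by (intro sum.cong refl sum.swap)
        also have "\<dots> = (\<Sum>a<q. \<Sum>b<q. \<Sum>c<q. u a * T a b c * v b * x c)"
          by (rule sum.swap)
        also have "\<dots> = (\<Sum>a<q. u a * bil q (T a) v x)"
          by (simp add: bil_def sum_distrib_left mult_ac)
        finally show ?thesis ..
      qed
      have "(\<integral>\<^sup>+v. \<integral>\<^sup>+x. ennreal (exp (bil q M v x)) \<partial>G \<partial>G) \<le> ennreal (exp ((\<Sum>b<q. \<Sum>c<q. (M b c)\<^sup>2) / \<kappa>\<^sup>2))"
      proof (rule exp_bilinear_le)
        fix x
        define z where "z c = ip q (\<lambda>b. M b c) x" for c
        \<comment> \<open>Here \<open>z\<close> is the image of \<open>x\<close> under the transpose
          of \<open>M\<close>. Its squared norm is the form at \<open>x\<close> and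
          \<open>z\<close>, so that one factor \<open>nm q z\<close> cancels in the estimate
          below.\<close>
        have zz: "(nm q z)\<^sup>2 = bil q M x z"
          unfolding nm_sq bil_def by (subst sum.swap) (simp add: ip_def z_def sum_distrib_right sum_distrib_left mult_ac)
        have "bil q M x z \<le> (\<Sum>a<q. \<bar>u a\<bar> * (L * nm q x * nm q z))"
          unfolding M[symmetric]
        proof (rule sum_mono)
          fix a assume a: "a \<in> {..<q}"
          have "u a * bil q (T a) x z \<le> \<bar>u a\<bar> * \<bar>bil q (T a) x z\<bar>"
            by (metis abs_ge_self abs_mult)
          also have "\<dots> \<le> \<bar>u a\<bar> * (L * nm q x * nm q z)"
            using a by (intro mult_left_mono T) auto
          finally show "u a * bil q (T a) x z \<le> \<bar>u a\<bar> * (L * nm q x * nm q z)" .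
        qed
        also have "\<dots> \<le> sqrt (real q) * R * (L * nm q x * nm q z)"
          unfolding sum_distrib_right[symmetric]
          using L True order_trans[OF sum_abs_le_nm[where q = q and u = u] mult_left_mono[OF True, of "sqrt (real q)"]]
          by (intro mult_right_mono) (auto simp: L2_set_nonneg)
        finally have "nm q z * nm q z \<le> (sqrt (real q) * R * L * nm q x) * nm q z"
          unfolding zz[symmetric] by (simp add: power2_eq_square mult_ac)
        then have "nm q z \<le> sqrt (real q) * R * L * nm q x"
          using L R L2_set_nonneg[of z "{..<q}"] L2_set_nonneg[of x "{..<q}"]
          by (cases "nm q z = 0") (auto simp: mult_le_cancel_right)
        then have "(nm q z)\<^sup>2 \<le> (sqrt (real q) * R * L * nm q x)\<^sup>2"
          by (rule power_mono) (rule L2_set_nonneg)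
        also have "\<dots> = real q * R\<^sup>2 * L\<^sup>2 * ip q x x"
          by (simp add: power_mult_distrib nm_sq)
        also have "\<dots> \<le> \<kappa>\<^sup>2 / 2 * ip q x x"
          using R by (intro mult_right_mono ip_nonneg)
        finally show "(\<Sum>j<q. (ip q (\<lambda>i. M i j) x)\<^sup>2) \<le> \<kappa>\<^sup>2 / 2 * ip q x x"
          unfolding nm_sq by (simp add: ip_def[of q z] z_def power2_eq_square)
      qed
      also have "(\<Sum>b<q. \<Sum>c<q. (M b c)\<^sup>2) / \<kappa>\<^sup>2 = (\<Sum>k\<in>K. (ip q (s k) u)\<^sup>2) / 2"
      proof -
        have "(ip q (s k) u)\<^sup>2 = 2 / \<kappa>\<^sup>2 * (M (fst k) (snd k))\<^sup>2" for k
        proof -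
          have "ip q (s k) u = sqrt 2 / \<kappa> * M (fst k) (snd k)"
            by (simp add: ip_def s_def M_def sum_distrib_left mult_ac)
          then show ?thesis by (simp add: power_mult_distrib power_divide)
        qed
        then show ?thesis
          unfolding K_def by (simp add: sum.cartesian_product sum_divide_distrib sum_distrib_right split_beta' mult_ac)
      qed
      finally show ?thesis using True by (simp add: M)
    qed simp
  qed
  also have "\<dots> \<le> ennreal (exp ((\<Sum>k\<in>K. (nm q (s k))\<^sup>2) / \<kappa>))"
  proof (rule exp_quadratic_le)
    fix x
    have "(\<Sum>k\<in>K. (ip q (s k) x)\<^sup>2) \<le> (\<Sum>k\<in>K. (nm q (s k))\<^sup>2 * ip q x x)"
    proof (rule sum_mono)
      fix k
      have "(ip q (s k) x)\<^sup>2 \<le> (nm q (s k) * nm q x)\<^sup>2"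
        using abs_ip_le[of q "s k" x] by (simp add: abs_le_square_iff[symmetric] abs_mult L2_set_nonneg)
      then show "(ip q (s k) x)\<^sup>2 \<le> (nm q (s k))\<^sup>2 * ip q x x"
        by (simp add: power_mult_distrib nm_sq)
    qed
    also have "\<dots> \<le> (2 * (real q)\<^sup>2 * L\<^sup>2 / \<kappa>\<^sup>2) * ip q x x"
      unfolding sum_distrib_right[symmetric] by (intro mult_right_mono frob ip_nonneg)
    also have "\<dots> \<le> \<kappa> / 2 * ip q x x"
      using small kappa_pos by (intro mult_right_mono ip_nonneg) (simp add: field_simps power2_eq_square power3_eq_cube)
    finally show "(\<Sum>k\<in>K. (ip q (s k) x)\<^sup>2) \<le> \<kappa> / 2 * ip q x x" .
  qed (simp add: K_def)
  also have "\<dots> \<le> ennreal (exp (2 * (real q)\<^sup>2 * L\<^sup>2 / \<kappa> ^ 3))"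
  proof (intro ennreal_leI, subst exp_le_cancel_iff)
    have "(\<Sum>k\<in>K. (nm q (s k))\<^sup>2) / \<kappa> \<le> (2 * (real q)\<^sup>2 * L\<^sup>2 / \<kappa>\<^sup>2) / \<kappa>"
      using frob kappa_pos by (intro divide_right_mono) auto
    then show "(\<Sum>k\<in>K. (nm q (s k))\<^sup>2) / \<kappa> \<le> 2 * (real q)\<^sup>2 * L\<^sup>2 / \<kappa> ^ 3"
      by (simp add: power2_eq_square power3_eq_cube)
  qed
  finally show ?thesis .
qed

lemma C1b_bump_integrable:
  assumes F: "C1b q \<rho> F F1" and r: "0 < r" "2 * r \<le> \<rho>"
  shows "integrable G (\<lambda>u. bump q r u * F u)"
proof -
  have [measurable]: "F \<in> borel_measurable borel" using F by (simp add: C1b_def)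
  obtain M where M: "\<And>u. u \<in> ob q \<rho> \<Longrightarrow> \<bar>F u\<bar> \<le> M" using F unfolding C1b_def by blast
  have "bddf (\<lambda>u. bump q r u * F u)"
  proof (rule bddfI[of _ "\<bar>M\<bar>"])
    fix u show "\<bar>bump q r u * F u\<bar> \<le> \<bar>M\<bar>"
    proof (cases "bump q r u = 0")
      case False
      have "\<bar>F u\<bar> \<le> \<bar>M\<bar>" using M[OF bump_support(2)[OF r False]] by linarith
      then show ?thesis
        using bump_bounds[of q r u] mult_mono[of "bump q r u" 1 "\<bar>F u\<bar>" "\<bar>M\<bar>"]
        by (simp add: abs_mult)
    qed simp
  qed
  then show ?thesis by (intro integrable_G_bddf) measurable
qed

lemma bump_mass:
  assumes r: "0 < r" and \<tau>: "measure G {u. r \<le> nm q u} \<le> \<tau>"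
  shows "1 - \<tau> \<le> (\<integral>u. bump q r u \<partial>G)" "(\<integral>u. bump q r u \<partial>G) \<le> 1"
proof -
  have int: "integrable G (bump q r)" by (intro integrable_G_bddf bddf_bump) measurable
  have "(\<integral>u. bump q r u \<partial>G) \<le> (\<integral>u. 1 \<partial>G)"
    using int bump_bounds by (intro integral_mono) auto
  then show "(\<integral>u. bump q r u \<partial>G) \<le> 1" by (simp add: G.prob_space[simplified])
  have ind: "integrable G (indicator {u. r \<le> nm q u} :: _ \<Rightarrow> real)"
    by (auto simp: G.emeasure_eq_measure)
  have "(\<integral>u. 1 - indicator {u. r \<le> nm q u} u \<partial>G) \<le> (\<integral>u. bump q r u \<partial>G)"
  proof (rule integral_mono)
    show "integrable G (\<lambda>u. 1 - indicator {u. r \<le> nm q u} u :: real)" using ind by simp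
    fix u show "1 - indicator {u. r \<le> nm q u} u \<le> bump q r u"
      using bump_bounds[of q r u] bump_eq_1[OF r, of u q]
      by (cases "r \<le> nm q u") (auto simp: bump_eq_1[OF r])
  qed (rule int)
  also have "(\<integral>u. 1 - indicator {u. r \<le> nm q u} u \<partial>G) = 1 - measure G {u. r \<le> nm q u}"
    using ind by (simp add: G.prob_space[simplified])
  finally show "1 - \<tau> \<le> (\<integral>u. bump q r u \<partial>G)" using \<tau> by linarith
qed

end

lemma C1b_scale:
  assumes F: "C1b q \<rho> F F1" and s: "0 \<le> s" "s \<le> 1" and \<rho>: "0 < \<rho>"
  shows "C1b q \<rho> (\<lambda>u. F (\<lambda>k. s * u k)) (\<lambda>i u. s * F1 i (\<lambda>k. s * u k))"
  unfolding C1b_def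
proof (intro conjI allI ballI impI)
  have inS: "(\<lambda>k. s * u k) \<in> ob q \<rho>" if "u \<in> ob q \<rho>" for u
    by (rule ob_scale[OF that]) (use s in auto)
  show "cyl q (\<lambda>u. F (\<lambda>k. s * u k))"
    using F by (auto simp: C1b_def cyl_def)
  show "partial_on q (ob q \<rho>) (\<lambda>u. F (\<lambda>k. s * u k)) (\<lambda>i u. s * F1 i (\<lambda>k. s * u k))"
    unfolding partial_on_def
  proof (intro ballI allI impI)
    fix u i assume u: "u \<in> ob q \<rho>" and i: "i < q"
    have p: "partial_on q (ob q \<rho>) F F1" using F by (simp add: C1b_def)
    have "((\<lambda>t. F ((\<lambda>k. s * u k)(i := t))) has_real_derivative F1 i (\<lambda>k. s * u k)) (at (s * u i))"
      using partial_onD[OF p inS[OF u] i] by simp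
    moreover have "((\<lambda>t. s * t) has_real_derivative s) (at (u i))"
      by (auto intro!: derivative_eq_intros)
    ultimately have "((\<lambda>t. F ((\<lambda>k. s * u k)(i := s * t))) has_real_derivative F1 i (\<lambda>k. s * u k) * s) (at (u i))"
      by (rule DERIV_chain2)
    moreover have "(\<lambda>k. s * u k)(i := s * t) = (\<lambda>k. s * (u(i := t)) k)" for t by auto
    ultimately show "((\<lambda>t. F (\<lambda>k. s * (u(i := t)) k)) has_real_derivative s * F1 i (\<lambda>k. s * u k)) (at (u i))"
      by (simp add: mult.commute)
  qed
  have [measurable]: "F \<in> borel_measurable borel" "\<And>i. i < q \<Longrightarrow> F1 i \<in> borel_measurable borel"
    using F by (auto simp: C1b_def)
  show "(\<lambda>u. F (\<lambda>k. s * u k)) \<in> borel_measurable borel" by measurable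
  show "(\<lambda>u. s * F1 i (\<lambda>k. s * u k)) \<in> borel_measurable borel" if "i < q" for i
    using that by measurable
  obtain M where M: "\<forall>u\<in>ob q \<rho>. \<bar>F u\<bar> \<le> M \<and> (\<forall>i<q. \<bar>F1 i u\<bar> \<le> M)" using F unfolding C1b_def by blast
  have "\<bar>s * x\<bar> \<le> \<bar>M\<bar>" if "\<bar>x\<bar> \<le> M" for x
    using that s mult_mono[of "\<bar>s\<bar>" 1 "\<bar>x\<bar>" "\<bar>M\<bar>"] by (simp add: abs_mult)
  moreover have "\<bar>x\<bar> \<le> \<bar>M\<bar>" if "\<bar>x\<bar> \<le> M" for x using that by linarith
  ultimately show "\<exists>M. \<forall>u\<in>ob q \<rho>. \<bar>F (\<lambda>k. s * u k)\<bar> \<le> M \<and> (\<forall>i<q. \<bar>s * F1 i (\<lambda>k. s * u k)\<bar> \<le> M)"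
    using M inS by (intro exI[of _ "\<bar>M\<bar>"]) blast
  fix i u assume i: "i < q" and u: "u \<in> ob q \<rho>"
  have c: "cts_at q (F1 i) (\<lambda>k. s * u k)" using F i inS[OF u] by (auto simp: C1b_def)
  have "cts_at q (\<lambda>u. F1 i (\<lambda>k. s * u k)) u"
    unfolding cts_at_def
  proof (intro allI impI)
    fix \<epsilon> :: real assume "\<epsilon> > 0"
    then obtain d where d: "d > 0" "\<And>v. (\<forall>i<q. \<bar>v i - s * u i\<bar> < d) \<Longrightarrow> \<bar>F1 i v - F1 i (\<lambda>k. s * u k)\<bar> < \<epsilon>"
      using c by (auto simp: cts_at_def)
    have "\<bar>s * v i - s * u i\<bar> < d" if "\<bar>v i - u i\<bar> < d" for v i
    proof -
      have "\<bar>s * v i - s * u i\<bar> = s * \<bar>v i - u i\<bar>" using s by (simp add: abs_mult right_diff_distrib[symmetric])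
      also have "\<dots> \<le> 1 * \<bar>v i - u i\<bar>" using s by (intro mult_right_mono) auto
      finally show ?thesis using that by simp
    qed
    then show "\<exists>d>0. \<forall>v. (\<forall>i<q. \<bar>v i - u i\<bar> < d) \<longrightarrow> \<bar>F1 i (\<lambda>k. s * v k) - F1 i (\<lambda>k. s * u k)\<bar> < \<epsilon>"
      using d by (intro exI[of _ d]) auto
  qed
  then show "cts_at q (\<lambda>u. s * F1 i (\<lambda>k. s * u k)) u" by (rule cts_at_cmult)
qed

subsection \<open>Remainders with bounded derivative slices\<close>

lemma C1b_sum2:
  assumes "\<And>a b. a < q \<Longrightarrow> b < q \<Longrightarrow> C1b q \<rho> (H a b) (H1 a b)"
  shows "C1b q \<rho> (\<lambda>u. \<Sum>a<q. \<Sum>b<q. c a b * H a b u) (\<lambda>i u. \<Sum>a<q. \<Sum>b<q. c a b * H1 a b i u)"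
proof -
  have "C1b q \<rho> (\<lambda>u. \<Sum>a<q. 1 * (\<Sum>b<q. c a b * H a b u)) (\<lambda>i u. \<Sum>a<q. 1 * (\<Sum>b<q. c a b * H1 a b i u))"
    by (intro C1b_sum) (use assms in auto)
  then show ?thesis by simp
qed

lemma C1b_bil:
  assumes "\<And>a b. a < q \<Longrightarrow> b < q \<Longrightarrow> C1b q \<rho> (H a b) (H1 a b)"
  shows "C1b q \<rho> (\<lambda>u. bil q (\<lambda>a b. H a b u) x y) (\<lambda>i u. bil q (\<lambda>a b. H1 a b i u) x y)"
  using C1b_sum2[OF assms, where c = "\<lambda>a b. x a * y b"] by (simp add: bil_def mult_ac)

lemma C1b_ip:
  assumes "\<And>a. a < q \<Longrightarrow> C1b q \<rho> (H a) (H1 a)"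
  shows "C1b q \<rho> (\<lambda>u. ip q x (\<lambda>a. H a u)) (\<lambda>i u. ip q x (\<lambda>a. H1 a i u))"
  using C1b_sum[of "{..<q}" q \<rho> H H1 x] assms by (simp add: ip_def)

lemma C1b_segment_bound:
  assumes F: "C1b q \<rho> F F1" and zero: "F (\<lambda>_. 0) = 0" and u: "u \<in> ob q \<rho>"
    and K: "\<And>v. v \<in> ob q \<rho> \<Longrightarrow> nm q v \<le> nm q u \<Longrightarrow> \<bar>ip q (\<lambda>i. F1 i v) u\<bar> \<le> K"
  shows "\<bar>F u\<bar> \<le> K"
proof -
  have "\<bar>F (\<lambda>i. 1 * u i) - F (\<lambda>i. 0 * u i) - 0 * (1 - 0)\<bar> \<le> K * \<bar>1 - 0\<bar>"
  proof (rule deriv_bound_linear[where f' = "\<lambda>s. ip q (\<lambda>i. F1 i (\<lambda>k. s * u k)) u"])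
    fix s :: real assume s: "s \<in> closed_segment 0 1"
    then have s: "0 \<le> s" "s \<le> 1" by (auto simp: closed_segment_eq_real_ivl)
    show "((\<lambda>s. F (\<lambda>i. s * u i)) has_real_derivative ip q (\<lambda>i. F1 i (\<lambda>k. s * u k)) u) (at s)"
      by (rule segment_deriv[OF _ _ _ u]) (use F s in \<open>auto simp: C1b_def\<close>)
    show "\<bar>ip q (\<lambda>i. F1 i (\<lambda>k. s * u k)) u - 0\<bar> \<le> K"
      unfolding diff_zero using s u
      by (intro K ob_scale) (auto simp: nm_scale L2_set_nonneg mult_left_le_one_le)
  qed
  then show ?thesis using zero by simp
qed

lemma ip_ip_eq_bil: "ip q (\<lambda>i. ip q x (\<lambda>a. H a i)) u = bil q H x u"
proof -
  have "ip q (\<lambda>i. ip q x (\<lambda>a. H a i)) u = (\<Sum>i<q. \<Sum>a<q. H a i * x a * u i)"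
    by (simp add: ip_def sum_distrib_left sum_distrib_right mult_ac)
  also have "\<dots> = bil q H x u"
    unfolding bil_def by (rule sum.swap)
  finally show ?thesis .
qed

lemma bil_cong: "(\<And>a b. a < q \<Longrightarrow> b < q \<Longrightarrow> A a b = A' a b) \<Longrightarrow> bil q A x y = bil q A' x y"
  unfolding bil_def by (intro sum.cong refl) auto

lemma abs_sum_le_card:
  assumes "\<And>i. i < q \<Longrightarrow> \<bar>f i\<bar> \<le> (c::real)" shows "\<bar>\<Sum>i<q. f i\<bar> \<le> real q * c"
  using order_trans[OF sum_abs sum_mono[of "{..<q}" "\<lambda>i. \<bar>f i\<bar>" "\<lambda>_. c"]] assms by simp

lemma (in pd_form) nm_Qi_le: "i < q \<Longrightarrow> nm q (Qi i) \<le> 1 / \<kappa>"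
proof -
  assume i: "i < q"
  define e where "e j = (if j = i then 1 else 0 :: real)" for j
  have "nm q (Qi i) = nm q (Qinv e)"
    using i by (intro nm_cong) (simp add: Qinv_def e_def mult_delta_right Qi_sym[of i])
  also have "\<dots> \<le> nm q e / \<kappa>" by (rule nm_Qinv_le)
  also have "nm q e = 1"
  proof -
    have "(e j)\<^sup>2 = (if j = i then 1 else 0)" for j by (simp add: e_def)
    then show ?thesis using i by (simp add: L2_set_def)
  qed
  finally show ?thesis .
qed

lemma (in pd_form) bump_integral_le:
  assumes r: "0 < r" "2 * r \<le> \<rho>" and f: "\<And>u. u \<in> ob q \<rho> \<Longrightarrow> \<bar>f u\<bar> \<le> C" and C: "0 \<le> C"
  shows "\<bar>\<integral>u. bump q r u * f u \<partial>G\<bar> \<le> C"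
proof (cases "integrable G (\<lambda>u. bump q r u * f u)")
  case True
  have "\<bar>bump q r u * f u\<bar> \<le> C" for u
  proof (cases "bump q r u = 0")
    case False
    have "\<bar>f u\<bar> \<le> C" by (rule f[OF bump_support(2)[OF r False]])
    then show ?thesis
      using bump_bounds[of q r u] mult_mono[of "bump q r u" 1 "\<bar>f u\<bar>" C] C by (simp add: abs_mult)
  qed (use C in simp)
  then have "(\<integral>u. \<bar>bump q r u * f u\<bar> \<partial>G) \<le> (\<integral>u. C \<partial>G)"
    using True by (intro integral_mono) auto
  also have "(\<integral>u. C \<partial>G) = C" by (simp add: G.prob_space[simplified])
  finally have "(\<integral>u. \<bar>bump q r u * f u\<bar> \<partial>G) \<le> C" .
  then show ?thesis
    using integral_norm_bound[of G "\<lambda>u. bump q r u * f u"] unfolding real_norm_def by linarith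
qed (use C in \<open>simp add: not_integrable_integral_eq\<close>)

text \<open>\<open>R\<close> is the log-density without its quadratic part, and the last index of a
  derivative belongs to the differentiation carried out last. Slices of third and fourth order are
  of size \<open>B * \<kappa>\<close>, hence of order n. The condition \<open>8 * r < \<rho>\<close>
  leaves room for three doublings of the radius. The constant 3000000 covers the 2130048 that the
  mean gradient causes in \<open>mean_first_exp\<close>; the constant 128000 becomes 2000 for r =
  \<gamma> / 8.\<close>

locale laplace_core = pd_form q Q \<kappa> for q Q \<kappa> +
  fixes \<rho> r B \<tau> :: real
    and R :: "(nat \<Rightarrow> real) \<Rightarrow> real"
    and R1 :: "nat \<Rightarrow> (nat \<Rightarrow> real) \<Rightarrow> real"
    and R2 :: "nat \<Rightarrow> nat \<Rightarrow> (nat \<Rightarrow> real) \<Rightarrow> real"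
    and R3 :: "nat \<Rightarrow> nat \<Rightarrow> nat \<Rightarrow> (nat \<Rightarrow> real) \<Rightarrow> real"
    and R4 :: "nat \<Rightarrow> nat \<Rightarrow> nat \<Rightarrow> nat \<Rightarrow> (nat \<Rightarrow> real) \<Rightarrow> real"
  assumes C0: "C1b q \<rho> R R1"
    and C1: "\<And>a. a < q \<Longrightarrow> C1b q \<rho> (R1 a) (R2 a)"
    and C2: "\<And>a b. a < q \<Longrightarrow> b < q \<Longrightarrow> C1b q \<rho> (R2 a b) (R3 a b)"
    and C3: "\<And>a b c. a < q \<Longrightarrow> b < q \<Longrightarrow> c < q \<Longrightarrow> C1b q \<rho> (R3 a b c) (R4 a b c)"
    and zero: "R (\<lambda>_. 0) = 0" "\<And>a. a < q \<Longrightarrow> R1 a (\<lambda>_. 0) = 0"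
      "\<And>a b. a < q \<Longrightarrow> b < q \<Longrightarrow> R2 a b (\<lambda>_. 0) = 0"
    and sym3: "\<And>u a b c. u \<in> ob q \<rho> \<Longrightarrow> a < q \<Longrightarrow> b < q \<Longrightarrow> c < q \<Longrightarrow> R3 a b c u = R3 b a c u"
      "\<And>u a b c. u \<in> ob q \<rho> \<Longrightarrow> a < q \<Longrightarrow> b < q \<Longrightarrow> c < q \<Longrightarrow> R3 a b c u = R3 a c b u"
    and sym4: "\<And>u a b c d. u \<in> ob q \<rho> \<Longrightarrow> a < q \<Longrightarrow> b < q \<Longrightarrow> c < q \<Longrightarrow> d < q \<Longrightarrow> R4 a b c d u = R4 b a c d u"
      "\<And>u a b c d. u \<in> ob q \<rho> \<Longrightarrow> a < q \<Longrightarrow> b < q \<Longrightarrow> c < q \<Longrightarrow> d < q \<Longrightarrow> R4 a b c d u = R4 a c b d u"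
    and slice3: "\<And>u c x y. u \<in> ob q \<rho> \<Longrightarrow> c < q \<Longrightarrow>
      \<bar>bil q (\<lambda>a b. R3 a b c u) x y\<bar> \<le> B * \<kappa> * nm q x * nm q y"
    and slice4: "\<And>u c d x y. u \<in> ob q \<rho> \<Longrightarrow> c < q \<Longrightarrow> d < q \<Longrightarrow>
      \<bar>bil q (\<lambda>a b. R4 a b c d u) x y\<bar> \<le> B * \<kappa> * nm q x * nm q y"
    and r: "0 < r" "8 * r < \<rho>" "\<rho> \<le> 16 * r" "r \<le> 1" "1 / \<kappa> \<le> r\<^sup>2"
    and pars: "1 \<le> B" "2 \<le> \<kappa>" "1 \<le> q"
    and \<tau>: "measure G {u. r \<le> nm q u} \<le> \<tau>" "\<tau> \<le> 1 / \<kappa>"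
    and small: "128000 * real q * r\<^sup>2 * B\<^sup>2 \<le> 1" "3000000 * B\<^sup>2 * (real q)\<^sup>2 / \<kappa> \<le> 1"
begin

section \<open>Bounds and Gaussian means for the remainder and its derivatives\<close>

lemma R2_bound:
  assumes u: "u \<in> ob q \<rho>"
  shows "\<bar>bil q (\<lambda>a b. R2 a b u) x y\<bar> \<le> sqrt (real q) * nm q u * (B * \<kappa> * nm q x * nm q y)"
proof (rule C1b_segment_bound[OF C1b_bil[OF C2] _ u])
  show "bil q (\<lambda>a b. R2 a b (\<lambda>_. 0)) x y = 0" by (simp add: bil_def zero)
  fix v assume v: "v \<in> ob q \<rho>"
  have "\<bar>ip q (\<lambda>i. bil q (\<lambda>a b. R3 a b i v) x y) u\<bar> \<le> (\<Sum>i<q. (B * \<kappa> * nm q x * nm q y) * \<bar>u i\<bar>)"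
    unfolding ip_def
    by (rule order_trans[OF sum_abs sum_mono]) (auto simp: abs_mult intro!: mult_right_mono slice3 v)
  also have "\<dots> \<le> sqrt (real q) * nm q u * (B * \<kappa> * nm q x * nm q y)"
    unfolding sum_distrib_left[symmetric]
    using mult_left_mono[OF sum_abs_le_nm[where q = q and u = u], of "B * \<kappa> * nm q x * nm q y"] pars
    by (simp add: L2_set_nonneg mult_ac)
  finally show "\<bar>ip q (\<lambda>i. bil q (\<lambda>a b. R3 a b i v) x y) u\<bar> \<le> sqrt (real q) * nm q u * (B * \<kappa> * nm q x * nm q y)" .
qed

lemma R1_bound:
  assumes u: "u \<in> ob q \<rho>"
  shows "\<bar>ip q x (\<lambda>a. R1 a u)\<bar> \<le> sqrt (real q) * (nm q u)\<^sup>2 * (B * \<kappa> * nm q x)"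
proof (rule C1b_segment_bound[OF C1b_ip[OF C1] _ u])
  show "ip q x (\<lambda>a. R1 a (\<lambda>_. 0)) = 0" by (simp add: ip_def zero)
  fix v assume v: "v \<in> ob q \<rho>" "nm q v \<le> nm q u"
  have "ip q (\<lambda>i. ip q x (\<lambda>a. R2 a i v)) u = bil q (\<lambda>a i. R2 a i v) x u"
    by (rule ip_ip_eq_bil)
  also have "\<bar>\<dots>\<bar> \<le> sqrt (real q) * nm q v * (B * \<kappa> * nm q x * nm q u)" by (rule R2_bound[OF v(1)])
  also have "\<dots> \<le> sqrt (real q) * nm q u * (B * \<kappa> * nm q x * nm q u)"
    using v(2) pars by (intro mult_right_mono mult_left_mono) (auto simp: L2_set_nonneg)
  finally show "\<bar>ip q (\<lambda>i. ip q x (\<lambda>a. R2 a i v)) u\<bar> \<le> sqrt (real q) * (nm q u)\<^sup>2 * (B * \<kappa> * nm q x)"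
    by (simp add: power2_eq_square mult_ac)
qed

lemma \<tau>_bounds: "0 \<le> \<tau>" "\<tau> \<le> r" "\<tau> \<le> 1 / 2"
proof -
  show "0 \<le> \<tau>" using \<tau>(1) measure_nonneg[of G] order_trans by blast
  have "1 / \<kappa> \<le> 1 / 2" using pars by (simp add: field_simps)
  then show "\<tau> \<le> 1 / 2" using \<tau>(2) by linarith
  have "r\<^sup>2 \<le> r" using r by (simp add: power2_eq_square mult_le_cancel_left1)
  then show "\<tau> \<le> r" using \<tau>(2) r(5) by linarith
qed

lemma tail_mono: "r \<le> t \<Longrightarrow> measure G {u. t \<le> nm q u} \<le> \<tau>"
  using G.finite_measure_mono[of "{u. t \<le> nm q u}" "{u. r \<le> nm q u}"] \<tau>(1) by force

lemma sqrt_q_le: "sqrt (real q) \<le> real q" "real q \<le> (real q)\<^sup>2"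
proof -
  have q: "1 \<le> real q" using pars by simp
  then show 2: "real q \<le> (real q)\<^sup>2" by (simp add: power2_eq_square)
  then show "sqrt (real q) \<le> real q" by (simp add: real_le_lsqrt)
qed

lemma q_le_kappa: "real q \<le> \<kappa>" "(real q)\<^sup>2 \<le> \<kappa>"
proof -
  have "3000000 * B\<^sup>2 * (real q)\<^sup>2 \<le> \<kappa>" using small(2) kappa_pos by (simp add: field_simps)
  moreover have "1 * (real q)\<^sup>2 \<le> 3000000 * B\<^sup>2 * (real q)\<^sup>2"
    using pars by (intro mult_right_mono) (auto intro: order_trans[of _ "B\<^sup>2"] simp: one_le_power)
  ultimately show "(real q)\<^sup>2 \<le> \<kappa>" by linarith
  then show "real q \<le> \<kappa>" using sqrt_q_le by linarith
qed

text \<open>The trace \<open>L\<close> vanishes at the origin, so its mean can again be computed by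
  integration by parts. The resulting double trace of the fourth derivative is a sum over q^2 slices
  of size \<open>B * \<kappa>\<close>, each paired with two rows of the covariance matrix of norm at
  most \<open>1 / \<kappa>\<close>.\<close>

lemma mean_L:
  assumes s: "0 \<le> s" "s \<le> 1"
  shows "\<bar>\<integral>u. bump q r u * trQ R2 (\<lambda>k. s * u k) \<partial>G\<bar> \<le> 17 * ((real q)\<^sup>2 * B / \<kappa>)"
proof -
  define L where "L u = (\<Sum>i<q. \<Sum>k<q. Qi i k * R2 k i u)" for u
  define L1 where "L1 c u = (\<Sum>i<q. \<Sum>k<q. Qi i k * R3 k i c u)" for c u
  define L2 where "L2 c d u = (\<Sum>i<q. \<Sum>k<q. Qi i k * R4 k i c d u)" for c d u
  have CL: "C1b q \<rho> L L1" and CL1: "c < q \<Longrightarrow> C1b q \<rho> (L1 c) (L2 c)" for c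
    unfolding L_def[abs_def] L1_def[abs_def] L2_def[abs_def] by (intro C1b_sum2 C2 C3; assumption)+
  have \<rho>: "0 < \<rho>" "2 * r \<le> \<rho>" using r by auto
  have L1_bd: "nm q (\<lambda>c. L1 c v) \<le> real q * B" if v: "v \<in> ob q \<rho>" for v
  proof (rule nm_le_if_dual)
    fix y
    have "ip q (\<lambda>c. L1 c v) y = (\<Sum>c<q. \<Sum>i<q. \<Sum>k<q. Qi i k * R3 k i c v * y c)"
      by (simp add: ip_def L1_def sum_distrib_right)
    \<comment> \<open>The sums are regrouped so that the row index \<open>i\<close> of the
      covariance matrix selects the slice; each of the \<open>q\<close> slices then pairs a row of
      norm at most \<open>1 / \<kappa>\<close> with \<open>y\<close>.\<close>
    also have "\<dots> = (\<Sum>i<q. \<Sum>c<q. \<Sum>k<q. Qi i k * R3 k i c v * y c)" by (rule sum.swap)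
    also have "\<dots> = (\<Sum>i<q. \<Sum>k<q. \<Sum>c<q. Qi i k * R3 k i c v * y c)" by (intro sum.cong refl sum.swap)
    also have "\<dots> = (\<Sum>i<q. bil q (\<lambda>k c. R3 k c i v) (Qi i) y)"
      unfolding bil_def by (intro sum.cong refl) (simp add: sym3(2)[OF v] mult_ac)
    also have "\<bar>\<dots>\<bar> \<le> real q * (B * nm q y)"
    proof (rule abs_sum_le_card)
      fix i assume i: "i < q"
      have "\<bar>bil q (\<lambda>k c. R3 k c i v) (Qi i) y\<bar> \<le> B * \<kappa> * nm q (Qi i) * nm q y"
        by (rule slice3[OF v i])
      also have "\<dots> \<le> B * \<kappa> * (1 / \<kappa>) * nm q y"
        using pars by (intro mult_right_mono mult_left_mono nm_Qi_le i) (auto simp: L2_set_nonneg)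
      finally show "\<bar>bil q (\<lambda>k c. R3 k c i v) (Qi i) y\<bar> \<le> B * nm q y" using kappa_pos by simp
    qed
    finally show "\<bar>ip q (\<lambda>c. L1 c v) y\<bar> \<le> real q * B * nm q y" by (simp add: mult_ac)
  qed (use pars in simp)
  have L2_bd: "\<bar>trQ L2 v\<bar> \<le> (real q)\<^sup>2 * B / \<kappa>" if v: "v \<in> ob q \<rho>" for v
  proof -
    have "trQ L2 v = (\<Sum>d<q. \<Sum>c<q. \<Sum>i<q. \<Sum>k<q. Qi d c * (Qi i k * R4 k i c d v))"
      by (simp add: trQ_def L2_def sum_distrib_left)
    also have "\<dots> = (\<Sum>d<q. \<Sum>i<q. \<Sum>c<q. \<Sum>k<q. Qi d c * (Qi i k * R4 k i c d v))"
      by (intro sum.cong refl sum.swap)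
    also have "\<dots> = (\<Sum>d<q. \<Sum>i<q. \<Sum>k<q. \<Sum>c<q. Qi d c * (Qi i k * R4 k i c d v))"
      by (intro sum.cong refl sum.swap)
    also have "\<dots> = (\<Sum>d<q. \<Sum>i<q. bil q (\<lambda>k c. R4 k c i d v) (Qi i) (Qi d))"
      unfolding bil_def by (intro sum.cong refl) (simp add: sym4(2)[OF v] mult_ac)
    also have "\<bar>\<dots>\<bar> \<le> real q * (real q * (B / \<kappa>))"
    proof (intro abs_sum_le_card)
      fix d i assume di: "d < q" "i < q"
      have "\<bar>bil q (\<lambda>k c. R4 k c i d v) (Qi i) (Qi d)\<bar> \<le> B * \<kappa> * nm q (Qi i) * nm q (Qi d)"
        by (rule slice4[OF v di(2,1)])
      also have "\<dots> \<le> B * \<kappa> * (1 / \<kappa>) * (1 / \<kappa>)"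
        using pars by (intro mult_mono nm_Qi_le di) (auto simp: L2_set_nonneg)
      finally show "\<bar>bil q (\<lambda>k c. R4 k c i d v) (Qi i) (Qi d)\<bar> \<le> B / \<kappa>" using kappa_pos by simp
    qed
    finally show ?thesis by (simp add: power2_eq_square)
  qed
  define X where "X = (real q)\<^sup>2 * B / \<kappa>"
  have X: "0 \<le> X" using pars by (simp add: X_def)
  have sS: "(\<lambda>k. s * v k) \<in> ob q \<rho>" if "v \<in> ob q \<rho>" for v
    by (rule ob_scale[OF that]) (use s in auto)
  have "\<bar>(\<integral>u. bump q r u * L (\<lambda>k. s * u k) \<partial>G) - L (\<lambda>k. s * 0) * (\<integral>u. bump q r u \<partial>G)\<bar>
      \<le> X + 16 / (r * \<kappa>) * (real q * B) * \<tau>"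
  proof (rule cutoff_mean_bound[OF C1b_scale[OF CL s \<rho>(1)] C1b_cmult[OF C1b_scale[OF CL1 s \<rho>(1)]] r(1) \<rho>(2)])
    fix t :: real assume t: "0 \<le> t" "t \<le> 1"
    show "\<bar>\<integral>u. bump q r u * trQ (\<lambda>i a u. s * (s * L2 i a (\<lambda>k. s * u k))) (\<lambda>k. t * u k) \<partial>G\<bar> \<le> X"
    proof (rule bump_integral_le[OF r(1) \<rho>(2)])
      fix u assume u: "u \<in> ob q \<rho>"
      have tS: "(\<lambda>k. t * u k) \<in> ob q \<rho>" by (rule ob_scale[OF u]) (use t in auto)
      have "trQ (\<lambda>i a u. s * (s * L2 i a (\<lambda>k. s * u k))) (\<lambda>k. t * u k) = (s * s) * trQ L2 (\<lambda>k. s * (t * u k))"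
        by (simp add: trQ_def sum_distrib_left mult_ac)
      also have "\<bar>\<dots>\<bar> \<le> (1 * 1) * X"
        unfolding abs_mult X_def using s by (intro mult_mono L2_bd sS[OF tS]) (auto simp: mult_le_one)
      finally show "\<bar>trQ (\<lambda>i a u. s * (s * L2 i a (\<lambda>k. s * u k))) (\<lambda>k. t * u k)\<bar> \<le> X" by simp
    qed (rule X)
  next
    fix u assume u: "u \<in> ob q \<rho>"
    have "nm q (\<lambda>j. s * L1 j (\<lambda>k. s * u k)) \<le> 1 * (real q * B)"
      unfolding nm_scale using s by (intro mult_mono L1_bd sS[OF u]) (auto simp: L2_set_nonneg)
    then show "nm q (\<lambda>j. s * L1 j (\<lambda>k. s * u k)) \<le> real q * B" by simp
  qed (use \<tau>(1) in auto)
  moreover have "L (\<lambda>k. s * 0) = 0" by (simp add: L_def zero)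
  \<comment> \<open>The bound \<open>\<tau> \<le> r\<close> absorbs the factor \<open>1 / r\<close>
    from the gradient of the cutoff.\<close>
  moreover have "16 / (r * \<kappa>) * (real q * B) * \<tau> \<le> 16 * X"
  proof -
    have "16 / (r * \<kappa>) * (real q * B) * \<tau> \<le> 16 / (r * \<kappa>) * (real q * B) * r"
      using \<tau>_bounds r pars by (intro mult_left_mono) auto
    also have "\<dots> = 16 * (real q * B / \<kappa>)" using r by simp
    also have "\<dots> \<le> 16 * X"
      unfolding X_def using sqrt_q_le pars by (intro mult_left_mono divide_right_mono mult_right_mono) auto
    finally show ?thesis .
  qed
  ultimately show ?thesis
    by (simp add: X_def[symmetric] L_def trQ_def)
qed

lemma mean_R: "\<bar>\<integral>u. bump q r u * R u \<partial>G\<bar> \<le> 5000 * ((real q)\<^sup>2 * B / \<kappa>)"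
proof -
  have \<rho>: "0 < \<rho>" "2 * r \<le> \<rho>" using r by auto
  define X where "X = (real q)\<^sup>2 * B / \<kappa>"
  have X: "0 \<le> X" using pars by (simp add: X_def)
  have "\<bar>(\<integral>u. bump q r u * R u \<partial>G) - R (\<lambda>_. 0) * (\<integral>u. bump q r u \<partial>G)\<bar>
      \<le> 17 * X + 16 / (r * \<kappa>) * (256 * real q * r\<^sup>2 * (B * \<kappa>)) * \<tau>"
  proof (rule cutoff_mean_bound[OF C0 C1 r(1) \<rho>(2)])
    show "\<bar>\<integral>u. bump q r u * trQ R2 (\<lambda>k. s * u k) \<partial>G\<bar> \<le> 17 * X" if "0 \<le> s" "s \<le> 1" for s
      unfolding X_def by (rule mean_L[OF that])
    fix u assume u: "u \<in> ob q \<rho>"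
    show "nm q (\<lambda>j. R1 j u) \<le> 256 * real q * r\<^sup>2 * (B * \<kappa>)"
    proof (rule nm_le_if_dual)
      fix y
      have "\<bar>ip q (\<lambda>j. R1 j u) y\<bar> = \<bar>ip q y (\<lambda>j. R1 j u)\<bar>" by (simp add: ip_def mult.commute)
      also have "\<dots> \<le> sqrt (real q) * (nm q u)\<^sup>2 * (B * \<kappa> * nm q y)" by (rule R1_bound[OF u])
      also have "\<dots> \<le> real q * (16 * r)\<^sup>2 * (B * \<kappa> * nm q y)"
        using u r sqrt_q_le pars
        by (intro mult_right_mono mult_mono power_mono) (auto simp: ob_def L2_set_nonneg)
      also have "\<dots> = 256 * real q * r\<^sup>2 * (B * \<kappa>) * nm q y"
        by (simp add: power_mult_distrib mult_ac)
      finally show "\<bar>ip q (\<lambda>j. R1 j u) y\<bar> \<le> 256 * real q * r\<^sup>2 * (B * \<kappa>) * nm q y" .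
    qed (use pars in simp)
  qed (use \<tau>(1) in auto)
  \<comment> \<open>The bound for the gradient of \<open>R\<close> on the ball contains a factor
    \<kappa>, which \<open>\<tau> \<le> 1 / \<kappa>\<close> compensates together with
    \<open>1 / \<kappa>\<close> from the covariance. The coefficient is 4096 = 16 * 256, and with
    the 17 of the trace term it stays below 5000.\<close>
  moreover have "16 / (r * \<kappa>) * (256 * real q * r\<^sup>2 * (B * \<kappa>)) * \<tau> \<le> 4096 * X"
  proof -
    have "16 / (r * \<kappa>) * (256 * real q * r\<^sup>2 * (B * \<kappa>)) * \<tau> = 4096 * (real q * B) * (r * \<tau>)"
      using r kappa_pos by (simp add: power2_eq_square)
    also have "\<dots> \<le> 4096 * ((real q)\<^sup>2 * B) * (1 * (1 / \<kappa>))"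
      using r \<tau> \<tau>_bounds sqrt_q_le pars by (intro mult_mono) auto
    finally show ?thesis by (simp add: X_def)
  qed
  ultimately show ?thesis using X zero(1) by (simp add: X_def[symmetric])
qed

text \<open>The cutoff radius is \<open>2 * r\<close>, since this mean appears after the first
  decoupling. A mean gradient of norm of order q B is good enough, because its square enters divided
  by \<kappa>.\<close>

lemma mean_R1: "\<bar>\<integral>u. bump q (2 * r) u * ip q \<xi> (\<lambda>a. R1 a u) \<partial>G\<bar> \<le> 129 * (real q * B * nm q \<xi>)"
proof -
  have \<rho>: "0 < \<rho>" "0 < 2 * r" "2 * (2 * r) \<le> \<rho>" using r by auto
  define X where "X = real q * B * nm q \<xi>"
  have X: "0 \<le> X" using pars by (simp add: X_def L2_set_nonneg)
  have "\<bar>(\<integral>u. bump q (2 * r) u * ip q \<xi> (\<lambda>a. R1 a u) \<partial>G) - ip q \<xi> (\<lambda>a. R1 a (\<lambda>_. 0)) * (\<integral>u. bump q (2 * r) u \<partial>G)\<bar>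
      \<le> X + 16 / (2 * r * \<kappa>) * (16 * real q * r * (B * \<kappa> * nm q \<xi>)) * \<tau>"
  proof (rule cutoff_mean_bound[OF C1b_ip[OF C1] C1b_ip[OF C2] \<rho>(2,3)])
    fix s :: real assume s: "0 \<le> s" "s \<le> 1"
    show "\<bar>\<integral>u. bump q (2 * r) u * trQ (\<lambda>i a u. ip q \<xi> (\<lambda>b. R3 b i a u)) (\<lambda>k. s * u k) \<partial>G\<bar> \<le> X"
    proof (rule bump_integral_le[OF \<rho>(2,3)])
      fix u assume u: "u \<in> ob q \<rho>"
      define v where "v = (\<lambda>k. s * u k)"
      have v: "v \<in> ob q \<rho>" unfolding v_def by (rule ob_scale[OF u]) (use s in auto)
      have "trQ (\<lambda>i a u. ip q \<xi> (\<lambda>b. R3 b i a u)) v = (\<Sum>i<q. \<Sum>j<q. \<Sum>b<q. Qi i j * (\<xi> b * R3 b j i v))"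
        by (simp add: trQ_def ip_def sum_distrib_left)
      also have "\<dots> = (\<Sum>i<q. \<Sum>b<q. \<Sum>j<q. Qi i j * (\<xi> b * R3 b j i v))" by (intro sum.cong refl sum.swap)
      also have "\<dots> = (\<Sum>i<q. bil q (\<lambda>b j. R3 b j i v) \<xi> (Qi i))"
        unfolding bil_def by (simp add: mult_ac)
      also have "\<bar>\<dots>\<bar> \<le> real q * (B * nm q \<xi>)"
      proof (rule abs_sum_le_card)
        fix i assume i: "i < q"
        have "\<bar>bil q (\<lambda>b j. R3 b j i v) \<xi> (Qi i)\<bar> \<le> B * \<kappa> * nm q \<xi> * nm q (Qi i)"
          by (rule slice3[OF v i])
        also have "\<dots> \<le> B * \<kappa> * nm q \<xi> * (1 / \<kappa>)"
          using pars by (intro mult_left_mono nm_Qi_le i) (auto simp: L2_set_nonneg)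
        finally show "\<bar>bil q (\<lambda>b j. R3 b j i v) \<xi> (Qi i)\<bar> \<le> B * nm q \<xi>" using kappa_pos by simp
      qed
      finally show "\<bar>trQ (\<lambda>i a u. ip q \<xi> (\<lambda>b. R3 b i a u)) (\<lambda>k. s * u k)\<bar> \<le> X"
        by (simp add: X_def v_def mult_ac)
    qed (rule X)
  next
    fix u assume u: "u \<in> ob q \<rho>"
    show "nm q (\<lambda>j. ip q \<xi> (\<lambda>b. R2 b j u)) \<le> 16 * real q * r * (B * \<kappa> * nm q \<xi>)"
    proof (rule nm_le_if_dual)
      fix y
      have "ip q (\<lambda>j. ip q \<xi> (\<lambda>b. R2 b j u)) y = bil q (\<lambda>b j. R2 b j u) \<xi> y"
        by (rule ip_ip_eq_bil)
      also have "\<bar>\<dots>\<bar> \<le> sqrt (real q) * nm q u * (B * \<kappa> * nm q \<xi> * nm q y)" by (rule R2_bound[OF u])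
      also have "\<dots> \<le> real q * (16 * r) * (B * \<kappa> * nm q \<xi> * nm q y)"
        using u r sqrt_q_le pars
        by (intro mult_right_mono mult_mono) (auto simp: ob_def L2_set_nonneg)
      finally show "\<bar>ip q (\<lambda>j. ip q \<xi> (\<lambda>b. R2 b j u)) y\<bar> \<le> 16 * real q * r * (B * \<kappa> * nm q \<xi>) * nm q y"
        by (simp add: mult_ac)
    qed (use pars r in \<open>simp add: L2_set_nonneg\<close>)
  qed (use tail_mono r in auto)
  moreover have "16 / (2 * r * \<kappa>) * (16 * real q * r * (B * \<kappa> * nm q \<xi>)) * \<tau> \<le> 128 * X"
  proof -
    have "16 / (2 * r * \<kappa>) * (16 * real q * r * (B * \<kappa> * nm q \<xi>)) * \<tau> = 128 * X * \<tau>"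
      using r kappa_pos by (simp add: X_def)
    also have "\<dots> \<le> 128 * X * 1" using \<tau>_bounds X by (intro mult_left_mono) auto
    finally show ?thesis by simp
  qed
  ultimately show ?thesis using X by (simp add: X_def[symmetric] ip_def zero)
qed

text \<open>The mean that appears after the second decoupling, hence the cutoff radius
  \<open>4 * r\<close>. One integration by parts leads to slices of the fourth derivative; the
  result bounds the norm of a row of the mean Hessian.\<close>

lemma mean_R2:
  assumes j: "j < q"
  shows "\<bar>\<integral>u. bump q (4 * r) u * ip q y (\<lambda>l. R2 j l u) \<partial>G\<bar> \<le> 5 * (real q * B * nm q y)"
proof -
  have \<rho>: "0 < \<rho>" "0 < 4 * r" "2 * (4 * r) \<le> \<rho>" using r by auto
  define X where "X = real q * B * nm q y"
  have X: "0 \<le> X" using pars by (simp add: X_def L2_set_nonneg)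
  have "\<bar>(\<integral>u. bump q (4 * r) u * ip q y (\<lambda>l. R2 j l u) \<partial>G) - ip q y (\<lambda>l. R2 j l (\<lambda>_. 0)) * (\<integral>u. bump q (4 * r) u \<partial>G)\<bar>
      \<le> X + 16 / (4 * r * \<kappa>) * (B * \<kappa> * nm q y) * \<tau>"
  proof (rule cutoff_mean_bound[OF C1b_ip[OF C2[OF j]] C1b_ip[OF C3[OF j]] \<rho>(2,3)])
    fix s :: real assume s: "0 \<le> s" "s \<le> 1"
    show "\<bar>\<integral>u. bump q (4 * r) u * trQ (\<lambda>k a u. ip q y (\<lambda>l. R4 j l k a u)) (\<lambda>k. s * u k) \<partial>G\<bar> \<le> X"
    proof (rule bump_integral_le[OF \<rho>(2,3)])
      fix u assume u: "u \<in> ob q \<rho>"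
      define v where "v = (\<lambda>k. s * u k)"
      have v: "v \<in> ob q \<rho>" unfolding v_def by (rule ob_scale[OF u]) (use s in auto)
      have "trQ (\<lambda>k a u. ip q y (\<lambda>l. R4 j l k a u)) v = (\<Sum>i<q. \<Sum>k<q. \<Sum>l<q. Qi i k * (y l * R4 j l k i v))"
        by (simp add: trQ_def ip_def sum_distrib_left)
      also have "\<dots> = (\<Sum>i<q. \<Sum>l<q. \<Sum>k<q. Qi i k * (y l * R4 j l k i v))" by (intro sum.cong refl sum.swap)
      also have "\<dots> = (\<Sum>i<q. bil q (\<lambda>l k. R4 l k j i v) y (Qi i))"
        unfolding bil_def
        by (intro sum.cong refl) (simp add: sym4(1)[OF v j] sym4(2)[OF v _ j] mult_ac)
      also have "\<bar>\<dots>\<bar> \<le> real q * (B * nm q y)"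
      proof (rule abs_sum_le_card)
        fix i assume i: "i < q"
        have "\<bar>bil q (\<lambda>l k. R4 l k j i v) y (Qi i)\<bar> \<le> B * \<kappa> * nm q y * nm q (Qi i)"
          by (rule slice4[OF v j i])
        also have "\<dots> \<le> B * \<kappa> * nm q y * (1 / \<kappa>)"
          using pars by (intro mult_left_mono nm_Qi_le i) (auto simp: L2_set_nonneg)
        finally show "\<bar>bil q (\<lambda>l k. R4 l k j i v) y (Qi i)\<bar> \<le> B * nm q y" using kappa_pos by simp
      qed
      finally show "\<bar>trQ (\<lambda>k a u. ip q y (\<lambda>l. R4 j l k a u)) (\<lambda>k. s * u k)\<bar> \<le> X"
        by (simp add: X_def v_def mult_ac)
    qed (rule X)
  next
    fix u assume u: "u \<in> ob q \<rho>"
    show "nm q (\<lambda>k. ip q y (\<lambda>l. R3 j l k u)) \<le> B * \<kappa> * nm q y"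
    proof (rule nm_le_if_dual)
      fix z
      have "ip q (\<lambda>k. ip q y (\<lambda>l. R3 j l k u)) z = bil q (\<lambda>l k. R3 j l k u) y z"
        by (rule ip_ip_eq_bil)
      also have "\<dots> = bil q (\<lambda>l k. R3 l k j u) y z"
        by (rule bil_cong) (simp add: sym3(1)[OF u j] sym3(2)[OF u _ j])
      also have "\<bar>\<dots>\<bar> \<le> B * \<kappa> * nm q y * nm q z" by (rule slice3[OF u j])
      finally show "\<bar>ip q (\<lambda>k. ip q y (\<lambda>l. R3 j l k u)) z\<bar> \<le> B * \<kappa> * nm q y * nm q z" .
    qed (use pars in \<open>simp add: L2_set_nonneg\<close>)
  qed (use tail_mono r in auto)
  moreover have "16 / (4 * r * \<kappa>) * (B * \<kappa> * nm q y) * \<tau> \<le> 4 * X"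
  proof -
    have "16 / (4 * r * \<kappa>) * (B * \<kappa> * nm q y) * \<tau> = 4 * (1 * B * nm q y) * (\<tau> / r)"
      using r kappa_pos by (simp add: field_simps)
    also have "\<dots> \<le> 4 * (real q * B * nm q y) * 1"
      using \<tau>_bounds pars r by (intro mult_mono) (auto simp: L2_set_nonneg)
    finally show ?thesis by (simp add: X_def)
  qed
  ultimately show ?thesis using X j by (simp add: X_def[symmetric] ip_def zero)
qed

end

section \<open>Exponential moments at the three levels of decoupling\<close>

context laplace_core
begin

lemma R_measurable [measurable]: "R \<in> borel_measurable borel"
  and R1_measurable [measurable]: "a < q \<Longrightarrow> R1 a \<in> borel_measurable borel"
  and R2_measurable [measurable]: "a < q \<Longrightarrow> b < q \<Longrightarrow> R2 a b \<in> borel_measurable borel"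
  and R3_measurable [measurable]: "a < q \<Longrightarrow> b < q \<Longrightarrow> c < q \<Longrightarrow> R3 a b c \<in> borel_measurable borel"
  using C0 C1 C2 C3 by (auto simp: C1b_def)

definition X :: real where "X = 3000000 * B\<^sup>2 * (real q)\<^sup>2 / \<kappa>"

lemma X_bounds: "0 \<le> X" "X \<le> 1"
  using small(2) pars by (auto simp: X_def)

lemma le_X: "0 \<le> c \<Longrightarrow> c \<le> 3000000 \<Longrightarrow> c * (B\<^sup>2 * (real q)\<^sup>2 / \<kappa>) \<le> X"
  unfolding X_def using pars mult_right_mono[of c 3000000 "B\<^sup>2 * (real q)\<^sup>2 / \<kappa>"] by simp

abbreviation cl :: "real \<Rightarrow> (nat \<Rightarrow> real) \<Rightarrow> real" where
  "cl t \<equiv> indicator {u. nm q u \<le> t}"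

definition mass :: "real \<Rightarrow> real" where "mass t = (\<integral>u. bump q t u \<partial>G)"

lemma mass: "r \<le> t \<Longrightarrow> 1 - \<tau> \<le> mass t" "r \<le> t \<Longrightarrow> mass t \<le> 1" "r \<le> t \<Longrightarrow> 1 / 2 \<le> mass t" "r \<le> t \<Longrightarrow> 0 < mass t"
proof -
  assume t: "r \<le> t"
  then have "0 < t" using r by simp
  from bump_mass[OF this tail_mono[OF t]] show "1 - \<tau> \<le> mass t" "mass t \<le> 1" by (auto simp: mass_def)
  then show "1 / 2 \<le> mass t" using \<tau>_bounds by linarith
  then show "0 < mass t" by linarith
qed

lemma pi_powers: "pi\<^sup>2 \<le> 16" "(pi ^ 3)\<^sup>2 \<le> 4096"
proof -
  have "pi \<le> 4" using pi_less_4 by simp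
  then have "pi\<^sup>2 \<le> 4\<^sup>2" "(pi ^ 3)\<^sup>2 \<le> (4 ^ 3)\<^sup>2" by (intro power_mono; simp)+
  then show "pi\<^sup>2 \<le> 16" "(pi ^ 3)\<^sup>2 \<le> 4096" by simp_all
qed

text \<open>Every decoupling multiplies the derivative by \<open>pi\<close>, so the third derivative
  arrives with \<open>pi ^ 3\<close>.\<close>

definition E3 :: "(nat \<Rightarrow> real) \<Rightarrow> (nat \<Rightarrow> real) \<Rightarrow> (nat \<Rightarrow> real) \<Rightarrow> (nat \<Rightarrow> real) \<Rightarrow> real" where
  "E3 u v w x = (\<Sum>a<q. v a * bil q (\<lambda>b c. pi ^ 3 * R3 a b c u) w x)"

lemma E3_measurable [measurable (raw)]:
  assumes [measurable]: "f \<in> borel_measurable M" "g \<in> borel_measurable M" "h \<in> borel_measurable M" "k \<in> borel_measurable M"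
  shows "(\<lambda>x. E3 (f x) (g x) (h x) (k x)) \<in> borel_measurable M"
  unfolding E3_def bil_def by measurable

text \<open>The base point \<open>u\<close> of the third derivative is fixed first, because the
  estimate for trilinear forms is uniform in it. The restriction of \<open>v\<close> is the one
  which that estimate requires.\<close>

lemma third_order:
  "(\<integral>\<^sup>+u. ennreal (cl (8 * r) u) * (\<integral>\<^sup>+v. ennreal (cl (2 * r) v) *
      (\<integral>\<^sup>+w. \<integral>\<^sup>+x. ennreal (exp (E3 u v w x)) \<partial>G \<partial>G) \<partial>G) \<partial>G) \<le> ennreal (exp X)"
proof -
  have "(\<integral>\<^sup>+u. ennreal (cl (8 * r) u) * (\<integral>\<^sup>+v. ennreal (cl (2 * r) v) *
      (\<integral>\<^sup>+w. \<integral>\<^sup>+x. ennreal (exp (E3 u v w x)) \<partial>G \<partial>G) \<partial>G) \<partial>G) \<le> (\<integral>\<^sup>+u. ennreal (exp X) \<partial>G)"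
  proof (rule nn_integral_mono)
    fix u
    show "ennreal (cl (8 * r) u) * (\<integral>\<^sup>+v. ennreal (cl (2 * r) v) *
      (\<integral>\<^sup>+w. \<integral>\<^sup>+x. ennreal (exp (E3 u v w x)) \<partial>G \<partial>G) \<partial>G) \<le> ennreal (exp X)"
    proof (cases "nm q u \<le> 8 * r")
      case True
      then have u: "u \<in> ob q \<rho>" using r by (simp add: ob_def)
      define L where "L = pi ^ 3 * (B * \<kappa>)"
      have L2: "L\<^sup>2 \<le> 4096 * (B\<^sup>2 * \<kappa>\<^sup>2)"
        unfolding L_def power_mult_distrib using pi_powers by (intro mult_right_mono) auto
      have "(\<integral>\<^sup>+v. ennreal (cl (2 * r) v) * (\<integral>\<^sup>+w. \<integral>\<^sup>+x. ennreal (exp (E3 u v w x)) \<partial>G \<partial>G) \<partial>G)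
        \<le> ennreal (exp (2 * (real q)\<^sup>2 * L\<^sup>2 / \<kappa> ^ 3))"
        unfolding E3_def
      proof (rule exp_trilinear_le)
        fix a x y assume a: "a < q"
        have "bil q (\<lambda>b c. pi ^ 3 * R3 a b c u) x y = pi ^ 3 * bil q (\<lambda>b c. R3 a b c u) x y"
          by (simp add: bil_def sum_distrib_left mult_ac)
        also have "bil q (\<lambda>b c. R3 a b c u) x y = bil q (\<lambda>b c. R3 b c a u) x y"
          by (rule bil_cong) (simp add: sym3(1)[OF u a] sym3(2)[OF u _ a])
        also have "\<bar>pi ^ 3 * \<dots>\<bar> \<le> pi ^ 3 * (B * \<kappa> * nm q x * nm q y)"
          unfolding abs_mult by (intro mult_mono slice3 u a) auto
        finally show "\<bar>bil q (\<lambda>b c. pi ^ 3 * R3 a b c u) x y\<bar> \<le> L * nm q x * nm q y"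
          by (simp add: L_def mult_ac)
      next
        show "0 \<le> L" unfolding L_def using pars by simp
        have "real q * (2 * r)\<^sup>2 * L\<^sup>2 \<le> real q * (2 * r)\<^sup>2 * (4096 * (B\<^sup>2 * \<kappa>\<^sup>2))"
          using L2 by (intro mult_left_mono) auto
        also have "\<dots> = (16384 * (real q * r\<^sup>2 * B\<^sup>2)) * \<kappa>\<^sup>2" by (simp add: power_mult_distrib)
        also have "\<dots> \<le> (1 / 2) * \<kappa>\<^sup>2"
        proof (intro mult_right_mono)
          have "0 \<le> real q * r\<^sup>2 * B\<^sup>2" by simp
          then show "16384 * (real q * r\<^sup>2 * B\<^sup>2) \<le> 1 / 2" using small(1) by simp
        qed simp
        finally show "real q * (2 * r)\<^sup>2 * L\<^sup>2 \<le> \<kappa>\<^sup>2 / 2" by simp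
        have "(real q)\<^sup>2 * L\<^sup>2 \<le> (real q)\<^sup>2 * (4096 * (B\<^sup>2 * \<kappa>\<^sup>2))"
          using L2 by (intro mult_left_mono) auto
        also have "\<dots> = (4096 * (B\<^sup>2 * (real q)\<^sup>2 / \<kappa>)) * \<kappa> ^ 3"
          using kappa_pos by (simp add: power2_eq_square power3_eq_cube)
        also have "\<dots> \<le> (1 / 4) * \<kappa> ^ 3"
        proof (intro mult_right_mono)
          show "4096 * (B\<^sup>2 * (real q)\<^sup>2 / \<kappa>) \<le> 1 / 4"
            using le_X[of 16384] X_bounds by simp
        qed (use kappa_pos in simp)
        finally show "(real q)\<^sup>2 * L\<^sup>2 \<le> \<kappa> ^ 3 / 4" by simp
      qed (use r in auto)
      also have "\<dots> \<le> ennreal (exp X)"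
      proof (intro ennreal_leI, subst exp_le_cancel_iff)
        have "2 * (real q)\<^sup>2 * L\<^sup>2 / \<kappa> ^ 3 \<le> 2 * (real q)\<^sup>2 * (4096 * (B\<^sup>2 * \<kappa>\<^sup>2)) / \<kappa> ^ 3"
          using L2 kappa_pos by (intro divide_right_mono mult_left_mono) auto
        also have "\<dots> = 8192 * (B\<^sup>2 * (real q)\<^sup>2 / \<kappa>)"
          using kappa_pos by (simp add: power2_eq_square power3_eq_cube)
        also have "\<dots> \<le> X" by (rule le_X) auto
        finally show "2 * (real q)\<^sup>2 * L\<^sup>2 / \<kappa> ^ 3 \<le> X" .
      qed
      finally show ?thesis using True by simp
    qed simp
  qed
  then show ?thesis by (simp add: G.emeasure_space_1[simplified])
qed

definition M2 :: "nat \<Rightarrow> nat \<Rightarrow> real" where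
  "M2 j l = pi\<^sup>2 * (\<integral>u. bump q (4 * r) u * R2 j l u \<partial>G)"

lemma mean_second: "(\<integral>u. bump q (4 * r) u * (pi\<^sup>2 * bil q (\<lambda>j l. R2 j l u) v w) \<partial>G) = bil q M2 v w"
proof -
  have int: "integrable G (\<lambda>u. bump q (4 * r) u * R2 j l u)" if "j < q" "l < q" for j l
    by (rule C1b_bump_integrable[OF C2[OF that]]) (use r in auto)
  have "(\<integral>u. bump q (4 * r) u * (pi\<^sup>2 * bil q (\<lambda>j l. R2 j l u) v w) \<partial>G)
      = (\<integral>u. (\<Sum>j<q. \<Sum>l<q. (pi\<^sup>2 * v j * w l) * (bump q (4 * r) u * R2 j l u)) \<partial>G)"
    by (simp add: bil_def sum_distrib_left mult_ac)
  also have "\<dots> = (\<Sum>j<q. \<Sum>l<q. (pi\<^sup>2 * v j * w l) * (\<integral>u. bump q (4 * r) u * R2 j l u \<partial>G))"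
    using int by (subst Bochner_Integration.integral_sum, force, intro sum.cong refl,
        subst Bochner_Integration.integral_sum) auto
  also have "\<dots> = bil q M2 v w"
    unfolding bil_def M2_def by (intro sum.cong refl) (simp add: mult_ac)
  finally show ?thesis .
qed

text \<open>There are \<open>q\<close> rows of norm of order q B, which makes q^3 B^2; the third
  factor q is absorbed by \<open>real q \<le> \<kappa>\<close>. The factor \<open>c\<close> stands
  for \<open>2 / mass (4 * r)\<close>, which is at most 4 because the mass is at least one
  half.\<close>

lemma M2_frobenius:
  assumes c: "0 \<le> c" "c \<le> 4"
  shows "(\<Sum>i<q. \<Sum>j<q. (c * M2 i j)\<^sup>2) \<le> X / 4 * \<kappa>\<^sup>2"
proof -
  have row: "nm q (M2 i) \<le> 80 * (real q * B)" if i: "i < q" for i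
  proof (rule nm_le_if_dual)
    fix y
    have int: "integrable G (\<lambda>u. bump q (4 * r) u * R2 i l u)" if "l < q" for l
      by (rule C1b_bump_integrable[OF C2[OF i that]]) (use r in auto)
    have "(\<integral>u. bump q (4 * r) u * ip q y (\<lambda>l. R2 i l u) \<partial>G)
        = (\<integral>u. (\<Sum>l<q. y l * (bump q (4 * r) u * R2 i l u)) \<partial>G)"
      by (simp add: ip_def sum_distrib_left mult_ac)
    also have "\<dots> = (\<Sum>l<q. y l * (\<integral>u. bump q (4 * r) u * R2 i l u \<partial>G))"
      using int by (subst Bochner_Integration.integral_sum) auto
    finally have "ip q (M2 i) y = pi\<^sup>2 * (\<integral>u. bump q (4 * r) u * ip q y (\<lambda>l. R2 i l u) \<partial>G)"
      by (simp add: ip_def M2_def sum_distrib_left mult_ac)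
    also have "\<bar>\<dots>\<bar> \<le> 16 * (5 * (real q * B * nm q y))"
      unfolding abs_mult using pi_powers by (intro mult_mono mean_R2 i) auto
    finally show "\<bar>ip q (M2 i) y\<bar> \<le> 80 * (real q * B) * nm q y" by simp
  qed (use pars in simp)
  have "(\<Sum>i<q. \<Sum>j<q. (c * M2 i j)\<^sup>2) = (\<Sum>i<q. c\<^sup>2 * (nm q (M2 i))\<^sup>2)"
    unfolding nm_sq by (simp add: ip_def sum_distrib_left power2_eq_square mult_ac)
  also have "\<dots> \<le> (\<Sum>i<q. 4\<^sup>2 * (80 * (real q * B))\<^sup>2)"
    using c by (intro sum_mono mult_mono power_mono row) (auto simp: L2_set_nonneg)
  also have "\<dots> = (409600 / 4) * (B\<^sup>2 * (real q)\<^sup>2 / \<kappa>) * \<kappa> * real q"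
    using kappa_pos by (simp add: power2_eq_square mult_ac)
  also have "\<dots> \<le> (X / 4) * \<kappa> * \<kappa>"
    using le_X[of 409600] q_le_kappa kappa_pos X_bounds by (intro mult_mono) auto
  finally show ?thesis by (simp add: power2_eq_square)
qed

lemma mean_second_exp:
  "(\<integral>\<^sup>+v. \<integral>\<^sup>+w. ennreal (exp (2 * bil q M2 v w / mass (4 * r))) \<partial>G \<partial>G) \<le> ennreal (exp X)"
proof -
  define c where "c = 2 / mass (4 * r)"
  have c: "0 \<le> c" "c \<le> 4"
    using mass(3,4)[of "4 * r"] r by (auto simp: c_def field_simps)
  have "(\<integral>\<^sup>+v. \<integral>\<^sup>+w. ennreal (exp (bil q (\<lambda>i j. c * M2 i j) v w)) \<partial>G \<partial>G)
      \<le> ennreal (exp ((\<Sum>i<q. \<Sum>j<q. (c * M2 i j)\<^sup>2) / \<kappa>\<^sup>2))"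
  proof (rule exp_bilinear_frobenius_le)
    have "X / 4 * \<kappa>\<^sup>2 \<le> 1 / 2 * \<kappa>\<^sup>2" using X_bounds by (intro mult_right_mono) auto
    then show "(\<Sum>i<q. \<Sum>j<q. (c * M2 i j)\<^sup>2) \<le> \<kappa>\<^sup>2 / 2"
      using M2_frobenius[OF c] by simp
  qed
  also have "\<dots> \<le> ennreal (exp X)"
  proof (intro ennreal_leI, subst exp_le_cancel_iff)
    have "(\<Sum>i<q. \<Sum>j<q. (c * M2 i j)\<^sup>2) / \<kappa>\<^sup>2 \<le> X / 4 * \<kappa>\<^sup>2 / \<kappa>\<^sup>2"
      using M2_frobenius[OF c] by (intro divide_right_mono) auto
    also have "\<dots> = X / 4" using kappa_pos by simp
    finally show "(\<Sum>i<q. \<Sum>j<q. (c * M2 i j)\<^sup>2) / \<kappa>\<^sup>2 \<le> X" using X_bounds by linarith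
  qed
  finally have "(\<integral>\<^sup>+v. \<integral>\<^sup>+w. ennreal (exp (bil q (\<lambda>i j. c * M2 i j) v w)) \<partial>G \<partial>G) \<le> ennreal (exp X)" .
  moreover have "bil q (\<lambda>i j. c * M2 i j) v w = 2 * bil q M2 v w / mass (4 * r)" for v w
    by (simp add: bil_def c_def sum_distrib_left sum_divide_distrib mult_ac)
  ultimately show ?thesis by simp
qed

definition M1 :: "nat \<Rightarrow> real" where
  "M1 j = pi * (\<integral>u. bump q (2 * r) u * R1 j u \<partial>G)"

lemma mean_first: "(\<integral>u. bump q (2 * r) u * (pi * ip q v (\<lambda>a. R1 a u)) \<partial>G) = ip q M1 v"
proof -
  have int: "integrable G (\<lambda>u. bump q (2 * r) u * R1 j u)" if "j < q" for j
    by (rule C1b_bump_integrable[OF C1[OF that]]) (use r in auto)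
  have "(\<integral>u. bump q (2 * r) u * (pi * ip q v (\<lambda>a. R1 a u)) \<partial>G)
      = (\<integral>u. (\<Sum>j<q. (pi * v j) * (bump q (2 * r) u * R1 j u)) \<partial>G)"
    by (simp add: ip_def sum_distrib_left mult_ac)
  also have "\<dots> = (\<Sum>j<q. (pi * v j) * (\<integral>u. bump q (2 * r) u * R1 j u \<partial>G))"
    using int by (subst Bochner_Integration.integral_sum) auto
  also have "\<dots> = ip q M1 v"
    unfolding ip_def M1_def by (intro sum.cong refl) (simp add: mult_ac)
  finally show ?thesis .
qed

lemma mean_first_exp:
  "(\<integral>\<^sup>+v. ennreal (exp (2 * ip q M1 v / mass (2 * r))) \<partial>G) \<le> ennreal (exp X)"
proof -
  define c where "c = 2 / mass (2 * r)"
  have c: "0 \<le> c" "c \<le> 4"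
    using mass(3,4)[of "2 * r"] r by (auto simp: c_def field_simps)
  have M1: "nm q M1 \<le> 516 * (real q * B)"
  proof (rule nm_le_if_dual)
    fix y
    have "ip q M1 y = pi * (\<integral>u. bump q (2 * r) u * ip q y (\<lambda>a. R1 a u) \<partial>G)"
      unfolding mean_first[symmetric] by (simp add: mult.left_commute[of "bump _ _ _"])
    also have "\<bar>\<dots>\<bar> \<le> 4 * (129 * (real q * B * nm q y))"
      unfolding abs_mult using pi_less_4 by (intro mult_mono mean_R1) auto
    finally show "\<bar>ip q M1 y\<bar> \<le> 516 * (real q * B) * nm q y" by simp
  qed (use pars in simp)
  have "(\<integral>\<^sup>+v. ennreal (exp (ip q (\<lambda>i. c * M1 i) v)) \<partial>G) \<le> ennreal (exp ((nm q (\<lambda>i. c * M1 i))\<^sup>2 / (2 * \<kappa>)))"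
    by (rule mgf_le)
  also have "\<dots> \<le> ennreal (exp X)"
  proof (intro ennreal_leI, subst exp_le_cancel_iff)
    have "nm q (\<lambda>i. c * M1 i) \<le> 4 * (516 * (real q * B))"
      unfolding nm_scale using c M1 by (intro mult_mono) (auto simp: L2_set_nonneg)
    then have "(nm q (\<lambda>i. c * M1 i))\<^sup>2 / (2 * \<kappa>) \<le> (4 * (516 * (real q * B)))\<^sup>2 / (2 * \<kappa>)"
      using kappa_pos by (intro divide_right_mono power_mono) (auto simp: L2_set_nonneg)
    also have "\<dots> = 2130048 * (B\<^sup>2 * (real q)\<^sup>2 / \<kappa>)" by (simp add: power_mult_distrib)
    also have "\<dots> \<le> X" by (rule le_X) auto
    finally show "(nm q (\<lambda>i. c * M1 i))\<^sup>2 / (2 * \<kappa>) \<le> X" .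
  qed
  finally have "(\<integral>\<^sup>+v. ennreal (exp (ip q (\<lambda>i. c * M1 i) v)) \<partial>G) \<le> ennreal (exp X)" .
  moreover have "ip q (\<lambda>i. c * M1 i) v = 2 * ip q M1 v / mass (2 * r)" for v
    by (simp add: ip_def c_def sum_distrib_left sum_divide_distrib mult_ac)
  ultimately show ?thesis by simp
qed

text \<open>The factor one half from the arithmetic-geometric mean inequality meets two terms with
  the same bound, so a level of decoupling costs no more than a division by the mass of its
  cutoff.\<close>

lemma half_add_le:
  assumes "A \<le> ennreal (exp X)" "A' \<le> ennreal (exp X / d)" "0 < d" "d \<le> 1" "0 < a"
  shows "ennreal (1 / (2 * a)) * (A + A') \<le> ennreal (exp X / (a * d))"
proof -
  have "exp X \<le> exp X / d" using assms by (simp add: field_simps)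
  have "ennreal (1 / (2 * a)) * (A + A') \<le> ennreal (1 / (2 * a)) * (ennreal (exp X) + ennreal (exp X / d))"
    using assms by (intro mult_left_mono add_mono) auto
  also have "\<dots> = ennreal (1 / (2 * a) * (exp X + exp X / d))"
    using assms by (simp add: ennreal_mult[symmetric] ennreal_plus[symmetric] del: ennreal_plus)
  also have "\<dots> \<le> ennreal (1 / (2 * a) * (exp X / d + exp X / d))"
    using assms \<open>exp X \<le> exp X / d\<close> by (intro ennreal_leI mult_left_mono add_mono) auto
  also have "1 / (2 * a) * (exp X / d + exp X / d) = exp X / (a * d)"
    using assms by (simp add: field_simps)
  finally show ?thesis .
qed

text \<open>For fixed \<open>v\<close> and \<open>w\<close> the Hessian form is a function of
  \<open>u\<close> alone; decoupling it introduces \<open>x\<close> as a third direction and leads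
  to \<open>E3\<close>. Its mean is the bilinear form of \<open>M2\<close>, whose exponential moment
  has its own bound.\<close>

lemma second_order:
  "(\<integral>\<^sup>+v. ennreal (cl (2 * r) v) * (\<integral>\<^sup>+u. \<integral>\<^sup>+w. ennreal (cl (4 * r) u * cl (4 * r) w
      * exp (pi\<^sup>2 * bil q (\<lambda>j l. R2 j l u) v w)) \<partial>G \<partial>G) \<partial>G)
    \<le> ennreal (exp X / mass (4 * r))"
proof -
  interpret GG: pair_prob_space G G ..
  define a where "a = mass (4 * r)"
  have a: "0 < a" "a \<le> 1" using mass[of "4 * r"] r by (auto simp: a_def)
  define J where "J v w = (\<integral>\<^sup>+u. \<integral>\<^sup>+x. ennreal (cl (8 * r) u) * ennreal (exp (E3 u v w x)) \<partial>G \<partial>G)" for v w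
  have J_meas [measurable]: "(\<lambda>(v, w). J v w) \<in> borel_measurable (borel \<Otimes>\<^sub>M borel)"
    unfolding J_def by measurable
  have step: "(\<integral>\<^sup>+u. ennreal (cl (4 * r) u * exp (pi\<^sup>2 * bil q (\<lambda>j l. R2 j l u) v w)) \<partial>G)
      \<le> ennreal (1 / (2 * a)) * (ennreal (exp (2 * bil q M2 v w / a)) + J v w)" for v w
  proof -
    have C: "C1b q \<rho> (\<lambda>u. pi\<^sup>2 * bil q (\<lambda>j l. R2 j l u) v w) (\<lambda>i u. pi\<^sup>2 * bil q (\<lambda>j l. R3 j l i u) v w)"
      by (intro C1b_cmult C1b_bil C2)
    have "(\<integral>\<^sup>+u. ennreal (cl (4 * r) u * exp (pi\<^sup>2 * bil q (\<lambda>j l. R2 j l u) v w)) \<partial>G)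
      \<le> (\<integral>\<^sup>+u. ennreal (bump q (4 * r) u * exp (pi\<^sup>2 * bil q (\<lambda>j l. R2 j l u) v w)) \<partial>G)"
      using r bump_bounds bump_eq_1[of "4 * r"]
      by (intro nn_integral_mono ennreal_leI mult_right_mono) (auto simp: indicator_def)
    also have "\<dots> \<le> ennreal (1 / (2 * a)) * (ennreal (exp (2 * bil q M2 v w / a))
      + (\<integral>\<^sup>+u. \<integral>\<^sup>+x. ennreal (cl (2 * (4 * r)) u * cl (2 * (4 * r)) x
          * exp (pi * ip q (\<lambda>i. pi\<^sup>2 * bil q (\<lambda>j l. R3 j l i u) v w) x)) \<partial>G \<partial>G))"
      using exp_decoupling[OF C, of "4 * r" a "bil q M2 v w"] r a mean_second[of v w]
      by (simp add: a_def mass_def)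
    also have "\<dots> \<le> ennreal (1 / (2 * a)) * (ennreal (exp (2 * bil q M2 v w / a)) + J v w)"
      unfolding J_def
    proof (intro mult_left_mono add_left_mono nn_integral_mono)
      fix u x
      show "ennreal (cl (2 * (4 * r)) u * cl (2 * (4 * r)) x
          * exp (pi * ip q (\<lambda>i. pi\<^sup>2 * bil q (\<lambda>j l. R3 j l i u) v w) x))
        \<le> ennreal (cl (8 * r) u) * ennreal (exp (E3 u v w x))"
      proof (cases "nm q u \<le> 8 * r")
        case True
        have "pi * ip q (\<lambda>i. pi\<^sup>2 * bil q (\<lambda>j l. R3 j l i u) v w) x
            = (\<Sum>i<q. \<Sum>j<q. \<Sum>l<q. pi ^ 3 * R3 j l i u * v j * w l * x i)"
          by (simp add: ip_def bil_def sum_distrib_left sum_distrib_right power2_eq_square power3_eq_cube mult_ac)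
        also have "\<dots> = (\<Sum>j<q. \<Sum>i<q. \<Sum>l<q. pi ^ 3 * R3 j l i u * v j * w l * x i)" by (rule sum.swap)
        also have "\<dots> = (\<Sum>j<q. \<Sum>l<q. \<Sum>i<q. pi ^ 3 * R3 j l i u * v j * w l * x i)"
          by (intro sum.cong refl sum.swap)
        also have "\<dots> = E3 u v w x"
          by (simp add: E3_def bil_def sum_distrib_left mult_ac)
        finally show ?thesis using True by (simp add: indicator_def)
      qed simp
    qed auto
    finally show ?thesis .
  qed
  have "(\<integral>\<^sup>+v. ennreal (cl (2 * r) v) * (\<integral>\<^sup>+u. \<integral>\<^sup>+w. ennreal (cl (4 * r) u * cl (4 * r) w
      * exp (pi\<^sup>2 * bil q (\<lambda>j l. R2 j l u) v w)) \<partial>G \<partial>G) \<partial>G)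
    \<le> (\<integral>\<^sup>+v. ennreal (cl (2 * r) v) * (\<integral>\<^sup>+w. ennreal (1 / (2 * a)) * (ennreal (exp (2 * bil q M2 v w / a)) + J v w) \<partial>G) \<partial>G)"
  proof (rule nn_integral_mono, rule mult_left_mono)
    fix v
    have "(\<integral>\<^sup>+u. \<integral>\<^sup>+w. ennreal (cl (4 * r) u * cl (4 * r) w * exp (pi\<^sup>2 * bil q (\<lambda>j l. R2 j l u) v w)) \<partial>G \<partial>G)
        = (\<integral>\<^sup>+w. \<integral>\<^sup>+u. ennreal (cl (4 * r) u * cl (4 * r) w * exp (pi\<^sup>2 * bil q (\<lambda>j l. R2 j l u) v w)) \<partial>G \<partial>G)"
      by (rule GG.Fubini'[symmetric]) (unfold bil_def, measurable)
    \<comment> \<open>The restriction of \<open>w\<close> is dropped and that of \<open>v\<close>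
      kept, since the third level works with one restricted direction.\<close>
    also have "\<dots> \<le> (\<integral>\<^sup>+w. \<integral>\<^sup>+u. ennreal (cl (4 * r) u * exp (pi\<^sup>2 * bil q (\<lambda>j l. R2 j l u) v w)) \<partial>G \<partial>G)"
      by (intro nn_integral_mono ennreal_leI) (auto simp: indicator_def)
    also have "\<dots> \<le> (\<integral>\<^sup>+w. ennreal (1 / (2 * a)) * (ennreal (exp (2 * bil q M2 v w / a)) + J v w) \<partial>G)"
      by (intro nn_integral_mono step)
    finally show "(\<integral>\<^sup>+u. \<integral>\<^sup>+w. ennreal (cl (4 * r) u * cl (4 * r) w * exp (pi\<^sup>2 * bil q (\<lambda>j l. R2 j l u) v w)) \<partial>G \<partial>G)
      \<le> (\<integral>\<^sup>+w. ennreal (1 / (2 * a)) * (ennreal (exp (2 * bil q M2 v w / a)) + J v w) \<partial>G)" .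
  qed simp
  also have "\<dots> \<le> ennreal (1 / (2 * a)) * ((\<integral>\<^sup>+v. \<integral>\<^sup>+w. ennreal (exp (2 * bil q M2 v w / a)) \<partial>G \<partial>G)
      + (\<integral>\<^sup>+v. ennreal (cl (2 * r) v) * (\<integral>\<^sup>+w. J v w \<partial>G) \<partial>G))"
  proof -
    have "(\<integral>\<^sup>+v. ennreal (cl (2 * r) v) * (\<integral>\<^sup>+w. ennreal (1 / (2 * a)) * (ennreal (exp (2 * bil q M2 v w / a)) + J v w) \<partial>G) \<partial>G)
      = (\<integral>\<^sup>+v. ennreal (1 / (2 * a)) * (ennreal (cl (2 * r) v) * (\<integral>\<^sup>+w. ennreal (exp (2 * bil q M2 v w / a)) \<partial>G)
          + ennreal (cl (2 * r) v) * (\<integral>\<^sup>+w. J v w \<partial>G)) \<partial>G)"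
    proof (rule nn_integral_cong)
      fix v
      have "(\<integral>\<^sup>+w. ennreal (1 / (2 * a)) * (ennreal (exp (2 * bil q M2 v w / a)) + J v w) \<partial>G)
          = ennreal (1 / (2 * a)) * ((\<integral>\<^sup>+w. ennreal (exp (2 * bil q M2 v w / a)) \<partial>G) + (\<integral>\<^sup>+w. J v w \<partial>G))"
        by (subst nn_integral_cmult, measurable, subst nn_integral_add) measurable
      then show "ennreal (cl (2 * r) v) * (\<integral>\<^sup>+w. ennreal (1 / (2 * a)) * (ennreal (exp (2 * bil q M2 v w / a)) + J v w) \<partial>G)
          = ennreal (1 / (2 * a)) * (ennreal (cl (2 * r) v) * (\<integral>\<^sup>+w. ennreal (exp (2 * bil q M2 v w / a)) \<partial>G)
          + ennreal (cl (2 * r) v) * (\<integral>\<^sup>+w. J v w \<partial>G))"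
        by (simp only: distrib_left mult_ac)
    qed
    also have "\<dots> \<le> (\<integral>\<^sup>+v. ennreal (1 / (2 * a)) * ((\<integral>\<^sup>+w. ennreal (exp (2 * bil q M2 v w / a)) \<partial>G)
          + ennreal (cl (2 * r) v) * (\<integral>\<^sup>+w. J v w \<partial>G)) \<partial>G)"
      by (intro nn_integral_mono mult_left_mono add_right_mono) (auto simp: indicator_def)
    also have "\<dots> = ennreal (1 / (2 * a)) * ((\<integral>\<^sup>+v. \<integral>\<^sup>+w. ennreal (exp (2 * bil q M2 v w / a)) \<partial>G \<partial>G)
      + (\<integral>\<^sup>+v. ennreal (cl (2 * r) v) * (\<integral>\<^sup>+w. J v w \<partial>G) \<partial>G))"
      by (simp add: nn_integral_cmult nn_integral_add)
    finally show ?thesis .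
  qed
  \<comment> \<open>Fubini's theorem moves the base point \<open>u\<close> to the outside, where
    \<open>third_order\<close> has it.\<close>
  also have "(\<integral>\<^sup>+v. ennreal (cl (2 * r) v) * (\<integral>\<^sup>+w. J v w \<partial>G) \<partial>G)
    = (\<integral>\<^sup>+u. ennreal (cl (8 * r) u) * (\<integral>\<^sup>+v. ennreal (cl (2 * r) v) *
      (\<integral>\<^sup>+w. \<integral>\<^sup>+x. ennreal (exp (E3 u v w x)) \<partial>G \<partial>G) \<partial>G) \<partial>G)"
  proof -
    define I where "I u v w = (\<integral>\<^sup>+x. ennreal (exp (E3 u v w x)) \<partial>G)" for u v w
    have [measurable]: "(\<lambda>(u, v, w). I u v w) \<in> borel_measurable (borel \<Otimes>\<^sub>M borel \<Otimes>\<^sub>M borel)"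
      unfolding I_def by measurable
    have I_raw [measurable (raw)]: "(\<lambda>y. I (f y) (g y) (h y)) \<in> borel_measurable N"
      if [measurable]: "f \<in> borel_measurable N" "g \<in> borel_measurable N" "h \<in> borel_measurable N" for f g h N
      unfolding I_def by measurable
    have "(\<integral>\<^sup>+w. J v w \<partial>G) = (\<integral>\<^sup>+u. ennreal (cl (8 * r) u) * (\<integral>\<^sup>+w. I u v w \<partial>G) \<partial>G)" for v
    proof -
      have "(\<integral>\<^sup>+w. J v w \<partial>G) = (\<integral>\<^sup>+w. \<integral>\<^sup>+u. ennreal (cl (8 * r) u) * I u v w \<partial>G \<partial>G)"
        unfolding J_def I_def by (intro nn_integral_cong nn_integral_cmult) measurable
      also have "\<dots> = (\<integral>\<^sup>+u. \<integral>\<^sup>+w. ennreal (cl (8 * r) u) * I u v w \<partial>G \<partial>G)"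
        by (rule GG.Fubini') measurable
      also have "\<dots> = (\<integral>\<^sup>+u. ennreal (cl (8 * r) u) * (\<integral>\<^sup>+w. I u v w \<partial>G) \<partial>G)"
        by (intro nn_integral_cong nn_integral_cmult) measurable
      finally show ?thesis .
    qed
    then have "(\<integral>\<^sup>+v. ennreal (cl (2 * r) v) * (\<integral>\<^sup>+w. J v w \<partial>G) \<partial>G)
        = (\<integral>\<^sup>+v. \<integral>\<^sup>+u. ennreal (cl (2 * r) v) * (ennreal (cl (8 * r) u) * (\<integral>\<^sup>+w. I u v w \<partial>G)) \<partial>G \<partial>G)"
      by (simp add: nn_integral_cmult)
    also have "\<dots> = (\<integral>\<^sup>+u. \<integral>\<^sup>+v. ennreal (cl (2 * r) v) * (ennreal (cl (8 * r) u) * (\<integral>\<^sup>+w. I u v w \<partial>G)) \<partial>G \<partial>G)"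
      by (rule GG.Fubini') measurable
    also have "\<dots> = (\<integral>\<^sup>+u. ennreal (cl (8 * r) u) * (\<integral>\<^sup>+v. ennreal (cl (2 * r) v) * (\<integral>\<^sup>+w. I u v w \<partial>G) \<partial>G) \<partial>G)"
      by (intro nn_integral_cong) (subst nn_integral_cmult[symmetric], measurable, simp add: mult_ac)
    finally show ?thesis by (simp add: I_def)
  qed
  also have "ennreal (1 / (2 * a)) * ((\<integral>\<^sup>+v. \<integral>\<^sup>+w. ennreal (exp (2 * bil q M2 v w / a)) \<partial>G \<partial>G) + \<dots>)
      \<le> ennreal (exp X / (a * 1))"
    by (rule half_add_le) (use mean_second_exp third_order a in \<open>auto simp: a_def\<close>)
  finally show ?thesis by (simp add: a_def)
qed

text \<open>For fixed \<open>v\<close> the derivative of \<open>R\<close> in the direction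
  \<open>v\<close> is decoupled in its base point, and the velocity of the rotation becomes the
  second direction. Dropping the cutoff of \<open>v\<close> from the mean part alone keeps it
  available for the levels above.\<close>

lemma first_order:
  "(\<integral>\<^sup>+u. \<integral>\<^sup>+v. ennreal (cl (2 * r) u * cl (2 * r) v * exp (pi * ip q (\<lambda>i. R1 i u) v)) \<partial>G \<partial>G)
    \<le> ennreal (exp X / (mass (2 * r) * mass (4 * r)))"
proof -
  interpret GG: pair_prob_space G G ..
  define a where "a = mass (2 * r)"
  have a: "0 < a" "a \<le> 1" using mass[of "2 * r"] r by (auto simp: a_def)
  have a': "0 < mass (4 * r)" "mass (4 * r) \<le> 1" using mass[of "4 * r"] r by auto
  define J where "J v = (\<integral>\<^sup>+u. \<integral>\<^sup>+w. ennreal (cl (4 * r) u * cl (4 * r) w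
      * exp (pi\<^sup>2 * bil q (\<lambda>j l. R2 j l u) v w)) \<partial>G \<partial>G)" for v
  have J_meas [measurable]: "J \<in> borel_measurable borel"
    unfolding J_def[abs_def] bil_def by measurable
  have step: "(\<integral>\<^sup>+u. ennreal (cl (2 * r) u * exp (pi * ip q v (\<lambda>a. R1 a u))) \<partial>G)
      \<le> ennreal (1 / (2 * a)) * (ennreal (exp (2 * ip q M1 v / a)) + J v)" for v
  proof -
    have C: "C1b q \<rho> (\<lambda>u. pi * ip q v (\<lambda>a. R1 a u)) (\<lambda>i u. pi * ip q v (\<lambda>a. R2 a i u))"
      by (intro C1b_cmult C1b_ip C1)
    have "(\<integral>\<^sup>+u. ennreal (cl (2 * r) u * exp (pi * ip q v (\<lambda>a. R1 a u))) \<partial>G)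
      \<le> (\<integral>\<^sup>+u. ennreal (bump q (2 * r) u * exp (pi * ip q v (\<lambda>a. R1 a u))) \<partial>G)"
      using r bump_bounds bump_eq_1[of "2 * r"]
      by (intro nn_integral_mono ennreal_leI mult_right_mono) (auto simp: indicator_def)
    also have "\<dots> \<le> ennreal (1 / (2 * a)) * (ennreal (exp (2 * ip q M1 v / a))
      + (\<integral>\<^sup>+u. \<integral>\<^sup>+x. ennreal (cl (2 * (2 * r)) u * cl (2 * (2 * r)) x
          * exp (pi * ip q (\<lambda>i. pi * ip q v (\<lambda>a. R2 a i u)) x)) \<partial>G \<partial>G))"
      using exp_decoupling[OF C, of "2 * r" a "ip q M1 v"] r a mean_first[of v]
      by (simp add: a_def mass_def)
    finally have "(\<integral>\<^sup>+u. ennreal (cl (2 * r) u * exp (pi * ip q v (\<lambda>a. R1 a u))) \<partial>G)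
      \<le> ennreal (1 / (2 * a)) * (ennreal (exp (2 * ip q M1 v / a))
      + (\<integral>\<^sup>+u. \<integral>\<^sup>+x. ennreal (cl (2 * (2 * r)) u * cl (2 * (2 * r)) x
          * exp (pi * ip q (\<lambda>i. pi * ip q v (\<lambda>a. R2 a i u)) x)) \<partial>G \<partial>G))" .
    moreover have "pi * ip q (\<lambda>i. pi * ip q v (\<lambda>a. R2 a i u)) x = pi\<^sup>2 * bil q (\<lambda>j l. R2 j l u) v x" for u x
      unfolding ip_ip_eq_bil[symmetric]
      by (simp add: ip_def[of q _ x] sum_distrib_left power2_eq_square mult_ac)
    ultimately show ?thesis unfolding J_def by simp
  qed
  have "(\<integral>\<^sup>+u. \<integral>\<^sup>+v. ennreal (cl (2 * r) u * cl (2 * r) v * exp (pi * ip q (\<lambda>i. R1 i u) v)) \<partial>G \<partial>G)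
      = (\<integral>\<^sup>+v. \<integral>\<^sup>+u. ennreal (cl (2 * r) u * cl (2 * r) v * exp (pi * ip q (\<lambda>i. R1 i u) v)) \<partial>G \<partial>G)"
    by (rule GG.Fubini'[symmetric]) (unfold ip_def, measurable)
  also have "\<dots> = (\<integral>\<^sup>+v. ennreal (cl (2 * r) v) * (\<integral>\<^sup>+u. ennreal (cl (2 * r) u * exp (pi * ip q v (\<lambda>a. R1 a u))) \<partial>G) \<partial>G)"
  proof (rule nn_integral_cong)
    fix v
    have "ennreal (cl (2 * r) u * cl (2 * r) v * exp (pi * ip q (\<lambda>i. R1 i u) v))
        = ennreal (cl (2 * r) v) * ennreal (cl (2 * r) u * exp (pi * ip q v (\<lambda>a. R1 a u)))" for u
      by (simp add: ennreal_mult[symmetric] ip_def mult_ac)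
    then show "(\<integral>\<^sup>+u. ennreal (cl (2 * r) u * cl (2 * r) v * exp (pi * ip q (\<lambda>i. R1 i u) v)) \<partial>G)
        = ennreal (cl (2 * r) v) * (\<integral>\<^sup>+u. ennreal (cl (2 * r) u * exp (pi * ip q v (\<lambda>a. R1 a u))) \<partial>G)"
      by (simp only:) (rule nn_integral_cmult, unfold ip_def, measurable)
  qed
  also have "\<dots> \<le> (\<integral>\<^sup>+v. ennreal (cl (2 * r) v) * (ennreal (1 / (2 * a)) * (ennreal (exp (2 * ip q M1 v / a)) + J v)) \<partial>G)"
    by (intro nn_integral_mono mult_left_mono step) simp
  also have "\<dots> \<le> (\<integral>\<^sup>+v. ennreal (1 / (2 * a)) * (ennreal (exp (2 * ip q M1 v / a)) + ennreal (cl (2 * r) v) * J v) \<partial>G)"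
    by (intro nn_integral_mono) (auto simp: indicator_def)
  also have "\<dots> = ennreal (1 / (2 * a)) * ((\<integral>\<^sup>+v. ennreal (exp (2 * ip q M1 v / a)) \<partial>G) + (\<integral>\<^sup>+v. ennreal (cl (2 * r) v) * J v \<partial>G))"
    by (subst nn_integral_cmult, measurable, subst nn_integral_add) measurable
  also have "\<dots> \<le> ennreal (exp X / (a * mass (4 * r)))"
    by (rule half_add_le) (use mean_first_exp second_order a a' in \<open>auto simp: a_def J_def\<close>)
  finally show ?thesis by (simp add: a_def)
qed

lemma bump_exp_integrable: "integrable G (\<lambda>u. bump q r u * exp (R u))"
proof -
  obtain M where M: "\<And>u. u \<in> ob q \<rho> \<Longrightarrow> \<bar>R u\<bar> \<le> M" using C0 unfolding C1b_def by blast
  have "bddf (\<lambda>u. bump q r u * exp (R u))"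
  proof (rule bddfI[of _ "exp M"])
    fix u show "\<bar>bump q r u * exp (R u)\<bar> \<le> exp M"
    proof (cases "bump q r u = 0")
      case False
      have "u \<in> ob q \<rho>" by (rule bump_support(2)[OF _ _ False]) (use r in auto)
      then have "exp (R u) \<le> exp M" using M by fastforce
      then show ?thesis
        using bump_bounds[of q r u] mult_mono[of "bump q r u" 1 "exp (R u)" "exp M"]
        by (simp add: abs_mult)
    qed simp
  qed
  then show ?thesis by (intro integrable_G_bddf) measurable
qed

text \<open>The lower bound rests on \<open>exp R \<ge> 1 + R\<close>, the upper one on one more
  decoupling before \<open>first_order\<close>, so that three cutoff masses appear in the
  denominator, each at least \<open>1 - \<tau>\<close>. Multiplying out (1 + 2 X) (1 + 14 \<tau>)
  with \<tau> and X \<tau> bounded by X gives 2 + 14 + 28 = 44.\<close>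

theorem bump_exp_integral:
  "\<bar>(\<integral>u. bump q r u * exp (R u) \<partial>G) - 1\<bar> \<le> 44 * X"
proof -
  define m where "m = (\<integral>u. bump q r u * R u \<partial>G)"
  have X: "0 \<le> X" "X \<le> 1" by (rule X_bounds)+
  have B2: "B \<le> B\<^sup>2" using pars by (simp add: power2_eq_square)
  have m: "\<bar>m\<bar> \<le> 5000 * (B\<^sup>2 * (real q)\<^sup>2 / \<kappa>)"
  proof -
    have "(real q)\<^sup>2 * B / \<kappa> \<le> B\<^sup>2 * (real q)\<^sup>2 / \<kappa>"
      using mult_right_mono[OF B2, of "(real q)\<^sup>2"] kappa_pos by (intro divide_right_mono) (auto simp: mult_ac)
    then show ?thesis using mean_R by (simp add: m_def)
  qed
  have mX: "\<bar>m\<bar> \<le> X / 4" using m le_X[of 20000] by simp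
  have a: "0 < mass r" "mass r \<le> 1" "1 - \<tau> \<le> mass r" "1 / 2 \<le> mass r" using mass[of r] by auto
  have a': "0 < mass (2 * r)" "mass (2 * r) \<le> 1" "1 - \<tau> \<le> mass (2 * r)"
    "0 < mass (4 * r)" "mass (4 * r) \<le> 1" "1 - \<tau> \<le> mass (4 * r)"
    using mass[of "2 * r"] mass[of "4 * r"] r by auto
  have \<tau>X: "\<tau> \<le> X"
  proof -
    have "1 \<le> 3000000 * B\<^sup>2 * (real q)\<^sup>2"
    proof -
      have "1 \<le> B\<^sup>2" "1 \<le> (real q)\<^sup>2" using pars by (auto intro: one_le_power)
      then show ?thesis using mult_mono[of 1 "3000000 * B\<^sup>2" 1 "(real q)\<^sup>2"] by linarith
    qed
    then have "1 / \<kappa> \<le> X" unfolding X_def using kappa_pos by (intro divide_right_mono) auto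
    then show ?thesis using \<tau>(2) by linarith
  qed
  have bumpR: "integrable G (\<lambda>u. bump q r u * R u)"
    by (rule C1b_bump_integrable[OF C0]) (use r in auto)
  have bumpi: "integrable G (bump q r)" by (intro integrable_G_bddf bddf_bump) measurable
  have lower: "mass r + m \<le> (\<integral>u. bump q r u * exp (R u) \<partial>G)"
  proof -
    have "mass r + m = (\<integral>u. bump q r u + bump q r u * R u \<partial>G)"
      using bumpi bumpR by (simp add: mass_def m_def)
    also have "\<dots> \<le> (\<integral>u. bump q r u * exp (R u) \<partial>G)"
    proof (rule integral_mono)
      fix u
      have "bump q r u * (1 + R u) \<le> bump q r u * exp (R u)"
        using bump_bounds by (intro mult_left_mono exp_ge_add_one_self)
      then show "bump q r u + bump q r u * R u \<le> bump q r u * exp (R u)" by (simp add: algebra_simps)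
    qed (use bumpi bumpR bump_exp_integrable in auto)
    finally show ?thesis .
  qed
  have upper: "(\<integral>u. bump q r u * exp (R u) \<partial>G) \<le> exp X / (mass r * (mass (2 * r) * mass (4 * r)))"
  proof -
    have "ennreal (\<integral>u. bump q r u * exp (R u) \<partial>G) = (\<integral>\<^sup>+u. ennreal (bump q r u * exp (R u)) \<partial>G)"
      by (rule nn_integral_eq_integral[symmetric, OF bump_exp_integrable]) (use bump_bounds in auto)
    also have "\<dots> \<le> ennreal (1 / (2 * mass r)) * (ennreal (exp (2 * m / mass r))
        + (\<integral>\<^sup>+u. \<integral>\<^sup>+v. ennreal (cl (2 * r) u * cl (2 * r) v * exp (pi * ip q (\<lambda>i. R1 i u) v)) \<partial>G \<partial>G))"
      using exp_decoupling[OF C0, of r "mass r" m] r a by (simp add: mass_def m_def)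
    also have "\<dots> \<le> ennreal (exp X / (mass r * (mass (2 * r) * mass (4 * r))))"
    proof (rule half_add_le)
      have "X * (1 / 2) \<le> X * mass r" using a X by (intro mult_left_mono) auto
      then have "2 * m \<le> X * mass r" using mX by linarith
      then have "2 * m / mass r \<le> X" using a by (simp add: pos_divide_le_eq)
      then show "ennreal (exp (2 * m / mass r)) \<le> ennreal (exp X)" by (intro ennreal_leI) simp
    qed (use first_order a a' in \<open>auto simp: mult_le_one\<close>)
    finally show ?thesis using a a' by (simp add: ennreal_le_iff)
  qed
  have inv: "1 / x \<le> 1 + 2 * \<tau>" if "1 - \<tau> \<le> x" "0 < x" for x
  proof -
    have "0 \<le> \<tau> * (1 - 2 * \<tau>)" using \<tau>_bounds by (intro mult_nonneg_nonneg) auto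
    then have "1 \<le> (1 + 2 * \<tau>) * (1 - \<tau>)" by (simp add: algebra_simps)
    also have "\<dots> \<le> (1 + 2 * \<tau>) * x" using that \<tau>_bounds by (intro mult_left_mono) auto
    finally show ?thesis using that by (simp add: field_simps)
  qed
  have "exp X / (mass r * (mass (2 * r) * mass (4 * r)))
      = exp X * (1 / mass r * (1 / mass (2 * r) * (1 / mass (4 * r))))" by simp
  also have "\<dots> \<le> (1 + 2 * X) * ((1 + 2 * \<tau>) * ((1 + 2 * \<tau>) * (1 + 2 * \<tau>)))"
  proof (intro mult_mono inv)
    have "exp X \<le> 1 + X + X\<^sup>2" using X by (rule exp_bound)
    also have "X\<^sup>2 \<le> X" using X by (simp add: power2_eq_square mult_left_le)
    finally show "exp X \<le> 1 + 2 * X" by simp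
  qed (use a a' \<tau>_bounds X in auto)
  also have "\<dots> \<le> (1 + 2 * X) * (1 + 14 * \<tau>)"
  proof (intro mult_left_mono)
    define t where "t = 2 * \<tau>"
    have t: "0 \<le> t" "t \<le> 1" using \<tau>_bounds by (auto simp: t_def)
    have "t * t \<le> t" "t * (t * t) \<le> t" using t by (auto simp: mult_left_le mult_le_one)
    then have "(1 + t) * ((1 + t) * (1 + t)) \<le> 1 + 7 * t" by (simp add: algebra_simps)
    then show "(1 + 2 * \<tau>) * ((1 + 2 * \<tau>) * (1 + 2 * \<tau>)) \<le> 1 + 14 * \<tau>" by (simp add: t_def)
  qed (use X in simp)
  also have "\<dots> \<le> 1 + 44 * X"
  proof -
    have "X * \<tau> \<le> 1 * X" using X \<tau>X \<tau>_bounds by (subst mult.commute, intro mult_right_mono) auto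
    then show ?thesis using \<tau>X by (simp add: algebra_simps)
  qed
  finally have "(\<integral>u. bump q r u * exp (R u) \<partial>G) \<le> 1 + 44 * X" using upper by linarith
  moreover have "1 - 44 * X \<le> (\<integral>u. bump q r u * exp (R u) \<partial>G)"
    using lower a(3) \<tau>X mX X by linarith
  ultimately show ?thesis by linarith
qed

end

section \<open>Compactness and boundedness on balls\<close>

lemma compact_box:
  assumes "\<And>i. compact (A i :: real set)"
  shows "compact {u :: nat \<Rightarrow> real. \<forall>i. u i \<in> A i}"
proof -
  have "compactin (product_topology (\<lambda>_. euclidean) UNIV) (PiE UNIV A)"
    using assms by (simp add: compactin_PiE)
  moreover have "PiE UNIV A = {u. \<forall>i. u i \<in> A i}" by (auto simp: PiE_def)
  ultimately show ?thesis by (simp add: euclidean_product_topology)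
qed

lemma compact_closed_ball:
  "compact {u. (\<forall>i. q \<le> i \<longrightarrow> u i = 0) \<and> nm q u \<le> \<rho>}"
proof -
  define A where "A i = (if i < q then {- \<rho>..\<rho>} else {0 :: real})" for i
  have "compact ({u. \<forall>i. u i \<in> A i} \<inter> {u. nm q u \<le> \<rho>})"
    by (intro compact_Int_closed compact_box closed_Collect_le continuous_nm continuous_intros)
       (auto simp: A_def)
  also have "{u. \<forall>i. u i \<in> A i} \<inter> {u. nm q u \<le> \<rho>} = {u. (\<forall>i. q \<le> i \<longrightarrow> u i = 0) \<and> nm q u \<le> \<rho>}"
  proof (rule equalityI; rule subsetI)
    fix u assume "u \<in> {u. \<forall>i. u i \<in> A i} \<inter> {u. nm q u \<le> \<rho>}"
    then have u: "\<And>i. u i \<in> A i" "nm q u \<le> \<rho>" by auto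
    have "u i = 0" if "q \<le> i" for i using u(1)[of i] that by (simp add: A_def)
    then show "u \<in> {u. (\<forall>i. q \<le> i \<longrightarrow> u i = 0) \<and> nm q u \<le> \<rho>}" using u(2) by simp
  next
    fix u assume "u \<in> {u. (\<forall>i. q \<le> i \<longrightarrow> u i = 0) \<and> nm q u \<le> \<rho>}"
    then have u: "\<forall>i. q \<le> i \<longrightarrow> u i = 0" "nm q u \<le> \<rho>" by auto
    have "\<bar>u i\<bar> \<le> \<rho>" if "i < q" for i using abs_coord_le_nm[OF that, of u] u by simp
    then show "u \<in> {u. \<forall>i. u i \<in> A i} \<inter> {u. nm q u \<le> \<rho>}"
      using u by (auto simp: A_def abs_le_iff minus_le_iff)
  qed
  finally show ?thesis .
qed

text \<open>The ball in the space of all sequences is not relatively compact, as the coordinates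
  beyond \<open>q\<close> are free. Setting them to zero does not change \<open>F\<close> and leads
  into a compact closed ball.\<close>

lemma bounded_on_ob:
  assumes cyl: "cyl q F" and cts: "\<And>u. u \<in> ob q \<rho>' \<Longrightarrow> cts_at q F u" and \<rho>: "\<rho> < \<rho>'"
  shows "\<exists>M. \<forall>u\<in>ob q \<rho>. \<bar>F u\<bar> \<le> M"
proof -
  let ?K = "{u. (\<forall>i. q \<le> i \<longrightarrow> u i = 0) \<and> nm q u \<le> \<rho>}"
  have "continuous_on ?K F"
    by (rule continuous_on_of_cts_at[where q = q]) (use cts \<rho> in \<open>auto simp: ob_def\<close>)
  from compact_continuous_image[OF this compact_closed_ball]
  have "bounded (F ` ?K)" by (rule compact_imp_bounded)
  then obtain M where M: "\<And>u. u \<in> ?K \<Longrightarrow> \<bar>F u\<bar> \<le> M"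
    unfolding bounded_iff by auto
  have "\<bar>F u\<bar> \<le> M" if u: "u \<in> ob q \<rho>" for u
  proof -
    define u' where "u' i = (if i < q then u i else 0)" for i
    have "F u = F u'" by (rule cylD[OF cyl]) (simp add: u'_def)
    moreover have "nm q u' = nm q u" by (rule nm_cong) (simp add: u'_def)
    ultimately show ?thesis using M[of u'] u by (simp add: u'_def ob_def)
  qed
  then show ?thesis by blast
qed

subsection \<open>Eigenvalues of symmetric matrices\<close>

lemma linear_coeff_zero:
  assumes "\<And>t::real. 2 * t * a + t\<^sup>2 * b \<le> 0" shows "a = 0"
proof (rule ccontr)
  assume a: "a \<noteq> 0"
  define t where "t = a / (1 + \<bar>b\<bar>)"
  have ta: "a = t * (1 + \<bar>b\<bar>)" and t: "t \<noteq> 0" using a by (auto simp: t_def add_nonneg_eq_0_iff)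
  have "2 * t * a + t\<^sup>2 * b = t\<^sup>2 * (2 * (1 + \<bar>b\<bar>) + b)"
    by (subst ta) (simp add: power2_eq_square algebra_simps)
  moreover have "t\<^sup>2 * (2 * (1 + \<bar>b\<bar>) + b) > 0" using t by (intro mult_pos_pos) auto
  ultimately show False using assms[of t] by linarith
qed

text \<open>The quadratic form attains its maximum on the unit sphere, and the first-order condition
  at the maximizer \<open>v\<close>, tested in the direction of the defect
  \<open>w = M v - k v\<close>, forces \<open>w = 0\<close>.\<close>

lemma ex_max_eigenvector:
  assumes sym: "\<And>i j. i < q \<Longrightarrow> j < q \<Longrightarrow> M i j = M j i" and q: "0 < q"
  shows "\<exists>k v. ip q v v = 1 \<and> (\<forall>i<q. (\<Sum>j<q. M i j * v j) = k * v i) \<and> (\<forall>x. bil q M x x \<le> k * ip q x x)"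
proof -
  let ?S = "{u. (\<forall>i. q \<le> i \<longrightarrow> u i = 0) \<and> nm q u \<le> 1} \<inter> {u. nm q u = 1}"
  have cont: "continuous_on A (\<lambda>u. bil q M u u)" for A
    unfolding bil_def
    by (intro continuous_intros continuous_on_subset[OF continuous_on_product_coordinates subset_UNIV])
  have "compact ?S"
    by (intro compact_Int_closed compact_closed_ball closed_Collect_eq continuous_nm continuous_intros)
  moreover have "?S \<noteq> {}"
  proof -
    define e where "e i = (if i = 0 then 1 else 0 :: real)" for i :: nat
    have "(e i)\<^sup>2 = (if i = 0 then 1 else 0)" for i by (simp add: e_def)
    then have "nm q e = 1" using q by (simp add: L2_set_def)
    moreover have "\<forall>i. q \<le> i \<longrightarrow> e i = 0" using q by (simp add: e_def)
    ultimately have "e \<in> ?S" by simp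
    then show ?thesis by blast
  qed
  ultimately have "\<exists>v\<in>?S. \<forall>u\<in>?S. bil q M u u \<le> bil q M v v"
    by (rule continuous_attains_sup[OF _ _ cont])
  then obtain v where v: "v \<in> ?S" "\<And>u. u \<in> ?S \<Longrightarrow> bil q M u u \<le> bil q M v v" by blast
  define k where "k = bil q M v v"
  have max: "bil q M x x \<le> k * ip q x x" for x
  proof (cases "nm q x = 0")
    case True
    then have "x i = 0" if "i < q" for i using abs_coord_le_nm[OF that, of x] by simp
    then show ?thesis by (simp add: bil_def ip_def)
  next
    case False
    then have pos: "nm q x > 0" using L2_set_nonneg[of x "{..<q}"] by linarith
    define y where "y i = (if i < q then 1 / nm q x * x i else 0)" for i
    have "nm q y = nm q (\<lambda>i. 1 / nm q x * x i)" by (rule nm_cong) (simp add: y_def)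
    also have "\<dots> = 1" unfolding nm_scale using pos by simp
    finally have "bil q M y y \<le> k" using v(2)[of y] by (simp add: k_def y_def)
    moreover have "bil q M y y = bil q M (\<lambda>i. 1 / nm q x * x i) (\<lambda>i. 1 / nm q x * x i)"
      unfolding bil_def by (intro sum.cong refl) (simp add: y_def)
    ultimately have "bil q M x x / (nm q x)\<^sup>2 \<le> k"
      unfolding bil_simps by (simp add: power2_eq_square)
    then show ?thesis using pos by (simp add: nm_sq[symmetric] pos_divide_le_eq)
  qed
  define w where "w i = (\<Sum>j<q. M i j * v j) - k * v i" for i
  have vv: "ip q v v = 1" using v(1) by (simp add: nm_sq[symmetric])
  have ww: "bil q M w v - k * ip q w v = ip q w w"
    unfolding bil_eq_ip by (simp add: ip_def w_def sum_distrib_left sum_subtractf[symmetric] algebra_simps)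
  have "2 * t * (bil q M w v - k * ip q w v) + t\<^sup>2 * (bil q M w w - k * ip q w w) \<le> 0" for t
  proof -
    have b: "bil q M (\<lambda>i. v i + t * w i) (\<lambda>i. v i + t * w i) = k + 2 * t * bil q M w v + t\<^sup>2 * bil q M w w"
      unfolding bil_simps using bil_sym[of q M v w] sym by (simp add: k_def power2_eq_square algebra_simps)
    have "ip q (\<lambda>i. v i + t * w i) (\<lambda>i. v i + t * w i) = ip q v v + 2 * t * ip q w v + t\<^sup>2 * ip q w w"
      by (simp add: ip_def sum_distrib_left sum.distrib[symmetric] power2_eq_square algebra_simps)
    then show ?thesis
      using max[of "\<lambda>i. v i + t * w i"] vv unfolding b by (simp add: algebra_simps)
  qed
  then have "ip q w w = 0" unfolding ww[symmetric] by (rule linear_coeff_zero)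
  then have "w i = 0" if "i < q" for i
    using that by (simp add: ip_def sum_nonneg_eq_0_iff)
  then show ?thesis using vv max by (intro exI[of _ k] exI[of _ v]) (auto simp: w_def)
qed

lemma eigenvalue_matI:
  assumes v: "ip q v v = 1" and ev: "\<And>i. i < q \<Longrightarrow> (\<Sum>j<q. M i j * v j) = k * v i"
  shows "eigenvalue (Matrix.mat q q (\<lambda>(i, j). M i j)) k"
proof -
  have "Matrix.vec q v \<noteq> 0\<^sub>v q"
  proof
    assume "Matrix.vec q v = 0\<^sub>v q"
    then have "v i = 0" if "i < q" for i using that by (metis index_vec index_zero_vec(1))
    then show False using v by (simp add: ip_def)
  qed
  moreover have "Matrix.mat q q (\<lambda>(i, j). M i j) *\<^sub>v Matrix.vec q v = k \<cdot>\<^sub>v Matrix.vec q v"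
    by (rule eq_vecI) (auto simp: scalar_prod_def atLeast0LessThan ev)
  ultimately show ?thesis
    by (auto simp: eigenvalue_def eigenvector_def intro!: exI[of _ "Matrix.vec q v"])
qed

lemma finite_eigenvalues:
  "A \<in> carrier_mat q q \<Longrightarrow> finite {k :: real. eigenvalue A k}"
proof -
  assume A: "A \<in> carrier_mat q q"
  have "coeff (char_poly A) q = 1" using degree_monic_char_poly[OF A] by simp
  then have "char_poly A \<noteq> 0" by auto
  then show ?thesis using eigenvalue_root_char_poly[OF A] by (simp add: poly_roots_finite)
qed

text \<open>The extreme values of the quadratic form on the sphere are themselves eigenvalues, hence
  members of the finite set whose minimum and maximum are bounded. The lower bound is the upper one
  for \<open>- M\<close>.\<close>

lemma eigenvalues_between_bil:
  assumes E: "eigenvalues_between a (Matrix.mat q q (\<lambda>(i, j). M i j)) b" and q: "0 < q"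
  shows "\<And>i j. i < q \<Longrightarrow> j < q \<Longrightarrow> M i j = M j i"
    and "\<And>x. a * ip q x x \<le> bil q M x x" and "\<And>x. bil q M x x \<le> b * ip q x x"
proof -
  let ?A = "Matrix.mat q q (\<lambda>(i, j). M i j)"
  have T: "transpose_mat ?A = ?A" and a: "a \<le> Min {k. eigenvalue ?A k}" and b: "Max {k. eigenvalue ?A k} \<le> b"
    using E by (auto simp: eigenvalues_between_def min_eigenvalue_def max_eigenvalue_def)
  show sym: "M i j = M j i" if "i < q" "j < q" for i j
  proof -
    have "?A $$ (i, j) = transpose_mat ?A $$ (i, j)" by (simp only: T)
    then show ?thesis using that by simp
  qed
  have fin: "finite {k. eigenvalue ?A k}" by (rule finite_eigenvalues[of _ q]) simp
  obtain k v where k: "ip q v v = 1" "\<forall>i<q. (\<Sum>j<q. M i j * v j) = k * v i" "\<And>x. bil q M x x \<le> k * ip q x x"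
    using ex_max_eigenvector[of q M, OF sym q] by blast
  have "eigenvalue ?A k" using eigenvalue_matI[OF k(1)] k(2) by blast
  then have "k \<le> b" using Max_ge[OF fin, of k] b by simp
  then show "bil q M x x \<le> b * ip q x x" for x
    using k(3)[of x] mult_right_mono[OF _ ip_nonneg, of k b q x] by linarith
  have sym': "- M i j = - M j i" if "i < q" "j < q" for i j using sym[OF that] by simp
  obtain l w where l: "ip q w w = 1" "\<forall>i<q. (\<Sum>j<q. - M i j * w j) = l * w i" "\<And>x. bil q (\<lambda>i j. - M i j) x x \<le> l * ip q x x"
    using ex_max_eigenvector[of q "\<lambda>i j. - M i j", OF sym' q] by blast
  have "eigenvalue ?A (- l)"
  proof (rule eigenvalue_matI[OF l(1)])
    fix i assume "i < q"
    then have "- (\<Sum>j<q. M i j * w j) = l * w i" using l(2) by (simp add: sum_negf)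
    then show "(\<Sum>j<q. M i j * w j) = - l * w i" by linarith
  qed
  then have "a \<le> - l" using Min_le[OF fin, of "- l"] a by simp
  then show "a * ip q x x \<le> bil q M x x" for x
    using l(3)[of x] mult_right_mono[OF _ ip_nonneg, of a "- l" q x] by (simp add: bil_def sum_negf)
qed

text \<open>Polarization and the parallelogram identity for unit vectors, then scaling.\<close>

lemma bil_le_of_quadratic:
  assumes sym: "\<And>i j. i < q \<Longrightarrow> j < q \<Longrightarrow> M i j = M j i" and L: "\<And>x. \<bar>bil q M x x\<bar> \<le> L * ip q x x"
  shows "\<bar>bil q M x y\<bar> \<le> L * nm q x * nm q y"
proof -
  have unit: "bil q M x y \<le> L" if xy: "nm q x = 1" "nm q y = 1" for x y
  proof -
    have "4 * bil q M x y = bil q M (\<lambda>i. x i + y i) (\<lambda>i. x i + y i) - bil q M (\<lambda>i. x i - y i) (\<lambda>i. x i - y i)"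
      unfolding bil_simps using bil_sym[of q M x y] sym by simp
    also have "\<dots> \<le> L * ip q (\<lambda>i. x i + y i) (\<lambda>i. x i + y i) + L * ip q (\<lambda>i. x i - y i) (\<lambda>i. x i - y i)"
      using L[of "\<lambda>i. x i + y i"] L[of "\<lambda>i. x i - y i"] by linarith
    also have "\<dots> = L * (2 * ip q x x + 2 * ip q y y)"
      by (simp add: ip_def sum_distrib_left sum.distrib[symmetric] algebra_simps)
    also have "\<dots> = 4 * L" using xy by (simp add: nm_sq[symmetric])
    finally show ?thesis by simp
  qed
  show ?thesis
  proof (cases "nm q x = 0 \<or> nm q y = 0")
    case True
    then have "(\<forall>i<q. x i = 0) \<or> (\<forall>i<q. y i = 0)"
      using abs_coord_le_nm[of _ q x] abs_coord_le_nm[of _ q y] by fastforce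
    then have "bil q M x y = 0" by (auto simp: bil_def)
    then show ?thesis using True by auto
  next
    case False
    then have pos: "nm q x > 0" "nm q y > 0"
      using L2_set_nonneg[of x "{..<q}"] L2_set_nonneg[of y "{..<q}"] by linarith+
    have "s * bil q M x y / (nm q x * nm q y) \<le> L" if "\<bar>s\<bar> = 1" for s
    proof -
      have "nm q (\<lambda>i. s / nm q x * x i) = 1" "nm q (\<lambda>i. 1 / nm q y * y i) = 1"
        unfolding nm_scale using pos that by (auto simp: abs_mult)
      then have "bil q M (\<lambda>i. s / nm q x * x i) (\<lambda>i. 1 / nm q y * y i) \<le> L" by (rule unit)
      then show ?thesis unfolding bil_simps by (simp add: mult_ac)
    qed
    from this[of 1] this[of "-1"] have "bil q M x y / (nm q x * nm q y) \<le> L" "- bil q M x y / (nm q x * nm q y) \<le> L"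
      by simp_all
    then have "bil q M x y \<le> L * (nm q x * nm q y)" "- bil q M x y \<le> L * (nm q x * nm q y)"
      using pos by (simp_all only: pos_divide_le_eq mult_pos_pos)
    then show ?thesis by (simp add: mult.assoc)
  qed
qed

lemma eigenvalues_between_bil_abs:
  assumes E: "eigenvalues_between a (Matrix.mat q q (\<lambda>(i, j). M i j)) b" and q: "0 < q"
    and L: "\<bar>a\<bar> \<le> L" "\<bar>b\<bar> \<le> L"
  shows "\<bar>bil q M x y\<bar> \<le> L * nm q x * nm q y"
proof (rule bil_le_of_quadratic)
  show "M i j = M j i" if "i < q" "j < q" for i j by (rule eigenvalues_between_bil(1)[OF E q that])
  fix x
  have "- (L * ip q x x) \<le> a * ip q x x" "b * ip q x x \<le> L * ip q x x"
    using L mult_right_mono[OF _ ip_nonneg, of "- L" a q x] mult_right_mono[OF _ ip_nonneg, of b L q x] by auto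
  then show "\<bar>bil q M x x\<bar> \<le> L * ip q x x"
    using eigenvalues_between_bil(2,3)[OF E q, of x] by linarith
qed

lemma bil_unit_entry:
  assumes "\<And>x y. \<bar>bil q M x y\<bar> \<le> L * nm q x * nm q y" "i < q" "j < q"
  shows "\<bar>M i j\<bar> \<le> L"
proof -
  define e where "e i = (\<lambda>k. if k = i then 1 else 0 :: real)" for i :: nat
  have n: "nm q (e i) = 1" if "i < q" for i
  proof -
    have "(e i k)\<^sup>2 = (if k = i then 1 else 0)" for k by (simp add: e_def)
    then show ?thesis using that by (simp add: L2_set_def)
  qed
  have "bil q M (e i) (e j) = (\<Sum>a<q. e i a * (\<Sum>b<q. e j b * M a b))"
    by (simp add: bil_def sum_distrib_left mult_ac)
  also have "\<dots> = M i j" using assms(2,3) by (simp add: e_def mult_delta_left)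
  finally show ?thesis using assms(1)[of "e i" "e j"] n assms(2,3) by simp
qed

subsection \<open>Second and higher derivatives\<close>

lemma cts_at_of_cts_partials:
  assumes cyl: "cyl q F" and part: "partial_on q (ob q \<rho>) F F'" and u: "u \<in> ob q \<rho>"
    and cts: "\<And>i. i < q \<Longrightarrow> cts_at q (F' i) u"
  shows "cts_at q F u"
  unfolding cts_at_def
proof (intro allI impI)
  fix \<epsilon> :: real assume \<epsilon>: "\<epsilon> > 0"
  obtain d where d: "d > 0" "\<And>v. (\<forall>i<q. \<bar>v i - u i\<bar> < d) \<Longrightarrow> v \<in> ob q \<rho>"
    using ob_nbhd[OF u] by blast
  have "\<forall>i\<in>{..<q}. \<exists>d>0. \<forall>v. (\<forall>j<q. \<bar>v j - u j\<bar> < d) \<longrightarrow> \<bar>F' i v - F' i u\<bar> < 1"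
    using cts unfolding cts_at_def by auto
  then obtain g where g: "\<And>i. i < q \<Longrightarrow> g i > 0"
    "\<And>i v. i < q \<Longrightarrow> (\<forall>j<q. \<bar>v j - u j\<bar> < g i) \<Longrightarrow> \<bar>F' i v - F' i u\<bar> < 1"
    by (auto dest!: bchoice)
  define C where "C = (\<Sum>i<q. \<bar>F' i u\<bar>) + real q + 1"
  have C: "C > 0" unfolding C_def by (intro add_nonneg_pos add_nonneg_nonneg sum_nonneg) auto
  define m where "m = Min (insert (\<epsilon> / C) (insert d (g ` {..<q})))"
  have m_le: "m \<le> x" if "x \<in> insert (\<epsilon> / C) (insert d (g ` {..<q}))" for x
    unfolding m_def using that by (intro Min_le) auto
  have m: "m > 0" "m \<le> d" "m \<le> \<epsilon> / C" "\<And>i. i < q \<Longrightarrow> m \<le> g i"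
    using d(1) g(1) \<epsilon> C m_le by (auto simp: m_def)
  have "\<bar>F v - F u\<bar> < \<epsilon>" if v: "\<forall>i<q. \<bar>v i - u i\<bar> < m" for v
  proof -
    have near: "\<forall>j<q. \<bar>y j - u j\<bar> < m" if "\<And>i. i < q \<Longrightarrow> \<bar>y i - u i\<bar> \<le> \<bar>v i - u i\<bar>" for y
      using that v by force
    have "\<bar>F v - F u - (\<Sum>i<q. F' i u * (v i - u i))\<bar> \<le> 1 * (\<Sum>i<q. \<bar>v i - u i\<bar>)"
    proof (rule telescoping_bound[OF cyl part])
      fix y assume y: "\<And>i. i < q \<Longrightarrow> \<bar>y i - u i\<bar> \<le> \<bar>v i - u i\<bar>"
      show "y \<in> ob q \<rho>" using near[OF y] m(2) by (intro d(2)) force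
      show "\<bar>F' i y - F' i u\<bar> \<le> 1" if "i < q" for i
        using near[OF y] m(4)[OF that] by (intro less_imp_le g(2)[OF that]) force
    qed
    also have "\<dots> \<le> (\<Sum>i<q. m)" unfolding mult_1 using v by (intro sum_mono) auto
    finally have 1: "\<bar>F v - F u - (\<Sum>i<q. F' i u * (v i - u i))\<bar> \<le> real q * m" by simp
    have "\<bar>\<Sum>i<q. F' i u * (v i - u i)\<bar> \<le> (\<Sum>i<q. \<bar>F' i u\<bar> * m)"
      by (rule order_trans[OF sum_abs sum_mono]) (use v in \<open>auto simp: abs_mult intro!: mult_left_mono\<close>)
    then have 2: "\<bar>\<Sum>i<q. F' i u * (v i - u i)\<bar> \<le> (\<Sum>i<q. \<bar>F' i u\<bar>) * m" by (simp add: sum_distrib_right)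
    have "\<bar>F v - F u\<bar> \<le> ((\<Sum>i<q. \<bar>F' i u\<bar>) + real q) * m" using 1 2 by (simp add: algebra_simps)
    also have "\<dots> < C * m" using m(1) by (intro mult_strict_right_mono) (auto simp: C_def)
    also have "\<dots> \<le> C * (\<epsilon> / C)" using m(3) C by (intro mult_left_mono) auto
    also have "\<dots> = \<epsilon>" using C by simp
    finally show ?thesis .
  qed
  with m(1) show "\<exists>d>0. \<forall>v. (\<forall>i<q. \<bar>v i - u i\<bar> < d) \<longrightarrow> \<bar>F v - F u\<bar> < \<epsilon>" by blast
qed

lemma double_difference:
  assumes F: "partial_on q S F F1" and F1: "partial_on q S (F1 a) (F2 a)"
    and ab: "a < q" "b < q" "a \<noteq> b" and h: "0 < h"
    and S: "\<And>s t. 0 \<le> s \<Longrightarrow> s \<le> h \<Longrightarrow> 0 \<le> t \<Longrightarrow> t \<le> h \<Longrightarrow> u(a := u a + s, b := u b + t) \<in> S"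
  shows "\<exists>s t. 0 \<le> s \<and> s \<le> h \<and> 0 \<le> t \<and> t \<le> h \<and>
    F (u(a := u a + h, b := u b + h)) - F (u(a := u a + h)) - F (u(b := u b + h)) + F u
      = h * (h * F2 a b (u(a := u a + s, b := u b + t)))"
proof -
  define p where "p s t = u(a := u a + s, b := u b + t)" for s t
  have p: "p s t = (p 0 t)(a := u a + s)" "p s t = (p s 0)(b := u b + t)" for s t
    using ab by (auto simp: p_def)
  have d1: "((\<lambda>s. F (p s t)) has_real_derivative F1 a (p s t)) (at s)" if "0 \<le> s" "s \<le> h" "0 \<le> t" "t \<le> h" for s t
  proof -
    have "((\<lambda>x. F ((p 0 t)(a := x))) has_real_derivative F1 a ((p 0 t)(a := u a + s))) (at (u a + s))"
      by (rule partial_onD'[OF F]) (use S[OF that] ab p(1)[of s t] in \<open>auto simp: p_def\<close>)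
    then have "((\<lambda>x. F ((p 0 t)(a := x + u a))) has_real_derivative F1 a ((p 0 t)(a := u a + s))) (at s)"
      by (subst (asm) add.commute, subst DERIV_shift[symmetric])
    moreover have "(\<lambda>s. F (p s t)) = (\<lambda>x. F ((p 0 t)(a := x + u a)))"
    proof
      fix x show "F (p x t) = F ((p 0 t)(a := x + u a))" by (subst p(1)) (simp add: add.commute)
    qed
    ultimately show ?thesis by (simp only: p(1)[of s t, symmetric])
  qed
  have d2: "((\<lambda>t. F1 a (p s t)) has_real_derivative F2 a b (p s t)) (at t)" if "0 \<le> s" "s \<le> h" "0 \<le> t" "t \<le> h" for s t
  proof -
    have "((\<lambda>x. F1 a ((p s 0)(b := x))) has_real_derivative F2 a b ((p s 0)(b := u b + t))) (at (u b + t))"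
      by (rule partial_onD'[OF F1]) (use S[OF that] ab p(2)[of s t] in \<open>auto simp: p_def\<close>)
    then have "((\<lambda>x. F1 a ((p s 0)(b := x + u b))) has_real_derivative F2 a b ((p s 0)(b := u b + t))) (at t)"
      by (subst (asm) add.commute, subst DERIV_shift[symmetric])
    moreover have "(\<lambda>t. F1 a (p s t)) = (\<lambda>x. F1 a ((p s 0)(b := x + u b)))"
    proof
      fix x show "F1 a (p s x) = F1 a ((p s 0)(b := x + u b))" by (subst p(2)) (simp add: add.commute)
    qed
    ultimately show ?thesis by (simp only: p(2)[of s t, symmetric])
  qed
  have "\<exists>s. 0 < s \<and> s < h \<and> (F (p h h) - F (p h 0)) - (F (p 0 h) - F (p 0 0)) = (h - 0) * (F1 a (p s h) - F1 a (p s 0))"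
    by (rule MVT2[OF h]) (auto intro!: derivative_intros d1 h[THEN less_imp_le])
  then obtain s where s: "0 < s" "s < h"
    "(F (p h h) - F (p h 0)) - (F (p 0 h) - F (p 0 0)) = h * (F1 a (p s h) - F1 a (p s 0))" by auto
  have "\<exists>t. 0 < t \<and> t < h \<and> F1 a (p s h) - F1 a (p s 0) = (h - 0) * F2 a b (p s t)"
    by (rule MVT2[OF h]) (use s in \<open>auto intro!: d2\<close>)
  then obtain t where t: "0 < t" "t < h" "F1 a (p s h) - F1 a (p s 0) = h * F2 a b (p s t)" by auto
  have p0: "p h 0 = u(a := u a + h)" "p 0 h = u(b := u b + h)" "p 0 0 = u" using ab by (auto simp: p_def fun_eq_iff)
  have "F (p h h) - F (p h 0) - F (p 0 h) + F (p 0 0) = h * (h * F2 a b (p s t))"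
    using s(3) unfolding t(3) by simp
  then show ?thesis using s t unfolding p0 by (intro exI[of _ s] exI[of _ t]) (simp add: p_def)
qed

text \<open>The mixed second difference over a square of side \<open>h\<close> equals
  \<open>h * h\<close> times either mixed derivative at some point of the square; continuity at
  \<open>u\<close> identifies the two.\<close>

lemma mixed_partials_commute:
  assumes F: "partial_on q (ob q \<rho>) F F1" and F1: "\<And>a. a < q \<Longrightarrow> partial_on q (ob q \<rho>) (F1 a) (F2 a)"
    and cts: "\<And>a b. a < q \<Longrightarrow> b < q \<Longrightarrow> cts_at q (F2 a b) u" and u: "u \<in> ob q \<rho>"
    and ab: "a < q" "b < q"
  shows "F2 a b u = F2 b a u"
proof (rule ccontr)
  assume ne: "F2 a b u \<noteq> F2 b a u"
  then have ab': "a \<noteq> b" by auto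
  define \<epsilon> where "\<epsilon> = \<bar>F2 a b u - F2 b a u\<bar> / 2"
  have \<epsilon>: "\<epsilon> > 0" using ne by (simp add: \<epsilon>_def)
  obtain d where d: "d > 0" "\<And>v. (\<forall>i<q. \<bar>v i - u i\<bar> < d) \<Longrightarrow> v \<in> ob q \<rho>" using ob_nbhd[OF u] by blast
  obtain d1 where d1: "d1 > 0" "\<And>v. (\<forall>i<q. \<bar>v i - u i\<bar> < d1) \<Longrightarrow> \<bar>F2 a b v - F2 a b u\<bar> < \<epsilon>"
    using cts[OF ab] \<epsilon> unfolding cts_at_def by blast
  obtain d2 where d2: "d2 > 0" "\<And>v. (\<forall>i<q. \<bar>v i - u i\<bar> < d2) \<Longrightarrow> \<bar>F2 b a v - F2 b a u\<bar> < \<epsilon>"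
    using cts[OF ab(2,1)] \<epsilon> unfolding cts_at_def by blast
  define h where "h = min d (min d1 d2) / 2"
  have h: "0 < h" "h < d" "h < d1" "h < d2" using d(1) d1(1) d2(1) by (auto simp: h_def)
  have inS: "u(a := u a + s, b := u b + t) \<in> ob q \<rho>" "u(b := u b + s, a := u a + t) \<in> ob q \<rho>"
    if "0 \<le> s" "s \<le> h" "0 \<le> t" "t \<le> h" for s t
    using that h d(1) ab' by (auto intro!: d(2))
  obtain s t where st: "0 \<le> s" "s \<le> h" "0 \<le> t" "t \<le> h"
    "F (u(a := u a + h, b := u b + h)) - F (u(a := u a + h)) - F (u(b := u b + h)) + F u
      = h * (h * F2 a b (u(a := u a + s, b := u b + t)))"
    using double_difference[where u = u and ?F2.0 = F2 and ?F1.0 = F1, OF F F1[OF ab(1)] ab ab' h(1) inS(1)] by blast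
  obtain s' t' where st': "0 \<le> s'" "s' \<le> h" "0 \<le> t'" "t' \<le> h"
    "F (u(b := u b + h, a := u a + h)) - F (u(b := u b + h)) - F (u(a := u a + h)) + F u
      = h * (h * F2 b a (u(b := u b + s', a := u a + t')))"
    using double_difference[where u = u and ?F2.0 = F2 and ?F1.0 = F1, OF F F1[OF ab(2)] ab(2,1) ab'[symmetric] h(1) inS(2)] by blast
  have "F2 a b (u(a := u a + s, b := u b + t)) = F2 b a (u(b := u b + s', a := u a + t'))"
  proof -
    have "h * (h * F2 a b (u(a := u a + s, b := u b + t))) = h * (h * F2 b a (u(b := u b + s', a := u a + t')))"
      using st(5) st'(5) unfolding fun_upd_twist[OF ab', of u "u a + h" "u b + h"] by linarith
    then show ?thesis using h(1) by simp
  qed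
  moreover have "\<bar>F2 a b (u(a := u a + s, b := u b + t)) - F2 a b u\<bar> < \<epsilon>"
    by (rule d1(2)) (use st h d1 in auto)
  moreover have "\<bar>F2 b a (u(b := u b + s', a := u a + t')) - F2 b a u\<bar> < \<epsilon>"
    by (rule d2(2)) (use st' h d2 in auto)
  ultimately have "\<bar>F2 a b u - F2 b a u\<bar> < \<epsilon> + \<epsilon>" by linarith
  then show False by (simp add: \<epsilon>_def)
qed

text \<open>\<open>C1b\<close> requires measurability on the whole space, while a function with
  partial derivatives on a ball is controlled only there. Cutting it off changes nothing inside the
  ball.\<close>

definition mask :: "nat \<Rightarrow> real \<Rightarrow> ((nat \<Rightarrow> real) \<Rightarrow> real) \<Rightarrow> (nat \<Rightarrow> real) \<Rightarrow> real" where
  "mask q \<rho> F u = (if u \<in> ob q \<rho> then F u else 0)"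

lemma ob_cong: "(\<And>i. i < q \<Longrightarrow> u i = v i) \<Longrightarrow> u \<in> ob q \<rho> \<longleftrightarrow> v \<in> ob q \<rho>"
  using nm_cong[of q u v] by (simp add: ob_def)

lemma cyl_mask: "cyl q F \<Longrightarrow> cyl q (mask q \<rho> F)"
  unfolding cyl_def mask_def using ob_cong by metis

lemma cts_at_mask:
  assumes "cts_at q F u" "u \<in> ob q \<rho>" shows "cts_at q (mask q \<rho> F) u"
  unfolding cts_at_def
proof (intro allI impI)
  fix \<epsilon> :: real assume "\<epsilon> > 0"
  then obtain d where d: "d > 0" "\<And>v. (\<forall>i<q. \<bar>v i - u i\<bar> < d) \<Longrightarrow> \<bar>F v - F u\<bar> < \<epsilon>"
    using assms(1) unfolding cts_at_def by blast
  obtain e where e: "e > 0" "\<And>v. (\<forall>i<q. \<bar>v i - u i\<bar> < e) \<Longrightarrow> v \<in> ob q \<rho>"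
    using ob_nbhd[OF assms(2)] by blast
  have "\<bar>mask q \<rho> F v - mask q \<rho> F u\<bar> < \<epsilon>" if "\<forall>i<q. \<bar>v i - u i\<bar> < min d e" for v
    using d(2)[of v] e(2)[of v] that assms(2) by (simp add: mask_def)
  then show "\<exists>d>0. \<forall>v. (\<forall>i<q. \<bar>v i - u i\<bar> < d) \<longrightarrow> \<bar>mask q \<rho> F v - mask q \<rho> F u\<bar> < \<epsilon>"
    using d(1) e(1) by (intro exI[of _ "min d e"]) auto
qed

lemma mask_deriv:
  assumes "((\<lambda>t. F (u(i := t))) has_real_derivative D) (at (u i))" "u \<in> ob q \<rho>"
  shows "((\<lambda>t. mask q \<rho> F (u(i := t))) has_real_derivative D) (at (u i))"
proof -
  obtain d where d: "d > 0" "\<And>v. (\<forall>i<q. \<bar>v i - u i\<bar> < d) \<Longrightarrow> v \<in> ob q \<rho>"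
    using ob_nbhd[OF assms(2)] by blast
  have inS: "u(i := t) \<in> ob q \<rho>" if "t \<in> {u i - d<..<u i + d}" for t
    using that d(1) by (intro d(2)) (auto simp: abs_less_iff)
  show ?thesis
  proof (rule has_field_derivative_transform_within_open[OF assms(1)])
    show "F (u(i := t)) = mask q \<rho> F (u(i := t))" if "t \<in> {u i - d<..<u i + d}" for t
      using inS[OF that] by (simp only: mask_def if_True)
  qed (use d(1) in auto)
qed

text \<open>The gap between \<rho> and \<rho>' provides the bounds: continuity on the larger ball
  implies boundedness on the smaller one.\<close>

lemma C1b_mask:
  assumes cyl: "cyl q F" and part: "partial_on q (ob q \<rho>') F F1"
    and cyl1: "\<And>i. i < q \<Longrightarrow> cyl q (F1 i)"
    and cts: "\<And>i u. i < q \<Longrightarrow> u \<in> ob q \<rho>' \<Longrightarrow> cts_at q (F1 i) u" and \<rho>: "\<rho> < \<rho>'"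
  shows "C1b q \<rho> (mask q \<rho>' F) (\<lambda>i. mask q \<rho>' (F1 i))"
proof -
  have ctsF: "cts_at q F u" if "u \<in> ob q \<rho>'" for u
    by (rule cts_at_of_cts_partials[OF cyl part that]) (rule cts[OF _ that])
  have sub: "u \<in> ob q \<rho>'" if "u \<in> ob q \<rho>" for u using that \<rho> by (simp add: ob_def)
  have bd: "\<exists>M. \<forall>u\<in>ob q \<rho>. \<bar>mask q \<rho>' H u\<bar> \<le> M" if "cyl q H" "\<And>u. u \<in> ob q \<rho>' \<Longrightarrow> cts_at q H u" for H
    using bounded_on_ob[OF that \<rho>] sub by (simp add: mask_def)
  have "\<forall>i\<in>{..<q}. \<exists>M. \<forall>u\<in>ob q \<rho>. \<bar>mask q \<rho>' (F1 i) u\<bar> \<le> M" using bd cyl1 cts by simp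
  then obtain N where N: "\<And>i u. i < q \<Longrightarrow> u \<in> ob q \<rho> \<Longrightarrow> \<bar>mask q \<rho>' (F1 i) u\<bar> \<le> N i" by (auto dest!: bchoice)
  obtain N0 where N0: "\<And>u. u \<in> ob q \<rho> \<Longrightarrow> \<bar>mask q \<rho>' F u\<bar> \<le> N0" using bd[OF cyl ctsF] by blast
  have Nsum: "N i \<le> \<bar>N0\<bar> + (\<Sum>i<q. \<bar>N i\<bar>)" if "i < q" for i
  proof -
    have "\<bar>N i\<bar> \<le> (\<Sum>i<q. \<bar>N i\<bar>)" using that by (intro member_le_sum) auto
    then show ?thesis by linarith
  qed
  have "0 \<le> (\<Sum>i<q. \<bar>N i\<bar>)" by (intro sum_nonneg) auto
  then have N0sum: "N0 \<le> \<bar>N0\<bar> + (\<Sum>i<q. \<bar>N i\<bar>)" by linarith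
  show ?thesis
    unfolding C1b_def
  proof (intro conjI allI ballI impI)
    show "cyl q (mask q \<rho>' F)" by (rule cyl_mask[OF cyl])
    show "partial_on q (ob q \<rho>) (mask q \<rho>' F) (\<lambda>i. mask q \<rho>' (F1 i))"
      unfolding partial_on_def
    proof (intro ballI allI impI)
      fix u i assume u: "u \<in> ob q \<rho>" and i: "i < q"
      show "((\<lambda>t. mask q \<rho>' F (u(i := t))) has_real_derivative mask q \<rho>' (F1 i) u) (at (u i))"
        using mask_deriv[OF partial_onD[OF part sub[OF u] i] sub[OF u]] sub[OF u] by (simp add: mask_def[of _ _ "F1 i"])
    qed
    show "mask q \<rho>' F \<in> borel_measurable borel"
      using borel_measurable_of_cts_at[OF ctsF] by (simp add: mask_def[abs_def])
    show "mask q \<rho>' (F1 i) \<in> borel_measurable borel" if "i < q" for i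
      using borel_measurable_of_cts_at[OF cts[OF that]] by (simp add: mask_def[abs_def])
    show "cts_at q (mask q \<rho>' (F1 i)) u" if "i < q" "u \<in> ob q \<rho>" for i u
      by (rule cts_at_mask[OF cts[OF that(1) sub[OF that(2)]] sub[OF that(2)]])
    show "\<exists>M. \<forall>u\<in>ob q \<rho>. \<bar>mask q \<rho>' F u\<bar> \<le> M \<and> (\<forall>i<q. \<bar>mask q \<rho>' (F1 i) u\<bar> \<le> M)"
      using N N0 N0sum Nsum by (intro exI[of _ "\<bar>N0\<bar> + (\<Sum>i<q. \<bar>N i\<bar>)"]) (meson order_trans)
  qed
qed

subsection \<open>Strong concavity without continuity of the second derivatives\<close>

text \<open>A pointwise limit of difference quotients. It serves derivatives that exist everywhere
  but may fail to be continuous.\<close>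

lemma partial_measurable:
  fixes \<Phi> :: "(nat \<Rightarrow> real) \<Rightarrow> real" and i :: nat
  assumes [measurable]: "\<Phi> \<in> borel_measurable borel"
    and d: "\<And>u. ((\<lambda>t. \<Phi> (u(i := t))) has_real_derivative \<Phi>' u) (at (u i))"
  shows "\<Phi>' \<in> borel_measurable borel"
proof (rule borel_measurable_LIMSEQ_real)
  fix u :: "nat \<Rightarrow> real"
  have "((\<lambda>h. (\<Phi> (u(i := u i + h)) - \<Phi> u) / h) \<longlongrightarrow> \<Phi>' u) (at 0)"
    using d[of u] unfolding DERIV_def by simp
  moreover have "filterlim (\<lambda>n. 1 / real (Suc n)) (at 0) sequentially"
    unfolding filterlim_at using LIMSEQ_Suc[OF lim_1_over_n] by auto
  ultimately show "(\<lambda>n. (\<Phi> (u(i := u i + 1 / real (Suc n))) - \<Phi> u) / (1 / real (Suc n))) \<longlonglongrightarrow> \<Phi>' u"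
    by (rule filterlim_compose)
next
  fix n
  show "(\<lambda>u. (\<Phi> (u(i := u i + 1 / real (Suc n))) - \<Phi> u) / (1 / real (Suc n))) \<in> borel_measurable borel"
    by measurable
qed

lemma borel_measurable_shift [measurable (raw)]:
  assumes [measurable]: "f \<in> borel_measurable M" "g \<in> borel_measurable M" "h \<in> borel_measurable M"
  shows "(\<lambda>x (j::nat). f x j - g x * h x j :: real) \<in> borel_measurable M"
  by (rule borel_measurable_into_fun) measurable

lemma integral_lebR_translate:
  fixes f :: "(nat \<Rightarrow> real) \<Rightarrow> real"
  assumes I: "finite I" and f: "f \<in> borel_measurable borel" and c: "\<And>j. j \<notin> I \<Longrightarrow> c j = 0"
  shows "(\<integral>u. f (\<lambda>j. u j + c j) \<partial>lebR I) = (\<integral>u. f u \<partial>lebR I)"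
proof -
  have m [measurable]: "(\<lambda>u j. u j + c j) \<in> borel_measurable borel"
    by (rule borel_measurable_into_fun) measurable
  have "distr (lebR I) borel (\<lambda>u j. u j + c j) = lebR I"
  proof (rule measure_eqI)
    fix A assume "A \<in> sets (distr (lebR I) borel (\<lambda>u j. u j + c j))"
    then have [measurable]: "A \<in> sets borel" by simp
    have "emeasure (distr (lebR I) borel (\<lambda>u j. u j + c j)) A
        = (\<integral>\<^sup>+u. indicator A u \<partial>distr (lebR I) borel (\<lambda>u j. u j + c j))"
      by (subst nn_integral_indicator) auto
    also have "\<dots> = (\<integral>\<^sup>+u. indicator A (\<lambda>j. u j + c j) \<partial>lebR I)"
      by (rule nn_integral_distr) (auto simp: m)
    also have "\<dots> = (\<integral>\<^sup>+u. indicator A u \<partial>lebR I)"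
      by (rule nn_integral_lebR_translate[OF I _ c]) auto
    also have "\<dots> = emeasure (lebR I) A" by (subst nn_integral_indicator) auto
    finally show "emeasure (distr (lebR I) borel (\<lambda>u j. u j + c j)) A = emeasure (lebR I) A" .
  qed simp
  then have "(\<integral>u. f u \<partial>lebR I) = (\<integral>u. f u \<partial>distr (lebR I) borel (\<lambda>u j. u j + c j))" by simp
  also have "\<dots> = (\<integral>u. f (\<lambda>j. u j + c j) \<partial>lebR I)"
    by (rule integral_distr) (use f m in auto)
  finally show ?thesis ..
qed

text \<open>A small cube around the origin, on which the bump is one, has positive volume.\<close>

lemma bump_integral_pos:
  assumes s: "0 < s"
  shows "0 < (\<integral>u. bump q s u \<partial>lebR {..<q})"
proof -
  interpret product_sigma_finite "\<lambda>_. lborel :: real measure" by standard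
  define c where "c = s / (real q + 1)"
  have c: "0 < c" using s by (simp add: c_def)
  define A where "A = {u :: nat \<Rightarrow> real. \<forall>i<q. \<bar>u i\<bar> \<le> c}"
  have [measurable]: "A \<in> sets borel" unfolding A_def by measurable
  have small: "nm q u \<le> s" if "u \<in> A" for u
  proof -
    have "nm q u \<le> (\<Sum>i<q. \<bar>u i\<bar>)" by (rule L2_set_le_sum_abs)
    also have "\<dots> \<le> (\<Sum>i<q. c)" using that by (intro sum_mono) (auto simp: A_def)
    also have "\<dots> \<le> (real q + 1) * c" using c by simp
    also have "\<dots> = s" by (simp add: c_def)
    finally show ?thesis .
  qed
  have int: "integrable (lebR {..<q}) (bump q s)"
  proof (rule integrable_lebR_bounded_support[where M = 1 and \<rho> = "2 * s"])
    show "\<bar>bump q s u\<bar> \<le> 1" for u using bump_bounds[of q s u] by simp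
    show "bump q s u = 0" if "u \<notin> ob q (2 * s)" for u
    proof (rule bump_eq_0[OF s])
      have "sqrt 2 * s \<le> 2 * s" using s sqrt2_less_2 by (intro mult_right_mono) auto
      moreover have "2 * s \<le> nm q u" using that by (simp add: ob_def)
      ultimately show "sqrt 2 * s \<le> nm q u" by linarith
    qed
  qed measurable
  have "emeasure (lebR {..<q}) A = emeasure (PiM {..<q} (\<lambda>_. lborel)) (PiE {..<q} (\<lambda>_. {- c..c}))"
  proof -
    have "(\<lambda>u i. if i \<in> {..<q} then u i else 0) -` A \<inter> space (PiM {..<q} (\<lambda>_. lborel)) = PiE {..<q} (\<lambda>_. {- c..c})"
    proof (intro equalityI subsetI)
      fix u assume "u \<in> (\<lambda>u i. if i \<in> {..<q} then u i else 0) -` A \<inter> space (PiM {..<q} (\<lambda>_. lborel))"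
      then have "\<bar>u i\<bar> \<le> c" if "i < q" for i using that by (auto simp: A_def dest!: spec[of _ i])
      moreover have "u \<in> extensional {..<q}" using \<open>u \<in> _\<close> by (simp add: space_PiM PiE_def)
      ultimately show "u \<in> PiE {..<q} (\<lambda>_. {- c..c})" by (force simp: PiE_def)
    next
      fix u assume u: "u \<in> PiE {..<q} (\<lambda>_. {- c..c})"
      then have "\<bar>u i\<bar> \<le> c" if "i < q" for i using PiE_mem[OF u, of i] that by (simp add: abs_le_iff)
      then show "u \<in> (\<lambda>u i. if i \<in> {..<q} then u i else 0) -` A \<inter> space (PiM {..<q} (\<lambda>_. lborel))"
        using u by (simp add: A_def space_PiM PiE_def)
    qed
    moreover have "emeasure (lebR {..<q}) A = emeasure (PiM {..<q} (\<lambda>_. lborel))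
        ((\<lambda>u i. if i \<in> {..<q} then u i else 0) -` A \<inter> space (PiM {..<q} (\<lambda>_. lborel)))"
      unfolding lebR_def by (rule emeasure_distr[OF zero_ext_measurable]) simp
    ultimately show ?thesis by simp
  qed
  also have "\<dots> = ennreal ((2 * c) ^ q)"
    using c by (subst emeasure_PiM) (auto simp: ennreal_power)
  finally have em: "emeasure (lebR {..<q}) A = ennreal ((2 * c) ^ q)" .
  have "0 < (2 * c) ^ q" using c by simp
  also have "(2 * c) ^ q = (\<integral>u. indicator A u \<partial>lebR {..<q})"
    using em c by (simp add: measure_def)
  also have "\<dots> \<le> (\<integral>u. bump q s u \<partial>lebR {..<q})"
  proof (rule integral_mono)
    show "integrable (lebR {..<q}) (indicator A :: _ \<Rightarrow> real)" using em by auto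
    show "indicator A u \<le> bump q s u" for u
      using small[of u] bump_eq_1[OF s, where q = q and u = u] bump_bounds[of q s u] by (auto simp: indicator_def)
  qed (rule int)
  finally show ?thesis .
qed

text \<open>If the second partial derivatives are not continuous, the gradient need not be
  differentiable, and the bound on the partial derivatives only controls directional increments
  after averaging against a bump function.\<close>

lemma directional_increment_le:
  assumes cyl: "cyl q F" and part: "partial_on q (ob q \<delta>) F F'"
    and bd: "\<And>i u. i < q \<Longrightarrow> u \<in> ob q \<delta> \<Longrightarrow> \<bar>F' i u\<bar> \<le> M"
    and w: "w \<in> ob q \<delta>" "\<And>j. q \<le> j \<Longrightarrow> w j = 0"
    and K: "\<And>v. v \<in> ob q \<delta> \<Longrightarrow> ip q w (\<lambda>i. F' i v) \<le> - K"
  shows "F w - F (\<lambda>_. 0) \<le> - K"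
proof (rule ccontr)
  assume "\<not> F w - F (\<lambda>_. 0) \<le> - K"
  \<comment> \<open>A quarter of the presumed violation: replacing \<open>F\<close> by its averages
    near \<open>w\<close> and near 0 uses up two quarters.\<close>
  define \<eta> where "\<eta> = (F w - F (\<lambda>_. 0) + K) / 4"
  have \<eta>: "0 < \<eta>" using \<open>\<not> F w - F (\<lambda>_. 0) \<le> - K\<close> by (simp add: \<eta>_def)
  have cts: "cts_at q F u" if "u \<in> ob q \<delta>" for u
    by (rule cts_at_of_bounded_partials[OF cyl part bd that])
  have "nm q w < \<delta>" using w(1) by (simp add: ob_def)
  then have \<delta>: "0 < \<delta>" using L2_set_nonneg[of w "{..<q}"] by linarith
  have zero: "(\<lambda>_. 0) \<in> ob q \<delta>" using \<delta> by (simp add: ob_def L2_set_def)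
  obtain d0 where d0: "d0 > 0" "\<And>v. (\<forall>i<q. \<bar>v i - 0\<bar> < d0) \<Longrightarrow> \<bar>F v - F (\<lambda>_. 0)\<bar> < \<eta>"
    using cts[OF zero] \<eta> unfolding cts_at_def by blast
  obtain d1 where d1: "d1 > 0" "\<And>v. (\<forall>i<q. \<bar>v i - w i\<bar> < d1) \<Longrightarrow> \<bar>F v - F w\<bar> < \<eta>"
    using cts[OF w(1)] \<eta> unfolding cts_at_def by blast
  define s where "s = min (min d0 d1) (\<delta> - nm q w) / 4"
  have s: "0 < s" "2 * s < d0" "2 * s < d1" "nm q w + 4 * s \<le> \<delta>"
    using d0(1) d1(1) w(1) by (auto simp: s_def ob_def)
  define \<delta>' where "\<delta>' = nm q w + 3 * s"
  have \<delta>': "\<delta>' < \<delta>" "0 < \<delta>'" using s L2_set_nonneg[of w "{..<q}"] by (auto simp: \<delta>'_def intro: add_nonneg_pos)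
  have sub: "u \<in> ob q \<delta>" if "u \<in> ob q \<delta>'" for u using that \<delta>' by (simp add: ob_def)
  define b where "b = bump q s"
  define E where "E = mask q \<delta>' F"
  define E' where "E' i = mask q \<delta>' (F' i)" for i
  have [measurable]: "b \<in> borel_measurable borel" by (simp add: b_def)
  have E_meas [measurable]: "E \<in> borel_measurable borel"
    using borel_measurable_of_cts_at[of q \<delta>' F] cts sub by (simp add: E_def mask_def[abs_def])
  obtain N where N: "\<And>u. \<bar>E u\<bar> \<le> N"
  proof -
    obtain N0 where "\<forall>u\<in>ob q \<delta>'. \<bar>F u\<bar> \<le> N0" using bounded_on_ob[OF cyl cts \<delta>'(1)] by blast
    then have "\<bar>E u\<bar> \<le> \<bar>N0\<bar>" for u by (auto simp: E_def mask_def)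
    then show thesis by (rule that)
  qed
  have N0: "0 \<le> N" using N[of "\<lambda>_. 0"] by linarith
  have b_supp: "nm q u < 2 * s" if "b u \<noteq> 0" for u
  proof -
    have "nm q u < sqrt 2 * s" using that bump_eq_0[OF s(1), where q = q and u = u] by (force simp: b_def)
    also have "\<dots> \<le> 2 * s" using s sqrt2_less_2 by (intro mult_right_mono) auto
    finally show ?thesis .
  qed
  \<comment> \<open>The bump centred at \<open>t w\<close> is \<open>b (sh t y)\<close>, and the
    integral of \<open>E\<close> against it is a smoothed value of \<open>F\<close> at
    \<open>t w\<close>. In \<open>t\<close> only the bump is differentiated, which avoids
    derivatives of \<open>F\<close> along a direction.\<close>
  define sh where "sh t y = (\<lambda>j. y j - t * w j)" for t and y :: "nat \<Rightarrow> real"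
  have sh_meas [measurable]: "(\<lambda>x. sh (f x) (g x)) \<in> borel_measurable M"
    if [measurable]: "f \<in> borel_measurable M" "g \<in> borel_measurable M" for f g and M :: "'m measure"
    unfolding sh_def by measurable
  have sh1 [measurable]: "sh t \<in> borel_measurable borel" for t
    unfolding sh_def[abs_def] by measurable
  have near: "nm q y < \<delta>'" if "nm q (sh t y) < 3 * s" "0 \<le> t" "t \<le> 1" for t y
  proof -
    have "nm q y \<le> nm q (sh t y) + nm q (\<lambda>j. t * w j)"
      using nm_triangle[where q = q and u = "sh t y" and v = "\<lambda>j. t * w j"] by (simp add: sh_def)
    also have "nm q (\<lambda>j. t * w j) \<le> nm q w"
      unfolding nm_scale using that by (simp add: L2_set_nonneg mult_left_le_one_le)
    finally show ?thesis using that(1) by (simp add: \<delta>'_def)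
  qed
  define I0 where "I0 = (\<integral>u. b u \<partial>lebR {..<q})"
  have I0: "0 < I0" unfolding I0_def b_def by (rule bump_integral_pos[OF s(1)])
  have b_int: "integrable (lebR {..<q}) b"
  proof (rule integrable_lebR_bounded_support[where M = 1 and \<rho> = "2 * s"])
    show "\<bar>b u\<bar> \<le> 1" for u using bump_bounds[of q s u] by (simp add: b_def)
    show "b u = 0" if "u \<notin> ob q (2 * s)" for u using b_supp[of u] that by (auto simp: ob_def)
  qed measurable
  have b_shift: "(\<integral>y. b (sh t y) \<partial>lebR {..<q}) = I0" for t
    using integral_lebR_translate[of "{..<q}" b "\<lambda>j. - t * w j"] w(2) by (simp add: sh_def I0_def not_less)
  define db where "db y = (\<Sum>i<q. w i * bump' q s i y)" for y
  have db_meas [measurable]: "db \<in> borel_measurable borel" unfolding db_def[abs_def] by measurable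
  have db_bd: "\<bar>db y\<bar> \<le> 16 / s * nm q w" for y
    unfolding db_def by (rule bump'_bound[OF s(1)])
  have b_path: "((\<lambda>t. b (sh t y)) has_real_derivative - db (sh t y)) (at t)" for t y
  proof -
    have "((\<lambda>t. ip q (sh t y) (sh t y)) has_real_derivative (\<Sum>j<q. - (2 * w j * sh t y j))) (at t)"
      unfolding ip_def sh_def by (auto intro!: derivative_eq_intros simp: algebra_simps)
    then have "((\<lambda>t. ip q (sh t y) (sh t y) / s\<^sup>2) has_real_derivative (\<Sum>j<q. - (2 * w j * sh t y j)) / s\<^sup>2) (at t)"
      by (rule DERIV_cdivide)
    from DERIV_chain2[OF cutoff_deriv this]
    have "((\<lambda>t. b (sh t y)) has_real_derivative cutoff' (ip q (sh t y) (sh t y) / s\<^sup>2) * ((\<Sum>j<q. - (2 * w j * sh t y j)) / s\<^sup>2)) (at t)"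
      by (simp add: b_def bump_def)
    moreover have "cutoff' (ip q (sh t y) (sh t y) / s\<^sup>2) * ((\<Sum>j<q. - (2 * w j * sh t y j)) / s\<^sup>2) = - db (sh t y)"
      by (simp add: db_def bump'_def sum_divide_distrib sum_distrib_left sum_negf mult_ac)
    ultimately show ?thesis by simp
  qed
  \<comment> \<open>Integration by parts in each coordinate moves the directional derivative from
    the bump to \<open>E\<close>, where the assumption on the partial derivatives applies pointwise
    under the integral.\<close>
  have ibp: "(\<integral>y. E y * db (sh t y) \<partial>lebR {..<q}) \<ge> K * I0" if t: "0 \<le> t" "t \<le> 1" for t
  proof -
    have b_out: "b (sh t y) = 0 \<and> bump' q s i (sh t y) = 0" if "y \<notin> ob q \<delta>'" for y i
    proof -
      have "3 * s \<le> nm q (sh t y)" using near[of t y] that t by (force simp: ob_def)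
      moreover have "sqrt 2 * s \<le> 3 * s" using s sqrt2_less_2 by (intro mult_right_mono) auto
      ultimately have "sqrt 2 * s \<le> nm q (sh t y)" by linarith
      then show ?thesis unfolding b_def using s(1) by (auto intro!: bump_eq_0 bump'_eq_0)
    qed
    define D where "D i y = E' i y * b (sh t y) + E y * bump' q s i (sh t y)" for i y
    have deriv: "((\<lambda>x. E (y(i := x)) * b (sh t (y(i := x)))) has_real_derivative D i y) (at (y i))" if i: "i < q" for i y
    proof (cases "y \<in> ob q \<delta>'")
      case True
      have dE: "((\<lambda>x. E (y(i := x))) has_real_derivative E' i y) (at (y i))"
        using mask_deriv[OF partial_onD[OF part sub[OF True] i] True] True by (simp add: E_def E'_def mask_def[of _ _ "F' i"])
      have "((\<lambda>x. b ((sh t y)(i := x))) has_real_derivative bump' q s i (sh t y)) (at (sh t y i))"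
        using bump_partial[of q UNIV s] i by (auto simp: partial_on_def b_def)
      then have "((\<lambda>x. b ((sh t y)(i := x + (- t * w i)))) has_real_derivative bump' q s i (sh t y)) (at (y i))"
        using DERIV_shift[where f = "\<lambda>x. b ((sh t y)(i := x))" and z = "- t * w i" and x = "y i" and y = "bump' q s i (sh t y)"]
        by (simp add: sh_def)
      moreover have "(sh t y)(i := x + (- t * w i)) = sh t (y(i := x))" for x by (auto simp: sh_def)
      ultimately have db: "((\<lambda>x. b (sh t (y(i := x)))) has_real_derivative bump' q s i (sh t y)) (at (y i))" by simp
      show ?thesis using DERIV_mult[OF dE db] by (simp add: D_def algebra_simps)
    next
      case False
      have "((\<lambda>x. 0) has_real_derivative 0) (at (y i))" by simp
      then have "((\<lambda>x. E (y(i := x)) * b (sh t (y(i := x)))) has_real_derivative 0) (at (y i))"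
      proof (rule has_field_derivative_transform_within_open[where S = "{x. 2 * s < nm q (sh t (y(i := x)))}"])
        have "continuous_on UNIV (\<lambda>x. (y(i := x)) j)" for j
          by (cases "j = i") (auto intro!: continuous_intros)
        then have "continuous_on UNIV (\<lambda>x. nm q (sh t (y(i := x))))"
          unfolding L2_set_def sh_def by (intro continuous_intros)
        then show "open {x. 2 * s < nm q (sh t (y(i := x)))}"
          by (intro open_Collect_less continuous_intros)
        show "0 = E (y(i := x)) * b (sh t (y(i := x)))" if "x \<in> {x. 2 * s < nm q (sh t (y(i := x)))}" for x
          using b_supp[of "sh t (y(i := x))"] that by force
        have "3 * s \<le> nm q (sh t y)" using near[of t y] False t by (force simp: ob_def)
        then show "y i \<in> {x. 2 * s < nm q (sh t (y(i := x)))}" using s by simp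
      qed
      moreover have "D i y = 0" using b_out[OF False] by (simp add: D_def)
      ultimately show ?thesis by simp
    qed
    have D_meas [measurable]: "D i \<in> borel_measurable borel" if i: "i < q" for i
      by (rule partial_measurable[OF _ deriv[OF i]]) measurable
    have D_zero: "D i y = 0" if "y \<notin> ob q \<delta>'" for i y using b_out[OF that] by (simp add: D_def)
    have D_bd: "\<bar>D i y\<bar> \<le> \<bar>M\<bar> + N * (16 / s * nm q (\<lambda>j. if j = i then 1 else 0))" if i: "i < q" for i y
    proof -
      have "(\<Sum>j<q. (if j = i then 1 else 0) * bump' q s j (sh t y)) = bump' q s i (sh t y)"
        using i by (simp add: mult_delta_left)
      then have 1: "\<bar>bump' q s i (sh t y)\<bar> \<le> 16 / s * nm q (\<lambda>j. if j = i then 1 else 0)"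
        using bump'_bound[OF s(1), where q = q and y = "\<lambda>j. if j = i then 1 else 0" and u = "sh t y"] by simp
      have 2: "\<bar>E' i y\<bar> \<le> \<bar>M\<bar>" using bd[OF i sub] by (force simp: E'_def mask_def)
      have 3: "\<bar>b (sh t y)\<bar> \<le> 1" using bump_bounds[of q s] by (simp add: b_def)
      have "\<bar>D i y\<bar> \<le> \<bar>E' i y\<bar> * \<bar>b (sh t y)\<bar> + \<bar>E y\<bar> * \<bar>bump' q s i (sh t y)\<bar>"
        unfolding D_def abs_mult[symmetric] by (rule abs_triangle_ineq)
      also have "\<dots> \<le> \<bar>M\<bar> * 1 + N * (16 / s * nm q (\<lambda>j. if j = i then 1 else 0))"
        using N0 by (intro add_mono mult_mono 1 2 3 N) auto
      finally show ?thesis by simp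
    qed
    have D_int: "integrable (lebR {..<q}) (D i)" if "i < q" for i
      by (rule integrable_lebR_bounded_support[OF D_meas[OF that] D_bd[OF that] D_zero])
    have D0: "(\<integral>y. D i y \<partial>lebR {..<q}) = 0" if i: "i < q" for i
      by (rule integral_partial_eq_0[where \<Phi> = "\<lambda>y. E y * b (sh t y)", OF D_meas[OF i] i deriv[OF i] D_bd[OF i] _ D_zero \<delta>'(2)])
         (use b_out in auto)
    have Edb_int: "integrable (lebR {..<q}) (\<lambda>y. E y * db (sh t y))"
    proof (rule integrable_lebR_bounded_support[where M = "N * (16 / s * nm q w)" and \<rho> = \<delta>'])
      show "\<bar>E y * db (sh t y)\<bar> \<le> N * (16 / s * nm q w)" for y
        unfolding abs_mult using N N0 db_bd by (intro mult_mono) auto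
    qed (measurable, auto simp: E_def mask_def)
    have "0 = (\<integral>y. (\<Sum>i<q. w i * D i y) \<partial>lebR {..<q})"
      using D_int D0 by simp
    also have "\<dots> \<le> (\<integral>y. - K * b (sh t y) + E y * db (sh t y) \<partial>lebR {..<q})"
    proof (rule integral_mono)
      show "integrable (lebR {..<q}) (\<lambda>y. \<Sum>i<q. w i * D i y)" using D_int by auto
      have "integrable (lebR {..<q}) (\<lambda>y. b (sh t y))"
      proof (rule integrable_lebR_bounded_support[where M = 1 and \<rho> = \<delta>'])
        show "\<bar>b (sh t u)\<bar> \<le> 1" for u using bump_bounds[of q s] by (simp add: b_def)
      qed (measurable, use b_out in auto)
      then show "integrable (lebR {..<q}) (\<lambda>y. - K * b (sh t y) + E y * db (sh t y))" using Edb_int by auto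
      fix y
      have "(\<Sum>i<q. w i * D i y) = ip q w (\<lambda>i. E' i y) * b (sh t y) + E y * db (sh t y)"
        by (simp add: D_def ip_def db_def sum.distrib sum_distrib_left sum_distrib_right algebra_simps)
      moreover have "ip q w (\<lambda>i. E' i y) * b (sh t y) \<le> - K * b (sh t y)"
      proof (cases "y \<in> ob q \<delta>'")
        case True
        then have "ip q w (\<lambda>i. E' i y) \<le> - K" using K[OF sub[OF True]] by (simp add: E'_def mask_def)
        then show ?thesis using bump_bounds[of q s] by (intro mult_right_mono) (auto simp: b_def)
      qed (use b_out in simp)
      ultimately show "(\<Sum>i<q. w i * D i y) \<le> - K * b (sh t y) + E y * db (sh t y)" by simp
    qed
    also have "\<dots> = - K * I0 + (\<integral>y. E y * db (sh t y) \<partial>lebR {..<q})"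
    proof -
      have "integrable (lebR {..<q}) (\<lambda>y. b (sh t y))"
      proof (rule integrable_lebR_bounded_support[where M = 1 and \<rho> = \<delta>'])
        show "\<bar>b (sh t u)\<bar> \<le> 1" for u using bump_bounds[of q s] by (simp add: b_def)
      qed (measurable, use b_out in auto)
      then show ?thesis using Edb_int b_shift[of t] by simp
    qed
    finally show ?thesis by simp
  qed
  interpret lebR: sigma_finite_measure "lebR {..<q}" by (rule sigma_finite_lebR) simp
  interpret P: pair_sigma_finite U01 "lebR {..<q}" ..
  have joint: "integrable (U01 \<Otimes>\<^sub>M lebR {..<q}) (\<lambda>(t, y). E y * db (sh t y))"
  proof (rule integrableI_bounded_set[where A = "UNIV \<times> ob q \<delta>'" and B = "N * (16 / s * nm q w)"])
    show "emeasure (U01 \<Otimes>\<^sub>M lebR {..<q}) (UNIV \<times> ob q \<delta>') < \<infinity>"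
      using emeasure_ob_finite[of q \<delta>'] U01.emeasure_space_1
      by (subst lebR.emeasure_pair_measure_Times) (auto simp: ennreal_mult_less_top)
    have "\<bar>E y * db (sh t y)\<bar> \<le> N * (16 / s * nm q w)" for t y
      unfolding abs_mult using N N0 db_bd by (intro mult_mono) auto
    then show "AE x\<in>UNIV \<times> ob q \<delta>' in U01 \<Otimes>\<^sub>M lebR {..<q}. norm (case x of (t, y) \<Rightarrow> E y * db (sh t y)) \<le> N * (16 / s * nm q w)"
      by (auto simp: split_beta')
  qed (measurable, auto simp: E_def mask_def intro!: AE_I2 split: if_splits)
  have path: "E y * (b (sh 1 y) - b (sh 0 y)) = - (\<integral>t. E y * db (sh t y) \<partial>U01)" for y
  proof -
    have "(\<integral>t. - db (sh t y) \<partial>U01) = b (sh 1 y) - b (sh 0 y)"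
      by (rule integral_U01_deriv[OF _ b_path]) (measurable, use db_bd in simp)
    from this[symmetric] show ?thesis by simp
  qed
  have "(\<integral>y. E y * (b (sh 1 y) - b (sh 0 y)) \<partial>lebR {..<q}) = - (\<integral>y. \<integral>t. E y * db (sh t y) \<partial>U01 \<partial>lebR {..<q})"
    by (simp only: path) simp
  also have "(\<integral>y. \<integral>t. E y * db (sh t y) \<partial>U01 \<partial>lebR {..<q}) = (\<integral>t. \<integral>y. E y * db (sh t y) \<partial>lebR {..<q} \<partial>U01)"
    by (rule P.Fubini_integral[OF joint])
  also have "- (\<integral>t. \<integral>y. E y * db (sh t y) \<partial>lebR {..<q} \<partial>U01) \<le> - (\<integral>t. K * I0 \<partial>U01)"
  proof -
    have "(\<integral>t. K * I0 \<partial>U01) \<le> (\<integral>t. \<integral>y. E y * db (sh t y) \<partial>lebR {..<q} \<partial>U01)"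
    proof (rule integral_mono_AE)
      show "integrable U01 (\<lambda>t. \<integral>y. E y * db (sh t y) \<partial>lebR {..<q})"
        using P.integrable_fst'[OF joint] by simp
      show "AE t in U01. K * I0 \<le> (\<integral>y. E y * db (sh t y) \<partial>lebR {..<q})"
        using AE_U01 by eventually_elim (use ibp in auto)
    qed simp
    then show ?thesis by simp
  qed
  also have "\<dots> = - (K * I0)" by (simp add: U01.prob_space[simplified])
  finally have upper: "(\<integral>y. E y * (b (sh 1 y) - b (sh 0 y)) \<partial>lebR {..<q}) \<le> - (K * I0)" .
  have int01: "integrable (lebR {..<q}) (\<lambda>y. E y * b (sh t y))" for t
  proof (rule integrable_lebR_bounded_support[where M = "N * 1" and \<rho> = \<delta>'])
    show "\<bar>E y * b (sh t y)\<bar> \<le> N * 1" for y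
      unfolding abs_mult using N N0 bump_bounds[of q s] by (intro mult_mono) (auto simp: b_def)
  qed (measurable, auto simp: E_def mask_def)
  have at1: "(\<integral>y. E y * b (sh 1 y) \<partial>lebR {..<q}) \<ge> (F w - \<eta>) * I0"
  proof -
    have "(\<lambda>y. E y * b (sh 1 y)) \<in> borel_measurable borel" by measurable
    then have "(\<integral>y. E y * b (sh 1 y) \<partial>lebR {..<q}) = (\<integral>y. E (\<lambda>j. y j + w j) * b y \<partial>lebR {..<q})"
      using integral_lebR_translate[of "{..<q}" "\<lambda>y. E y * b (sh 1 y)" w] w(2)
      by (simp add: sh_def not_less)
    moreover have "(F w - \<eta>) * I0 \<le> (\<integral>y. E (\<lambda>j. y j + w j) * b y \<partial>lebR {..<q})"
    proof -
      have [measurable]: "(\<lambda>y j. y j + w j) \<in> borel_measurable borel"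
        by (rule borel_measurable_into_fun) measurable
      have "(\<integral>y. (F w - \<eta>) * b y \<partial>lebR {..<q}) \<le> (\<integral>y. E (\<lambda>j. y j + w j) * b y \<partial>lebR {..<q})"
      proof (rule integral_mono)
        show "integrable (lebR {..<q}) (\<lambda>y. (F w - \<eta>) * b y)" using b_int by simp
        show "integrable (lebR {..<q}) (\<lambda>y. E (\<lambda>j. y j + w j) * b y)"
        proof (rule integrable_lebR_bounded_support[where M = "N * 1" and \<rho> = "2 * s"])
          show "\<bar>E (\<lambda>j. y j + w j) * b y\<bar> \<le> N * 1" for y
            unfolding abs_mult using N N0 bump_bounds[of q s] by (intro mult_mono) (auto simp: b_def)
          show "E (\<lambda>j. y j + w j) * b y = 0" if "y \<notin> ob q (2 * s)" for y using b_supp[of y] that by (auto simp: ob_def)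
        qed measurable
        fix y
        show "(F w - \<eta>) * b y \<le> E (\<lambda>j. y j + w j) * b y"
        proof (cases "b y = 0")
          case False
          note y = b_supp[OF False]
          have "nm q (\<lambda>j. y j + w j) < \<delta>'"
            using nm_triangle[where q = q and u = y and v = w] y s by (simp add: \<delta>'_def)
          then have "E (\<lambda>j. y j + w j) = F (\<lambda>j. y j + w j)" by (simp add: E_def mask_def ob_def)
          moreover have "\<bar>F (\<lambda>j. y j + w j) - F w\<bar> < \<eta>"
            by (rule d1(2)) (use y s abs_coord_le_nm[of _ q y] in force)
          ultimately show ?thesis using bump_bounds[of q s y] by (intro mult_right_mono) (auto simp: b_def)
        qed simp
      qed
      then show ?thesis by (simp add: I0_def)
    qed
    ultimately show ?thesis by simp
  qed
  have at0: "(\<integral>y. E y * b (sh 0 y) \<partial>lebR {..<q}) \<le> (F (\<lambda>_. 0) + \<eta>) * I0"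
  proof -
    have "(\<integral>y. E y * b y \<partial>lebR {..<q}) \<le> (\<integral>y. (F (\<lambda>_. 0) + \<eta>) * b y \<partial>lebR {..<q})"
    proof (rule integral_mono)
      show "integrable (lebR {..<q}) (\<lambda>y. (F (\<lambda>_. 0) + \<eta>) * b y)" using b_int by simp
      show "integrable (lebR {..<q}) (\<lambda>y. E y * b y)" using int01[of 0] by (simp add: sh_def)
      fix y
      show "E y * b y \<le> (F (\<lambda>_. 0) + \<eta>) * b y"
      proof (cases "b y = 0")
        case False
        note y = b_supp[OF False]
        have "nm q y < \<delta>'" unfolding \<delta>'_def using y s(1) L2_set_nonneg[of w "{..<q}"] by linarith
        then have "E y = F y" by (simp add: E_def mask_def ob_def)
        moreover have "\<bar>F y - F (\<lambda>_. 0)\<bar> < \<eta>"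
          by (rule d0(2)) (use y s abs_coord_le_nm[of _ q y] in force)
        ultimately show ?thesis using bump_bounds[of q s y] by (intro mult_right_mono) (auto simp: b_def)
      qed simp
    qed
    then show ?thesis by (simp add: I0_def sh_def)
  qed
  have "(F w - \<eta>) * I0 - (F (\<lambda>_. 0) + \<eta>) * I0 \<le> - (K * I0)"
    using at1 at0 upper int01[of 0] int01[of 1] by (simp add: right_diff_distrib)
  then have "(F w - F (\<lambda>_. 0) - 2 * \<eta>) * I0 \<le> - K * I0" by (simp add: algebra_simps)
  then have "F w - F (\<lambda>_. 0) - 2 * \<eta> \<le> - K" using mult_right_le_imp_le[OF _ I0] by simp
  then show False using \<eta> by (simp add: \<eta>_def field_simps)
qed

text \<open>Along a ray the radial derivative is at most \<open>- (t * \<kappa> * ip q u u)\<close>,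
  by the averaged mean value inequality, so \<open>f\<close> plus the matching quadratic term is
  nonincreasing. The gradient is continuous because the second derivatives are bounded, hence the
  chain rule for \<open>f\<close> itself is available.\<close>

lemma strongly_concave_upper:
  assumes cyl: "cyl q f" "\<And>a. a < q \<Longrightarrow> cyl q (f1 a)"
    and part: "partial_on q (ob q \<delta>) f f1" "\<And>a. a < q \<Longrightarrow> partial_on q (ob q \<delta>) (f1 a) (f2 a)"
    and bd: "\<And>a b u. a < q \<Longrightarrow> b < q \<Longrightarrow> u \<in> ob q \<delta> \<Longrightarrow> \<bar>f2 a b u\<bar> \<le> M"
    and zero: "\<And>a. a < q \<Longrightarrow> f1 a (\<lambda>_. 0) = 0"
    and neg: "\<And>v x. v \<in> ob q \<delta> \<Longrightarrow> bil q (\<lambda>a b. f2 a b v) x x \<le> - \<kappa> * ip q x x"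
    and u: "u \<in> ob q \<delta>"
  shows "f u - f (\<lambda>_. 0) \<le> - (\<kappa> * ip q u u) / 2"
proof -
  define u' where "u' i = (if i < q then u i else 0)" for i
  have u'S: "u' \<in> ob q \<delta>" using ob_cong[of q u' u \<delta>] u by (simp add: u'_def)
  have fu: "f u = f u'" by (rule cylD[OF cyl(1)]) (simp add: u'_def)
  have iu: "ip q u u = ip q u' u'" by (simp add: ip_def u'_def)
  have cts1: "cts_at q (f1 a) v" if "a < q" "v \<in> ob q \<delta>" for a v
    by (rule cts_at_of_bounded_partials[OF cyl(2)[OF that(1)] part(2)[OF that(1)] bd[OF that(1)] that(2)])
  have grad: "ip q u' (\<lambda>a. f1 a (\<lambda>i. t * u' i)) \<le> - (t * \<kappa> * ip q u' u')" if t: "0 \<le> t" "t \<le> 1" for t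
  proof -
    have "ip q u' (\<lambda>a. f1 a (\<lambda>i. t * u' i)) - ip q u' (\<lambda>a. f1 a (\<lambda>_. 0)) \<le> - (t * (\<kappa> * ip q u' u'))"
    proof (rule directional_increment_le[where F = "\<lambda>v. ip q u' (\<lambda>a. f1 a v)" and F' = "\<lambda>i v. ip q u' (\<lambda>a. f2 a i v)"
          and M = "\<Sum>a<q. \<bar>u' a\<bar> * M"])
      show "cyl q (\<lambda>v. ip q u' (\<lambda>a. f1 a v))"
        unfolding cyl_def
      proof (intro allI impI)
        fix v w :: "nat \<Rightarrow> real" assume "\<forall>i<q. v i = w i"
        then have "f1 a v = f1 a w" if "a < q" for a using cylD[OF cyl(2)[OF that], of v w] by simp
        then show "ip q u' (\<lambda>a. f1 a v) = ip q u' (\<lambda>a. f1 a w)" by (simp add: ip_def)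
      qed
      show "partial_on q (ob q \<delta>) (\<lambda>v. ip q u' (\<lambda>a. f1 a v)) (\<lambda>i v. ip q u' (\<lambda>a. f2 a i v))"
        unfolding partial_on_def ip_def
        by (intro ballI allI impI DERIV_sum DERIV_cmult) (use part(2) in \<open>auto simp: partial_on_def\<close>)
      show "\<bar>ip q u' (\<lambda>a. f2 a i v)\<bar> \<le> (\<Sum>a<q. \<bar>u' a\<bar> * M)" if "i < q" "v \<in> ob q \<delta>" for i v
        unfolding ip_def
        by (rule order_trans[OF sum_abs sum_mono]) (use bd that in \<open>auto simp: abs_mult intro!: mult_left_mono\<close>)
      show "(\<lambda>i. t * u' i) \<in> ob q \<delta>" by (rule ob_scale[OF u'S]) (use t in auto)
      show "t * u' j = 0" if "q \<le> j" for j using that by (simp add: u'_def)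
      fix v assume v: "v \<in> ob q \<delta>"
      have "ip q (\<lambda>i. t * u' i) (\<lambda>i. ip q u' (\<lambda>a. f2 a i v)) = t * ip q (\<lambda>i. ip q u' (\<lambda>a. f2 a i v)) u'"
        by (simp add: ip_def[of q _ u'] ip_def[of q "\<lambda>i. t * u' i"] sum_distrib_left mult_ac)
      also have "\<dots> = t * bil q (\<lambda>a b. f2 a b v) u' u'" by (simp add: ip_ip_eq_bil)
      also have "\<dots> \<le> t * (- \<kappa> * ip q u' u')" using t by (intro mult_left_mono neg v)
      finally show "ip q (\<lambda>i. t * u' i) (\<lambda>i. ip q u' (\<lambda>a. f2 a i v)) \<le> - (t * (\<kappa> * ip q u' u'))" by simp
    qed
    moreover have "ip q u' (\<lambda>a. f1 a (\<lambda>_. 0)) = 0" by (simp add: ip_def zero)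
    ultimately show ?thesis by (simp add: mult_ac)
  qed
  have "f (\<lambda>i. 1 * u' i) + \<kappa> * ip q u' u' / 2 * 1\<^sup>2 \<le> f (\<lambda>i. 0 * u' i) + \<kappa> * ip q u' u' / 2 * 0\<^sup>2"
  proof (rule DERIV_nonpos_imp_nonincreasing[where f = "\<lambda>t. f (\<lambda>i. t * u' i) + \<kappa> * ip q u' u' / 2 * t\<^sup>2" and a = 0 and b = 1])
    fix t :: real assume t: "0 \<le> t" "t \<le> 1"
    have "((\<lambda>t. f (\<lambda>i. t * u' i)) has_real_derivative ip q (\<lambda>i. f1 i (\<lambda>i. t * u' i)) u') (at t)"
      by (rule segment_deriv[OF cyl(1) part(1) cts1 u'S]) (use t in auto)
    then have "((\<lambda>t. f (\<lambda>i. t * u' i) + \<kappa> * ip q u' u' / 2 * t\<^sup>2) has_real_derivative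
        ip q (\<lambda>i. f1 i (\<lambda>i. t * u' i)) u' + \<kappa> * ip q u' u' * t) (at t)"
      by (auto intro!: derivative_eq_intros)
    moreover have "ip q (\<lambda>i. f1 i (\<lambda>i. t * u' i)) u' + \<kappa> * ip q u' u' * t \<le> 0"
      using grad[OF t] by (simp add: ip_def mult_ac)
    ultimately show "\<exists>y. ((\<lambda>t. f (\<lambda>i. t * u' i) + \<kappa> * ip q u' u' / 2 * t\<^sup>2) has_real_derivative y) (at t) \<and> y \<le> 0"
      by blast
  qed simp
  then show ?thesis by (simp add: fu iu)
qed

subsection \<open>Laplace's method for a fixed function\<close>

text \<open>Read off from the derivative of the Gaussian weight, whose negative logarithm is half of
  the form.\<close>

lemma (in pd_form) half_quadratic_partial:
  "((\<lambda>t. bil q Q (u(i := t)) (u(i := t)) / 2) has_real_derivative (\<Sum>k<q. Q i k * u k)) (at (u i))"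
  if i: "i < q"
proof -
  have "((\<lambda>t. - ln (wt (u(i := t)))) has_real_derivative (\<Sum>k<q. Q i k * u k)) (at (u i))"
    using wt_partial[OF i, of u] wt_pos[of u]
    by (auto intro!: derivative_eq_intros simp: less_imp_neq[THEN not_sym])
  moreover have "- ln (wt v) = bil q Q v v / 2" for v by (simp add: wt_def)
  ultimately show ?thesis by simp
qed

lemma linear_partial:
  fixes i q :: nat and A :: "nat \<Rightarrow> real"
  assumes "i < q"
  shows "((\<lambda>t. \<Sum>k<q. A k * (u(i := t)) k) has_real_derivative A i) (at (u i))"
proof -
  have "(\<Sum>k<q. A k * (u(i := t)) k) = A i * t + (\<Sum>k\<in>{..<q} - {i}. A k * u k)" for t
    using assms by (subst sum.remove[of _ i]) auto
  then show ?thesis by (auto intro!: derivative_eq_intros)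
qed

text \<open>\<open>P js\<close> is the iterated partial derivative of \<open>P []\<close> along \<open>js\<close>.\<close>

locale local_expansion =
  fixes q :: nat and P :: "nat list \<Rightarrow> (nat \<Rightarrow> real) \<Rightarrow> real" and \<delta> \<rho>' M \<kappa> \<kappa>' L3 L4 :: real
  assumes q: "0 < q" and \<kappa>: "0 < \<kappa>" and \<kappa>': "0 < \<kappa>'" and \<delta>: "0 < \<delta>" and \<rho>': "0 < \<rho>'"
    and cyl_P: "\<And>js. cyl q (P js)"
    and partial2: "\<And>js. set js \<subseteq> {..<q} \<Longrightarrow> length js < 2 \<Longrightarrow> partial_on q (ob q \<delta>) (P js) (\<lambda>i. P (i # js))"
    and partial5: "\<And>js. set js \<subseteq> {..<q} \<Longrightarrow> length js < 5 \<Longrightarrow> partial_on q (ob q \<rho>') (P js) (\<lambda>i. P (i # js))"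
    and maximal: "\<And>u. u \<in> ob q \<delta> \<Longrightarrow> P [] u \<le> P [] (\<lambda>_. 0)"
    and hessian: "\<And>u. u \<in> ob q \<delta> \<Longrightarrow>
      eigenvalues_between \<kappa> (Matrix.mat q q (\<lambda>(a, b). - P [a, b] u)) \<kappa>'"
    and third: "\<And>l x y. l < q \<Longrightarrow>
      \<bar>bil q (\<lambda>a b. P [a, b, l] (\<lambda>_. 0)) x y\<bar> \<le> L3 * nm q x * nm q y"
    and fourth: "\<And>u l m x y. u \<in> ob q \<rho>' \<Longrightarrow> l < q \<Longrightarrow> m < q \<Longrightarrow>
      \<bar>bil q (\<lambda>a b. P [a, b, l, m] u) x y\<bar> \<le> L4 * nm q x * nm q y"
    and fifth: "\<And>u js. u \<in> ob q \<rho>' \<Longrightarrow> set js \<subseteq> {..<q} \<Longrightarrow> length js = 5 \<Longrightarrow> \<bar>P js u\<bar> \<le> M"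
begin

lemma zero_in: "0 < \<rho> \<Longrightarrow> (\<lambda>_. 0) \<in> ob q \<rho>"
  by (simp add: ob_def L2_set_def)

text \<open>Downward from the fifth order: bounded fifth derivatives make the fourth ones
  continuous, and continuity then passes from the partial derivatives of a function to the function
  itself.\<close>

lemma cts_P: "cts_at q (P js) u" if "u \<in> ob q \<rho>'" "set js \<subseteq> {..<q}" "length js \<le> 4"
  using that(2,3)
proof (induction "4 - length js" arbitrary: js)
  case 0
  show ?case
    by (rule cts_at_of_bounded_partials[where M = M, OF cyl_P partial5 _ that(1)]) (use 0 in \<open>auto intro!: fifth\<close>)
next
  case (Suc n)
  show ?case
    by (rule cts_at_of_cts_partials[OF cyl_P partial5 that(1)]) (use Suc in auto)
qed

text \<open>The eigenvalue conditions give symmetry in the first two indices of a slice only; other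
  exchanges follow from the continuity of the derivatives. Under a common prefix the inner equality
  is differentiated. It holds only on the ball and is therefore stated for masked functions.\<close>

lemma swap: "P (xs @ a # b # ys) u = P (xs @ b # a # ys) u"
  if "u \<in> ob q \<rho>'" "set (xs @ a # b # ys) \<subseteq> {..<q}" "length xs + length ys \<le> 2"
  using that
proof (induction xs arbitrary: u)
  case Nil
  show ?case
    unfolding append_Nil
    by (rule mixed_partials_commute[where ?F2.0 = "\<lambda>a b. P (b # a # ys)" and ?F1.0 = "\<lambda>a. P (a # ys)", OF partial5 partial5 cts_P, symmetric, where a = a and b = b])
      (use Nil in auto)
next
  case (Cons c xs)
  have c: "c < q" using Cons.prems by simp
  have 1: "((\<lambda>t. P (xs @ a # b # ys) (u(c := t))) has_real_derivative P (c # xs @ a # b # ys) u) (at (u c))"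
    by (rule partial_onD[OF partial5 Cons.prems(1) c]) (use Cons.prems in auto)
  have 2: "((\<lambda>t. P (xs @ b # a # ys) (u(c := t))) has_real_derivative P (c # xs @ b # a # ys) u) (at (u c))"
    by (rule partial_onD[OF partial5 Cons.prems(1) c]) (use Cons.prems in auto)
  have "((\<lambda>t. mask q \<rho>' (P (xs @ a # b # ys)) (u(c := t))) has_real_derivative P (c # xs @ a # b # ys) u) (at (u c))"
    by (rule mask_deriv[OF 1 Cons.prems(1)])
  moreover have "((\<lambda>t. mask q \<rho>' (P (xs @ b # a # ys)) (u(c := t))) has_real_derivative P (c # xs @ b # a # ys) u) (at (u c))"
    by (rule mask_deriv[OF 2 Cons.prems(1)])
  moreover have "mask q \<rho>' (P (xs @ a # b # ys)) = mask q \<rho>' (P (xs @ b # a # ys))"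
    using Cons by (auto simp: mask_def)
  ultimately show ?case by (simp add: DERIV_unique)
qed

lemma hessian_bil:
  assumes u: "u \<in> ob q \<delta>"
  shows "\<And>a b. a < q \<Longrightarrow> b < q \<Longrightarrow> P [a, b] u = P [b, a] u"
    and "\<And>x. \<kappa> * ip q x x \<le> bil q (\<lambda>a b. - P [a, b] u) x x"
    and "\<And>x. bil q (\<lambda>a b. - P [a, b] u) x x \<le> \<kappa>' * ip q x x"
    and "\<And>a b. a < q \<Longrightarrow> b < q \<Longrightarrow> \<bar>P [a, b] u\<bar> \<le> max \<kappa> \<kappa>'"
proof -
  note E = hessian[OF u]
  show "P [a, b] u = P [b, a] u" if "a < q" "b < q" for a b
    using eigenvalues_between_bil(1)[OF E q that] by simp
  show "\<kappa> * ip q x x \<le> bil q (\<lambda>a b. - P [a, b] u) x x" for x by (rule eigenvalues_between_bil(2)[OF E q])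
  show "bil q (\<lambda>a b. - P [a, b] u) x x \<le> \<kappa>' * ip q x x" for x by (rule eigenvalues_between_bil(3)[OF E q])
  have "\<bar>- P [a, b] u\<bar> \<le> max \<kappa> \<kappa>'" if "a < q" "b < q" for a b
    by (rule bil_unit_entry[OF eigenvalues_between_bil_abs[OF E q] that]) (use \<kappa> \<kappa>' in auto)
  then show "\<bar>P [a, b] u\<bar> \<le> max \<kappa> \<kappa>'" if "a < q" "b < q" for a b using that by simp
qed

lemma gradient_zero: "P [a] (\<lambda>_. 0) = 0" if a: "a < q"
proof -
  have "((\<lambda>t. P [] ((\<lambda>_. 0)(a := t))) has_real_derivative P [a] (\<lambda>_. 0)) (at 0)"
    using partial_onD[OF partial2[of "[]"] zero_in[OF \<delta>] a] by simp
  moreover have "P [] ((\<lambda>_. 0)(a := y)) \<le> P [] ((\<lambda>_. 0)(a := 0))" if "\<bar>0 - y\<bar> < \<delta>" for y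
  proof -
    have "nm q ((\<lambda>_. 0)(a := y)) \<le> (\<Sum>i<q. \<bar>((\<lambda>_. 0)(a := y)) i\<bar>)" by (rule L2_set_le_sum_abs)
    also have "\<dots> = \<bar>y\<bar>" using a by (subst sum.remove[of _ a]) auto
    finally show ?thesis using maximal[of "(\<lambda>_. 0)(a := y)"] that by (simp add: ob_def fun_upd_idem)
  qed
  ultimately show ?thesis using DERIV_local_max[OF _ \<delta>] by blast
qed

definition Q :: "nat \<Rightarrow> nat \<Rightarrow> real" where "Q a b = - P [a, b] (\<lambda>_. 0)"

lemma Q_eq: "Q = (\<lambda>a b. - P [a, b] (\<lambda>_. 0))"
  by (intro ext) (simp add: Q_def)

sublocale pd_form q Q \<kappa>
  unfolding Q_eq using hessian_bil[OF zero_in[OF \<delta>]] \<kappa> by unfold_locales auto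

lemma Q_upper: "bil q Q u u \<le> \<kappa>' * ip q u u"
  using hessian_bil(3)[OF zero_in[OF \<delta>], of u] by (simp add: Q_eq)

definition f :: "(nat \<Rightarrow> real) \<Rightarrow> real" where "f u = P [] u - P [] (\<lambda>_. 0)"

lemma f_upper: "u \<in> ob q \<delta> \<Longrightarrow> f u \<le> - (\<kappa> * ip q u u) / 2"
  unfolding f_def
\<comment> \<open>In \<open>P\<close> the latest derivative stands first, in
  \<open>strongly_concave_upper\<close> it stands last; hence the reversed list.\<close>
proof (rule strongly_concave_upper[where ?f1.0 = "\<lambda>a. P [a]" and ?f2.0 = "\<lambda>a b. P [b, a]" and M = "max \<kappa> \<kappa>'"])
  fix v x assume v: "v \<in> ob q \<delta>"
  have "bil q (\<lambda>a b. P [b, a] v) x x = - bil q (\<lambda>a b. - P [a, b] v) x x"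
    unfolding bil_def sum_negf[symmetric] by (subst sum.swap) (simp add: mult_ac)
  then show "bil q (\<lambda>a b. P [b, a] v) x x \<le> - \<kappa> * ip q x x" using hessian_bil(2)[OF v, of x] by simp
qed (use partial2[of "[]"] partial2 hessian_bil(4) in \<open>auto intro: cyl_P gradient_zero\<close>)

lemma f_measurable [measurable]: "(\<lambda>u. indicator (ob q \<delta>) u * exp (f u)) \<in> borel_measurable borel"
proof -
  have cts1: "cts_at q (P [a]) u" if "u \<in> ob q \<delta>" "a < q" for u a
    by (rule cts_at_of_bounded_partials[OF cyl_P partial2 hessian_bil(4) that(1)]) (use that in auto)
  have "cts_at q (P []) u" if u: "u \<in> ob q \<delta>" for u
    by (rule cts_at_of_cts_partials[OF cyl_P partial2 u]) (auto intro: cts1 u)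
  from borel_measurable_of_cts_at[OF this]
  have [measurable]: "(\<lambda>u. if u \<in> ob q \<delta> then P [] u else 0) \<in> borel_measurable borel" .
  have "(\<lambda>u. indicator (ob q \<delta>) u * exp (f u))
      = (\<lambda>u. indicator (ob q \<delta>) u * exp ((if u \<in> ob q \<delta> then P [] u else 0) - P [] (\<lambda>_. 0)))"
    by (auto simp: f_def indicator_def)
  then show ?thesis by simp
qed

text \<open>Since \<open>Q\<close> is minus the Hessian at the origin, adding half of its form
  removes the quadratic part of \<open>f\<close>.\<close>

definition F :: "(nat \<Rightarrow> real) \<Rightarrow> real" where
  "F u = f u + bil q Q u u / 2"
definition F1 :: "nat \<Rightarrow> (nat \<Rightarrow> real) \<Rightarrow> real" where
  "F1 a u = P [a] u + (\<Sum>k<q. Q a k * u k)"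
definition F2 :: "nat \<Rightarrow> nat \<Rightarrow> (nat \<Rightarrow> real) \<Rightarrow> real" where
  "F2 a b u = P [b, a] u + Q a b"

lemma F_partial: "partial_on q (ob q \<rho>') F F1"
  unfolding partial_on_def F_def F1_def f_def
proof (intro ballI allI impI)
  fix u i assume u: "u \<in> ob q \<rho>'" and i: "i < q"
  show "((\<lambda>t. P [] (u(i := t)) - P [] (\<lambda>_. 0) + bil q Q (u(i := t)) (u(i := t)) / 2) has_real_derivative
      P [i] u + (\<Sum>k<q. Q i k * u k)) (at (u i))"
    using DERIV_add[OF DERIV_diff[OF partial_onD[OF partial5[of "[]"] u i] DERIV_const] half_quadratic_partial[OF i, of u]]
    by simp
qed

lemma F1_partial: "partial_on q (ob q \<rho>') (F1 a) (F2 a)" if "a < q"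
  unfolding partial_on_def F1_def F2_def
proof (intro ballI allI impI)
  fix u i assume u: "u \<in> ob q \<rho>'" and i: "i < q"
  have "((\<lambda>t. P [a] (u(i := t))) has_real_derivative P [i, a] u) (at (u i))"
    by (rule partial_onD[OF partial5[of "[a]"] u i]) (use that in auto)
  then show "((\<lambda>t. P [a] (u(i := t)) + (\<Sum>k<q. Q a k * (u(i := t)) k)) has_real_derivative P [i, a] u + Q a i) (at (u i))"
    by (rule DERIV_add) (rule linear_partial[OF i])
qed

lemma F2_partial: "partial_on q (ob q \<rho>') (F2 a b) (\<lambda>c. P [c, b, a])" if "a < q" "b < q"
  unfolding partial_on_def F2_def
proof (intro ballI allI impI)
  fix u i assume u: "u \<in> ob q \<rho>'" and i: "i < q"
  show "((\<lambda>t. P [b, a] (u(i := t)) + Q a b) has_real_derivative P [i, b, a] u) (at (u i))"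
    using DERIV_add[OF partial_onD[OF partial5[of "[b, a]"] u i] DERIV_const[of "Q a b"]] that by simp
qed

lemma cyl_F: "cyl q F" and cyl_F1: "cyl q (F1 a)" and cyl_F2: "cyl q (F2 a b)"
proof -
  have "F u = F v \<and> F1 a u = F1 a v \<and> F2 a b u = F2 a b v" if uv: "\<forall>i<q. u i = v i" for u v
  proof -
    have "P js u = P js v" for js using cylD[OF cyl_P, of u v js] uv by simp
    moreover have "bil q Q u u = bil q Q v v" "(\<Sum>k<q. Q a k * u k) = (\<Sum>k<q. Q a k * v k)"
      using uv by (simp_all add: bil_def)
    ultimately show ?thesis by (simp add: F_def F1_def F2_def f_def)
  qed
  then show "cyl q F" "cyl q (F1 a)" "cyl q (F2 a b)" by (auto simp: cyl_def)
qed

lemma cts_F2: "u \<in> ob q \<rho>' \<Longrightarrow> a < q \<Longrightarrow> b < q \<Longrightarrow> cts_at q (F2 a b) u"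
  unfolding F2_def by (intro cts_at_add cts_at_cyl_const cts_P) auto

lemma cts_F1: "u \<in> ob q \<rho>' \<Longrightarrow> a < q \<Longrightarrow> cts_at q (F1 a) u"
  by (rule cts_at_of_cts_partials[OF cyl_F1 F1_partial]) (auto intro: cts_F2)

text \<open>The slices of the third derivative are bounded by assumption at the maximizer only. Away
  from it the fourth-order slices are integrated along the ray, at the price of
  \<open>sqrt (real q) * \<rho> * L4\<close>; this is affordable because q \<gamma>^2 tends to
  zero.\<close>

lemma third_bound:
  assumes u: "u \<in> ob q \<rho>" and c: "c < q" and \<rho>: "\<rho> < \<rho>'"
  shows "\<bar>bil q (\<lambda>a b. P [c, b, a] u) x y\<bar> \<le> (L3 + sqrt (real q) * \<rho> * L4) * nm q x * nm q y"
proof -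
  let ?H = "\<lambda>a b. P [a, b, c]"
  let ?H' = "\<lambda>a b u. ?H a b u - ?H a b (\<lambda>_. 0)"
  have sub: "v \<in> ob q \<rho>'" if "v \<in> ob q \<rho>" for v using that \<rho> by (simp add: ob_def)
  have L4: "0 \<le> L4 * nm q x * nm q y"
    using fourth[OF zero_in[OF \<rho>'] q q, of x y] by linarith
  have "nm q u < \<rho>" using u by (simp add: ob_def)
  have "bil q (\<lambda>a b. P [c, b, a] u) x y = bil q (\<lambda>a b. ?H a b u) x y"
  proof (rule bil_cong)
    fix a b assume ab: "a < q" "b < q"
    have "P [c, b, a] u = P [c, a, b] u" using swap[of u "[c]" b a "[]"] sub[OF u] ab c by simp
    also have "\<dots> = P [a, c, b] u" using swap[of u "[]" c a "[b]"] sub[OF u] ab c by simp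
    also have "\<dots> = P [a, b, c] u" using swap[of u "[a]" c b "[]"] sub[OF u] ab c by simp
    finally show "P [c, b, a] u = P [a, b, c] u" .
  qed
  moreover have "\<bar>bil q (\<lambda>a b. mask q \<rho>' (?H' a b) u) x y\<bar> \<le> sqrt (real q) * \<rho> * (L4 * nm q x * nm q y)"
  proof (rule C1b_segment_bound[OF C1b_bil _ u])
    fix a b assume ab: "a < q" "b < q"
    have "partial_on q (ob q \<rho>') (?H' a b) (\<lambda>i. P [i, a, b, c])"
      using partial5[of "[a, b, c]"] ab c DERIV_diff[OF _ DERIV_const]
      unfolding partial_on_def by fastforce
    moreover have "cyl q (?H' a b)" using cyl_P[of "[a, b, c]"] by (auto simp: cyl_def)
    ultimately show "C1b q \<rho> (mask q \<rho>' (?H' a b)) (\<lambda>i. mask q \<rho>' (P [i, a, b, c]))"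
      by (intro C1b_mask[OF _ _ cyl_P cts_P \<rho>]) (use ab c in auto)
  next
    show "bil q (\<lambda>a b. mask q \<rho>' (?H' a b) (\<lambda>_. 0)) x y = 0"
      using zero_in[OF \<rho>'] by (simp add: bil_def mask_def)
  next
    fix v assume v: "v \<in> ob q \<rho>"
    have "bil q (\<lambda>a b. mask q \<rho>' (P [i, a, b, c]) v) x y = bil q (\<lambda>a b. P [a, b, i, c] v) x y" if i: "i < q" for i
    proof (rule bil_cong)
      fix a b assume ab: "a < q" "b < q"
      have "P [i, a, b, c] v = P [a, i, b, c] v" using swap[of v "[]" i a "[b, c]"] sub[OF v] ab c i by simp
      also have "\<dots> = P [a, b, i, c] v" using swap[of v "[a]" i b "[c]"] sub[OF v] ab c i by simp
      finally show "mask q \<rho>' (P [i, a, b, c]) v = P [a, b, i, c] v"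
        using sub[OF v] by (simp add: mask_def)
    qed
    then have "\<bar>ip q (\<lambda>i. bil q (\<lambda>a b. mask q \<rho>' (P [i, a, b, c]) v) x y) u\<bar> \<le> (\<Sum>i<q. (L4 * nm q x * nm q y) * \<bar>u i\<bar>)"
      unfolding ip_def
      by (intro order_trans[OF sum_abs sum_mono])
         (use fourth[OF sub[OF v]] c in \<open>auto simp: abs_mult intro!: mult_right_mono\<close>)
    also have "\<dots> \<le> (L4 * nm q x * nm q y) * (sqrt (real q) * \<rho>)"
      unfolding sum_distrib_left[symmetric]
      using sum_abs_le_nm[of u q] \<open>nm q u < \<rho>\<close> mult_left_mono[of "nm q u" \<rho> "sqrt (real q)"]
      by (intro mult_left_mono L4) auto
    finally show "\<bar>ip q (\<lambda>i. bil q (\<lambda>a b. mask q \<rho>' (P [i, a, b, c]) v) x y) u\<bar> \<le> sqrt (real q) * \<rho> * (L4 * nm q x * nm q y)"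
      by (simp add: mult_ac)
  qed
  moreover have "bil q (\<lambda>a b. mask q \<rho>' (?H' a b) u) x y
      = bil q (\<lambda>a b. ?H a b u) x y - bil q (\<lambda>a b. ?H a b (\<lambda>_. 0)) x y"
    using sub[OF u] by (simp add: bil_def mask_def sum_subtractf left_diff_distrib)
  ultimately show ?thesis using third[OF c, of x y] by (simp add: algebra_simps)
qed

text \<open>Adjacent exchanges reverse the order of the indices, as the newest derivative comes
  first in \<open>P\<close> and last in \<open>laplace_core\<close>.\<close>

lemma fourth_bound:
  assumes u: "u \<in> ob q \<rho>'" and cd: "c < q" "d < q"
  shows "\<bar>bil q (\<lambda>a b. P [d, c, b, a] u) x y\<bar> \<le> L4 * nm q x * nm q y"
proof -
  have "bil q (\<lambda>a b. P [d, c, b, a] u) x y = bil q (\<lambda>a b. P [a, b, c, d] u) x y"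
  proof (rule bil_cong)
    fix a b assume ab: "a < q" "b < q"
    note s = swap[OF u]
    have "P [d, c, b, a] u = P [c, d, b, a] u" using s[of "[]" d c "[b, a]"] ab cd by simp
    also have "\<dots> = P [c, b, d, a] u" using s[of "[c]" d b "[a]"] ab cd by simp
    also have "\<dots> = P [b, c, d, a] u" using s[of "[]" c b "[d, a]"] ab cd by simp
    also have "\<dots> = P [b, c, a, d] u" using s[of "[b, c]" d a "[]"] ab cd by simp
    also have "\<dots> = P [b, a, c, d] u" using s[of "[b]" c a "[d]"] ab cd by simp
    also have "\<dots> = P [a, b, c, d] u" using s[of "[]" b a "[c, d]"] ab cd by simp
    finally show "P [d, c, b, a] u = P [a, b, c, d] u" .
  qed
  then show ?thesis using fourth[OF u cd] by simp
qed

theorem laplace_local: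
  assumes \<rho>'_le: "\<rho>' \<le> \<delta>" "\<rho>' = sqrt 2 * \<gamma>" and \<gamma>: "0 < \<gamma>" "\<gamma> \<le> 1" "64 / \<kappa> \<le> \<gamma>\<^sup>2"
    and B: "1 \<le> B" "L3 + sqrt (real q) * \<rho>' * L4 \<le> B * \<kappa>" "L4 \<le> B * \<kappa>" "0 \<le> L4" and \<kappa>2: "2 \<le> \<kappa>"
    and small: "2000 * real q * \<gamma>\<^sup>2 * B\<^sup>2 \<le> 1" "3000000 * B\<^sup>2 * (real q)\<^sup>2 / \<kappa> \<le> 1"
    and tail_le: "tail \<kappa>' (\<gamma> / 8) \<le> 1 / \<kappa>"
  shows "integrable (lebR {..<q}) (\<lambda>u. indicator (ob q \<delta>) u * exp (f u))"
    and "\<bar>(\<integral>u. indicator (ob q \<delta>) u * exp (f u) \<partial>lebR {..<q}) / Z - 1\<bar>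
      \<le> 44 * (3000000 * B\<^sup>2 * (real q)\<^sup>2 / \<kappa>) + 1 / \<kappa>"
proof -
  define r where "r = \<gamma> / 8"
  \<comment> \<open>The factor lies strictly between 1 and sqrt 2: \<open>8 * r = \<gamma>\<close>
    has to stay below \<rho>, and \<rho> below \<rho>', so that continuous derivatives are bounded
    on the smaller ball.\<close>
  define \<rho> where "\<rho> = 6 / 5 * \<gamma>"
  have r0: "0 < r" using \<gamma> by (simp add: r_def)
  have \<rho>: "0 < \<rho>" "\<rho> < \<rho>'" "sqrt 2 * r < \<rho>'"
  proof -
    have "6 / 5 < sqrt 2" by (rule real_less_rsqrt) (simp add: power2_eq_square)
    then show "\<rho> < \<rho>'" unfolding \<rho>_def \<rho>'_le(2) using \<gamma> by (intro mult_strict_right_mono) auto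
    show "0 < \<rho>" "sqrt 2 * r < \<rho>'" using \<gamma> by (auto simp: \<rho>_def r_def \<rho>'_le(2))
  qed
  have sub: "u \<in> ob q \<rho>'" if "u \<in> ob q \<rho>" for u using that \<rho> by (simp add: ob_def)
  interpret core: laplace_core q Q \<kappa> \<rho> r B "1 / \<kappa>" "mask q \<rho>' F" "\<lambda>a. mask q \<rho>' (F1 a)" "\<lambda>a b. mask q \<rho>' (F2 a b)"
    "\<lambda>a b c. mask q \<rho>' (P [c, b, a])" "\<lambda>a b c d. mask q \<rho>' (P [d, c, b, a])"
  proof unfold_locales
    show "C1b q \<rho> (mask q \<rho>' F) (\<lambda>a. mask q \<rho>' (F1 a))"
      by (rule C1b_mask[OF cyl_F F_partial cyl_F1 cts_F1 \<rho>(2)])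
    show "C1b q \<rho> (mask q \<rho>' (F1 a)) (\<lambda>b. mask q \<rho>' (F2 a b))" if "a < q" for a
      by (rule C1b_mask[OF cyl_F1 F1_partial[OF that] cyl_F2 cts_F2 \<rho>(2)]) (use that in auto)
    show "C1b q \<rho> (mask q \<rho>' (F2 a b)) (\<lambda>c. mask q \<rho>' (P [c, b, a]))" if "a < q" "b < q" for a b
      by (rule C1b_mask[OF cyl_F2 F2_partial[OF that] cyl_P cts_P \<rho>(2)]) (use that in auto)
    show "C1b q \<rho> (mask q \<rho>' (P [c, b, a])) (\<lambda>d. mask q \<rho>' (P [d, c, b, a]))" if "a < q" "b < q" "c < q" for a b c
      by (rule C1b_mask[OF cyl_P partial5 cyl_P cts_P \<rho>(2)]) (use that in auto)
    show "mask q \<rho>' F (\<lambda>_. 0) = 0" by (simp add: mask_def F_def f_def bil_def)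
    show "mask q \<rho>' (F1 a) (\<lambda>_. 0) = 0" if "a < q" for a
      using gradient_zero[OF that] by (simp add: mask_def F1_def)
    show "mask q \<rho>' (F2 a b) (\<lambda>_. 0) = 0" if "a < q" "b < q" for a b
      using hessian_bil(1)[OF zero_in[OF \<delta>] that] by (simp add: mask_def F2_def Q_def)
    fix u a b c assume u: "u \<in> ob q \<rho>" and ab: "a < q" "b < q" "c < q"
    note s = swap[OF sub[OF u]]
    show "mask q \<rho>' (P [c, b, a]) u = mask q \<rho>' (P [c, a, b]) u"
      using s[of "[c]" b a "[]"] ab by (simp add: mask_def)
    show "mask q \<rho>' (P [c, b, a]) u = mask q \<rho>' (P [b, c, a]) u"
      using s[of "[]" c b "[a]"] ab by (simp add: mask_def)
    fix d assume d: "d < q"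
    show "mask q \<rho>' (P [d, c, b, a]) u = mask q \<rho>' (P [d, c, a, b]) u"
      using s[of "[d, c]" b a "[]"] ab d by (simp add: mask_def)
    show "mask q \<rho>' (P [d, c, b, a]) u = mask q \<rho>' (P [d, b, c, a]) u"
      using s[of "[d]" c b "[a]"] ab d by (simp add: mask_def)
  next
    fix u c x y assume u: "u \<in> ob q \<rho>" and c: "c < q"
    have "\<bar>bil q (\<lambda>a b. mask q \<rho>' (P [c, b, a]) u) x y\<bar> \<le> (L3 + sqrt (real q) * \<rho> * L4) * nm q x * nm q y"
      using third_bound[OF u c \<rho>(2)] sub[OF u] by (simp add: mask_def)
    also have "\<dots> \<le> B * \<kappa> * nm q x * nm q y"
    proof (intro mult_right_mono L2_set_nonneg)
      have "sqrt (real q) * \<rho> * L4 \<le> sqrt (real q) * \<rho>' * L4"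
        using \<rho> B by (intro mult_right_mono mult_left_mono) auto
      then show "L3 + sqrt (real q) * \<rho> * L4 \<le> B * \<kappa>" using B by linarith
    qed
    finally show "\<bar>bil q (\<lambda>a b. mask q \<rho>' (P [c, b, a]) u) x y\<bar> \<le> B * \<kappa> * nm q x * nm q y" .
    fix d assume d: "d < q"
    have "\<bar>bil q (\<lambda>a b. mask q \<rho>' (P [d, c, b, a]) u) x y\<bar> \<le> L4 * nm q x * nm q y"
      using fourth_bound[OF sub[OF u] c d] sub[OF u] by (simp add: mask_def)
    also have "\<dots> \<le> B * \<kappa> * nm q x * nm q y"
      using B by (intro mult_right_mono L2_set_nonneg) auto
    finally show "\<bar>bil q (\<lambda>a b. mask q \<rho>' (P [d, c, b, a]) u) x y\<bar> \<le> B * \<kappa> * nm q x * nm q y" .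
  next
    show "measure G {u. r \<le> nm q u} \<le> 1 / \<kappa>"
      using G_tail_le[OF Q_upper \<kappa>' less_imp_le[OF r0]] tail_le by (simp add: r_def)
    show "1 / \<kappa> \<le> r\<^sup>2" using \<gamma> \<kappa> by (simp add: r_def field_simps power2_eq_square)
    show "128000 * real q * r\<^sup>2 * B\<^sup>2 \<le> 1" using small(1) by (simp add: r_def power_divide)
  qed (use \<gamma> B \<kappa>2 small q in \<open>auto simp: r_def \<rho>_def\<close>)
  \<comment> \<open>The integrand is split by the bump. The inner part is a Gaussian mean of the
    exponential of the remainder; the outer part \<open>k\<close> is controlled by the concavity of
    \<open>f\<close> and the Gaussian tail.\<close>
  let ?h = "\<lambda>u. indicator (ob q \<delta>) u * exp (f u)"
  define b where "b = bump q r"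
  define k where "k u = (1 - b u) * ?h u / Z" for u
  have [measurable]: "b \<in> borel_measurable borel" "k \<in> borel_measurable borel"
    unfolding b_def k_def by measurable
  have b01: "0 \<le> b u" "b u \<le> 1" for u using bump_bounds by (auto simp: b_def)
  have k0: "0 \<le> k u" for u using b01[of u] Z_pos by (simp add: k_def)
  have "(\<integral>\<^sup>+u. ennreal (k u) \<partial>lebR {..<q})
      \<le> (\<integral>\<^sup>+u. indicator {u. r \<le> nm q u} u * ennreal (exp (- (\<kappa> * ip q u u) / 2) / Z) \<partial>lebR {..<q})"
  proof (rule nn_integral_mono)
    fix u
    show "ennreal (k u) \<le> indicator {u. r \<le> nm q u} u * ennreal (exp (- (\<kappa> * ip q u u) / 2) / Z)"
    proof (cases "nm q u < r \<or> u \<notin> ob q \<delta>")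
      case True
      then have "k u = 0" using bump_eq_1[OF r0, where q = q and u = u] by (auto simp: k_def b_def)
      then show ?thesis by simp
    next
      case False
      then have "k u \<le> 1 * exp (f u) / Z" unfolding k_def using b01[of u] Z_pos by (intro divide_right_mono mult_mono) auto
      also have "\<dots> \<le> exp (- (\<kappa> * ip q u u) / 2) / Z"
        using f_upper[of u] False Z_pos by (intro divide_right_mono) auto
      finally show ?thesis using False by (simp add: ennreal_leI)
    qed
  qed
  also have "\<dots> \<le> ennreal (tail \<kappa>' r)" by (rule gauss_tail_le[OF Q_upper \<kappa>' less_imp_le[OF r0]])
  also have "\<dots> \<le> ennreal (1 / \<kappa>)" using tail_le by (simp add: r_def ennreal_leI)
  finally have k_nn: "(\<integral>\<^sup>+u. ennreal (k u) \<partial>lebR {..<q}) \<le> ennreal (1 / \<kappa>)" .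
  have k_int: "integrable (lebR {..<q}) k"
    by (rule integrableI_bounded) (use k_nn k0 in \<open>auto simp: less_top[symmetric] top_unique\<close>)
  have k_le: "0 \<le> (\<integral>u. k u \<partial>lebR {..<q})" "(\<integral>u. k u \<partial>lebR {..<q}) \<le> 1 / \<kappa>"
    using k_nn nn_integral_eq_integral[OF k_int] k0 \<kappa> by (auto simp: ennreal_le_iff)
  have bR: "wt u / Z * (b u * exp (mask q \<rho>' F u)) = b u * ?h u / Z" for u
  proof (cases "b u = 0")
    case False
    then have "nm q u < sqrt 2 * r" using bump_eq_0[OF r0, where q = q and u = u] by (force simp: b_def)
    then have "nm q u < \<rho>'" using \<rho>(3) by linarith
    then have "u \<in> ob q \<rho>' \<and> u \<in> ob q \<delta>" using \<rho>'_le(1) by (auto simp: ob_def)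
    moreover have "wt u * exp (F u) = exp (f u)" by (simp add: wt_def F_def exp_add[symmetric])
    ultimately show ?thesis by (simp add: mask_def)
  qed simp
  have G_int: "integrable G (\<lambda>u. b u * exp (mask q \<rho>' F u))"
    using core.bump_exp_integrable by (simp add: b_def)
  have b_int: "integrable (lebR {..<q}) (\<lambda>u. b u * ?h u / Z)"
    unfolding bR[symmetric] using G_int unfolding G_def
    by (subst (asm) integrable_density) (use Z_pos wt_pos in \<open>auto simp: less_imp_le\<close>)
  have eq: "?h u / Z = b u * ?h u / Z + k u" for u by (simp add: k_def left_diff_distrib diff_divide_distrib)
  have hZ: "integrable (lebR {..<q}) (\<lambda>u. ?h u / Z)" unfolding eq by (intro Bochner_Integration.integrable_add b_int k_int)
  then have "integrable (lebR {..<q}) (\<lambda>u. Z * (?h u / Z))" by (rule integrable_mult_right)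
  then show "integrable (lebR {..<q}) ?h" using Z_pos by simp
  have "(\<integral>u. ?h u \<partial>lebR {..<q}) / Z = (\<integral>u. b u * ?h u / Z \<partial>lebR {..<q}) + (\<integral>u. k u \<partial>lebR {..<q})"
    unfolding Bochner_Integration.integral_divide_zero[symmetric] eq
    by (rule Bochner_Integration.integral_add[OF b_int k_int])
  also have "(\<integral>u. b u * ?h u / Z \<partial>lebR {..<q}) = (\<integral>u. bump q r u * exp (mask q \<rho>' F u) \<partial>G)"
  proof -
    have "(\<lambda>u. b u * exp (mask q \<rho>' F u)) \<in> borel_measurable borel" by measurable
    from integral_G[OF this] show ?thesis unfolding bR by (simp add: b_def)
  qed
  finally show "\<bar>(\<integral>u. ?h u \<partial>lebR {..<q}) / Z - 1\<bar> \<le> 44 * (3000000 * B\<^sup>2 * (real q)\<^sup>2 / \<kappa>) + 1 / \<kappa>"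
    using core.bump_exp_integral k_le unfolding core.X_def by linarith
qed

end

text \<open>A translation moves the centre to the origin, and the push-forward that defines
  \<open>lebR\<close> turns extensional vectors into zero-extended ones.\<close>

lemma eball_integral:
  fixes h :: "(nat \<Rightarrow> real) \<Rightarrow> real"
  assumes zh: "zh \<in> Rvec q"
    and g: "g = (\<lambda>u. indicator (ob q \<delta>) u * exp (h (\<lambda>i\<in>{..<q}. zh i + u i) - c))"
    and meas: "g \<in> borel_measurable borel" and int: "integrable (lebR {..<q}) g"
  shows "set_integrable (lebesgue_Rvec q) (eball q zh \<delta>) (\<lambda>z. exp (h z - c))"
    and "(LINT z : eball q zh \<delta> | lebesgue_Rvec q. exp (h z - c)) = (\<integral>u. g u \<partial>lebR {..<q})"
proof -
  note [measurable] = meas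
  define d where "d j = (if j < q then - zh j else 0)" for j
  have [measurable]: "(\<lambda>u j. u j + d j) \<in> borel_measurable borel"
    by (rule borel_measurable_into_fun) measurable
  have eq: "g (\<lambda>j. (if j \<in> {..<q} then z j else 0) + d j) = indicator (eball q zh \<delta>) z * exp (h z - c)"
    if z: "z \<in> space (lebesgue_Rvec q)" for z
  proof -
    have zR: "z \<in> Rvec q" using z by (simp add: space_PiM)
    have "(\<lambda>i\<in>{..<q}. zh i + ((if i \<in> {..<q} then z i else 0) + d i)) = z"
      using zR by (auto simp: d_def fun_eq_iff PiE_def extensional_def)
    moreover have "nm q (\<lambda>j. (if j \<in> {..<q} then z j else 0) + d j) = L2_set (\<lambda>i. z i - zh i) {..<q}"
      by (rule nm_cong) (simp add: d_def)
    ultimately show ?thesis using zR by (simp add: g ob_def eball_def indicator_def)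
  qed
  have "(\<integral>\<^sup>+u. ennreal (g (\<lambda>j. u j + d j)) \<partial>lebR {..<q}) = (\<integral>\<^sup>+u. ennreal (g u) \<partial>lebR {..<q})"
    by (rule nn_integral_lebR_translate[where f = "\<lambda>u. ennreal (g u)"]) (auto simp: d_def)
  also have "\<dots> = ennreal (\<integral>u. g u \<partial>lebR {..<q})"
    by (rule nn_integral_eq_integral[OF int]) (simp add: g)
  finally have nn: "(\<integral>\<^sup>+u. ennreal (g (\<lambda>j. u j + d j)) \<partial>lebR {..<q}) = ennreal (\<integral>u. g u \<partial>lebR {..<q})" .
  have "0 \<le> g u" for u by (simp add: g)
  with nn have "integrable (lebR {..<q}) (\<lambda>u. g (\<lambda>j. u j + d j))"
    by (intro integrableI_bounded) simp_all
  then have "integrable (lebesgue_Rvec q) (\<lambda>z. g (\<lambda>j. (if j \<in> {..<q} then z j else 0) + d j))"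
    by (subst (asm) integrable_lebR_iff) auto
  then show "set_integrable (lebesgue_Rvec q) (eball q zh \<delta>) (\<lambda>z. exp (h z - c))"
    unfolding set_integrable_def
    by (subst Bochner_Integration.integrable_cong[OF refl, where g = "\<lambda>z. g (\<lambda>j. (if j \<in> {..<q} then z j else 0) + d j)"])
       (use eq in auto)
  have "(\<integral>u. g u \<partial>lebR {..<q}) = (\<integral>u. g (\<lambda>j. u j + d j) \<partial>lebR {..<q})"
    by (rule integral_lebR_translate[symmetric]) (auto simp: d_def)
  also have "\<dots> = (\<integral>z. g (\<lambda>j. (if j \<in> {..<q} then z j else 0) + d j) \<partial>lebesgue_Rvec q)"
    by (rule integral_lebR) measurable
  also have "\<dots> = (\<integral>z. indicator (eball q zh \<delta>) z * exp (h z - c) \<partial>lebesgue_Rvec q)"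
    by (rule Bochner_Integration.integral_cong[OF refl eq])
  finally show "(LINT z : eball q zh \<delta> | lebesgue_Rvec q. exp (h z - c)) = (\<integral>u. g u \<partial>lebR {..<q})"
    by (simp add: set_lebesgue_integral_def)
qed

text \<open>The factor \<open>c\<close> is the reciprocal of the Gaussian normalization
  \<open>Z\<close>, so the integral over the ball contributes one up to the local error. The
  integral outside is carried along, because its size is given by the first Laplace
  condition.\<close>

theorem laplace_fixed_dimension:
  fixes h :: "(nat \<Rightarrow> real) \<Rightarrow> real" and \<kappa> :: real and q :: nat and zh :: "nat \<Rightarrow> real"
  defines "c \<equiv> (2 * pi) powr (- real q / 2) * sqrt (Determinant.det (- deriv_slice q h zh []))"
  assumes q: "0 < q" and D: "D \<subseteq> Rvec q" and zh: "is_arg_max h (\<lambda>z. z \<in> D) zh"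
    and \<kappa>': "0 < \<kappa>'" and \<delta>: "0 < \<delta>" and \<rho>': "\<rho>' \<le> \<delta>" "\<rho>' = sqrt 2 * \<gamma>"
    and outer: "set_integrable (lebesgue_Rvec q) (D - eball q zh \<delta>) (\<lambda>z. exp (h z - h zh))"
    and exist2: "partials_exist q 2 D h (eball q zh \<delta>)"
    and exist5: "partials_exist q 5 D h (eball q zh \<rho>')"
    and hessian: "\<And>z. z \<in> eball q zh \<delta> \<Longrightarrow> eigenvalues_between \<kappa> (- deriv_slice q h z []) \<kappa>'"
    and third: "\<And>l. l < q \<Longrightarrow> eigenvalues_between a3 (deriv_slice q h zh [l]) b3"
    and fourth: "\<And>z l m. z \<in> eball q zh \<rho>' \<Longrightarrow> l < q \<Longrightarrow> m < q \<Longrightarrow>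
      eigenvalues_between a4 (deriv_slice q h z [l, m]) b4"
    and fifth: "\<And>z js. z \<in> eball q zh \<rho>' \<Longrightarrow> length js = 3 \<Longrightarrow> set js \<subseteq> {..<q} \<Longrightarrow>
      eigenvalues_between a5 (deriv_slice q h z js) b5"
    and L: "\<bar>a3\<bar> \<le> L3" "\<bar>b3\<bar> \<le> L3" "\<bar>a4\<bar> \<le> L4" "\<bar>b4\<bar> \<le> L4"
    and \<gamma>: "0 < \<gamma>" "\<gamma> \<le> 1" "64 / \<kappa> \<le> \<gamma>\<^sup>2"
    and B: "1 \<le> B" "L3 + sqrt (real q) * \<rho>' * L4 \<le> B * \<kappa>" "L4 \<le> B * \<kappa>" and \<kappa>2: "2 \<le> \<kappa>"
    and small: "2000 * real q * \<gamma>\<^sup>2 * B\<^sup>2 \<le> 1" "3000000 * B\<^sup>2 * (real q)\<^sup>2 / \<kappa> \<le> 1"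
    and tail_le: "exp (- (\<kappa> * (\<gamma> / 8)\<^sup>2 / 4)) * sqrt ((2 * \<kappa>' / \<kappa>) ^ q) \<le> 1 / \<kappa>"
  shows "0 < Determinant.det (- deriv_slice q h zh [])"
    and "\<bar>c * (LINT z : D | lebesgue_Rvec q. exp (h z - h zh)) - 1\<bar>
      \<le> 44 * (3000000 * B\<^sup>2 * (real q)\<^sup>2 / \<kappa>) + 1 / \<kappa>
        + \<bar>c * (LINT z : D - eball q zh \<delta> | lebesgue_Rvec q. exp (h z - h zh))\<bar>"
proof -
  define pt where "pt u = (\<lambda>i\<in>{..<q}. zh i + u i)" for u
  define P where "P js u = partials js h (pt u)" for js u
  have zhD: "zh \<in> D" and zhR: "zh \<in> Rvec q" using zh D by (auto simp: is_arg_max_def)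
  have pt0: "pt (\<lambda>_. 0) = zh" using zhR by (auto simp: pt_def fun_eq_iff PiE_def extensional_def)
  have pt_ball: "pt u \<in> eball q zh s \<longleftrightarrow> u \<in> ob q s" for u s
  proof -
    have "L2_set (\<lambda>i. pt u i - zh i) {..<q} = nm q u" by (rule nm_cong) (simp add: pt_def)
    moreover have "pt u \<in> Rvec q" by (auto simp: pt_def)
    ultimately show ?thesis by (simp add: eball_def ob_def)
  qed
  have partial: "partial_on q (ob q s) (P js) (\<lambda>i. P (i # js))"
    if ex: "partials_exist q k D h (eball q zh s)" and js: "set js \<subseteq> {..<q}" "length js < k" for s k js
    unfolding partial_on_def
  proof (intro ballI allI impI)
    fix u i assume u: "u \<in> ob q s" and i: "i < q"
    have "(\<lambda>t. partials js h ((pt u)(i := t))) field_differentiable at (pt u i)"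
      using ex js i pt_ball[of u s] u unfolding partials_exist_def by auto
    then have "((\<lambda>t. partials js h ((pt u)(i := t))) has_real_derivative P (i # js) u) (at (u i + zh i))"
      using i by (simp add: P_def DERIV_deriv_iff_field_differentiable pt_def add.commute)
    then have "((\<lambda>t. partials js h ((pt u)(i := t + zh i))) has_real_derivative P (i # js) u) (at (u i))"
      by (simp add: DERIV_shift)
    moreover have "(pt u)(i := t + zh i) = pt (u(i := t))" for t
      using i by (auto simp: pt_def fun_eq_iff)
    ultimately show "((\<lambda>t. P js (u(i := t))) has_real_derivative P (i # js) u) (at (u i))" by (simp add: P_def)
  qed
  have slice: "deriv_slice q h (pt u) js = Matrix.mat q q (\<lambda>(a, b). P (a # b # js) u)" for u js
    by (simp add: deriv_slice_def P_def)
  have minus_slice: "- deriv_slice q h (pt u) [] = Matrix.mat q q (\<lambda>(a, b). - P [a, b] u)" for u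
    unfolding slice by (rule eq_matI) auto
  have \<rho>'0: "0 < \<rho>'" using \<gamma> by (simp add: \<rho>'(2))
  have zin: "zh \<in> eball q zh \<delta>" using pt_ball[of "\<lambda>_. 0" \<delta>] pt0 \<delta> by (simp add: ob_def L2_set_def)
  have cyl_P: "cyl q (P js)" for js
    unfolding cyl_def
  proof (intro allI impI)
    fix u v :: "nat \<Rightarrow> real" assume "\<forall>i<q. u i = v i"
    then have "pt u = pt v" by (auto simp: pt_def fun_eq_iff)
    then show "P js u = P js v" by (simp add: P_def)
  qed
  interpret E: local_expansion q P \<delta> \<rho>' "max \<bar>a5\<bar> \<bar>b5\<bar>" \<kappa> \<kappa>' L3 L4
  proof unfold_locales
    show "partial_on q (ob q \<delta>) (P js) (\<lambda>i. P (i # js))" if "set js \<subseteq> {..<q}" "length js < 2" for js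
      by (rule partial[OF exist2 that])
    show "partial_on q (ob q \<rho>') (P js) (\<lambda>i. P (i # js))" if "set js \<subseteq> {..<q}" "length js < 5" for js
      by (rule partial[OF exist5 that])
    show "P [] u \<le> P [] (\<lambda>_. 0)" if "u \<in> ob q \<delta>" for u
    proof -
      have "pt u \<in> D" using exist2 pt_ball[of u \<delta>] that by (auto simp: partials_exist_def)
      then show ?thesis using zh by (auto simp: P_def pt0 is_arg_max_linorder)
    qed
    show "eigenvalues_between \<kappa> (Matrix.mat q q (\<lambda>(a, b). - P [a, b] u)) \<kappa>'" if "u \<in> ob q \<delta>" for u
      using hessian[of "pt u"] that pt_ball unfolding minus_slice by simp
    show "\<bar>bil q (\<lambda>a b. P [a, b, l] (\<lambda>_. 0)) x y\<bar> \<le> L3 * nm q x * nm q y" if "l < q" for l x y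
      using third[OF that] unfolding pt0[symmetric] slice by (rule eigenvalues_between_bil_abs[OF _ q L(1,2)])
    show "\<bar>bil q (\<lambda>a b. P [a, b, l, m] u) x y\<bar> \<le> L4 * nm q x * nm q y"
      if "u \<in> ob q \<rho>'" "l < q" "m < q" for u l m x y
    proof -
      have "pt u \<in> eball q zh \<rho>'" using that pt_ball by simp
      from fourth[OF this that(2,3)] show ?thesis unfolding slice by (rule eigenvalues_between_bil_abs[OF _ q L(3,4)])
    qed
    show "\<bar>P js u\<bar> \<le> max \<bar>a5\<bar> \<bar>b5\<bar>" if u: "u \<in> ob q \<rho>'" and js5: "set js \<subseteq> {..<q}" "length js = 5" for u js
    proof -
      obtain a b js' where js: "js = a # b # js'" using js5 by (auto simp: length_Suc_conv numeral_eq_Suc)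
      have "pt u \<in> eball q zh \<rho>'" using u pt_ball by simp
      then have "eigenvalues_between a5 (deriv_slice q h (pt u) js') b5"
        by (rule fifth) (use js5 js in auto)
      note E = this[unfolded slice]
      show ?thesis unfolding js
        by (rule bil_unit_entry[OF eigenvalues_between_bil_abs[OF E q]]) (use js5 js in auto)
    qed
  qed (use q \<kappa>' \<delta> \<rho>'0 \<kappa>2 cyl_P in auto)
  have Q: "E.Qdet = Determinant.det (- deriv_slice q h zh [])"
    using minus_slice[of "\<lambda>_. 0"] by (simp add: pt0 E.Qdet_def E.Q_def)
  show "0 < Determinant.det (- deriv_slice q h zh [])" using E.Qdet_pos by (simp add: Q)
  have L4: "0 \<le> L4" using L by linarith
  have cZ: "c = 1 / E.Z"
  proof -
    have "sqrt ((2 * pi) ^ q) = ((2 * pi) powr real q) powr (1 / 2)"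
      by (subst powr_realpow) (simp_all add: powr_half_sqrt)
    also have "\<dots> = (2 * pi) powr (real q / 2)" by (subst powr_powr) simp
    finally have "(2 * pi) powr (- real q / 2) = 1 / sqrt ((2 * pi) ^ q)"
      by (simp only: minus_divide_left[symmetric] powr_minus_divide)
    then show ?thesis by (simp add: c_def Q[symmetric] E.Z_def real_sqrt_divide)
  qed
  have fh: "E.f u = h (pt u) - h zh" for u by (simp add: E.f_def P_def pt0)
  have "E.tail \<kappa>' (\<gamma> / 8) \<le> 1 / \<kappa>" using tail_le by (simp add: E.tail_def)
  note main = E.laplace_local[OF \<rho>' \<gamma> B L4 \<kappa>2 small this, unfolded fh pt_def]
  note ball = eball_integral[OF zhR refl E.f_measurable[unfolded fh pt_def] main(1)]
  have "(LINT z : eball q zh \<delta> \<union> (D - eball q zh \<delta>) | lebesgue_Rvec q. exp (h z - h zh))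
      = (LINT z : eball q zh \<delta> | lebesgue_Rvec q. exp (h z - h zh)) + (LINT z : D - eball q zh \<delta> | lebesgue_Rvec q. exp (h z - h zh))"
    by (rule set_integral_Un[OF _ ball(1) outer]) auto
  moreover have "eball q zh \<delta> \<union> (D - eball q zh \<delta>) = D" using exist2 by (auto simp: partials_exist_def)
  ultimately have "c * (LINT z : D | lebesgue_Rvec q. exp (h z - h zh))
      = c * (LINT z : eball q zh \<delta> | lebesgue_Rvec q. exp (h z - h zh)) + c * (LINT z : D - eball q zh \<delta> | lebesgue_Rvec q. exp (h z - h zh))"
    by (simp add: algebra_simps)
  moreover have "\<bar>c * (LINT z : eball q zh \<delta> | lebesgue_Rvec q. exp (h z - h zh)) - 1\<bar>
      \<le> 44 * (3000000 * B\<^sup>2 * (real q)\<^sup>2 / \<kappa>) + 1 / \<kappa>"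
    using main(2) unfolding ball(2) by (simp add: cZ)
  ultimately show "\<bar>c * (LINT z : D | lebesgue_Rvec q. exp (h z - h zh)) - 1\<bar>
      \<le> 44 * (3000000 * B\<^sup>2 * (real q)\<^sup>2 / \<kappa>) + 1 / \<kappa>
        + \<bar>c * (LINT z : D - eball q zh \<delta> | lebesgue_Rvec q. exp (h z - h zh))\<bar>"
    by linarith
qed

subsection \<open>Growing dimension\<close>

text \<open>For large n all conditions of the fixed-dimension estimate hold, and its error is a
  multiple of p^2 log(n)^2 / n, the first entry of the rate, plus the outer integral. The dimension
  \<open>q\<close> is kept apart from \<open>p\<close>: it will be \<open>p\<close> or
  \<open>p - 1\<close>, while the radius is the one for \<open>p\<close> in both cases.\<close>

lemma laplace_integral_bigo:
  fixes c3 c4 cinf :: real and \<zeta> :: nat and p q :: "nat \<Rightarrow> nat"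
    and h :: "nat \<Rightarrow> (nat \<Rightarrow> real) \<Rightarrow> real" and D :: "nat \<Rightarrow> (nat \<Rightarrow> real) set"
  defines "e \<equiv> err_rate p c3 \<zeta>"
  defines "zh \<equiv> \<lambda>n. arg_max_on (h n) (D n)"
  assumes lap: "laplace_conditions p q D h c3 c4 cinf \<zeta> e"
    and D: "\<And>n. 1 \<le> p n \<Longrightarrow> D n \<subseteq> Rvec (q n)"
    and pq: "\<And>n. q n \<le> p n" "\<forall>\<^sub>F n in sequentially. 1 \<le> q n"
    and p: "filterlim p at_top sequentially"
    and c3: "c3 \<le> 1" and c4: "c4 \<le> 1" and \<zeta>: "4 < \<zeta>"
  shows "\<forall>\<^sub>F n in sequentially. 0 < Determinant.det (- deriv_slice (q n) (h n) (zh n) [])"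
    and "(\<lambda>n. (2 * pi) powr (- real (q n) / 2) * sqrt (Determinant.det (- deriv_slice (q n) (h n) (zh n) []))
          * (LINT z : D n | lebesgue_Rvec (q n). exp (h n z - h n (zh n))) - 1) \<in> O(e)"
    and "e \<longlonglongrightarrow> 0"
proof -
  have zh_eq: "arg_max_on (h n) (D n) = zh n" for n by (simp add: zh_def)
  obtain \<delta> \<eta>1 \<eta>2 \<eta>3 \<eta>4 \<eta>5 \<eta>6 :: real and BB CC :: "nat \<Rightarrow> real" where
    outer: "\<forall>\<^sub>F n in sequentially. set_integrable (lebesgue_Rvec (q n)) (D n - eball (q n) (zh n) \<delta>)
        (\<lambda>z. exp (h n z - h n (zh n)))"
    and outer_O: "(\<lambda>n. (2 * pi) powr (- real (q n) / 2)
           * sqrt (Determinant.det (- deriv_slice (q n) (h n) (zh n) []))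
           * (LINT z : D n - eball (q n) (zh n) \<delta> | lebesgue_Rvec (q n). exp (h n z - h n (zh n)))) \<in> O(e)"
    and hess: "\<forall>\<^sub>F n in sequentially. 0 < \<eta>1 * real n \<and>
         partials_exist (q n) 2 (D n) (h n) (eball (q n) (zh n) \<delta>) \<and>
         (\<forall>z\<in>eball (q n) (zh n) \<delta>.
            eigenvalues_between (\<eta>1 * real n) (- deriv_slice (q n) (h n) z []) (\<eta>2 * real n))"
    and third: "\<forall>\<^sub>F n in sequentially. \<forall>l<q n.
         eigenvalues_between (\<eta>3 * real n powr c3) (deriv_slice (q n) (h n) (zh n) [l]) (\<eta>4 * real n powr c3)"
    and fourth: "\<forall>\<^sub>F n in sequentially.
         partials_exist (q n) 4 (D n) (h n) (eball (q n) (zh n) (sqrt 2 * gam p n)) \<and>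
         (\<forall>z\<in>eball (q n) (zh n) (sqrt 2 * gam p n). \<forall>l<q n. \<forall>m<q n.
            eigenvalues_between (\<eta>5 * real n powr c4)
              (deriv_slice (q n) (h n) z [l, m]) (\<eta>6 * real n powr c4))"
    and higher: "\<forall>k. 4 < k \<and> k \<le> \<zeta> \<longrightarrow> (\<forall>\<^sub>F n in sequentially.
           partials_exist (q n) k (D n) (h n) (eball (q n) (zh n) (sqrt 2 * gam p n)) \<and>
           (\<forall>z\<in>eball (q n) (zh n) (sqrt 2 * gam p n). \<forall>js. length js = k - 2 \<and> set js \<subseteq> {..<q n} \<longrightarrow>
              eigenvalues_between (BB k * real n) (deriv_slice (q n) (h n) z js) (CC k * real n)))"
    and \<delta>: "\<delta> > 0" and \<eta>: "\<eta>1 > 0" "\<eta>2 > 0" and e0: "e \<longlonglongrightarrow> 0"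
    and argmax: "\<forall>\<^sub>F n in sequentially. is_arg_max (h n) (\<lambda>z. z \<in> D n) (zh n)"
    using lap[unfolded laplace_conditions_def Let_def zh_eq] by (elim conjE exE) (rule that, assumption+)
  have fifth: "\<forall>\<^sub>F n in sequentially. partials_exist (q n) 5 (D n) (h n) (eball (q n) (zh n) (sqrt 2 * gam p n)) \<and>
           (\<forall>z\<in>eball (q n) (zh n) (sqrt 2 * gam p n). \<forall>js. length js = 3 \<and> set js \<subseteq> {..<q n} \<longrightarrow>
              eigenvalues_between (BB 5 * real n) (deriv_slice (q n) (h n) z js) (CC 5 * real n))"
    using higher[rule_format, of 5] \<zeta> by simp
  define w where "w n = (real (p n))\<^sup>2 * (ln (real n))\<^sup>2 / real n" for n
  have w_le: "w n \<le> e n" and w_nonneg: "0 \<le> w n" for n by (auto simp: w_def e_def err_rate_def)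
  have w0: "w \<longlonglongrightarrow> 0"
    by (rule tendsto_sandwich[OF _ _ tendsto_const e0]) (auto simp: w_le w_nonneg)
  define M3 M4 where "M3 = max \<bar>\<eta>3\<bar> \<bar>\<eta>4\<bar>" and "M4 = max \<bar>\<eta>5\<bar> \<bar>\<eta>6\<bar>"
  \<comment> \<open>As c3 and c4 are at most one, all slices are bounded by multiples of n, and
    \<open>B\<close> measures them in units of the lower bound \<open>\<eta>1 * n\<close> of the
    Hessian.\<close>
  define B where "B = max 1 ((M3 + M4) / \<eta>1)"
  have M: "0 \<le> M3" "0 \<le> M4" by (auto simp: M3_def M4_def)
  have B1: "1 \<le> B" by (simp add: B_def)
  have B2: "M3 + M4 \<le> B * \<eta>1" using \<eta> by (simp add: B_def pos_divide_le_eq[symmetric])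
  \<comment> \<open>The base of the exponential factor in the tail bound. Being at least one, it may
    be raised to the power p instead of q / 2.\<close>
  define C where "C = max 1 (2 * \<eta>2 / \<eta>1)"
  define K where "K = 44 * 3000000 * B\<^sup>2 / \<eta>1 + 1 / \<eta>1"
  let ?c = "\<lambda>n. (2 * pi) powr (- real (q n) / 2) * sqrt (Determinant.det (- deriv_slice (q n) (h n) (zh n) []))"
  let ?I = "\<lambda>n. LINT z : D n | lebesgue_Rvec (q n). exp (h n z - h n (zh n))"
  let ?O = "\<lambda>n. LINT z : D n - eball (q n) (zh n) \<delta> | lebesgue_Rvec (q n). exp (h n z - h n (zh n))"
  have p_big: "\<forall>\<^sub>F n in sequentially. N \<le> real (p n)" for N
    using filterlim_compose[OF filterlim_real_sequentially p] by (simp add: filterlim_at_top)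
  have n_big: "\<forall>\<^sub>F n in sequentially. N \<le> real n" for N
    using filterlim_real_sequentially by (simp add: filterlim_at_top)
  have ln_big: "\<forall>\<^sub>F n in sequentially. N \<le> ln (real n)" for N
    using filterlim_compose[OF ln_at_top filterlim_real_sequentially] by (simp add: filterlim_at_top)
  have w_small: "\<forall>\<^sub>F n in sequentially. w n \<le> c" if "0 < c" for c
    using order_tendstoD(2)[OF w0 that] by eventually_elim simp
  have c_pos: "0 < 1 / (2000 * B\<^sup>2)" "0 < \<eta>1 / (3000000 * B\<^sup>2)" "0 < \<delta>\<^sup>2 / 2" "0 < (1 / 2 :: real)"
    using B1 \<eta> \<delta> by auto
  have main: "\<forall>\<^sub>F n in sequentially. 0 < Determinant.det (- deriv_slice (q n) (h n) (zh n) []) \<and>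
      \<bar>?c n * ?I n - 1\<bar> \<le> K * w n + \<bar>?c n * ?O n\<bar>"
    using argmax outer hess third fourth fifth pq(2)
      p_big[of "64 / \<eta>1"] p_big[of "1024 / \<eta>1"] p_big[of 1] n_big[of "2 / \<eta>1"] n_big[of \<eta>1] n_big[of 1]
      ln_big[of 1] ln_big[of "512 * ln C / \<eta>1"]
      w_small[OF c_pos(1)] w_small[OF c_pos(2)] w_small[OF c_pos(3)] w_small[OF c_pos(4)]
  proof eventually_elim
    case (elim n)
    note hess = elim(3) and third = elim(4) and fourth = elim(5) and fifth = elim(6)
    have q: "1 \<le> real (q n)" "real (q n) \<le> real (p n)" using elim(7) pq(1)[of n] by auto
    have n: "1 \<le> real n" "0 < real n" and ln: "1 \<le> ln (real n)" and p1: "1 \<le> real (p n)"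
      using elim by auto
    have B0: "0 < B\<^sup>2" using B1 by simp
    define \<gamma> where "\<gamma> = gam p n"
    have \<gamma>_sq: "\<gamma>\<^sup>2 = real (p n) * ln (real n) / real n" using n ln by (simp add: \<gamma>_def gam_def)
    have "0 < real (p n) * ln (real n) / real n" using n ln p1 by (intro divide_pos_pos mult_pos_pos) linarith+
    then have \<gamma>0: "0 < \<gamma>" by (simp add: \<gamma>_def gam_def)
    have q\<gamma>: "real (q n) * \<gamma>\<^sup>2 \<le> w n"
    proof -
      have "real (q n) * \<gamma>\<^sup>2 \<le> real (p n) * (real (p n) * ln (real n) / real n)"
        unfolding \<gamma>_sq using q n ln by (intro mult_right_mono) auto
      also have "\<dots> = (real (p n))\<^sup>2 * (ln (real n) * 1) / real n" by (simp add: power2_eq_square)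
      also have "\<dots> \<le> (real (p n))\<^sup>2 * (ln (real n) * ln (real n)) / real n"
        using n ln by (intro divide_right_mono mult_left_mono) auto
      finally show ?thesis by (simp add: w_def power2_eq_square)
    qed
    have \<gamma>w: "\<gamma>\<^sup>2 \<le> w n"
    proof -
      have "1 * \<gamma>\<^sup>2 \<le> real (q n) * \<gamma>\<^sup>2" using q by (intro mult_right_mono) auto
      then show ?thesis using q\<gamma> by linarith
    qed
    have qw: "(real (q n))\<^sup>2 / real n \<le> w n" and nw: "1 / real n \<le> w n"
    proof -
      have "1 * 1 \<le> (real (p n))\<^sup>2 * (ln (real n))\<^sup>2" using p1 ln by (intro mult_mono) auto
      then show "1 / real n \<le> w n" unfolding w_def using n by (intro divide_right_mono) auto
      have "(real (q n))\<^sup>2 * 1 \<le> (real (p n))\<^sup>2 * (ln (real n))\<^sup>2"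
        using q ln by (intro mult_mono power_mono) auto
      then show "(real (q n))\<^sup>2 / real n \<le> w n" unfolding w_def using n by (intro divide_right_mono) auto
    qed
    have powr: "real n powr c3 \<le> real n" "real n powr c4 \<le> real n"
      using powr_mono[OF c3 n(1)] powr_mono[OF c4 n(1)] n by auto
    have L: "\<bar>t * real n powr c\<bar> \<le> M' * real n" if "\<bar>t\<bar> \<le> M'" "real n powr c \<le> real n" for t M' c
      using that unfolding abs_mult by (intro mult_mono) auto
    have slice_bounds: "\<bar>\<eta>3 * real n powr c3\<bar> \<le> M3 * real n" "\<bar>\<eta>4 * real n powr c3\<bar> \<le> M3 * real n"
      "\<bar>\<eta>5 * real n powr c4\<bar> \<le> M4 * real n" "\<bar>\<eta>6 * real n powr c4\<bar> \<le> M4 * real n"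
      by (intro L powr; simp add: M3_def M4_def)+
    have \<rho>_le: "sqrt 2 * \<gamma> \<le> \<delta>"
      by (rule power2_le_imp_le) (use \<gamma>w elim \<delta> in \<open>auto simp: power_mult_distrib\<close>)
    have \<gamma>1: "\<gamma> \<le> 1"
      by (rule power2_le_imp_le) (use \<gamma>w elim in auto)
    have \<gamma>\<kappa>: "64 / (\<eta>1 * real n) \<le> \<gamma>\<^sup>2"
    proof -
      have "64 / \<eta>1 * 1 \<le> real (p n) * ln (real n)" using elim \<eta> by (intro mult_mono) auto
      then have "64 / \<eta>1 / real n \<le> real (p n) * ln (real n) / real n" using n by (intro divide_right_mono) auto
      then show ?thesis by (simp add: \<gamma>_sq)
    qed
    have B3: "M3 * real n + sqrt (real (q n)) * (sqrt 2 * \<gamma>) * (M4 * real n) \<le> B * (\<eta>1 * real n)"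
    proof -
      have "sqrt (real (q n)) * (sqrt 2 * \<gamma>) \<le> 1"
        by (rule power2_le_imp_le) (use q\<gamma> elim in \<open>auto simp: power_mult_distrib\<close>)
      then have "sqrt (real (q n)) * (sqrt 2 * \<gamma>) * (M4 * real n) \<le> 1 * (M4 * real n)"
        using M n by (intro mult_right_mono) auto
      moreover have "(M3 + M4) * real n \<le> B * \<eta>1 * real n" using B2 n by (intro mult_right_mono) auto
      ultimately show ?thesis by (simp add: algebra_simps)
    qed
    have B4: "M4 * real n \<le> B * (\<eta>1 * real n)"
      using B2 M n mult_right_mono[of M4 "B * \<eta>1" "real n"] by (simp add: mult.assoc)
    have small1: "2000 * real (q n) * \<gamma>\<^sup>2 * B\<^sup>2 \<le> 1"
    proof -
      have "2000 * B\<^sup>2 * (real (q n) * \<gamma>\<^sup>2) \<le> 2000 * B\<^sup>2 * (1 / (2000 * B\<^sup>2))"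
        using q\<gamma> elim B1 by (intro mult_left_mono) auto
      then show ?thesis using B1 by (simp add: mult_ac)
    qed
    have small_eq: "3000000 * B\<^sup>2 * (real (q n))\<^sup>2 / (\<eta>1 * real n) = 3000000 * B\<^sup>2 / \<eta>1 * ((real (q n))\<^sup>2 / real n)"
      by simp
    have small2: "3000000 * B\<^sup>2 * (real (q n))\<^sup>2 / (\<eta>1 * real n) \<le> 3000000 * B\<^sup>2 / \<eta>1 * w n"
      unfolding small_eq using qw \<eta> by (intro mult_left_mono) auto
    also have "\<dots> \<le> 3000000 * B\<^sup>2 / \<eta>1 * (\<eta>1 / (3000000 * B\<^sup>2))"
      using elim \<eta> B1 by (intro mult_left_mono) auto
    also have "\<dots> = 1" using \<eta> B0 by simp
    finally have small3: "3000000 * B\<^sup>2 * (real (q n))\<^sup>2 / (\<eta>1 * real n) \<le> 1" .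
    \<comment> \<open>The exponent is \<eta>1 p ln n / 256. Half of it outweighs C^p as soon as ln n
      \<ge> 512 ln C / \<eta>1, and the other half is at least 2 ln n as soon as p \<ge> 1024 /
      \<eta>1, which leaves n^(-2).\<close>
    have tail: "exp (- (\<eta>1 * real n * (\<gamma> / 8)\<^sup>2 / 4)) * sqrt ((2 * (\<eta>2 * real n) / (\<eta>1 * real n)) ^ q n) \<le> 1 / (\<eta>1 * real n)"
    proof -
      have "sqrt ((2 * (\<eta>2 * real n) / (\<eta>1 * real n)) ^ q n) \<le> sqrt (C ^ q n)"
        using \<eta> n by (intro real_sqrt_le_mono power_mono) (auto simp: C_def)
      also have "\<dots> \<le> C ^ q n"
        by (rule real_le_lsqrt) (auto simp: C_def power2_eq_square intro!: mult_left_mono[of 1, simplified] one_le_power)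
      also have "\<dots> \<le> C ^ p n" using pq(1)[of n] by (intro power_increasing) (auto simp: C_def)
      also have "\<dots> = exp (real (p n) * ln C)" by (simp add: exp_of_nat_mult C_def)
      finally have 1: "sqrt ((2 * (\<eta>2 * real n) / (\<eta>1 * real n)) ^ q n) \<le> exp (real (p n) * ln C)" .
      have "real (p n) * ln C \<le> real (p n) * (\<eta>1 * ln (real n) / 512)"
        using elim \<eta> by (intro mult_left_mono) (auto simp: field_simps)
      moreover have e1: "\<eta>1 * real n * (\<gamma> / 8)\<^sup>2 / 4 = \<eta>1 * real (p n) * ln (real n) / 256"
        using n by (simp add: power_divide \<gamma>_sq)
      moreover have "2 * ln (real n) \<le> \<eta>1 * real (p n) / 512 * ln (real n)"
        using elim \<eta> by (intro mult_right_mono) (auto simp: field_simps)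
      ultimately have 2: "- (\<eta>1 * real n * (\<gamma> / 8)\<^sup>2 / 4) + real (p n) * ln C \<le> - (2 * ln (real n))"
        unfolding e1 by (simp add: field_simps)
      have "exp (- (\<eta>1 * real n * (\<gamma> / 8)\<^sup>2 / 4)) * sqrt ((2 * (\<eta>2 * real n) / (\<eta>1 * real n)) ^ q n)
          \<le> exp (- (\<eta>1 * real n * (\<gamma> / 8)\<^sup>2 / 4)) * exp (real (p n) * ln C)"
        by (rule mult_left_mono[OF 1]) simp
      also have "\<dots> \<le> exp (- (2 * ln (real n)))" using 2 by (simp add: exp_add[symmetric])
      also have "\<dots> = 1 / (real n * real n)"
        unfolding exp_minus inverse_eq_divide mult_2 exp_add exp_ln[OF n(2)] ..
      also have "\<dots> \<le> 1 / (\<eta>1 * real n)"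
        using elim \<eta> n by (intro divide_left_mono mult_right_mono) auto
      finally show ?thesis .
    qed
    have \<kappa>2: "2 \<le> \<eta>1 * real n" using elim \<eta> by (simp add: field_simps)
    have q0: "0 < q n" using elim(7) by simp
    have Dn: "D n \<subseteq> Rvec (q n)" using D[of n] p1 by simp
    have exist: "partials_exist (q n) 2 (D n) (h n) (eball (q n) (zh n) \<delta>)"
      "partials_exist (q n) 5 (D n) (h n) (eball (q n) (zh n) (sqrt 2 * \<gamma>))"
      using hess fifth by (auto simp: \<gamma>_def)
    have \<eta>2n: "0 < \<eta>2 * real n" using \<eta> n by simp
    have slices: "eigenvalues_between (\<eta>1 * real n) (- deriv_slice (q n) (h n) z []) (\<eta>2 * real n)"
      if "z \<in> eball (q n) (zh n) \<delta>" for z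
      using hess that by blast
    have slices3: "eigenvalues_between (\<eta>3 * real n powr c3) (deriv_slice (q n) (h n) (zh n) [l]) (\<eta>4 * real n powr c3)"
      if "l < q n" for l
      using third that by blast
    have slices4: "eigenvalues_between (\<eta>5 * real n powr c4) (deriv_slice (q n) (h n) z [l, m]) (\<eta>6 * real n powr c4)"
      if "z \<in> eball (q n) (zh n) (sqrt 2 * \<gamma>)" "l < q n" "m < q n" for z l m
      using fourth that unfolding \<gamma>_def by blast
    have slices5: "eigenvalues_between (BB 5 * real n) (deriv_slice (q n) (h n) z js) (CC 5 * real n)"
      if "z \<in> eball (q n) (zh n) (sqrt 2 * \<gamma>)" "length js = 3" "set js \<subseteq> {..<q n}" for z js
      using fifth that unfolding \<gamma>_def by blast
    note fixed = laplace_fixed_dimension[OF q0 Dn elim(1) \<eta>2n \<delta> \<rho>_le refl elim(2) exist slices slices3 slices4 slices5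
        slice_bounds \<gamma>0 \<gamma>1 \<gamma>\<kappa> B1 B3 B4 \<kappa>2 small1 small3 tail]
    have "44 * (3000000 * B\<^sup>2 * (real (q n))\<^sup>2 / (\<eta>1 * real n)) + 1 / (\<eta>1 * real n) \<le> K * w n"
    proof -
      have "1 / (\<eta>1 * real n) = 1 / \<eta>1 * (1 / real n)" by simp
      also have "\<dots> \<le> 1 / \<eta>1 * w n" using nw \<eta> by (intro mult_left_mono) auto
      finally have 1: "1 / (\<eta>1 * real n) \<le> 1 / \<eta>1 * w n" .
      have K: "K * w n = 44 * (3000000 * B\<^sup>2 / \<eta>1 * w n) + 1 / \<eta>1 * w n" by (simp add: K_def distrib_right)
      show ?thesis unfolding K by (intro add_mono mult_left_mono small2 1) simp
    qed
    then show ?case using fixed by linarith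
  qed
  show "\<forall>\<^sub>F n in sequentially. 0 < Determinant.det (- deriv_slice (q n) (h n) (zh n) [])"
    using main by eventually_elim simp
  have "(\<lambda>n. ?c n * ?I n - 1) \<in> O(\<lambda>n. \<bar>K * w n\<bar> + \<bar>?c n * ?O n\<bar>)"
    by (rule bigoI[where c = 1]) (use main in \<open>auto elim!: eventually_mono\<close>)
  also have "(\<lambda>n. \<bar>K * w n\<bar> + \<bar>?c n * ?O n\<bar>) \<in> O(e)"
  proof (rule sum_in_bigo)
    have "w \<in> O(e)" by (rule bigoI[where c = 1]) (use w_le w_nonneg in \<open>auto intro!: always_eventually order_trans[OF w_le abs_ge_self]\<close>)
    then show "(\<lambda>n. \<bar>K * w n\<bar>) \<in> O(e)" by simp
    show "(\<lambda>n. \<bar>?c n * ?O n\<bar>) \<in> O(e)" using outer_O by (simp add: mult.assoc)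
  qed
  finally show "(\<lambda>n. ?c n * ?I n - 1) \<in> O(e)" .
  show "e \<longlonglongrightarrow> 0" by (rule e0)
qed

text \<open>Prepending \<psi> turns an update of coordinate \<open>j\<close> into an update of
  coordinate \<open>Suc j\<close>.\<close>

lemma partials_slice_fun:
  "partials js (slice_fun g \<psi>) l = partials (map Suc js) g (case_nat \<psi> l)"
proof (induction js arbitrary: l)
  case (Cons j js)
  have "case_nat \<psi> (l(j := t)) = (case_nat \<psi> l)(Suc j := t)" for t
    by (auto simp: fun_eq_iff split: nat.splits)
  then show ?case by (simp add: Cons del: fun_upd_apply)
qed (simp add: slice_fun_def)

lemma ratio_bigo:
  fixes a b :: "nat \<Rightarrow> real"
  assumes "a \<in> O(e)" "b \<in> O(e)" "e \<longlonglongrightarrow> 0"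
  shows "(\<lambda>n. (1 + b n) / (1 + a n) - 1) \<in> O(e)"
proof -
  have a0: "a \<longlonglongrightarrow> 0" using landau_o.big_small_trans[OF assms(1), of "\<lambda>_. 1"] smalloI_tendsto[of e "\<lambda>_. 1"] assms(3)
    by (auto dest: smalloD_tendsto)
  have ev: "\<forall>\<^sub>F n in sequentially. \<bar>a n\<bar> < 1 / 2"
    using order_tendstoD(2)[OF tendsto_rabs_zero[OF a0], of "1 / 2"] by simp
  have "(\<lambda>n. (1 + b n) / (1 + a n) - 1) \<in> O(\<lambda>n. b n - a n)"
  proof (rule bigoI[where c = 2])
    show "\<forall>\<^sub>F n in sequentially. norm ((1 + b n) / (1 + a n) - 1) \<le> 2 * norm (b n - a n)"
      using ev
    proof eventually_elim
      case (elim n)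
      then have pos: "1 / 2 < 1 + a n" by linarith
      then have "(1 + b n) / (1 + a n) - 1 = (b n - a n) * (1 / (1 + a n))" by (simp add: field_simps)
      moreover have "1 / (1 + a n) \<le> 2" using pos by (simp add: field_simps)
      ultimately show ?case using pos mult_left_mono[of "1 / (1 + a n)" 2 "\<bar>b n - a n\<bar>"]
        by (simp add: abs_mult)
    qed
  qed
  also have "(\<lambda>n. b n - a n) \<in> O(e)" by (rule sum_in_bigo(2)[OF assms(2,1)])
  finally show ?thesis .
qed

lemma set_integral_exp_shift:
  "(LINT z : A | M. exp (f z :: real)) = exp c * (LINT z : A | M. exp (f z - c))"
proof -
  have "exp (f z) = exp c * exp (f z - c)" for z by (simp add: exp_add[symmetric])
  then show ?thesis by (subst set_integral_mult_right[symmetric]) simp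
qed

lemma param_space_subset:
  assumes "1 \<le> p" shows "param_space \<mu> n p x \<pi>\<psi> \<pi>l \<subseteq> Rvec p"
proof -
  have "orth_param \<mu> n p x \<phi> k = undefined" if "p \<le> k" for \<phi> k
    using that assms by (cases k) (auto simp: orth_param_def nuisance_mean_def)
  then have "orth_param \<mu> n p x \<phi> \<in> Rvec p" for \<phi> by (simp add: PiE_iff extensional_def)
  then show ?thesis by (auto simp: param_space_def)
qed

text \<open>Both integrals are taken relative to their own maximum and normalized by their own
  Hessian. The quotient of the marginal posterior and its approximation is then eventually equal to
  the quotient of the two normalized integrals, each of which is one plus O(e).\<close>

theorem theorem4p2:
  fixes \<mu> :: "real measure"
    and p :: "nat \<Rightarrow> nat"
    and x :: "nat \<Rightarrow> nat \<Rightarrow> nat \<Rightarrow> real"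
    and y :: "nat \<Rightarrow> real"
    and \<pi>\<psi> :: "nat \<Rightarrow> real \<Rightarrow> real"
    and \<pi>l :: "nat \<Rightarrow> (nat \<Rightarrow> real) \<Rightarrow> real"
    and D :: "nat \<Rightarrow> (nat \<Rightarrow> real) set"
    and g :: "nat \<Rightarrow> (nat \<Rightarrow> real) \<Rightarrow> real"
    and \<psi>hat :: "nat \<Rightarrow> real"
    and e :: "nat \<Rightarrow> real"
    and \<zeta> :: nat
    and c3 c4 cinf \<alpha> :: real
  assumes family: "expfam_base \<mu>"
    and parametrization:
      "\<forall>\<^sub>F n in sequentially. inj_on (orth_param \<mu> n (p n) (x n)) (canonical_space \<mu> n (p n) (x n))"
    and prior_psi: "\<And>n. \<pi>\<psi> n \<in> borel_measurable borel" "\<And>n t. 0 \<le> \<pi>\<psi> n t"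
    and prior_lambda:
      "\<And>n. \<pi>l n \<in> borel_measurable (lebesgue_Rvec (p n - 1))" "\<And>n l. 0 \<le> \<pi>l n l"
    and D_eq: "\<And>n. D n = param_space \<mu> n (p n) (x n) (\<pi>\<psi> n) (\<pi>l n)"
    and g_eq: "\<And>n. g n = log_posterior \<mu> n (p n) (x n) y (\<pi>\<psi> n) (\<pi>l n)"
    and psihat_eq: "\<And>n. \<psi>hat n = arg_max_on (g n) (D n) 0"
    and e_eq: "e = err_rate p c3 \<zeta>"
    and p_growing: "filterlim p at_top sequentially"
    and p_rate: "(\<lambda>n. real (p n)) \<in> O(\<lambda>n. real n powr \<alpha>)"
    and alpha: "\<alpha> \<le> 1 / 2 - 1 / (2 * (real \<zeta> - 1))"
    and zeta: "4 < \<zeta>"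
    and c3: "c3 \<le> 1" and c4: "c4 \<le> 1" and cinf: "0 \<le> cinf" "cinf \<le> 1 / 2"
    and joint: "laplace_conditions p p D g c3 c4 cinf \<zeta> e"
    and conditional:
      "\<And>\<psi>. (\<lambda>n. \<psi> n - \<psi>hat n) \<in> O(\<lambda>n. ln (real n) powr (1 / 2) / real n powr (1 / 2)) \<Longrightarrow>
         laplace_conditions p (\<lambda>n. p n - 1)
           (\<lambda>n. slice_dom (p n) (D n) (\<psi> n)) (\<lambda>n. slice_fun (g n) (\<psi> n)) c3 c4 cinf \<zeta> e"
  shows "\<forall>\<psi> :: nat \<Rightarrow> real.
      (\<lambda>n. \<psi> n - \<psi>hat n) \<in> O(\<lambda>n. ln (real n) powr (1 / 2) / real n powr (1 / 2)) \<longrightarrow>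
      (\<lambda>n. marginal_posterior (p n) (D n) (g n) (\<psi> n)
           / laplace_marginal (p n) (D n) (g n) (\<psi> n) - 1) \<in> O(e)"
proof (intro allI impI)
  fix \<psi> :: "nat \<Rightarrow> real"
  assume \<psi>: "(\<lambda>n. \<psi> n - \<psi>hat n) \<in> O(\<lambda>n. ln (real n) powr (1 / 2) / real n powr (1 / 2))"
  define zh where "zh n = arg_max_on (g n) (D n)" for n
  define lh where "lh n = arg_max_on (slice_fun (g n) (\<psi> n)) (slice_dom (p n) (D n) (\<psi> n))" for n
  define s1 where "s1 n = sqrt (Determinant.det (- deriv_slice (p n) (g n) (zh n) []))" for n
  define s2 where "s2 n = sqrt (Determinant.det (- deriv_slice (p n - 1) (slice_fun (g n) (\<psi> n)) (lh n) []))" for n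
  define c1 where "c1 n = (2 * pi) powr (- real (p n) / 2)" for n
  define c2 where "c2 n = (2 * pi) powr (- real (p n - 1) / 2)" for n
  define I1 where "I1 n = (LINT z : D n | lebesgue_Rvec (p n). exp (g n z - g n (zh n)))" for n
  define I2 where "I2 n = (LINT l : slice_dom (p n) (D n) (\<psi> n) | lebesgue_Rvec (p n - 1).
    exp (slice_fun (g n) (\<psi> n) l - slice_fun (g n) (\<psi> n) (lh n)))" for n
  \<comment> \<open>From \<open>2 \<le> p n\<close> on, the nuisance dimension is positive and
    \<open>p n - 1\<close> is a true subtraction.\<close>
  have p_ge: "\<forall>\<^sub>F n in sequentially. 2 \<le> p n" using p_growing by (simp add: filterlim_at_top)
  have p_ge1: "\<forall>\<^sub>F n in sequentially. 1 \<le> p n" "\<forall>\<^sub>F n in sequentially. 1 \<le> p n - 1"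
    using p_ge by (auto elim: eventually_mono)
  have D: "D n \<subseteq> Rvec (p n)" if "1 \<le> p n" for n unfolding D_eq by (rule param_space_subset[OF that])
  note J = laplace_integral_bigo[OF joint[unfolded e_eq] D order_refl p_ge1(1) p_growing c3 c4 zeta]
  note C = laplace_integral_bigo[OF conditional[OF \<psi>, unfolded e_eq] _ _ p_ge1(2) p_growing c3 c4 zeta]
  have a: "(\<lambda>n. c1 n * s1 n * I1 n - 1) \<in> O(e)"
    using J(2) by (simp add: c1_def s1_def I1_def zh_def e_eq)
  have b: "(\<lambda>n. c2 n * s2 n * I2 n - 1) \<in> O(e)"
    using C(2) by (simp add: c2_def s2_def I2_def lh_def e_eq slice_dom_def)
  have s1: "\<forall>\<^sub>F n in sequentially. 0 < s1 n" using J(1) by (simp add: s1_def zh_def)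
  have s2: "\<forall>\<^sub>F n in sequentially. 0 < s2 n" using C(1) by (simp add: s2_def lh_def slice_dom_def)
  have "\<forall>\<^sub>F n in sequentially. marginal_posterior (p n) (D n) (g n) (\<psi> n) / laplace_marginal (p n) (D n) (g n) (\<psi> n)
      = (1 + (c2 n * s2 n * I2 n - 1)) / (1 + (c1 n * s1 n * I1 n - 1))"
    using p_ge s1 s2
  proof eventually_elim
    case (elim n)
    have Hll: "Matrix.mat (p n - 1) (p n - 1) (\<lambda>(a, b). partials [Suc a, Suc b] (g n) (case_nat (\<psi> n) (lh n)))
        = deriv_slice (p n - 1) (slice_fun (g n) (\<psi> n)) (lh n) []"
      by (simp add: deriv_slice_def partials_slice_fun del: partials.simps)
    have L: "laplace_marginal (p n) (D n) (g n) (\<psi> n)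
        = s1 n / (sqrt (2 * pi) * s2 n) * (exp (slice_fun (g n) (\<psi> n) (lh n)) / exp (g n (zh n)))"
      unfolding laplace_marginal_def Let_def zh_def[symmetric] lh_def[symmetric] Hll
      by (simp add: s1_def s2_def exp_diff slice_fun_def)
    have M: "marginal_posterior (p n) (D n) (g n) (\<psi> n)
        = (exp (slice_fun (g n) (\<psi> n) (lh n)) * I2 n) / (exp (g n (zh n)) * I1 n)"
      unfolding marginal_posterior_def I1_def I2_def set_integral_exp_shift[symmetric] by (simp add: slice_fun_def)
    \<comment> \<open>The two powers of 2 pi differ by one dimension, which accounts for the factor
      \<open>sqrt (2 * pi)\<close> in the approximation.\<close>
    have "c2 n = (2 * pi) powr (- real (p n) / 2 + 1 / 2)"
      using elim(1) by (simp add: c2_def of_nat_diff field_simps)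
    also have "\<dots> = c1 n * sqrt (2 * pi)" unfolding powr_add by (simp add: c1_def powr_half_sqrt)
    finally have c2: "c2 n = c1 n * sqrt (2 * pi)" .
    have "0 < c1 n" by (simp add: c1_def)
    then show ?case unfolding L M c2 using elim by (simp add: field_simps)
  qed
  then have "\<forall>\<^sub>F n in sequentially. marginal_posterior (p n) (D n) (g n) (\<psi> n) / laplace_marginal (p n) (D n) (g n) (\<psi> n) - 1
      = (1 + (c2 n * s2 n * I2 n - 1)) / (1 + (c1 n * s1 n * I1 n - 1)) - 1"
    by eventually_elim simp
  from landau_o.big.in_cong[OF this] ratio_bigo[OF a b] J(3)
  show "(\<lambda>n. marginal_posterior (p n) (D n) (g n) (\<psi> n)
           / laplace_marginal (p n) (D n) (g n) (\<psi> n) - 1) \<in> O(e)"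
    by (simp add: e_eq)
qed

end
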